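(* Let $F$ and $G$ be holomorphic germs at $0\in\mathbb{C}$ with respective sets of singularities $(\alpha)$ and $(\beta)$ in $\mathbb{C}$. Assume that all these singularities are isolated and integrable. Then the set of singularities of the principal branch of the Hadamard product $F\odot G$ is contained in the product set $(\gamma)=(\alpha\beta)$ and consists of isolated singularities, and for every such $\gamma$ and every integer $N\ge 1$ we have, for $z$ near $\gamma$, $$(\Sigma_\gamma^N-\mathrm{Id})(F\odot G)(z)=-\frac{1}{2\pi i}\sum_{\substack{\alpha,\beta\\ \alpha\beta=\gamma}}\ \sum_{k=0}^{N-1}\int_\alpha^{z/\beta}\Delta_\alpha\big(\Sigma_\alpha^kF\big)(u)\cdot\Delta_\beta\big(\Sigma_\beta^kG\big)(z/u)\,\frac{du}{u},$$ where the first sum runs over pairs of a singularity $\alpha$ of $F$ and a singularity $\beta$ of $G$ with $\alpha\beta=\gamma$.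
   Context: Hadamard product: for $F(z)=\sum_{n\ge0}A_nz^n$ and $G(z)=\sum_{n\ge0}B_nz^n$, $F\odot G(z)=\sum_{n\ge0}A_nB_nz^n$. The principal branch is the one obtained by analytic continuation from the power series at $0$. A singularity $\alpha$ is isolated if the function extends analytically along all paths in a punctured disc around $\alpha$ (it may be multivalued there). For an isolated singularity $\alpha$ of $F$, $\Sigma_\alpha F$ is the branch obtained by local analytic continuation of $F$ along a loop of winding number $1$ around $\alpha$; $\Delta_\alpha=\Sigma_\alpha-\mathrm{Id}$ is the monodromy operator, and $\Sigma_\alpha^k$ is the $k$-th iterate. The singularity $\alpha$ is integrable if $(z-\alpha)F(z)\to0$ as $z\to\alpha$ in the Stolz sense, i.e. as $z\to\alpha$ with $\arg(z-\alpha)$ bounded. Integrals $\int_\alpha^{z/\beta}$ are taken along a local path (e.g. the segment) from $\alpha$ to $z/\beta$, which is near $\alpha$ when $z$ is near $\gamma=\alpha\beta$. *)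

theory Defs
  imports "HOL-Complex_Analysis.Complex_Analysis"
begin

definition fps_hadamard :: "complex fps \<Rightarrow> complex fps \<Rightarrow> complex fps" where
  "fps_hadamard F G = Abs_fps (\<lambda>n. fps_nth F n * fps_nth G n)"

section \<open>Analytic continuation along paths\<close>

text \<open>
  \<open>\<phi> t\<close> represents the germ at \<open>p t\<close>; only its values near \<open>p t\<close> matter.
\<close>

definition continuation_family ::
    "(real \<Rightarrow> complex) \<Rightarrow> (real \<Rightarrow> complex \<Rightarrow> complex) \<Rightarrow> bool" where
  "continuation_family p \<phi> \<longleftrightarrow> path p \<and>
     (\<forall>t\<in>{0..1}. \<phi> t analytic_on {p t} \<and>
        (\<forall>\<^sub>F s in at t within {0..1}. \<forall>\<^sub>F z in nhds (p s). \<phi> s z = \<phi> t z))"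

definition continues_along ::
    "(complex \<Rightarrow> complex) \<Rightarrow> (real \<Rightarrow> complex) \<Rightarrow> (real \<Rightarrow> complex \<Rightarrow> complex) \<Rightarrow> bool" where
  "continues_along f p \<phi> \<longleftrightarrow> continuation_family p \<phi> \<and>
     (\<forall>\<^sub>F z in nhds (pathstart p). \<phi> 0 z = f z)"

definition continuable :: "(complex \<Rightarrow> complex) \<Rightarrow> (real \<Rightarrow> complex) \<Rightarrow> bool" where
  "continuable f p \<longleftrightarrow> (\<exists>\<phi>. continues_along f p \<phi>)"

text \<open>
  The value, at the endpoint of \<open>p\<close>, of the continuation along \<open>p\<close> of the germ of \<open>f\<close> at
  the start of \<open>p\<close>. The continuation is unique; the value is meaningless if \<open>f\<close> is not
  continuable along \<open>p\<close>.
\<close>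

definition continuation_value :: "(complex \<Rightarrow> complex) \<Rightarrow> (real \<Rightarrow> complex) \<Rightarrow> complex" where
  "continuation_value f p = (THE v. \<exists>\<phi>. continues_along f p \<phi> \<and> v = \<phi> 1 (pathfinish p))"

text \<open>
  The branch of \<open>f\<close> reached by continuation along \<open>p\<close>, as a function of \<open>w\<close>: it is extended
  from the endpoint of \<open>p\<close> to \<open>w\<close> along the segment.
\<close>

definition branch :: "(complex \<Rightarrow> complex) \<Rightarrow> (real \<Rightarrow> complex) \<Rightarrow> complex \<Rightarrow> complex" where
  "branch f p w = continuation_value f (p +++ linepath (pathfinish p) w)"

section \<open>Monodromy operators\<close>

definition rotation_path :: "complex \<Rightarrow> complex \<Rightarrow> real \<Rightarrow> real \<Rightarrow> complex" where
  "rotation_path a z \<theta> = (\<lambda>t. a + (z - a) * cis (\<theta> * t))"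

text \<open>
  \<open>Sigma_op a f z\<close> only depends on the germ of \<open>f\<close> at \<open>z\<close>, which is continued once
  counterclockwise along the circle around \<open>a\<close> through \<open>z\<close>.
\<close>

definition Sigma_op :: "complex \<Rightarrow> (complex \<Rightarrow> complex) \<Rightarrow> complex \<Rightarrow> complex" where
  "Sigma_op a f z = continuation_value f (rotation_path a z (2 * pi))"

definition Delta_op :: "complex \<Rightarrow> (complex \<Rightarrow> complex) \<Rightarrow> complex \<Rightarrow> complex" where
  "Delta_op a f z = Sigma_op a f z - f z"

section \<open>Singularities of the principal branch\<close>

text \<open>
  The principal branch is the continuation of the power series along segments issued from \<open>0\<close>,
  hence a single-valued function on the star of \<open>F\<close>. A singularity may lie behind another one on
  the same ray (for instance \<open>2\<close>, for \<open>ln (1 - z) + ln (2 - z)\<close>), where it is seen by the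
  principal branch from either side of the ray only. So a point \<open>a\<close> is approached from
  nearby points \<open>z\<close> off the line through \<open>0\<close> and \<open>a\<close>, that is with \<open>Im (z / a) \<noteq> 0\<close>, and it
  is singular unless the principal branch continues to \<open>a\<close> from all such \<open>z\<close>, on both sides.
  The origin is not a singularity: the condition \<open>Im (z / 0) \<noteq> 0\<close> is never satisfied.
\<close>

definition singularities :: "complex fps \<Rightarrow> complex set" where
  "singularities F = {a. \<not> (\<exists>r>0. \<forall>z\<in>ball a r. Im (z / a) \<noteq> 0 \<longrightarrow>
     continuable (eval_fps F) (linepath 0 z +++ linepath z a))}"

text \<open>
  The paths which lead from \<open>0\<close> straight to a point near \<open>a\<close>, on either side of the ray of \<open>a\<close>,
  and then stay in the punctured disc of radius \<open>r\<close> around \<open>a\<close>. Continuation along them yields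
  all local determinations of the principal branch at \<open>a\<close>.
\<close>

definition local_paths :: "complex \<Rightarrow> real \<Rightarrow> (real \<Rightarrow> complex) set" where
  "local_paths a r = {linepath 0 (pathstart q) +++ q | q.
     path q \<and> path_image q \<subseteq> ball a r - {a} \<and> Im (pathstart q / a) \<noteq> 0}"

definition isolated_sing :: "complex fps \<Rightarrow> complex \<Rightarrow> bool" where
  "isolated_sing F a \<longleftrightarrow> (\<exists>r>0. \<forall>p\<in>local_paths a r. continuable (eval_fps F) p)"

text \<open>
  \<open>(w - a) F(w) \<rightarrow> 0\<close> as \<open>w \<rightarrow> a\<close> with \<open>arg (w - a)\<close> bounded, where \<open>F(w)\<close> is multivalued and
  \<open>arg (w - a)\<close> ranges over the real numbers: here \<open>w = a + (z - a) cis \<theta>\<close> is reached by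
  rotating \<open>z\<close> around \<open>a\<close> by the angle \<open>\<theta>\<close>, and the limit is uniform in \<open>\<bar>\<theta>\<bar> \<le> M\<close>, for all \<open>M\<close>.
\<close>

definition integrable_sing :: "complex fps \<Rightarrow> complex \<Rightarrow> bool" where
  "integrable_sing F a \<longleftrightarrow> (\<forall>M. uniform_limit {-M..M}
     (\<lambda>z \<theta>. ((z - a) * cis \<theta>) *
        continuation_value (eval_fps F) (linepath 0 z +++ rotation_path a z \<theta>))
     (\<lambda>_. 0) (at a within {z. Im (z / a) \<noteq> 0}))"

section \<open>The monodromy formula\<close>

text \<open>
  The path \<open>p\<close> leads from \<open>0\<close> to a point \<open>z\<close> near \<open>a * b\<close> and selects the branch of \<open>F \<odot> G\<close>
  near \<open>z\<close>. The corresponding branches are that of \<open>F\<close> along \<open>p / b\<close>, which ends at \<open>z / b\<close>,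
  near \<open>a\<close>, and that of \<open>G\<close> along \<open>p / a\<close>, which ends at \<open>z / a\<close>, near \<open>b\<close>. The variable \<open>u\<close>
  ranges over the segment from \<open>a\<close> to \<open>z / b\<close>, and \<open>z / u\<close> then goes from \<open>z / a\<close> to \<open>b\<close>.
\<close>

definition monodromy_integrand ::
    "complex fps \<Rightarrow> complex fps \<Rightarrow> (real \<Rightarrow> complex) \<Rightarrow> nat \<Rightarrow> complex \<Rightarrow> complex \<Rightarrow> complex \<Rightarrow> complex" where
  "monodromy_integrand F G p k a b u =
     Delta_op a ((Sigma_op a ^^ k) (branch (eval_fps F) (\<lambda>t. p t / b))) u *
     Delta_op b ((Sigma_op b ^^ k) (branch (eval_fps G) (\<lambda>t. p t / a))) (pathfinish p / u) / u"

definition singular_pairs :: "complex fps \<Rightarrow> complex fps \<Rightarrow> complex \<Rightarrow> (complex \<times> complex) set" where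
  "singular_pairs F G c = {(a, b). a \<in> singularities F \<and> b \<in> singularities G \<and> a * b = c}"

end

theory Submission
  imports Defs
begin

text \<open>
  In the coordinate \<open>u = exp x\<close> the Hadamard product is the contour integral of
  \<open>F (exp x) G (exp (w - x))\<close> over a closed period. As \<open>w\<close> tends to \<open>log \<gamma>\<close> from one
  side, the contour circles around the rays of the singularities of \<open>F\<close>, and only the pairs
  \<open>\<alpha> \<beta> = \<gamma>\<close> pinch it. Cutting the contour into cells between consecutive
  singularities, the unmatched cells are pushed away and contribute holomorphic functions of \<open>w\<close>;
  a pinched cell is expressed through the lifts of \<open>F\<close> and \<open>G\<close> to the logarithmic coverings at
  \<open>\<alpha>\<close> and \<open>\<beta>\<close>, and turning once changes it by the integral of the product of
  the two monodromies. Integrability makes the endpoint contributions vanish. The other side of the ray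
  follows by complex conjugation, and iterating gives a telescoping sum.
\<close>

section \<open>Analytic continuation along paths\<close>

text \<open>A multivalued germ near \<alpha> is handled as one function on a half-plane, in the
  coordinate \<open>X\<close> = log log (z / \<alpha>). The first logarithm turns u and z / u into x
  and w - x; the second unwinds the loops, so that \<open>Sigma_op\<close> becomes the translation
  by 2 pi i. The obstacle is a singularity behind another one on the same ray: the principal branch
  reaches it from either side, with possibly unrelated germs. Hence there are separate lifts and a
  separate representation for each side. On one side, the cuts of F (exp x) run to the right and
  those of G (exp (w - x)) to the left, displaced by a small imaginary amount; around each ray the
  contour is S-shaped and passes between the two kinds of cuts. The product of two differences does
  not appear at once. A turn adds circle integrals to each half of a pinched cell; adding the halves
  produces one difference in each integrand, and shrinking the circles to their centres produces the
  other. This last step is the one that rests on integrability.\<close>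

lemma identity_nhds:
 assumes "open S" "connected S" "f holomorphic_on S" "g holomorphic_on S" "b \<in> S"
  and "\<forall>\<^sub>F z in nhds b. f z = g z" and "z \<in> S"
 shows "f z = (g z :: complex)"
proof -
 obtain T where T: "open T" "b \<in> T" "!!z. z \<in> T ==> f z = g z"
  using assms(6) unfolding eventually_nhds by blast
 show ?thesis
  by (rule analytic_continuation_open[of "S \<inter> T" S f g]) (use assms T in auto)
qed

lemma eventually_within_nhds:
 assumes "path p" "t \<in> {0..1}" "open S" "p t \<in> S"
 shows "\<forall>\<^sub>F s in at t within {0..1}. p s \<in> S"
proof -
 have "continuous (at t within {0..1}) p"
  using assms by (simp add: path_def continuous_on_eq_continuous_within)
 then show ?thesis
  using assms by (simp add: continuous_within topological_tendstoD)
qed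

lemma continuation_familyI_local:
 assumes "path p"
  and "!!t. t \<in> {0..1} ==> \<phi> t analytic_on {p t}"
  and "!!t. t \<in> {0..1} ==> \<forall>\<^sub>F s in at t within {0..1}. \<forall>\<^sub>F z in nhds (p s). \<phi> s z = \<phi> t z"
 shows "continuation_family p \<phi>"
 using assms unfolding continuation_family_def by blast

text \<open>Keeping the path in the ball of half the radius leaves room: a ball of radius
  \<open>r / 2\<close> about any nearby \<open>p s\<close> still lies where the representative is
  holomorphic. The tube lemma depends on this margin.\<close>

lemma continuation_family_local:
 assumes "continuation_family p \<phi>" "t \<in> {0..1}"
 obtains r d where "r > 0" "d > 0" "\<phi> t holomorphic_on ball (p t) r"
  "!!s. s \<in> {0..1} ==> \<bar>s - t\<bar> < d ==>
   p s \<in> ball (p t) (r / 2) \<and> (\<forall>\<^sub>F z in nhds (p s). \<phi> s z = \<phi> t z)"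
proof -
 obtain r where r: "r > 0" "\<phi> t holomorphic_on ball (p t) r"
  using assms unfolding continuation_family_def analytic_on_def by blast
 have "path p" and ev: "\<forall>\<^sub>F s in at t within {0..1}. \<forall>\<^sub>F z in nhds (p s). \<phi> s z = \<phi> t z"
  using assms unfolding continuation_family_def by auto
 then have "\<forall>\<^sub>F s in at t within {0..1}. p s \<in> ball (p t) (r / 2) \<and> (\<forall>\<^sub>F z in nhds (p s). \<phi> s z = \<phi> t z)"
  using eventually_within_nhds[of p t "ball (p t) (r/2)"] assms(2) r(1)
  by (auto intro: eventually_conj)
 then obtain d where d: "d > 0" "!!s. s \<in> {0..1} ==> s ~= t ==> \<bar>s - t\<bar> < d ==>
   p s \<in> ball (p t) (r / 2) \<and> (\<forall>\<^sub>F z in nhds (p s). \<phi> s z = \<phi> t z)"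
  unfolding eventually_at by (auto simp: dist_real_def)
 show thesis
  by (rule that[OF r(1) d(1) r(2)]) (use d(2) r(1) in fastforce)
qed

text \<open>Over a short parameter interval each family is given by one function on a common ball.
  There, equality of germs at one parameter is equality on the whole ball by the identity theorem,
  hence equality at every other parameter. Connectedness of \<open>{0..1}\<close> does the
  rest.\<close>

lemma continuation_family_unique:
 assumes p: "continuation_family p \<phi>" and q: "continuation_family p \<psi>"
  and 0: "\<forall>\<^sub>F z in nhds (p 0). \<phi> 0 z = \<psi> 0 z" and t: "t \<in> {0..1}"
 shows "\<forall>\<^sub>F z in nhds (p t). \<phi> t z = \<psi> t z"
proof (rule connected_induction_simple[where S = "{0..1::real}" and a = 0 and b = t
   and P = "%t. \<forall>\<^sub>F z in nhds (p t). \<phi> t z = \<psi> t z"])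
 fix a :: real assume a: "a \<in> {0..1}"
 obtain r d where 1: "r > 0" "d > 0" "\<phi> a holomorphic_on ball (p a) r"
  "!!s. s \<in> {0..1} ==> \<bar>s - a\<bar> < d ==>
   p s \<in> ball (p a) (r / 2) \<and> (\<forall>\<^sub>F z in nhds (p s). \<phi> s z = \<phi> a z)"
  using continuation_family_local[OF p a] by metis
 obtain r' d' where 2: "r' > 0" "d' > 0" "\<psi> a holomorphic_on ball (p a) r'"
  "!!s. s \<in> {0..1} ==> \<bar>s - a\<bar> < d' ==>
   p s \<in> ball (p a) (r' / 2) \<and> (\<forall>\<^sub>F z in nhds (p s). \<psi> s z = \<psi> a z)"
  using continuation_family_local[OF q a] by metis
 let ?B = "ball (p a) (min r r')"
 define T where "T = {0..1} \<inter> ball a (min d d')"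
 have inB: "p s \<in> ?B" if "s \<in> T" for s
  using that 1(4)[of s] 2(4)[of s] 1(1) 2(1) by (auto simp: T_def dist_real_def abs_minus_commute)
 have iff: "(\<forall>\<^sub>F z in nhds (p s). \<phi> s z = \<psi> s z) \<longleftrightarrow> (\<forall>z\<in>?B. \<phi> a z = \<psi> a z)" if s: "s \<in> T" for s
 proof -
  have e: "\<forall>\<^sub>F z in nhds (p s). \<phi> s z = \<phi> a z" "\<forall>\<^sub>F z in nhds (p s). \<psi> s z = \<psi> a z"
   using s 1(4)[of s] 2(4)[of s] by (auto simp: T_def dist_real_def abs_minus_commute)
  have "(\<forall>\<^sub>F z in nhds (p s). \<phi> s z = \<psi> s z) \<longleftrightarrow> (\<forall>\<^sub>F z in nhds (p s). \<phi> a z = \<psi> a z)"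
  proof
   assume "\<forall>\<^sub>F z in nhds (p s). \<phi> s z = \<psi> s z"
   then show "\<forall>\<^sub>F z in nhds (p s). \<phi> a z = \<psi> a z" using e by eventually_elim simp
  next
   assume "\<forall>\<^sub>F z in nhds (p s). \<phi> a z = \<psi> a z"
   then show "\<forall>\<^sub>F z in nhds (p s). \<phi> s z = \<psi> s z" using e by eventually_elim simp
  qed
  also have "\<dots> \<longleftrightarrow> (\<forall>z\<in>?B. \<phi> a z = \<psi> a z)"
  proof
   assume ev: "\<forall>\<^sub>F z in nhds (p s). \<phi> a z = \<psi> a z"
   have h: "\<phi> a holomorphic_on ?B" "\<psi> a holomorphic_on ?B"
    using holomorphic_on_subset[OF 1(3) subset_ball[OF min.cobounded1]]
     holomorphic_on_subset[OF 2(3) subset_ball[OF min.cobounded2]] by blast+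
   show "\<forall>z\<in>?B. \<phi> a z = \<psi> a z"
    using identity_nhds[OF open_ball connected_ball h inB[OF s] ev] by blast
  next
   assume "\<forall>z\<in>?B. \<phi> a z = \<psi> a z"
   then show "\<forall>\<^sub>F z in nhds (p s). \<phi> a z = \<psi> a z"
    using inB[OF s] by (auto simp: eventually_nhds intro!: exI[of _ ?B])
  qed
  finally show ?thesis .
 qed
 show "\<exists>T. openin (top_of_set {0..1}) T \<and> a \<in> T \<and>
     (\<forall>x\<in>T. \<forall>y\<in>T. (\<forall>\<^sub>F z in nhds (p x). \<phi> x z = \<psi> x z) --> (\<forall>\<^sub>F z in nhds (p y). \<phi> y z = \<psi> y z))"
  using iff a 1(2) 2(2) by (intro exI[of _ T]) (auto simp: T_def openin_open)
qed (use 0 t in auto)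

lemma continuation_value_eq:
 assumes "continues_along f p \<phi>"
 shows "continuation_value f p = \<phi> 1 (pathfinish p)"
 unfolding continuation_value_def
proof (rule the_equality)
 fix v assume "\<exists>\<psi>. continues_along f p \<psi> \<and> v = \<psi> 1 (pathfinish p)"
 then obtain \<psi> where \<psi>: "continues_along f p \<psi>" "v = \<psi> 1 (pathfinish p)" by blast
 have "\<forall>\<^sub>F z in nhds (p 0). \<phi> 0 z = \<psi> 0 z"
  using assms \<psi>(1) unfolding continues_along_def pathstart_def
  by (auto elim: eventually_elim2)
 then have "\<forall>\<^sub>F z in nhds (p 1). \<phi> 1 z = \<psi> 1 z"
  using continuation_family_unique[of p \<phi> \<psi> 1] assms \<psi>(1) unfolding continues_along_def by auto
 then show "v = \<phi> 1 (pathfinish p)"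
  using \<psi>(2) eventually_nhds_x_imp_x[of "%z. \<phi> 1 z = \<psi> 1 z" "p 1"] by (simp add: pathfinish_def)
qed (use assms in blast)

lemma continues_along_unique:
 assumes "continues_along f p \<phi>" "continues_along f p \<psi>" "t \<in> {0..1}"
 shows "\<forall>\<^sub>F z in nhds (p t). \<phi> t z = \<psi> t z"
proof -
 have "\<forall>\<^sub>F z in nhds (p 0). \<phi> 0 z = \<psi> 0 z"
  using assms unfolding continues_along_def pathstart_def by (auto elim: eventually_elim2)
 then show ?thesis
  using continuation_family_unique assms unfolding continues_along_def by blast
qed

lemma continuation_family_reparam:
 assumes "continuation_family p \<phi>" "continuous_on {0..1} h" "!!t. t \<in> {0..1} ==> h t \<in> {0..1}"
 shows "continuation_family (%t. p (h t)) (%t. \<phi> (h t))"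
proof (rule continuation_familyI_local)
 have "path p" using assms unfolding continuation_family_def by blast
 then show "path (%t. p (h t))"
  using assms(2,3) unfolding path_def by (auto intro!: continuous_on_compose2[of "{0..1}" p])
 fix t :: real assume t: "t \<in> {0..1}"
 show "\<phi> (h t) analytic_on {p (h t)}"
  using assms t unfolding continuation_family_def by blast
 obtain r d where 1: "r > 0" "d > 0"
  "!!s. s \<in> {0..1} ==> \<bar>s - h t\<bar> < d ==>
   p s \<in> ball (p (h t)) (r / 2) \<and> (\<forall>\<^sub>F z in nhds (p s). \<phi> s z = \<phi> (h t) z)"
  using continuation_family_local[OF assms(1) assms(3)[OF t]] by metis
 have "\<forall>\<^sub>F s in at t within {0..1}. h s \<in> ball (h t) d"
  using eventually_within_nhds[of h t "ball (h t) d"] assms(2) t 1(2) by (simp add: path_def)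
 moreover have "\<forall>\<^sub>F s in at t within {0..1}. s \<in> {0..1}"
  by (auto simp: eventually_at intro: exI[of _ 1])
 ultimately show "\<forall>\<^sub>F s in at t within {0..1}. \<forall>\<^sub>F z in nhds (p (h s)). \<phi> (h s) z = \<phi> (h t) z"
  by eventually_elim (use 1(3) assms(3) in \<open>auto simp: dist_real_def abs_minus_commute\<close>)
qed

text \<open>Compactness gives one radius valid along the whole path, and the same representatives
  then serve every path within this distance, whatever its endpoint. This stability is what makes
  the star open and continued values holomorphic in the endpoint.\<close>

lemma continuation_family_tube:
 assumes "continuation_family p \<phi>"
 obtains eps \<phi>' where "eps > 0"
  "!!t. t \<in> {0..1} ==> \<phi>' t holomorphic_on ball (p t) eps"
  "!!t. t \<in> {0..1} ==> \<forall>\<^sub>F z in nhds (p t). \<phi>' t z = \<phi> t z"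
  "!!q. path q ==> (!!t. t \<in> {0..1} ==> dist (q t) (p t) < eps) ==> continuation_family q \<phi>'"
proof -
 have pp: "path p" using assms unfolding continuation_family_def by blast
 define Q where "Q t r d \<longleftrightarrow> r > 0 \<and> d > 0 \<and> \<phi> t holomorphic_on ball (p t) r \<and>
  (\<forall>s\<in>{0..1}. \<bar>s - t\<bar> < d --> p s \<in> ball (p t) (r / 2) \<and> (\<forall>\<^sub>F z in nhds (p s). \<phi> s z = \<phi> t z))" for t r d
 have "\<exists>r d. Q t r d" if "t \<in> {0..1}" for t
  unfolding Q_def by (rule continuation_family_local[OF assms that]) blast
 then obtain r d where Q: "!!t. t \<in> {0..1} ==> Q t (r t) (d t)" by metis
 have rd: "r t > 0 \<and> d t > 0 \<and> \<phi> t holomorphic_on ball (p t) (r t) \<and>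
  (\<forall>s\<in>{0..1}. \<bar>s - t\<bar> < d t --> p s \<in> ball (p t) (r t / 2) \<and> (\<forall>\<^sub>F z in nhds (p s). \<phi> s z = \<phi> t z))"
  if "t \<in> {0..1}" for t using Q[OF that] unfolding Q_def .
 have cov: "{0..1::real} \<subseteq> (\<Union>t\<in>{0..1}. ball t (d t))"
 proof
  fix t :: real assume "t \<in> {0..1}"
  then show "t \<in> (\<Union>t\<in>{0..1}. ball t (d t))" using rd[of t] by (intro UN_I[of t]) auto
 qed
 obtain K where K: "K \<subseteq> {0..1::real}" "finite K" "{0..1} \<subseteq> (\<Union>t\<in>K. ball t (d t))"
  by (rule compactE_image[of "{0..1::real}" "{0..1}" "%t. ball t (d t)"]) (use cov in auto)
 then have "\<exists>t\<in>K. s \<in> ball t (d t)" if "s \<in> {0..1}" for s using that by blast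
 then obtain \<tau> where \<tau>: "!!s. s \<in> {0..1} ==> \<tau> s \<in> K \<and> s \<in> ball (\<tau> s) (d (\<tau> s))" by metis
 have Kne: "K ~= {}" using K(3) by auto
 define eps where "eps = Min ((%t. r t / 2) ` K)"
 have eps: "eps > 0" "!!t. t \<in> K ==> eps <= r t / 2"
 proof -
  have "eps \<in> (%t. r t / 2) ` K" unfolding eps_def using K(2) Kne by (intro Min_in) auto
  then obtain t where "t \<in> K" "eps = r t / 2" by auto
  then show "eps > 0" using rd[of t] K(1) by (simp add: subset_iff)
  show "eps <= r t / 2" if "t \<in> K" for t
   unfolding eps_def using K(2) that by (intro Min_le) auto
 qed
 \<comment> \<open>Only finitely many functions occur: at \<open>s\<close> the one that belongs to
   the chosen centre \<open>\<tau> s\<close> of the finite subcover.\<close>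
 define \<phi>' where "\<phi>' s = \<phi> (\<tau> s)" for s
 have hol: "\<phi>' s holomorphic_on ball (p s) eps" and ev: "\<forall>\<^sub>F z in nhds (p s). \<phi>' s z = \<phi> s z"
  if s: "s \<in> {0..1}" for s
 proof -
  have *: "\<tau> s \<in> {0..1}" "\<bar>s - \<tau> s\<bar> < d (\<tau> s)" "\<tau> s \<in> K"
   using \<tau>[OF s] K(1) by (auto simp: dist_real_def abs_minus_commute)
  have a: "p s \<in> ball (p (\<tau> s)) (r (\<tau> s) / 2)" and b: "\<forall>\<^sub>F z in nhds (p s). \<phi> s z = \<phi> (\<tau> s) z"
   using rd[OF *(1)] s *(2) by blast+
  have "ball (p s) eps \<subseteq> ball (p (\<tau> s)) (r (\<tau> s))"
  proof
   fix z assume "z \<in> ball (p s) eps"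
   then show "z \<in> ball (p (\<tau> s)) (r (\<tau> s))"
    using a eps(2)[OF *(3)] dist_triangle[of "p (\<tau> s)" z "p s"] by auto
  qed
  then show "\<phi>' s holomorphic_on ball (p s) eps"
   using rd[OF *(1)] holomorphic_on_subset unfolding \<phi>'_def by blast
  show "\<forall>\<^sub>F z in nhds (p s). \<phi>' s z = \<phi> s z"
   using b unfolding \<phi>'_def by (auto elim: eventually_mono)
 qed
 have "continuation_family q \<phi>'" if q: "path q" and qd: "!!t. t \<in> {0..1} ==> dist (q t) (p t) < eps" for q
 proof (rule continuation_familyI_local[OF q])
  fix t :: real assume t: "t \<in> {0..1}"
  show "\<phi>' t analytic_on {q t}"
   unfolding analytic_at using hol[OF t] qd[OF t] by (auto intro!: exI[of _ "ball (p t) eps"] simp: dist_commute)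
  have 1: "\<forall>\<^sub>F s in at t within {0..1}. q s \<in> ball (p t) eps"
   by (rule eventually_within_nhds[OF q t open_ball]) (use qd[OF t] in \<open>simp add: dist_commute\<close>)
  have 2: "\<forall>\<^sub>F s in at t within {0..1}. p s \<in> ball (p t) eps"
   by (rule eventually_within_nhds[OF pp t open_ball]) (use eps(1) in simp)
  obtain T where T: "open T" "p t \<in> T" "!!z. z \<in> T ==> \<phi>' t z = \<phi> t z"
   using ev[OF t] unfolding eventually_nhds by blast
  have 3: "\<forall>\<^sub>F s in at t within {0..1}. p s \<in> T"
   using eventually_within_nhds[OF pp t T(1,2)] .
  have 4: "\<forall>\<^sub>F s in at t within {0..1}. \<forall>\<^sub>F z in nhds (p s). \<phi> s z = \<phi> t z"
   using assms t unfolding continuation_family_def by blast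
  have 5: "\<forall>\<^sub>F s in at t within {0..1}. s \<in> {0..1}"
   by (auto simp: eventually_at intro: exI[of _ 1])
  show "\<forall>\<^sub>F s in at t within {0..1}. \<forall>\<^sub>F z in nhds (q s). \<phi>' s z = \<phi>' t z"
   using 1 2 3 4 5
  proof eventually_elim
   case (elim s)
   \<comment> \<open>The overlap of the two discs is convex and contains \<open>p s\<close>, where
     the germs agree; agreement therefore spreads to \<open>q s\<close>.\<close>
   let ?S = "ball (p s) eps \<inter> ball (p t) eps"
   have "\<forall>\<^sub>F z in nhds (p s). z \<in> T" using T(1) elim(3) by (rule eventually_nhds_in_open)
   then have "\<forall>\<^sub>F z in nhds (p s). \<phi>' s z = \<phi>' t z"
    using ev[OF elim(5)] elim(4) by eventually_elim (use T(3) in simp)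
   then have eq: "\<phi>' s z = \<phi>' t z" if "z \<in> ?S" for z
    by (rule identity_nhds[of ?S "\<phi>' s" "\<phi>' t" "p s", rotated 5])
     (use that elim(2) eps(1) hol[OF t] hol[OF elim(5)] holomorphic_on_subset in
      \<open>auto intro!: convex_connected convex_Int\<close>)
   have "q s \<in> ?S" using elim(1) qd[OF elim(5)] by (simp add: dist_commute)
   then show ?case
    using eq by (auto simp: eventually_nhds intro!: exI[of _ ?S])
  qed
 qed
 then show thesis using that[of eps \<phi>'] eps(1) hol ev by blast
qed

lemma continuation_family_holomorphic:
 assumes "f holomorphic_on S" "open S" "path p" "path_image p \<subseteq> S"
 shows "continuation_family p (%_. f)"
proof (rule continuation_familyI_local[OF assms(3)])
 fix t :: real assume "t \<in> {0..1}"
 then have "p t \<in> S" using assms(4) by (auto simp: path_image_def)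
 then show "f analytic_on {p t}" using assms(1,2) by (auto simp: analytic_at)
qed auto

lemma continues_along_holomorphic:
 assumes "f holomorphic_on S" "open S" "path p" "path_image p \<subseteq> S"
  and "\<forall>\<^sub>F z in nhds (pathstart p). f z = g z"
 shows "continues_along g p (%_. f)"
 using continuation_family_holomorphic[OF assms(1-4)] assms(5) unfolding continues_along_def by auto

section \<open>Joining, splitting and descending continuations\<close>

text \<open>The junction \<open>t = 1/2\<close> is assigned to the second piece. To its left the
  germs of \<open>\<phi>\<close> must be compared with \<open>\<psi> 0\<close>, which works because
  \<open>\<phi> 1\<close> and \<open>\<psi> 0\<close> agree on an open set that the path has already
  entered.\<close>

lemma continues_along_join:
 assumes 1: "continues_along f p \<phi>" and 2: "continues_along g q \<psi>"
  and pq: "pathfinish p = pathstart q" and eq: "\<forall>\<^sub>F z in nhds (pathstart q). g z = \<phi> 1 z"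
 shows "continues_along f (p +++ q) (%t. if t < 1/2 then \<phi> (2 * t) else \<psi> (2 * t-1))"
proof -
 let ?\<theta> = "%t. if t < 1/2 then \<phi> (2 * t) else \<psi> (2 * t-1)"
 have p: "continuation_family p \<phi>" and q: "continuation_family q \<psi>"
  using 1 2 by (auto simp: continues_along_def)
 have pp: "path p" "path q" using p q by (auto simp: continuation_family_def)
 have mid: "\<forall>\<^sub>F z in nhds (q 0). \<psi> 0 z = \<phi> 1 z"
  using 2 eq unfolding continues_along_def pathstart_def by (auto elim: eventually_elim2)
 have "continuation_family (p +++ q) ?\<theta>"
 proof (rule continuation_familyI_local)
  show "path (p +++ q)" using pp pq by simp
  fix t :: real assume t: "t \<in> {0..1}"
  consider "t < 1/2" | "t = 1/2" | "t > 1/2" by linarith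
  then have "?\<theta> t analytic_on {(p +++ q) t} \<and>
   (\<exists>e>0. \<forall>s\<in>{0..1}. \<bar>s - t\<bar> < e --> (\<forall>\<^sub>F z in nhds ((p +++ q) s). ?\<theta> s z = ?\<theta> t z))"
  proof cases
   case 1
   have t': "2 * t \<in> {0..1}" using t 1 by auto
   obtain r d where rd: "d > 0" "!!s. s \<in> {0..1} ==> \<bar>s - 2 * t\<bar> < d ==> (\<forall>\<^sub>F z in nhds (p s). \<phi> s z = \<phi> (2 * t) z)"
    using continuation_family_local[OF p t'] by metis
   show ?thesis
   proof (intro conjI exI[of _ "min (d/2) (1/2-t)"] ballI impI)
    show "?\<theta> t analytic_on {(p +++ q) t}"
     using p t' 1 by (auto simp: continuation_family_def joinpaths_def)
    fix s :: real assume s: "s \<in> {0..1}" "\<bar>s - t\<bar> < min (d/2) (1/2-t)"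
    then have "s < 1/2" "\<bar>2 * s - 2 * t\<bar> < d" by linarith+
    then show "\<forall>\<^sub>F z in nhds ((p +++ q) s). ?\<theta> s z = ?\<theta> t z"
     using rd(2)[of "2 * s"] s(1) 1 by (auto simp: joinpaths_def)
   qed (use 1 rd(1) in auto)
  next
   case 3
   have t': "2 * t-1 \<in> {0..1}" using t 3 by auto
   obtain r d where rd: "d > 0" "!!s. s \<in> {0..1} ==> \<bar>s - (2 * t-1)\<bar> < d ==> (\<forall>\<^sub>F z in nhds (q s). \<psi> s z = \<psi> (2 * t-1) z)"
    using continuation_family_local[OF q t'] by metis
   show ?thesis
   proof (intro conjI exI[of _ "min (d/2) (t-1/2)"] ballI impI)
    show "?\<theta> t analytic_on {(p +++ q) t}"
     using q t' 3 by (auto simp: continuation_family_def joinpaths_def)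
    fix s :: real assume s: "s \<in> {0..1}" "\<bar>s - t\<bar> < min (d/2) (t-1/2)"
    then have "s > 1/2" "\<bar>(2 * s-1) - (2 * t-1)\<bar> < d" by linarith+
    then show "\<forall>\<^sub>F z in nhds ((p +++ q) s). ?\<theta> s z = ?\<theta> t z"
     using rd(2)[of "2 * s-1"] s(1) 3 by (auto simp: joinpaths_def)
   qed (use 3 rd(1) in auto)
  next
   case 2
   have t: "t = 1/2" using 2 .
   obtain r d where rd: "d > 0" "!!s. s \<in> {0..1} ==> \<bar>s - 0\<bar> < d ==> (\<forall>\<^sub>F z in nhds (q s). \<psi> s z = \<psi> 0 z)"
    using continuation_family_local[OF q, of 0] by (metis atLeastAtMost_iff zero_le_one order_refl)
   obtain r' d' where rd': "d' > 0" "r' > 0" "!!s. s \<in> {0..1} ==> \<bar>s - 1\<bar> < d' ==> p s \<in> ball (p 1) (r'/2) \<and> (\<forall>\<^sub>F z in nhds (p s). \<phi> s z = \<phi> 1 z)"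
    using continuation_family_local[OF p, of 1] by (metis atLeastAtMost_iff zero_le_one order_refl)
   obtain T where T: "open T" "p 1 \<in> T" "!!z. z \<in> T ==> \<psi> 0 z = \<phi> 1 z"
    using mid pq unfolding eventually_nhds pathfinish_def pathstart_def by metis
   obtain d'' where d'': "d'' > 0" "!!s. s \<in> {0..1} ==> \<bar>s - 1\<bar> < d'' ==> p s \<in> T"
   proof -
    have "\<forall>\<^sub>F s in at 1 within {0..1}. p s \<in> T"
     by (rule eventually_within_nhds[OF pp(1) _ T(1,2)]) simp
    then obtain e where "e > 0" "!!s. s \<in> {0..1} ==> s ~= 1 ==> \<bar>s - 1\<bar> < e ==> p s \<in> T"
     unfolding eventually_at dist_real_def by blast
    then show thesis using that[of e] T(2) by metis
   qed
   have fin: "\<forall>\<^sub>F z in nhds (p s). \<phi> s z = \<psi> 0 z" if "s \<in> {0..1}" "\<bar>s - 1\<bar> < min d' d''" for s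
   proof -
    have "\<forall>\<^sub>F z in nhds (p s). z \<in> T" using d''(2)[of s] that by (intro eventually_nhds_in_open T) auto
    moreover have "\<forall>\<^sub>F z in nhds (p s). \<phi> s z = \<phi> 1 z" using rd'(3)[of s] that by auto
    ultimately show ?thesis by eventually_elim (use T(3) in simp)
   qed
   show ?thesis
   proof (intro conjI exI[of _ "min (d/2) (min d' d''/2)"] ballI impI)
    show "?\<theta> t analytic_on {(p +++ q) t}"
    proof -
     have "\<psi> 0 analytic_on {q 0}" using q unfolding continuation_family_def by (metis atLeastAtMost_iff order_refl zero_le_one)
     moreover have "(p +++ q) (1/2) = q 0" using pq by (simp add: joinpaths_def pathfinish_def pathstart_def)
     ultimately show ?thesis unfolding t by simp
    qed
    fix s :: real assume s: "s \<in> {0..1}" "\<bar>s - t\<bar> < min (d/2) (min d' d''/2)"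
    show "\<forall>\<^sub>F z in nhds ((p +++ q) s). ?\<theta> s z = ?\<theta> t z"
    proof (cases "s < 1/2")
     case True
     then have "\<bar>2 * s - 1\<bar> < min d' d''" using s 2 by linarith
     then show ?thesis using True fin[of "2 * s"] s(1) unfolding t by (auto simp: joinpaths_def)
    next
     case False
     then have sd: "\<bar>2 * s - 1\<bar> < d" using s 2 by linarith
     show ?thesis
     proof (cases "s = 1/2")
      case True
      show ?thesis unfolding t True by simp
     next
      case ne: False
      then show ?thesis
       using sd False rd(2)[of "2 * s-1"] s(1) unfolding t
       by (simp add: joinpaths_def)
     qed
    qed
   qed (use rd(1) rd'(1) d''(1) in auto)
  qed
  then show "?\<theta> t analytic_on {(p +++ q) t}"
   "\<forall>\<^sub>F s in at t within {0..1}. \<forall>\<^sub>F z in nhds ((p +++ q) s). ?\<theta> s z = ?\<theta> t z"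
   unfolding eventually_at dist_real_def by blast+
 qed
 moreover have "\<forall>\<^sub>F z in nhds (pathstart (p +++ q)). ?\<theta> 0 z = f z"
  using 1 by (simp add: continues_along_def)
 ultimately show ?thesis by (simp add: continues_along_def)
qed

lemma continuation_value_join:
 assumes 1: "continues_along f p \<phi>" and 2: "continues_along (\<phi> 1) q \<psi>"
  and pq: "pathfinish p = pathstart q"
 shows "continuable f (p +++ q)" "continuation_value f (p +++ q) = \<psi> 1 (pathfinish q)"
proof -
 have *: "continues_along f (p +++ q) (%t. if t < 1/2 then \<phi> (2 * t) else \<psi> (2 * t-1))"
  by (rule continues_along_join[OF 1 2 pq]) auto
 show "continuable f (p +++ q)" using * unfolding continuable_def by blast
 show "continuation_value f (p +++ q) = \<psi> 1 (pathfinish q)"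
  using continuation_value_eq[OF *] by simp
qed

lemma continuation_family_cong:
 assumes that: "continuation_family p'' \<phi>'" "!!t. t \<in> {0..1} ==> p'' t = p' t"
 shows "continuation_family p' \<phi>'"
proof (rule continuation_familyI_local)
 show "path p'"
 proof -
  have "continuous_on {0..1} p''" using that(1) by (simp add: continuation_family_def path_def)
  then show ?thesis unfolding path_def by (rule continuous_on_eq) (use that(2) in auto)
 qed
 fix t :: real assume t: "t \<in> {0..1}"
 have "\<phi>' t analytic_on {p'' t}" using that(1) t unfolding continuation_family_def by blast
 then show "\<phi>' t analytic_on {p' t}" using that(2)[OF t] by simp
 have "\<forall>\<^sub>F s in at t within {0..1}. s \<in> {0..1}" by (auto simp: eventually_at intro: exI[of _ 1])
 moreover have "\<forall>\<^sub>F s in at t within {0..1}. \<forall>\<^sub>F z in nhds (p'' s). \<phi>' s z = \<phi>' t z"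
  using that(1) t unfolding continuation_family_def by blast
 ultimately show "\<forall>\<^sub>F s in at t within {0..1}. \<forall>\<^sub>F z in nhds (p' s). \<phi>' s z = \<phi>' t z"
  by eventually_elim (use that(2) in auto)
qed

lemma continues_along_split:
 assumes "continues_along f (p +++ q) \<theta>" and pq: "pathfinish p = pathstart q"
 shows "continues_along f p (%t. \<theta> (t/2))" "continues_along (\<theta> (1/2)) q (%t. \<theta> ((t+1)/2))"
proof -
 have c: "continuation_family (p +++ q) \<theta>" using assms by (simp add: continues_along_def)
 have eqp: "(p +++ q) (t/2) = p t" if "t \<in> {0..1}" for t using that by (auto simp: joinpaths_def)
 have eqq: "(p +++ q) ((t+1)/2) = q t" if "t \<in> {0..1}" for t
  using that pq by (cases "t = 0") (auto simp: joinpaths_def pathfinish_def pathstart_def add_divide_distrib)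
 have "continuation_family (%t. (p +++ q) (t/2)) (%t. \<theta> (t/2))"
  by (rule continuation_family_reparam[OF c]) (auto intro!: continuous_intros)
 then have "continuation_family p (%t. \<theta> (t/2))" by (rule continuation_family_cong) (rule eqp)
 then show "continues_along f p (%t. \<theta> (t/2))"
  using assms(1) by (simp add: continues_along_def)
 have "continuation_family (%t. (p +++ q) ((t+1)/2)) (%t. \<theta> ((t+1)/2))"
  by (rule continuation_family_reparam[OF c]) (auto intro!: continuous_intros)
 then have "continuation_family q (%t. \<theta> ((t+1)/2))" by (rule continuation_family_cong) (rule eqq)
 then show "continues_along (\<theta> (1/2)) q (%t. \<theta> ((t+1)/2))"
  by (simp add: continues_along_def)
qed

text \<open>A function on a covering descends along every path that lifts: at each parameter it is
  composed with a local inverse of \<open>e\<close>, and neighbouring inverses agree on the image of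
  the overlap of the discs upstairs. With \<open>dexp a\<close> for \<open>e\<close>, a function on
  a half-plane yields all continuations near \<open>a\<close>.\<close>

lemma continuation_family_lift:
 assumes e: "e holomorphic_on D" "open D" "!!x. x \<in> D ==> deriv e x ~= 0"
  and \<Phi>: "\<Phi> holomorphic_on D" and P: "path P" "path_image P \<subseteq> D"
 obtains \<phi> where "continuation_family (%t. e (P t)) \<phi>"
  "!!t. t \<in> {0..1} ==> \<forall>\<^sub>F x in nhds (P t). \<phi> t (e x) = \<Phi> x"
proof -
 have PD: "P t \<in> D" if "t \<in> {0..1}" for t using P(2) that by (auto simp: path_image_def)
 define Q where "Q t r g \<longleftrightarrow> r > 0 \<and> ball (P t) r \<subseteq> D \<and> inj_on e (ball (P t) r) \<and> g holomorphic_on (e ` ball (P t) r) \<and>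
  (\<forall>x\<in>ball (P t) r. g (e x) = x)" for t r g
 have "\<exists>r g. Q t r g" if t: "t \<in> {0..1}" for t
 proof -
  obtain r where r: "r > 0" "ball (P t) r \<subseteq> D" "inj_on e (ball (P t) r)"
   by (rule has_complex_derivative_locally_injective[OF e(1) PD[OF t] e(2) e(3)[OF PD[OF t]]])
  obtain g where "g holomorphic_on (e ` ball (P t) r)" "!!z. z \<in> ball (P t) r ==> g (e z) = z"
   by (rule holomorphic_has_inverse[OF holomorphic_on_subset[OF e(1) r(2)] open_ball r(3)]) blast
  then have "Q t r g" using r by (simp add: Q_def)
  then show ?thesis by blast
 qed
 then obtain r g where Q: "!!t. t \<in> {0..1} ==> Q t (r t) (g t)" by metis
 have rg: "r t > 0 \<and> ball (P t) (r t) \<subseteq> D \<and> inj_on e (ball (P t) (r t)) \<and>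
  g t holomorphic_on (e ` ball (P t) (r t)) \<and> (\<forall>x\<in>ball (P t) (r t). g t (e x) = x)"
  if "t \<in> {0..1}" for t using Q[OF that] unfolding Q_def .
 define \<phi> where "\<phi> t w = \<Phi> (g t w)" for t w
 have opn: "open (e ` S)" if "open S" "S \<subseteq> ball (P t) (r t)" "t \<in> {0..1}" for S t
 proof (rule open_mapping_thm3[OF _ that(1)])
  have "S \<subseteq> D" using that rg[OF that(3)] by auto
  then show "e holomorphic_on S" by (rule holomorphic_on_subset[OF e(1)])
  show "inj_on e S" using rg[OF that(3)] that(2) by (auto intro: inj_on_subset)
 qed
 have val: "\<phi> t (e x) = \<Phi> x" if "t \<in> {0..1}" "x \<in> ball (P t) (r t)" for t x
  using rg[OF that(1)] that(2) by (auto simp: \<phi>_def)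
 have fam: "continuation_family (%t. e (P t)) \<phi>"
 proof (rule continuation_familyI_local)
  show "path (%t. e (P t))"
   unfolding path_def
   by (rule continuous_on_compose2[OF holomorphic_on_imp_continuous_on[OF e(1)]])
    (use P in \<open>auto simp: path_def path_image_def\<close>)
  fix t :: real assume t: "t \<in> {0..1}"
  let ?B = "ball (P t) (r t)"
  have "\<phi> t holomorphic_on e ` ?B"
   unfolding \<phi>_def
   by (rule holomorphic_on_compose_gen[of "g t" _ \<Phi> D, unfolded o_def]) (use \<Phi> rg[OF t] in auto)
  moreover have "e (P t) \<in> e ` ?B" using rg[OF t] by auto
  moreover have "open (e ` ?B)" by (rule opn[OF _ _ t]) auto
  ultimately show "\<phi> t analytic_on {e (P t)}" unfolding analytic_at by blast
  have "\<forall>\<^sub>F s in at t within {0..1}. P s \<in> ?B"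
   by (rule eventually_within_nhds[OF P(1) t open_ball]) (use rg[OF t] in simp)
  moreover have "\<forall>\<^sub>F s in at t within {0..1}. s \<in> {0..1}" by (auto simp: eventually_at intro: exI[of _ 1])
  ultimately show "\<forall>\<^sub>F s in at t within {0..1}. \<forall>\<^sub>F z in nhds (e (P s)). \<phi> s z = \<phi> t z"
  proof eventually_elim
   case (elim s)
   let ?S = "?B \<inter> ball (P s) (r s)"
   have "open (e ` ?S)" by (rule opn[of _ t]) (use t in auto)
   moreover have "e (P s) \<in> e ` ?S" using elim rg[OF elim(2)] by auto
   moreover have "\<phi> s z = \<phi> t z" if "z \<in> e ` ?S" for z
    using that val[OF t] val[OF elim(2)] by auto
   ultimately show ?case unfolding eventually_nhds by blast
  qed
 qed
 have "\<forall>\<^sub>F x in nhds (P t). \<phi> t (e x) = \<Phi> x" if t: "t \<in> {0..1}" for t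
  unfolding eventually_nhds using val[OF t] rg[OF t] by (intro exI[of _ "ball (P t) (r t)"]) auto
 then show thesis using that fam by blast
qed

section \<open>The star of a power series and its singularities\<close>

definition star :: "complex fps => complex set" where
 "star F = {z. continuable (eval_fps F) (linepath 0 z)}"

definition pbranch :: "complex fps => complex => complex" where
 "pbranch F z = continuation_value (eval_fps F) (linepath 0 z)"

text \<open>The family along the segment to \<open>z\<close> also serves the segments to nearby
  \<open>w\<close>, because \<open>linepath 0 w\<close> stays within \<open>dist w z\<close> of
  \<open>linepath 0 z\<close>.\<close>

lemma star_local:
 assumes "z \<in> star F"
 obtains eps \<phi> where "eps > 0" "\<phi> holomorphic_on ball z eps" "ball z eps \<subseteq> star F"
  "!!w. w \<in> ball z eps ==> pbranch F w = \<phi> w"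
proof -
 obtain \<phi> where c: "continues_along (eval_fps F) (linepath 0 z) \<phi>"
  using assms by (auto simp: star_def continuable_def)
 then have cf: "continuation_family (linepath 0 z) \<phi>" and \<phi>0: "\<forall>\<^sub>F w in nhds 0. \<phi> 0 w = eval_fps F w"
  by (auto simp: continues_along_def)
 obtain eps \<phi>' where t: "eps > 0"
  "!!t. t \<in> {0..1} ==> \<phi>' t holomorphic_on ball (linepath 0 z t) eps"
  "!!t. t \<in> {0..1} ==> \<forall>\<^sub>F w in nhds (linepath 0 z t). \<phi>' t w = \<phi> t w"
  "!!q. path q ==> (!!t. t \<in> {0..1} ==> dist (q t) (linepath 0 z t) < eps) ==> continuation_family q \<phi>'"
  by (rule continuation_family_tube[OF cf]) blast
 have ca: "continues_along (eval_fps F) (linepath 0 w) \<phi>'" if "w \<in> ball z eps" for w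
 proof -
  have "dist (linepath 0 w t) (linepath 0 z t) < eps" if t: "t \<in> {0..1}" for t
  proof -
   have "dist (linepath 0 w t) (linepath 0 z t) = t * dist w z"
    using t by (simp add: linepath_def dist_norm flip: scaleR_diff_right)
   also have "\<dots> <= dist w z" using t by (simp add: mult_left_le_one_le)
   also have "\<dots> < eps" using \<open>w \<in> ball z eps\<close> by (simp add: dist_commute)
   finally show ?thesis .
  qed
  then have "continuation_family (linepath 0 w) \<phi>'" using t(4) by simp
  moreover have "\<forall>\<^sub>F w in nhds 0. \<phi>' 0 w = eval_fps F w"
   using t(3)[of 0] \<phi>0 by (auto elim: eventually_elim2)
  ultimately show ?thesis by (simp add: continues_along_def)
 qed
 show thesis
 proof (rule that[of eps "\<phi>' 1"])
  show "\<phi>' 1 holomorphic_on ball z eps" using t(2)[of 1] by (simp add: linepath_def)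
  show "ball z eps \<subseteq> star F" using ca unfolding star_def continuable_def by blast
  show "pbranch F w = \<phi>' 1 w" if "w \<in> ball z eps" for w
   using continuation_value_eq[OF ca[OF that]] by (simp add: pbranch_def)
 qed (rule t(1))
qed

lemma open_star: "open (star F)"
 unfolding open_contains_ball using star_local by metis

lemma pbranch_holomorphic: "pbranch F holomorphic_on star F"
proof (rule analytic_imp_holomorphic, unfold analytic_on_def, safe)
 fix z assume "z \<in> star F"
 then obtain eps \<phi> where *: "eps > 0" "\<phi> holomorphic_on ball z eps"
  "!!w. w \<in> ball z eps ==> pbranch F w = \<phi> w" by (rule star_local) blast
 have "pbranch F holomorphic_on ball z eps" by (rule holomorphic_transform[OF *(2)]) (simp add: *(3))
 then show "\<exists>e>0. pbranch F holomorphic_on ball z e" using *(1) by blast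
qed

text \<open>Along each segment the constant family \<open>f\<close> is a continuation. The contour
  integral will be recognised as the principal branch of the Hadamard product in this way.\<close>

lemma pbranch_unique:
 assumes f: "f holomorphic_on W" "open W" and W: "!!w. w \<in> W ==> closed_segment 0 w \<subseteq> W"
  and 0: "\<forall>\<^sub>F z in nhds 0. f z = eval_fps F z" and w: "w \<in> W"
 shows "w \<in> star F" "pbranch F w = f w"
proof -
 have c: "continues_along (eval_fps F) (linepath 0 w) (%_. f)"
  by (rule continues_along_holomorphic[OF f]) (use W[OF w] 0 in auto)
 show "w \<in> star F" using c by (auto simp: star_def continuable_def)
 show "pbranch F w = f w"
  using continuation_value_eq[OF c] by (simp add: pbranch_def)
qed

lemma star_scale:
 assumes "z \<in> star F" "t \<in> {0..1}" shows "complex_of_real t * z \<in> star F"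
proof -
 obtain \<phi> where c: "continues_along (eval_fps F) (linepath 0 z) \<phi>"
  using assms by (auto simp: star_def continuable_def)
 have "continuation_family (%s. linepath 0 z (t * s)) (%s. \<phi> (t * s))"
  by (rule continuation_family_reparam[of "linepath 0 z" \<phi>]) (use c assms(2) in \<open>auto simp: continues_along_def mult_le_one intro!: continuous_intros\<close>)
 moreover have "(%s. linepath 0 z (t * s)) = linepath 0 (of_real t * z)"
  by (auto simp: linepath_def scaleR_conv_of_real fun_eq_iff mult_ac)
 ultimately have "continuation_family (linepath 0 (of_real t * z)) (%s. \<phi> (t * s))" by metis
 then have "continues_along (eval_fps F) (linepath 0 (of_real t * z)) (%s. \<phi> (t * s))"
  using c by (simp add: continues_along_def)
 then show ?thesis by (auto simp: star_def continuable_def)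
qed

lemma star_segment: "z \<in> star F ==> closed_segment 0 z \<subseteq> star F"
 using star_scale by (auto simp: closed_segment_def scaleR_conv_of_real)

lemma pbranch_near_0:
 assumes "fps_conv_radius F > 0"
 obtains r where "r > 0" "ereal r < fps_conv_radius F" "ball 0 r \<subseteq> star F" "!!z. z \<in> ball 0 r ==> pbranch F z = eval_fps F z"
proof -
 obtain r where r: "ereal r > 0" "ereal r < fps_conv_radius F" using assms ereal_dense2 by blast
 then have sub: "ball 0 r \<subseteq> eball 0 (fps_conv_radius F)"
  by (auto simp: eball_def) (metis ereal_less_eq(3) less_le_trans less_le not_less)
 have seg: "closed_segment 0 w \<subseteq> ball 0 r" if "w \<in> ball (0::complex) r" for w
  by (rule closed_segment_subset) (use that r(1) in auto)
 show thesis
 proof (rule that[of r])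
  show "ball 0 r \<subseteq> star F" "!!z. z \<in> ball 0 r ==> pbranch F z = eval_fps F z"
   using pbranch_unique[of "eval_fps F" "ball 0 r" F, OF holomorphic_on_eval_fps[OF sub] open_ball seg]
   by auto
 qed (use r in auto)
qed

lemma zero_in_star: "fps_conv_radius F > 0 ==> 0 \<in> star F"
 using pbranch_near_0 by (metis centre_in_ball subset_iff)

lemma pbranch_eq_nhds_0:
 assumes "fps_conv_radius F > 0" shows "\<forall>\<^sub>F z in nhds 0. pbranch F z = eval_fps F z"
proof -
 obtain r where "r > 0" "!!z. z \<in> ball 0 r ==> pbranch F z = eval_fps F z"
  using pbranch_near_0[OF assms] by metis
 then show ?thesis unfolding eventually_nhds by (intro exI[of _ "ball 0 r"]) auto
qed

lemma star_continues_along: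
 assumes "fps_conv_radius F > 0" "z \<in> star F"
 shows "continues_along (eval_fps F) (linepath 0 z) (%_. pbranch F)"
 by (rule continues_along_holomorphic[OF pbranch_holomorphic open_star])
  (use star_segment[OF assms(2)] pbranch_eq_nhds_0[OF assms(1)] in auto)

lemma continuable_join_star:
 assumes "fps_conv_radius F > 0" "continuable (eval_fps F) (linepath 0 (pathstart q) +++ q)"
 shows "pathstart q \<in> star F" "continuable (pbranch F) q"
proof -
 obtain \<theta> where \<theta>: "continues_along (eval_fps F) (linepath 0 (pathstart q) +++ q) \<theta>"
  using assms unfolding continuable_def by blast
 have s: "continues_along (eval_fps F) (linepath 0 (pathstart q)) (%t. \<theta> (t/2))"
  "continues_along (\<theta> (1/2)) q (%t. \<theta> ((t+1)/2))"
  using continues_along_split[OF \<theta>] by auto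
 show z: "pathstart q \<in> star F" using s(1) by (auto simp: star_def continuable_def)
 have "\<forall>\<^sub>F w in nhds (pathstart q). \<theta> (1/2) w = pbranch F w"
  using continues_along_unique[OF s(1) star_continues_along[OF assms(1) z], of 1] by (simp add: linepath_def)
 then have "continues_along (pbranch F) q (%t. \<theta> ((t+1)/2))"
  using s(2) unfolding continues_along_def by (auto elim: eventually_elim2)
 then show "continuable (pbranch F) q" unfolding continuable_def by blast
qed

lemma continuable_joinI:
 assumes "fps_conv_radius F > 0" "pathstart q \<in> star F" "continues_along (pbranch F) q \<phi>"
 shows "continuable (eval_fps F) (linepath 0 (pathstart q) +++ q)"
  "continuation_value (eval_fps F) (linepath 0 (pathstart q) +++ q) = \<phi> 1 (pathfinish q)"
 using continuation_value_join[OF star_continues_along[OF assms(1,2)] assms(3)] by auto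

section \<open>Nonsingular points and one-sided extensions\<close>

lemma zero_not_singular: "0 \<notin> singularities F"
 unfolding singularities_def by (auto intro: exI[of _ 1])

lemma nonsingularI:
 assumes "r > 0" "!!z. z \<in> ball a r ==> Im (z / a) ~= 0 ==> continuable (eval_fps F) (linepath 0 z +++ linepath z a)"
 shows "a \<notin> singularities F"
 using assms unfolding singularities_def by blast

lemma nonsingularE:
 assumes "a \<notin> singularities F"
 obtains r where "r > 0" "!!z. z \<in> ball a r ==> Im (z / a) ~= 0 ==> continuable (eval_fps F) (linepath 0 z +++ linepath z a)"
 using assms unfolding singularities_def by blast

lemma open_half_plane_Im_div: "open {z. c * Im (z / a) > 0}"
 unfolding divide_inverse by (intro open_Collect_less continuous_intros)

lemma convex_half_plane_Im_div: "convex {z. c * Im (z / a) > 0}"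
 unfolding convex_def
proof (intro ballI allI impI CollectI)
 fix x y and u v :: real assume "x \<in> {z. c * Im (z / a) > 0}" "y \<in> {z. c * Im (z / a) > 0}" "0 <= u" "0 <= v" "u + v = 1"
 then have *: "c * Im (x / a) > 0" "c * Im (y / a) > 0" "0 <= u" "0 <= v" "u + v = 1" by auto
 have "c * Im ((u *\<^sub>R x + v *\<^sub>R y) / a) = u * (c * Im (x/a)) + v * (c * Im (y/a))"
  by (simp add: add_divide_distrib scaleR_conv_of_real flip: times_divide_eq_right) (simp add: algebra_simps)
 also have "\<dots> > 0" using * by (smt (verit, best) mult_nonneg_nonneg mult_pos_pos)
 finally show "c * Im ((u *\<^sub>R x + v *\<^sub>R y) / a) > 0" .
qed

text \<open>The definition of a nonsingular point gives a separate continuation for each starting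
  point. One of them suffices: its final germ agrees with the principal branch at a point of the
  segment close to \<open>a\<close>, and the identity theorem spreads the agreement over the
  connected half-disc. The two signs of \<open>c\<close> may give different extensions.\<close>

lemma nonsingular_extension:
 assumes F: "fps_conv_radius F > 0" and a: "a ~= 0" "a \<notin> singularities F" and c: "\<bar>c\<bar> = (1::real)"
 obtains r \<phi> where "r > 0" "\<phi> holomorphic_on ball a r"
  "!!z. z \<in> ball a r ==> c * Im (z / a) > 0 ==> z \<in> star F \<and> pbranch F z = \<phi> z"
proof -
 obtain r0 where r0: "r0 > 0" "!!z. z \<in> ball a r0 ==> Im (z / a) ~= 0 ==>
  continuable (eval_fps F) (linepath 0 z +++ linepath z a)"
  by (rule nonsingularE[OF a(2)]) blast
 let ?H = "ball a r0 \<inter> {z. c * Im (z / a) > 0}"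
 have Hs: "z \<in> star F" "continuable (pbranch F) (linepath z a)" if "z \<in> ?H" for z
 proof -
  have "Im (z / a) ~= 0" using that by auto
  then have "continuable (eval_fps F) (linepath 0 z +++ linepath z a)" using r0(2)[of z] that by blast
  then show "z \<in> star F" "continuable (pbranch F) (linepath z a)"
   using continuable_join_star[OF F, of "linepath z a"] by auto
 qed
 \<comment> \<open>A point on the normal to the ray at \<open>a\<close>, on the side
   \<open>c\<close>, at distance \<open>r0 / 2\<close> from \<open>a\<close>.\<close>
 define z1 where "z1 = a + a * (\<i> * of_real (c * r0 / (2 * norm a)))"
 have z1: "z1 \<in> ?H"
 proof -
  have "z1 / a = 1 + \<i> * of_real (c * r0 / (2 * norm a))" using a(1) by (simp add: z1_def field_simps)
  then have "c * Im (z1/a) = (c * c) * r0 / (2 * norm a)" by simp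
  also have "c * c = 1" using c by (metis abs_mult_self_eq mult_1)
  finally have "c * Im (z1/a) > 0" using a r0(1) by simp
  moreover have "dist a z1 = r0/2" using a c r0(1) by (simp add: z1_def dist_norm norm_mult norm_divide)
  ultimately show ?thesis using r0(1) by simp
 qed
 obtain \<psi> where \<psi>: "continues_along (pbranch F) (linepath z1 a) \<psi>"
  using Hs(2)[OF z1] unfolding continuable_def by blast
 then have fam: "continuation_family (linepath z1 a) \<psi>" by (simp add: continues_along_def)
 obtain r d where rd: "r > 0" "d > 0" "\<psi> 1 holomorphic_on ball (linepath z1 a 1) r"
  "!!s. s \<in> {0..1} ==> \<bar>s - 1\<bar> < d ==> linepath z1 a s \<in> ball (linepath z1 a 1) (r / 2) \<and>
   (\<forall>\<^sub>F z in nhds (linepath z1 a s). \<psi> s z = \<psi> 1 z)"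
  by (rule continuation_family_local[OF fam, of 1]) (simp, blast)
 define s where "s = 1 - min d 1 / 2"
 have s: "s \<in> {0..1}" "s < 1" "\<bar>s - 1\<bar> < d" using rd(2) by (auto simp: s_def)
 have inH: "linepath z1 a t \<in> ?H" if t: "t \<in> {0..1}" "t < 1" for t
 proof -
  have "linepath z1 a t \<in> ball a r0"
   using closed_segment_subset[of z1 "ball a r0" a] z1 r0(1) linepath_in_path[OF t(1), of z1 a] by auto
  have "Im (linepath z1 a t / a) = (1 - t) * Im (z1 / a)"
   using a(1) by (simp add: linepath_def add_divide_distrib scaleR_conv_of_real flip: times_divide_eq_right)
  then have e: "c * Im (linepath z1 a t / a) = (1 - t) * (c * Im (z1 / a))" by simp
  have "(1 - t) * (c * Im (z1 / a)) > 0" by (rule mult_pos_pos) (use z1 t in auto)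
  then have "c * Im (linepath z1 a t / a) > 0" unfolding e .
  with \<open>linepath z1 a t \<in> ball a r0\<close> show ?thesis by blast
 qed
 have "continuation_family (%u. linepath z1 a (s * u)) (%u. \<psi> (s * u))"
  by (rule continuation_family_reparam[OF fam]) (use s in \<open>auto simp: mult_le_one intro!: continuous_intros\<close>)
 moreover have "continuation_family (%u. linepath z1 a (s * u)) (%u. pbranch F)"
 proof (rule continuation_family_holomorphic[OF pbranch_holomorphic open_star])
  show "path (%u. linepath z1 a (s * u))" unfolding path_def linepath_def by (intro continuous_intros)
  show "path_image (%u. linepath z1 a (s * u)) \<subseteq> star F"
  proof (clarsimp simp: path_image_def)
   fix u :: real assume u: "0 <= u" "u <= 1"
   have "s * u \<in> {0..1}" "s * u < 1" using s u by (auto simp: mult_le_one) (metis dual_order.strict_trans2 mult_left_le)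
   then show "linepath z1 a (s * u) \<in> star F" using Hs(1)[OF inH] by blast
  qed
 qed
 moreover have "\<forall>\<^sub>F z in nhds (linepath z1 a (s * 0)). \<psi> (s * 0) z = pbranch F z"
 proof -
  have "linepath z1 a (s * 0) = z1" by (simp add: linepath_def)
  then show ?thesis using \<psi> by (simp add: continues_along_def)
 qed
 ultimately have "\<forall>\<^sub>F z in nhds (linepath z1 a (s * 1)). \<psi> (s * 1) z = pbranch F z"
  by (rule continuation_family_unique) auto
 then have ev: "\<forall>\<^sub>F z in nhds (linepath z1 a s). \<psi> 1 z = pbranch F z"
  using rd(4)[OF s(1,3)] by (auto elim: eventually_elim2)
 have sb: "linepath z1 a s \<in> ball a r" using rd(4)[OF s(1,3)] rd(1) by (simp add: linepath_def)
 let ?S = "ball a r \<inter> ?H"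
 have eq: "\<psi> 1 z = pbranch F z" if "z \<in> ?S" for z
 proof (rule identity_nhds[of ?S _ _ "linepath z1 a s", OF _ _ _ _ _ ev that])
  show "open ?S" using open_half_plane_Im_div[of c a] by blast
  show "connected ?S" using convex_half_plane_Im_div[of c a] by (intro convex_connected convex_Int) auto
  show "\<psi> 1 holomorphic_on ?S" by (rule holomorphic_on_subset[OF rd(3)]) (auto simp: linepath_def)
  show "pbranch F holomorphic_on ?S"
   by (rule holomorphic_on_subset[OF pbranch_holomorphic]) (use Hs(1) in auto)
  show "linepath z1 a s \<in> ?S" using sb inH[OF s(1,2)] by blast
 qed
 show thesis
 proof (rule that[of "min r r0" "\<psi> 1"])
  show "\<psi> 1 holomorphic_on ball a (min r r0)"
   by (rule holomorphic_on_subset[OF rd(3)]) (auto simp: linepath_def)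
 qed (use rd(1) r0(1) eq Hs(1) in auto)
qed

text \<open>The first point of the segment outside the open star must be singular: otherwise the
  extension of the principal branch to a disc around it, taken from one side, would also continue
  the germ along the segment itself.\<close>

lemma not_in_star_singular:
 assumes F: "fps_conv_radius F > 0" and z: "z \<notin> star F"
 obtains t where "0 < t" "t <= 1" "complex_of_real t * z \<in> singularities F"
proof -
 let ?T = "{0..1} \<inter> (%t. complex_of_real t * z) -` (- star F)"
 have z0: "z ~= 0" using z zero_in_star[OF F] by auto
 have "closed ?T" by (intro continuous_closed_preimage) (auto intro!: continuous_intros simp: closed_Compl open_star)
 then have "compact ?T" by (auto simp: compact_eq_bounded_closed intro: bounded_subset[of "{0..1}"])
 moreover have "1 \<in> ?T" using z by auto
 ultimately obtain t where t: "t \<in> ?T" "!!s. s \<in> ?T ==> t <= s" using compact_attains_inf[of ?T] by blast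
 have tpos: "t > 0" using t(1) zero_in_star[OF F] by (cases "t = 0") auto
 define a where "a = of_real t * z"
 have a: "a \<notin> star F" "a ~= 0" using t(1) tpos z0 by (auto simp: a_def)
 have lt: "of_real s * a \<in> star F" if "0 <= s" "s < 1" for s
 proof (rule ccontr)
  assume "of_real s * a \<notin> star F"
  then have "s * t \<in> ?T" using that t(1) by (auto simp: a_def mult_ac mult_le_one)
  then have "t <= s * t" using t(2) by blast
  then show False using that tpos by (simp add: field_simps)
 qed
 have "a \<in> singularities F"
 proof (rule ccontr)
  assume ns: "a \<notin> singularities F"
  obtain r \<phi> where r: "r > 0" "\<phi> holomorphic_on ball a r"
   "!!z. z \<in> ball a r ==> 1 * Im (z / a) > 0 ==> z \<in> star F \<and> pbranch F z = \<phi> z"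
   by (rule nonsingular_extension[OF F a(2) ns, of 1]) (simp, blast)
  let ?p = "linepath 0 a"
  have p: "?p s = of_real s * a" for s by (simp add: linepath_def scaleR_conv_of_real)
  let ?\<theta> = "%s::real. if s < 1 then pbranch F else \<phi>"
  have agree: "\<forall>\<^sub>F w in nhds (?p s). pbranch F w = \<phi> w" if s: "0 < s" "s < 1" "?p s \<in> ball a r" for s
  proof -
   have "?p s \<in> star F \<inter> ball a r" using lt[of s] s(1,2) s(3) unfolding p by simp
   then obtain \<delta> where \<delta>: "\<delta> > 0" "ball (?p s) \<delta> \<subseteq> star F \<inter> ball a r"
    using open_star open_ball by (meson open_Int open_contains_ball)
   \<comment> \<open>A nearby point off the ray, where the one-sided extension is known to be the
     principal branch; from there the identity theorem reaches \<open>?p s\<close>.\<close>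
   define b where "b = ?p s + a * (\<i> * of_real (\<delta> / (2 * norm a)))"
   have ba: "b / a = of_real s + \<i> * of_real (\<delta> / (2 * norm a))" using a(2) by (simp add: b_def p add_divide_distrib scaleR_conv_of_real)
   have "dist (?p s) b = \<delta>/2" using a(2) \<delta>(1) by (simp add: b_def dist_norm norm_mult norm_divide)
   then have b: "b \<in> ball (?p s) \<delta>" using \<delta>(1) by simp
   have bI: "Im (b / a) > 0" unfolding ba using \<delta>(1) a(2) by simp
   have ev: "\<forall>\<^sub>F w in nhds b. pbranch F w = \<phi> w"
    unfolding eventually_nhds
   proof (intro exI[of _ "ball a r \<inter> {z. 1 * Im (z/a) > 0}"] conjI)
    show "open (ball a r \<inter> {z. 1 * Im (z/a) > 0})" by (intro open_Int open_ball open_half_plane_Im_div)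
   qed (use b bI \<delta>(2) r(3) in auto)
   have "pbranch F w = \<phi> w" if "w \<in> ball (?p s) \<delta>" for w
    by (rule identity_nhds[of "ball (?p s) \<delta>" _ _ b, OF _ _ _ _ b ev that])
     (use \<delta>(2) holomorphic_on_subset[OF pbranch_holomorphic, of "ball (?p s) \<delta>"]
       holomorphic_on_subset[OF r(2), of "ball (?p s) \<delta>"] in auto)
   then show ?thesis unfolding eventually_nhds using \<delta>(1) by (intro exI[of _ "ball (?p s) \<delta>"]) auto
  qed
  have "continuation_family ?p ?\<theta>"
  proof (rule continuation_familyI_local)
   fix s :: real assume s: "s \<in> {0..1}"
   show "?\<theta> s analytic_on {?p s}"
   proof (cases "s < 1")
    case True
    then have "?p s \<in> star F" using lt[of s] s unfolding p by simp
    then show ?thesis using True open_star pbranch_holomorphic analytic_at by auto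
   next
    case False
    then show ?thesis using s r(1,2) by (auto simp: p analytic_at intro!: exI[of _ "ball a r"])
   qed
   show "\<forall>\<^sub>F u in at s within {0..1}. \<forall>\<^sub>F w in nhds (?p u). ?\<theta> u w = ?\<theta> s w"
   proof (cases "s < 1")
    case True
    then have "\<forall>\<^sub>F u in at s within {0..1}. u < 1"
     by (auto simp: eventually_at dist_real_def intro!: exI[of _ "1 - s"])
    then show ?thesis by eventually_elim (use True in simp)
   next
    case False
    then have s1: "s = 1" using s by simp
    have "\<forall>\<^sub>F u in at s within {0..1}. ?p u \<in> ball a r"
     by (rule eventually_within_nhds[OF path_linepath s open_ball]) (use s1 r(1) in \<open>auto simp: p\<close>)
    moreover have "\<forall>\<^sub>F u in at s within {0..1}. 0 < u \<and> u < 1"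
     by (auto simp: eventually_at dist_real_def s1 intro!: exI[of _ "1"])
    ultimately show ?thesis
    proof eventually_elim
     case (elim u)
     then show ?case using agree[of u] by (simp add: s1)
    qed
   qed
  qed auto
  then have "continues_along (eval_fps F) ?p ?\<theta>"
   using pbranch_eq_nhds_0[OF F] by (simp add: continues_along_def)
  then show False using a(1) by (auto simp: star_def continuable_def)
 qed
 then show thesis using that[of t] tpos t(1) by (auto simp: a_def)
qed

lemma star_nonsingular:
 assumes F: "fps_conv_radius F > 0" and "a \<in> star F" shows "a \<notin> singularities F"
proof -
 obtain \<delta> where \<delta>: "\<delta> > 0" "ball a \<delta> \<subseteq> star F" using assms open_star open_contains_ball by metis
 have "continuable (eval_fps F) (linepath 0 z +++ linepath z a)" if "z \<in> ball a \<delta>" for z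
 proof -
  have "closed_segment z a \<subseteq> ball a \<delta>" using that \<delta>(1) by (intro closed_segment_subset) auto
  then have "continues_along (pbranch F) (linepath z a) (%_. pbranch F)"
   by (intro continues_along_holomorphic[OF pbranch_holomorphic open_star]) (use \<delta> in auto)
  then show ?thesis using continuable_joinI(1)[OF F, of "linepath z a"] that \<delta>(2) by auto
 qed
 then show ?thesis by (rule nonsingularI[OF \<delta>(1)])
qed

lemma Im_div_scale:
 assumes "b = of_real s * a" shows "Im (z / b) = Im (z / a) / s"
proof -
 have e: "z / b = z / a / of_real s" by (simp add: assms mult.commute)
 show ?thesis unfolding e by (rule Im_divide_of_real)
qed

lemma real_multiple:
 assumes "Im (b / a) = 0" "a ~= 0" shows "b = of_real (Re (b / a)) * a"
proof -
 have "b / a = of_real (Re (b / a))" using assms(1) by (simp add: complex_eq_iff)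
 then show ?thesis using assms(2) by (metis nonzero_divide_eq_eq)
qed

text \<open>Points near \<open>a\<close> and off its ray lie in the star. A point \<open>b\<close>
  on the ray need not, but it is approached from the two sides by the two extensions at
  \<open>a\<close>. The bound \<open>norm a\<close> on the radius keeps \<open>b\<close> on the same
  half-line as \<open>a\<close>, so that both have the same sides.\<close>

lemma nonsingular_nhd:
 assumes F: "fps_conv_radius F > 0" and a: "a \<notin> singularities F"
 obtains r where "r > 0" "ball a r \<inter> singularities F = {}"
proof (cases "a = 0")
 case True
 obtain r where "r > 0" "ball 0 r \<subseteq> star F" using pbranch_near_0[OF F] by metis
 then show ?thesis using that[of r] True star_nonsingular[OF F] by blast
next
 case False
 obtain r \<phi> where r: "r > 0" "\<phi> holomorphic_on ball a r"
  "!!z. z \<in> ball a r ==> 1 * Im (z / a) > 0 ==> z \<in> star F \<and> pbranch F z = \<phi> z"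
  by (rule nonsingular_extension[OF F False a, of 1]) (simp, blast)
 obtain r' \<phi>' where r': "r' > 0" "\<phi>' holomorphic_on ball a r'"
  "!!z. z \<in> ball a r' ==> (-1) * Im (z / a) > 0 ==> z \<in> star F \<and> pbranch F z = \<phi>' z"
  by (rule nonsingular_extension[OF F False a, of "-1"]) (simp, blast)
 define \<rho> where "\<rho> = min (min r r') (norm a)"
 have \<rho>: "\<rho> > 0" "\<rho> <= r" "\<rho> <= r'" "\<rho> <= norm a" using r(1) r'(1) False by (auto simp: \<rho>_def)
 have "b \<notin> singularities F" if b: "b \<in> ball a \<rho>" for b
 proof (cases "Im (b / a) = 0")
  case False
  then have "b \<in> star F" using r(3)[of b] r'(3)[of b] b \<rho> by (cases "Im (b/a) > 0") auto
  then show ?thesis by (rule star_nonsingular[OF F])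
 next
  case True
  define s where "s = Re (b / a)"
  have bs: "b = of_real s * a"
   unfolding s_def using True \<open>a ~= 0\<close> by (rule real_multiple)
  have "a - b = of_real (1 - s) * a" by (simp add: bs algebra_simps)
  then have "dist a b = \<bar>1 - s\<bar> * norm a" by (simp add: dist_norm norm_mult del: of_real_diff)
  then have "\<bar>1 - s\<bar> * norm a < 1 * norm a" using b \<rho>(4) by simp
  then have "\<bar>1 - s\<bar> < 1" by (rule mult_right_less_imp_less) simp
  then have spos: "s > 0" by auto
  obtain \<delta> where \<delta>: "\<delta> > 0" "ball b \<delta> \<subseteq> ball a \<rho>" using b open_contains_ball open_ball by meson
  have "continuable (eval_fps F) (linepath 0 z +++ linepath z b)" if z: "z \<in> ball b \<delta>" "Im (z / b) ~= 0" for z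
  proof -
   have nz: "Im (z / a) ~= 0" using z(2) spos by (simp add: Im_div_scale[OF bs])
   have za: "z \<in> ball a \<rho>" using z \<delta> by blast
   have "\<exists>\<psi> c. \<psi> holomorphic_on ball a \<rho> \<and> c * Im (z / a) > 0 \<and> (\<forall>w\<in>ball a \<rho>. c * Im (w / a) > 0 -->
    w \<in> star F \<and> pbranch F w = \<psi> w)"
   proof (cases "Im (z / a) > 0")
    case True
    then show ?thesis using r \<rho> holomorphic_on_subset[OF r(2), of "ball a \<rho>"] by (intro exI[of _ \<phi>] exI[of _ 1]) auto
   next
    case False
    then show ?thesis using r' \<rho> nz holomorphic_on_subset[OF r'(2), of "ball a \<rho>"] by (intro exI[of _ \<phi>'] exI[of _ "-1"]) auto
   qed
   then obtain \<psi> c where \<psi>: "\<psi> holomorphic_on ball a \<rho>" "c * Im (z / a) > 0"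
    "!!w. w\<in>ball a \<rho> ==> c * Im (w / a) > 0 ==> w \<in> star F \<and> pbranch F w = \<psi> w" by blast
   have "\<forall>\<^sub>F w in nhds z. w \<in> ball a \<rho> \<inter> {w. c * Im (w / a) > 0}"
    by (intro eventually_nhds_in_open open_Int open_ball open_half_plane_Im_div) (use za \<psi>(2) in auto)
   then have "\<forall>\<^sub>F w in nhds z. \<psi> w = pbranch F w" by eventually_elim (use \<psi>(3) in auto)
   moreover have "closed_segment z b \<subseteq> ball b \<delta>" using z(1) \<delta>(1) by (intro closed_segment_subset) auto
   ultimately have "continues_along (pbranch F) (linepath z b) (%_. \<psi>)"
    by (intro continues_along_holomorphic[OF \<psi>(1) open_ball]) (use \<delta>(2) in auto)
   then show ?thesis using continuable_joinI(1)[OF F, of "linepath z b"] \<psi>(3)[OF za \<psi>(2)] by auto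
  qed
  then show ?thesis by (rule nonsingularI[OF \<delta>(1)])
 qed
 then show ?thesis using that[of \<rho>] \<rho>(1) by blast
qed

text \<open>A segment from \<open>z\<close> to \<open>b\<close> inside the punctured disc gives a
  local path at \<open>a\<close>, provided that \<open>z\<close> is off the line of \<open>a\<close>
  whenever it is off the line of \<open>b\<close>. If \<open>b\<close> is on the line of
  \<open>a\<close> the two conditions coincide, and otherwise a small disc around \<open>b\<close>
  avoids that line.\<close>

lemma isolated_sing_punctured:
 assumes "isolated_sing F a" "a ~= 0"
 obtains r where "r > 0" "(ball a r - {a}) \<inter> singularities F = {}"
proof -
 obtain r where r: "r > 0" "!!p. p \<in> local_paths a r ==> continuable (eval_fps F) p"
  using assms unfolding isolated_sing_def by blast
 have "b \<notin> singularities F" if b: "b \<in> ball a r - {a}" "b ~= 0" for b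
 proof -
  have ex: "\<exists>\<delta>>0. ball b \<delta> \<subseteq> ball a r - {a} \<and> (\<forall>z\<in>ball b \<delta>. Im (z / b) ~= 0 --> Im (z / a) ~= 0)"
  proof -
   obtain \<delta> where \<delta>: "\<delta> > 0" "ball b \<delta> \<subseteq> ball a r - {a}"
    using b open_contains_ball by (metis open_Diff open_ball closed_singleton)
   show ?thesis
   proof (cases "Im (b / a) = 0")
    case True
    define s where "s = Re (b / a)"
    have bs: "b = of_real s * a"
     unfolding s_def using True assms(2) by (rule real_multiple)
    show ?thesis using \<delta> by (intro exI[of _ \<delta>]) (auto simp: Im_div_scale[OF bs])
   next
    case False
    then have "b \<in> {z. Im (z/a) * Im (b / a) > 0}" using not_real_square_gt_zero[of "Im (b/a)"] by blast
    moreover have "open {z. Im (z/a) * Im (b / a) > 0}"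
     using open_half_plane_Im_div[of "Im (b/a)" a] by (simp add: mult.commute)
    ultimately obtain \<delta>' where \<delta>': "\<delta>' > 0" "ball b \<delta>' \<subseteq> {z. Im (z/a) * Im (b / a) > 0}"
     using open_contains_ball by metis
    show ?thesis using \<delta> \<delta>' by (intro exI[of _ "min \<delta> \<delta>'"]) (auto simp: subset_iff)
   qed
  qed
  then obtain \<delta> where \<delta>: "\<delta> > 0" "ball b \<delta> \<subseteq> ball a r - {a}" "!!z. z\<in>ball b \<delta> ==> Im (z / b) ~= 0 ==> Im (z / a) ~= 0" by blast
  have "continuable (eval_fps F) (linepath 0 z +++ linepath z b)" if z: "z \<in> ball b \<delta>" "Im (z / b) ~= 0" for z
  proof (rule r(2))
   have "closed_segment z b \<subseteq> ball b \<delta>" using z(1) \<delta>(1) by (intro closed_segment_subset) auto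
   then show "linepath 0 z +++ linepath z b \<in> local_paths a r"
    unfolding local_paths_def using \<delta> z by (intro CollectI exI[of _ "linepath z b"]) auto
  qed
  then show ?thesis by (rule nonsingularI[OF \<delta>(1)])
 qed
 then show thesis using that[of r] r(1) zero_not_singular by blast
qed

text \<open>An accumulation point could not be nonsingular, since such points have neighbourhoods
  without singularities, and it could not be an isolated singularity either.\<close>

lemma finite_singularities_cball:
 assumes F: "fps_conv_radius F > 0" and iso: "!!a. a \<in> singularities F ==> isolated_sing F a"
 shows "finite (singularities F \<inter> cball 0 R)"
proof (rule ccontr)
 assume "infinite (singularities F \<inter> cball 0 R)"
 then obtain x where x: "x islimpt (singularities F \<inter> cball 0 R)"
  using Heine_Borel_imp_Bolzano_Weierstrass[of "cball 0 R" "singularities F \<inter> cball 0 R"] by auto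
 then have xs: "x islimpt singularities F" using islimpt_subset by blast
 show False
 proof (cases "x \<in> singularities F")
  case False
  then obtain r where "r > 0" "ball x r \<inter> singularities F = {}" using nonsingular_nhd[OF F] by metis
  then show False using xs unfolding islimpt_def by (metis centre_in_ball disjoint_iff open_ball)
 next
  case True
  then have "x ~= 0" using zero_not_singular by metis
  then obtain r where "r > 0" "(ball x r - {x}) \<inter> singularities F = {}"
   using isolated_sing_punctured[OF iso[OF True]] by metis
  then show False using xs unfolding islimpt_def
   by (metis Diff_iff centre_in_ball disjoint_iff open_ball singletonD)
 qed
qed

section \<open>Lifts at an isolated singularity\<close>

text \<open>A map with nonzero derivative is open near the point, so identities between germs can be
  verified upstairs, in the coordinate of a covering.\<close>

lemma eventually_nhds_image:
 assumes e: "e holomorphic_on D" "open D" "x \<in> D" "deriv e x ~= 0"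
  and ev: "\<forall>\<^sub>F y in nhds x. Q (e y)"
 shows "\<forall>\<^sub>F w in nhds (e x). Q w"
proof -
 obtain T where T: "open T" "x \<in> T" "!!y. y \<in> T ==> Q (e y)" using ev unfolding eventually_nhds by blast
 obtain r where r: "r > 0" "ball x r \<subseteq> D" "inj_on e (ball x r)"
  by (rule has_complex_derivative_locally_injective[OF e(1,3,2,4)])
 let ?S = "ball x r \<inter> T"
 have "open (e ` ?S)"
  by (rule open_mapping_thm3[OF holomorphic_on_subset[OF e(1)]]) (use r T(1) in \<open>auto intro: inj_on_subset\<close>)
 moreover have "e x \<in> e ` ?S" using r(1) T(2) by auto
 ultimately show ?thesis unfolding eventually_nhds using T(3) by (intro exI[of _ "e ` ?S"]) auto
qed

section \<open>The covering in the coordinate log log (z / a)\<close>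

text \<open>For very negative \<open>Re X\<close> this is the universal covering of a punctured
  neighbourhood of \<open>a\<close>, with log (z / a) = \<open>exp X\<close>. It is preferred to z -
  a = \<open>exp X\<close> because multiplying points amounts to adding the
  \<open>exp X\<close>.\<close>

definition dexp :: "complex => complex => complex" where "dexp a X = a * exp (exp X)"

lemma dexp_holomorphic [holomorphic_intros]: "dexp a holomorphic_on S"
 unfolding dexp_def by (intro holomorphic_intros)

lemma dexp_deriv: "deriv (dexp a) X = a * (exp (exp X) * exp X)"
 unfolding dexp_def by (rule DERIV_imp_deriv) (auto intro!: derivative_eq_intros)

lemma dexp_deriv_nonzero: "a ~= 0 ==> deriv (dexp a) X ~= 0"
 by (simp add: dexp_deriv)

lemma continuous_on_dexp [continuous_intros]:
 "continuous_on S f ==> continuous_on S (%x. dexp a (f x))"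
 unfolding dexp_def by (intro continuous_intros)

text \<open>For small \<open>exp X\<close>, the strip \<open>0 < c * Im X < pi\<close> is the side
  \<open>c\<close> of the ray of \<open>a\<close>, where the principal branch itself is available;
  elsewhere \<open>f\<close> is what continuation around \<open>a\<close> makes of it.\<close>

definition local_lift :: "complex fps => complex => real => real => (complex => complex) => bool" where
 "local_lift F a c R f \<longleftrightarrow> f holomorphic_on {X. Re X < R} \<and>
  (\<forall>X. Re X < R --> 0 < c * Im X --> c * Im X < pi -->
    dexp a X \<in> star F \<and> f X = pbranch F (dexp a X))"

lemma local_lift_mono: "local_lift F a c R f ==> R' <= R ==> local_lift F a c R' f"
 unfolding local_lift_def by (auto intro: holomorphic_on_subset)

lemma open_half_plane_Re: "open {X. Re X < R}"
 by (simp add: open_halfspace_Re_lt)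

lemma local_lift_family:
 assumes a: "a ~= 0" and L: "f holomorphic_on {X. Re X < R}"
  and P: "path P" "!!t. t \<in> {0..1} ==> Re (P t) < R" and q: "!!t. t \<in> {0..1} ==> q t = dexp a (P t)"
 obtains \<phi> where "continuation_family q \<phi>" "!!t. t \<in> {0..1} ==> \<forall>\<^sub>F x in nhds (P t). \<phi> t (dexp a x) = f x"
proof -
 obtain \<phi> where \<phi>: "continuation_family (%t. dexp a (P t)) \<phi>"
  "!!t. t \<in> {0..1} ==> \<forall>\<^sub>F x in nhds (P t). \<phi> t (dexp a x) = f x"
  by (rule continuation_family_lift[OF dexp_holomorphic open_half_plane_Re _ L P(1)])
   (use P(2) a in \<open>auto simp: path_image_def dexp_deriv_nonzero\<close>)
 have "continuation_family q \<phi>"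
  by (rule continuation_family_cong[OF \<phi>(1)]) (simp add: q)
 then show thesis using \<phi>(2) that by blast
qed

lemma eventually_nhds_dexp:
 assumes "a ~= 0" "\<forall>\<^sub>F y in nhds x. Q (dexp a y)"
 shows "\<forall>\<^sub>F w in nhds (dexp a x). Q w"
 by (rule eventually_nhds_image[where D = UNIV]) (use assms in \<open>auto intro: dexp_holomorphic simp: dexp_deriv_nonzero\<close>)

lemma local_lift_continues:
 assumes F: "fps_conv_radius F > 0" and a: "a ~= 0" and L: "local_lift F a c R f"
  and P: "path P" "!!t. t \<in> {0..1} ==> Re (P t) < R" "0 < c * Im (P 0)" "c * Im (P 0) < pi"
  and q: "!!t. t \<in> {0..1} ==> q t = dexp a (P t)"
 obtains \<phi> where "continues_along (pbranch F) q \<phi>" "pathstart q \<in> star F"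
  "\<forall>\<^sub>F x in nhds (P 1). \<phi> 1 (dexp a x) = f x"
proof -
 have f: "f holomorphic_on {X. Re X < R}" using L by (simp add: local_lift_def)
 obtain \<phi> where \<phi>: "continuation_family q \<phi>" "!!t. t \<in> {0..1} ==> \<forall>\<^sub>F x in nhds (P t). \<phi> t (dexp a x) = f x"
  by (rule local_lift_family[OF a f P(1,2) q]) auto
 have q0: "pathstart q = dexp a (P 0)" using q[of 0] by (simp add: pathstart_def)
 have "\<forall>\<^sub>F x in nhds (P 0). x \<in> {X. Re X < R} \<inter> {X. 0 < c * Im X} \<inter> {X. c * Im X < pi}"
 proof (rule eventually_nhds_in_open)
  show "open ({X. Re X < R} \<inter> {X. 0 < c * Im X} \<inter> {X. c * Im X < pi})"
   by (intro open_Int open_half_plane_Re open_Collect_less continuous_intros)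
 qed (use P in auto)
 then have "\<forall>\<^sub>F x in nhds (P 0). \<phi> 0 (dexp a x) = pbranch F (dexp a x)"
  using \<phi>(2)[of 0, simplified] by eventually_elim (use L in \<open>auto simp: local_lift_def\<close>)
 then have "\<forall>\<^sub>F w in nhds (dexp a (P 0)). \<phi> 0 w = pbranch F w"
  by (rule eventually_nhds_dexp[OF a])
 then have "continues_along (pbranch F) q \<phi>"
  using \<phi>(1) q0 by (simp add: continues_along_def)
 moreover have "pathstart q \<in> star F" using L P(2)[of 0] P(3,4) q0 by (simp add: local_lift_def)
 ultimately show thesis using \<phi>(2)[of 1] that by auto
qed

lemma local_lift_value:
 assumes F: "fps_conv_radius F > 0" and a: "a ~= 0" and L: "local_lift F a c R f"
  and P: "path P" "!!t. t \<in> {0..1} ==> Re (P t) < R" "0 < c * Im (P 0)" "c * Im (P 0) < pi"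
  and q: "!!t. t \<in> {0..1} ==> q t = dexp a (P t)"
 shows "continuable (eval_fps F) (linepath 0 (pathstart q) +++ q)"
  "continuation_value (eval_fps F) (linepath 0 (pathstart q) +++ q) = f (P 1)"
proof -
 obtain \<phi> where \<phi>: "continues_along (pbranch F) q \<phi>" "pathstart q \<in> star F"
  "\<forall>\<^sub>F x in nhds (P 1). \<phi> 1 (dexp a x) = f x"
  by (rule local_lift_continues[OF assms])
 show "continuable (eval_fps F) (linepath 0 (pathstart q) +++ q)"
  by (rule continuable_joinI(1)[OF F \<phi>(2,1)])
 show "continuation_value (eval_fps F) (linepath 0 (pathstart q) +++ q) = f (P 1)"
  using continuable_joinI(2)[OF F \<phi>(2,1)] eventually_nhds_x_imp_x[OF \<phi>(3)] q[of 1] by (simp add: pathfinish_def)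
qed

text \<open>\<open>branch\<close> appends a segment from the endpoint of the path to
  \<open>w\<close>; \<open>P2\<close> is the lift of this segment, starting where the lift
  \<open>P\<close> of the path ends.\<close>

lemma local_lift_branch:
 assumes F: "fps_conv_radius F > 0" and a: "a ~= 0" and L: "local_lift F a c R f"
  and P: "path P" "!!t. t \<in> {0..1} ==> Re (P t) < R" "0 < c * Im (P 0)" "c * Im (P 0) < pi"
  and q: "!!t. t \<in> {0..1} ==> q t = dexp a (P t)"
  and P2: "path P2" "!!t. t \<in> {0..1} ==> Re (P2 t) < R" "P2 0 = P 1"
  and q2: "!!t. t \<in> {0..1} ==> linepath (pathfinish q) w t = dexp a (P2 t)"
 shows "branch (eval_fps F) (linepath 0 (pathstart q) +++ q) w = f (P2 1)"
proof -
 have f: "f holomorphic_on {X. Re X < R}" using L by (simp add: local_lift_def)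
 obtain \<phi> where \<phi>: "continues_along (pbranch F) q \<phi>" "pathstart q \<in> star F"
  "\<forall>\<^sub>F x in nhds (P 1). \<phi> 1 (dexp a x) = f x"
  by (rule local_lift_continues[OF F a L P q])
 obtain \<psi> where \<psi>: "continuation_family (linepath (pathfinish q) w) \<psi>"
  "!!t. t \<in> {0..1} ==> \<forall>\<^sub>F x in nhds (P2 t). \<psi> t (dexp a x) = f x"
  by (rule local_lift_family[OF a f P2(1,2) q2]) auto
 have q1: "pathfinish q = dexp a (P 1)" using q[of 1] by (simp add: pathfinish_def)
 have "\<forall>\<^sub>F x in nhds (P 1). \<psi> 0 (dexp a x) = \<phi> 1 (dexp a x)"
  using \<psi>(2)[of 0, simplified, unfolded P2(3)] \<phi>(3) by eventually_elim simp
 then have ev: "\<forall>\<^sub>F v in nhds (pathfinish q). \<psi> 0 v = \<phi> 1 v"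
  unfolding q1 by (rule eventually_nhds_dexp[OF a])
 define g where "g = (%t. if t < 1/2 then (%_. pbranch F) (2 * t) else \<phi> (2 * t-1))"
 have j: "continues_along (eval_fps F) (linepath 0 (pathstart q) +++ q) g"
  unfolding g_def by (rule continues_along_join[OF star_continues_along[OF F \<phi>(2)] \<phi>(1)]) auto
 have g1: "g 1 = \<phi> 1" by (simp add: g_def)
 have "continues_along (g 1) (linepath (pathfinish q) w) \<psi>"
  using \<psi>(1) ev by (simp add: continues_along_def g1)
 from continuation_value_join(2)[OF j this]
 have "branch (eval_fps F) (linepath 0 (pathstart q) +++ q) w = \<psi> 1 w"
  by (simp add: branch_def)
 also have "\<psi> 1 w = \<psi> 1 (dexp a (P2 1))" using q2[of 1] by (simp add: linepath_def)
 also have "\<dots> = f (P2 1)" using eventually_nhds_x_imp_x[OF \<psi>(2)[of 1]] by simp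
 finally show ?thesis .
qed

text \<open>
 The circles around \<open>a\<close> are described by the coordinate \<open>\<zeta>\<close> with \<open>z = a (1 + exp \<zeta>)\<close>, local
 lifts by the coordinate \<open>X\<close> with \<open>z = a exp (exp X)\<close>; \<open>from_log\<close> is the change of coordinates,
 which commutes with the translation by \<open>2\<pi>\<i>\<close>.
\<close>

definition log_ratio :: "complex => complex" where
 "log_ratio v = Ln (Ln v / (v - 1))"

definition from_log :: "complex => complex" where
 "from_log \<zeta> = \<zeta> + log_ratio (1 + exp \<zeta>)"

definition to_log :: "complex => complex" where
 "to_log X = X - log_ratio (exp (exp X))"

text \<open>With y = v - 1, the estimate |Ln v - y| <= |y|^2 / (1 - |y|) puts the quotient within
  1/3 of 1. Applied once more to the logarithm of the quotient it gives 1/6 + 1/3 = 1/2.\<close>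

lemma log_ratio_bounds:
 assumes "v ~= 1" "norm (v - 1) <= 1/4"
 shows "norm (log_ratio v) <= 1/2" "exp (log_ratio v) * (v - 1) = Ln v" "Ln v / (v - 1) \<notin> \<real>\<^sub>\<le>\<^sub>0"
proof -
 let ?y = "v - 1" let ?u = "Ln v / (v - 1) - 1"
 have y: "?y ~= 0" "norm ?y <= 1/4" using assms by auto
 have "norm (Ln v - ?y) <= norm ?y ^ 2 / (1 - norm ?y)"
  using Ln_approx_linear[of ?y] y by simp
 moreover have "?u = (Ln v - ?y) / ?y" using y(1) by (simp add: field_simps)
 ultimately have "norm ?u <= norm ?y / (1 - norm ?y)"
  using y by (simp add: norm_divide divide_simps power2_eq_square split: if_splits)
 also have "\<dots> <= 1/3" using y by (simp add: divide_simps)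
 finally have u: "norm ?u <= 1/3" .
 have "norm (Ln (1 + ?u) - ?u) <= norm ?u ^ 2 / (1 - norm ?u)"
  by (rule Ln_approx_linear) (use u in simp)
 also have "\<dots> <= (1/3)^2 / (1 - 1/3)"
  by (rule frac_le) (use u in \<open>auto intro!: power_mono\<close>)
 finally have "norm (Ln (1 + ?u)) <= 1/2"
  using u norm_triangle_sub[of "Ln (1 + ?u)" ?u] by (simp add: power2_eq_square)
 then show "norm (log_ratio v) <= 1/2" by (simp add: log_ratio_def)
 have Re: "Re (Ln v / (v - 1)) > 0" using abs_Re_le_cmod[of ?u] u by simp
 then have nz: "Ln v / (v - 1) ~= 0" by auto
 show "exp (log_ratio v) * (v - 1) = Ln v" using y(1) nz by (simp add: log_ratio_def)
 show "Ln v / (v - 1) \<notin> \<real>\<^sub>\<le>\<^sub>0" using Re by (auto simp: complex_nonpos_Reals_iff)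
qed

lemma exp_le_quarter: "Re \<zeta> <= -2 ==> norm (exp \<zeta>) <= 1/4"
proof -
 assume "Re \<zeta> <= -2"
 then have "norm (exp \<zeta>) <= exp (-2)" by simp
 also have "\<dots> <= 1/4" using exp_lower_Taylor_quadratic[of 2] by (simp add: exp_minus field_simps)
 finally show ?thesis .
qed

lemma from_log:
 assumes "Re \<zeta> <= -2"
 shows "norm (from_log \<zeta> - \<zeta>) <= 1/2" "exp (exp (from_log \<zeta>)) = 1 + exp \<zeta>"
  "exp (from_log \<zeta>) = Ln (1 + exp \<zeta>)"
proof -
 have *: "1 + exp \<zeta> ~= 1" "norm (1 + exp \<zeta> - 1) <= 1/4" using exp_le_quarter[OF assms] by auto
 show "norm (from_log \<zeta> - \<zeta>) <= 1/2" using log_ratio_bounds(1)[OF *] by (simp add: from_log_def)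
 show e: "exp (from_log \<zeta>) = Ln (1 + exp \<zeta>)" using log_ratio_bounds(2)[OF *] by (simp add: from_log_def exp_add mult.commute)
 have "Re (1 + exp \<zeta>) > 0" using exp_le_quarter[OF assms] abs_Re_le_cmod[of "exp \<zeta>"] by simp
 then have "1 + exp \<zeta> ~= 0" by (metis less_irrefl zero_complex.sel(1))
 then show "exp (exp (from_log \<zeta>)) = 1 + exp \<zeta>" unfolding e by simp
qed

lemma dexp_from_log: "Re \<zeta> <= -2 ==> dexp a (from_log \<zeta>) = a * (1 + exp \<zeta>)"
 by (simp only: dexp_def from_log(2))

lemma from_log_periodic: "from_log (\<zeta> + 2 * of_real pi * \<i>) = from_log \<zeta> + 2 * of_real pi * \<i>"
 by (simp add: from_log_def exp_add)

lemma continuous_on_from_log: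
 assumes "continuous_on S f" "!!x. x \<in> S ==> Re (f x) <= -2"
 shows "continuous_on S (%x. from_log (f x))"
proof -
 have *: "1 + exp (f x) ~= 1" "norm (1 + exp (f x) - 1) <= 1/4" if "x \<in> S" for x
  using exp_le_quarter[OF assms(2)[OF that]] by auto
 have np: "1 + exp (f x) \<notin> \<real>\<^sub>\<le>\<^sub>0" if "x \<in> S" for x
  using *(2)[OF that] abs_Re_le_cmod[of "exp (f x)"] by (auto simp: complex_nonpos_Reals_iff)
 show ?thesis
  unfolding from_log_def log_ratio_def
  by (intro continuous_intros assms(1)) (use * np log_ratio_bounds(3)[OF *] in auto)
qed

lemma norm_exp_minus_1_le:
 assumes "norm w < 1" shows "norm (exp w - 1) <= 3 * norm (w :: complex)"
proof -
 have e: "norm (exp z) <= 3" if "z \<in> ball (0::complex) 1" for z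
 proof -
  have "Re z <= 1" using that complex_Re_le_cmod[of z] by simp
  then have "norm (exp z) <= exp 1" by simp
  also have "\<dots> <= 3" using exp_le by simp
  finally show ?thesis .
 qed
 have "norm (exp w - exp 0) <= 3 * norm (w - 0)"
  by (rule field_differentiable_bound[OF convex_ball _ e, of 0 1 exp])
   (use assms in \<open>auto intro: DERIV_subset[OF DERIV_exp]\<close>)
 then show ?thesis by simp
qed

text \<open>13 is 1 + 4 + 8, a lower bound of \<open>exp 4\<close>. The Lipschitz factor 3 then
  leaves 3/13 <= 1/4, the range in which \<open>log_ratio_bounds\<close> applies.\<close>

lemma exp_small:
 assumes "Re X <= -4"
 shows "norm (exp X) <= 1/13" "norm (exp (exp X) - 1) <= 1/4" "exp (exp X) ~= 1" "Ln (exp (exp X)) = exp X"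
proof -
 have "norm (exp X) <= exp (-4)" using assms by simp
 also have "\<dots> <= 1/13" using exp_lower_Taylor_quadratic[of 4] by (simp add: exp_minus field_simps)
 finally show 1: "norm (exp X) <= 1/13" .
 then have "norm (exp (exp X) - 1) <= 3 * norm (exp X)" by (intro norm_exp_minus_1_le) linarith
 then show "norm (exp (exp X) - 1) <= 1/4" using 1 by simp
 have "\<bar>Im (exp X)\<bar> < pi" using 1 abs_Im_le_cmod[of "exp X"] pi_gt3 by linarith
 then show L: "Ln (exp (exp X)) = exp X" by (intro Ln_exp) auto
 show "exp (exp X) ~= 1" using L by auto
qed

lemma to_log:
 assumes "Re X <= -4"
 shows "norm (to_log X - X) <= 1/2" "1 + exp (to_log X) = exp (exp X)" "from_log (to_log X) = X"
proof -
 note * = exp_small[OF assms]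
 show "norm (to_log X - X) <= 1/2" using log_ratio_bounds(1)[OF *(3,2)] by (simp add: to_log_def)
 have "exp (to_log X) = exp (exp X) - 1"
  using log_ratio_bounds(2)[OF *(3,2)] by (simp add: to_log_def exp_diff field_simps *(4))
 then show e: "1 + exp (to_log X) = exp (exp X)" by simp
 show "from_log (to_log X) = X" unfolding from_log_def e by (simp add: to_log_def)
qed

lemma to_log_Re: "Re X <= -4 ==> Re (to_log X) <= Re X + 1/2"
 using to_log(1)[of X] abs_Re_le_cmod[of "to_log X - X"] by auto

lemma from_log_Re: "Re \<zeta> <= -2 ==> Re (from_log \<zeta>) <= Re \<zeta> + 1/2"
 using from_log(1)[of \<zeta>] abs_Re_le_cmod[of "from_log \<zeta> - \<zeta>"] by auto

text \<open>In the coordinate \<zeta> a rotation about \<open>a\<close> is a vertical translation,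
  which it is not in the coordinate \<open>X\<close>; this is the purpose of the detour through
  \<open>from_log\<close>.\<close>

lemma rotation_path_lift:
 assumes "Re \<zeta> <= -2"
 shows "rotation_path a (dexp a (from_log \<zeta>)) \<theta> t = dexp a (from_log (\<zeta> + \<i> * of_real (\<theta> * t)))"
 using assms by (simp add: rotation_path_def dexp_from_log exp_add cis_conv_exp algebra_simps)

lemma path_from_log_rotation:
 assumes "Re \<zeta> <= -2" shows "path (%t. from_log (\<zeta> + \<i> * of_real (\<theta> * t)))"
 unfolding path_def by (rule continuous_on_from_log) (use assms in \<open>auto intro!: continuous_intros\<close>)

section \<open>The operators \<open>Sigma_op\<close> as translations of lifts\<close>

text \<open>\<open>l\<close> is a continuous local inverse of \<open>dexp a\<close>, so the germ of
  \<open>b\<close> at \<open>w\<close> is that of \<open>f\<close> at \<open>l w\<close>. The circle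
  through \<open>w\<close> lifts to a path from \<open>l w\<close> to its translate by 2 pi i. The
  margin 1 below \<open>R\<close> pays for two changes of coordinate, at 1/2 each.\<close>

lemma Sigma_op_lift:
 assumes a: "a ~= 0" and f: "f holomorphic_on {X. Re X < R}" and \<Omega>: "open \<Omega>" "w \<in> \<Omega>" "continuous_on \<Omega> l"
  and l: "!!v. v \<in> \<Omega> ==> dexp a (l v) = v" and b: "!!v. v \<in> \<Omega> ==> b v = f (l v)"
  and R: "Re (l w) <= -4" "Re (l w) + 1 < R"
 shows "Sigma_op a b w = f (l w + 2 * of_real pi * \<i>)"
proof -
 let ?\<zeta> = "to_log (l w)"
 have \<zeta>: "Re ?\<zeta> <= Re (l w) + 1/2" "Re ?\<zeta> <= -2" "from_log ?\<zeta> = l w"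
  using to_log_Re[OF R(1)] to_log(3)[OF R(1)] R(1) by auto
 let ?P = "%t. from_log (?\<zeta> + \<i> * of_real (2 * pi * t))"
 have q: "rotation_path a w (2 * pi) t = dexp a (?P t)" for t
  using rotation_path_lift[OF \<zeta>(2), of a "2*pi" t] l[OF \<Omega>(2)] by (simp add: \<zeta>(3))
 have RP: "Re (?P t) < R" for t
  using from_log_Re[of "?\<zeta> + \<i> * of_real (2 * pi * t)"] \<zeta> R by simp
 have P0: "?P 0 = l w" by (simp add: \<zeta>(3))
 have P1: "?P 1 = l w + 2 * of_real pi * \<i>"
  using from_log_periodic[of ?\<zeta>] by (simp add: \<zeta>(3) mult_ac)
 obtain \<phi> where \<phi>: "continuation_family (rotation_path a w (2*pi)) \<phi>"
  "!!t. t \<in> {0..1} ==> \<forall>\<^sub>F x in nhds (?P t). \<phi> t (dexp a x) = f x"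
  by (rule local_lift_family[OF a f path_from_log_rotation[OF \<zeta>(2)] RP q]) auto
 have w: "rotation_path a w (2 * pi) 0 = w" "rotation_path a w (2 * pi) 1 = w"
  by (auto simp: rotation_path_def)
 have "\<forall>\<^sub>F x in nhds (l w). \<phi> 0 (dexp a x) = f x" using \<phi>(2)[of 0] P0 by simp
 then obtain T where T: "open T" "l w \<in> T" "!!x. x \<in> T ==> \<phi> 0 (dexp a x) = f x"
  unfolding eventually_nhds by blast
 have "open (\<Omega> \<inter> l -` T)" by (rule continuous_open_preimage[OF \<Omega>(3,1) T(1)])
 then have "\<forall>\<^sub>F v in nhds w. v \<in> \<Omega> \<inter> l -` T" by (rule eventually_nhds_in_open) (use \<Omega>(2) T(2) in auto)
 then have "\<forall>\<^sub>F v in nhds w. \<phi> 0 v = b v"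
 proof eventually_elim
  case (elim v)
  then show ?case using T(3)[of "l v"] l[of v] b[of v] by simp
 qed
 then have "continues_along b (rotation_path a w (2*pi)) \<phi>"
  using \<phi>(1) w(1) by (simp add: continues_along_def pathstart_def)
 from continuation_value_eq[OF this] have "Sigma_op a b w = \<phi> 1 w"
  by (simp add: Sigma_op_def pathfinish_def w(2))
 also have "\<dots> = \<phi> 1 (dexp a (?P 1))" using q[of 1] w(2) by simp
 also have "\<dots> = f (?P 1)" using eventually_nhds_x_imp_x[OF \<phi>(2)[of 1]] by simp
 finally show ?thesis by (simp only: P1)
qed

text \<open>After \<open>k\<close> turns the function is again a function on the half-plane composed
  with \<open>l\<close>, namely a translate of \<open>f\<close>, so \<open>Sigma_op_lift\<close>
  applies once more on the same open set.\<close>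

lemma Sigma_op_power_lift:
 assumes a: "a ~= 0" and f: "f holomorphic_on {X. Re X < R}" and \<Omega>: "open \<Omega>" "continuous_on \<Omega> l"
  and l: "!!v. v \<in> \<Omega> ==> dexp a (l v) = v" and b: "!!v. v \<in> \<Omega> ==> b v = f (l v)"
  and R: "!!v. v \<in> \<Omega> ==> Re (l v) <= -4 \<and> Re (l v) + 1 < R" and w: "w \<in> \<Omega>"
 shows "(Sigma_op a ^^ k) b w = f (l w + 2 * of_real pi * \<i> * of_nat k)"
 using w
proof (induction k arbitrary: w)
 case (Suc k)
 let ?f = "%X. f (X + 2 * of_real pi * \<i> * of_nat k)"
 have "?f holomorphic_on {X. Re X < R}"
  by (rule holomorphic_on_compose_gen[OF _ f, unfolded o_def]) (auto intro!: holomorphic_intros)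
 then have "Sigma_op a ((Sigma_op a ^^ k) b) w = ?f (l w + 2 * of_real pi * \<i>)"
  by (rule Sigma_op_lift[OF a _ \<Omega>(1) Suc.prems \<Omega>(2) l]) (use Suc R in auto)
 then show ?case by (simp add: algebra_simps)
qed (simp add: b)

text \<open>
 \<open>log_chart a X\<close> is the branch of the inverse of \<open>dexp a\<close> which maps \<open>dexp a X\<close> to \<open>X\<close>, on the
 part near \<open>a\<close> of the half-plane bounded by the normal at \<open>a\<close>.
\<close>

definition chart_dom :: "complex => complex => complex set" where
 "chart_dom a X = {v. Re ((v - a) / (dexp a X - a)) > 0 \<and> norm ((v - a) / (dexp a X - a)) < 2}"

definition log_chart :: "complex => complex => complex => complex" where
 "log_chart a X v = from_log (to_log X + Ln ((v - a) / (dexp a X - a)))"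

lemma chart_dom_open: "open (chart_dom a X)"
 unfolding chart_dom_def divide_inverse
 by (intro open_Collect_conj open_Collect_less continuous_intros)

lemma chart_dom_convex: "convex (chart_dom a X)"
proof -
 let ?d = "inverse (dexp a X - a)"
 have c: "convex ({v. Re v > 0} \<inter> ball (0::complex) 2)"
  by (intro convex_Int convex_halfspace_Re_gt convex_ball)
 have "chart_dom a X = (%v. (v - a) * ?d) -` ({v. Re v > 0} \<inter> ball 0 2)"
  by (auto simp: chart_dom_def divide_inverse)
 also have "convex \<dots>"
  unfolding convex_def
 proof (intro ballI allI impI)
  fix x y and u v :: real
  assume xy: "x \<in> (%v. (v - a) * ?d) -` ({v. Re v > 0} \<inter> ball 0 2)" "y \<in> (%v. (v - a) * ?d) -` ({v. Re v > 0} \<inter> ball 0 2)"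
   and uv: "0 <= u" "0 <= v" "u + v = 1"
  have "(u *\<^sub>R x + v *\<^sub>R y - a) * ?d = (u *\<^sub>R x + v *\<^sub>R y - (u + v) *\<^sub>R a) * ?d" using uv(3) by simp
  also have "\<dots> = u *\<^sub>R ((x - a) * ?d) + v *\<^sub>R ((y - a) * ?d)" by (simp add: algebra_simps scaleR_conv_of_real)
  also have "\<dots> \<in> {v. Re v > 0} \<inter> ball 0 2" using c xy uv unfolding convex_def by blast
  finally show "u *\<^sub>R x + v *\<^sub>R y \<in> (%v. (v - a) * ?d) -` ({v. Re v > 0} \<inter> ball 0 2)" by blast
 qed
 finally show ?thesis .
qed

text \<open>Each change of coordinate costs 1/2 and the size of the quotient costs
  \<open>ln 2 <= 1\<close>, so the real part grows by at most 2. With \<open>Re X <= -6\<close> the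
  values keep real part at most -4, as \<open>to_log\<close> requires.\<close>

lemma log_chart:
 assumes a: "a ~= 0" and X: "Re X <= -6"
 shows "dexp a X \<in> chart_dom a X" "log_chart a X (dexp a X) = X"
  "!!v. v \<in> chart_dom a X ==> dexp a (log_chart a X v) = v"
  "!!v. v \<in> chart_dom a X ==> Re (log_chart a X v) <= Re X + 2"
  "!!v. v \<in> chart_dom a X ==> norm (log_chart a X v - (X + Ln ((v - a) / (dexp a X - a)))) <= 1"
  "continuous_on (chart_dom a X) (log_chart a X)"
proof -
 have X4: "Re X <= -4" using X by simp
 have e: "dexp a X - a = a * exp (to_log X)"
  using to_log(2)[OF X4, symmetric] by (simp add: dexp_def algebra_simps)
 have d: "dexp a X - a ~= 0" using e a by simp
 then show "dexp a X \<in> chart_dom a X" by (simp add: chart_dom_def)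
 show "log_chart a X (dexp a X) = X" using d by (simp add: log_chart_def to_log(3)[OF X4])
 have Re: "Re (to_log X + Ln ((v - a) / (dexp a X - a))) <= Re X + 3/2" "(v - a) / (dexp a X - a) ~= 0" if v: "v \<in> chart_dom a X" for v
 proof -
  show nz: "(v - a) / (dexp a X - a) ~= 0" using v by (auto simp: chart_dom_def)
  then have "Re (Ln ((v - a) / (dexp a X - a))) = ln (norm ((v - a) / (dexp a X - a)))" by (rule Re_Ln)
  also have "\<dots> <= ln 2" using v nz by (intro ln_mono) (auto simp: chart_dom_def)
  also have "\<dots> <= 1" using ln_le_minus_one[of 2] by simp
  finally show "Re (to_log X + Ln ((v - a) / (dexp a X - a))) <= Re X + 3/2" using to_log_Re[OF X4] by simp
 qed
 fix v assume v: "v \<in> chart_dom a X"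
 have R2: "Re (to_log X + Ln ((v - a) / (dexp a X - a))) <= -2" using Re[OF v] X by simp
 show "dexp a (log_chart a X v) = v"
  unfolding log_chart_def dexp_from_log[OF R2] using Re(2)[OF v] d a
  by (simp add: exp_add e[symmetric] distrib_left) (simp add: e)
 show "Re (log_chart a X v) <= Re X + 2"
  using from_log_Re[OF R2] Re[OF v] by (simp add: log_chart_def)
 show "norm (log_chart a X v - (X + Ln ((v - a) / (dexp a X - a)))) <= 1"
 proof -
  have "log_chart a X v - (X + Ln ((v - a) / (dexp a X - a)))
    = (from_log (to_log X + Ln ((v - a) / (dexp a X - a))) - (to_log X + Ln ((v - a) / (dexp a X - a)))) + (to_log X - X)"
   by (simp add: log_chart_def)
  then show ?thesis using norm_triangle_le[OF add_mono[OF from_log(1)[OF R2] to_log(1)[OF X4]]]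
   by (simp only:)
 qed
next
 have X4: "Re X <= -4" using X by simp
 have np: "(v - a) / (dexp a X - a) \<notin> \<real>\<^sub>\<le>\<^sub>0" if v: "v \<in> chart_dom a X" for v
  using v by (auto simp: chart_dom_def complex_nonpos_Reals_iff)
 have Re: "Re (to_log X + Ln ((v - a) / (dexp a X - a))) <= - 2" if v: "v \<in> chart_dom a X" for v
 proof -
  have nz: "(v - a) / (dexp a X - a) ~= 0" using v by (auto simp: chart_dom_def)
  then have "Re (Ln ((v - a) / (dexp a X - a))) = ln (norm ((v - a) / (dexp a X - a)))" by (rule Re_Ln)
  also have "\<dots> <= ln 2" using v nz by (intro ln_mono) (auto simp: chart_dom_def)
  also have "\<dots> <= 1" using ln_le_minus_one[of 2] by simp
  finally show ?thesis using to_log_Re[OF X4] X by simp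
 qed
 have cl: "continuous_on (chart_dom a X) (%v. Ln ((v - a) / (dexp a X - a)))"
  unfolding divide_inverse
  by (intro continuous_intros) (use np in \<open>auto simp: divide_inverse\<close>)
 show "continuous_on (chart_dom a X) (log_chart a X)"
  unfolding log_chart_def by (rule continuous_on_from_log) (use Re cl in \<open>auto intro!: continuous_intros\<close>)
qed

text \<open>Convexity of \<open>chart_dom\<close> keeps the final segment of \<open>branch\<close>
  inside the chart, whose image of the segment serves as its lift.\<close>

lemma local_lift_branch_chart:
 assumes F: "fps_conv_radius F > 0" and a: "a ~= 0" and L: "local_lift F a c R f"
  and P: "path P" "!!t. t \<in> {0..1} ==> Re (P t) < R" "0 < c * Im (P 0)" "c * Im (P 0) < pi"
  and q: "!!t. t \<in> {0..1} ==> q t = dexp a (P t)"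
  and X: "Re (P 1) <= -6" "Re (P 1) + 2 < R" and v: "v \<in> chart_dom a (P 1)"
 shows "branch (eval_fps F) (linepath 0 (pathstart q) +++ q) v = f (log_chart a (P 1) v)"
proof -
 have q1: "pathfinish q = dexp a (P 1)" using q[of 1] by (simp add: pathfinish_def)
 have seg: "linepath (pathfinish q) v t \<in> chart_dom a (P 1)" if "t \<in> {0..1}" for t
 proof -
  have "closed_segment (dexp a (P 1)) v \<subseteq> chart_dom a (P 1)"
   by (rule closed_segment_subset[OF log_chart(1)[OF a X(1)] v chart_dom_convex])
  then show ?thesis unfolding q1 using linepath_in_path[OF that] by blast
 qed
 let ?P2 = "%t. log_chart a (P 1) (linepath (pathfinish q) v t)"
 have "branch (eval_fps F) (linepath 0 (pathstart q) +++ q) v = f (?P2 1)"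
 proof (rule local_lift_branch[where ?P2.0 = ?P2, OF F a L P q])
  show "path ?P2" unfolding path_def
   by (rule continuous_on_compose2[OF log_chart(6)[OF a X(1)]]) (use seg in \<open>auto intro: continuous_on_linepath\<close>)
  show "Re (?P2 t) < R" if "t \<in> {0..1}" for t using log_chart(4)[OF a X(1) seg[OF that]] X(2) by simp
  show "?P2 0 = P 1" using log_chart(2)[OF a X(1)] by (simp add: q1 linepath_def)
  show "linepath (pathfinish q) v t = dexp a (?P2 t)" if "t \<in> {0..1}" for t
   using log_chart(3)[OF a X(1) seg[OF that]] by simp
 qed auto
 then show ?thesis by (simp add: linepath_def)
qed

section \<open>Integrability as decay of the lift\<close>

text \<open>What integrability becomes for a lift: \<open>exp X\<close> is asymptotically (z - a) /
  a, and a bounded argument of z - a is a bounded \<open>Im X\<close>.\<close>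

definition decays :: "(complex => complex) => bool" where
 "decays f \<longleftrightarrow> (\<forall>M. \<forall>eps>0. \<exists>T. \<forall>X. Re X < T --> \<bar>Im X\<bar> <= M --> norm (f X * exp X) < eps)"

text \<open>A given \<open>X\<close> is reached by rotating a base point on the normal to the ray at
  \<open>a\<close>, of argument \<open>c * pi / 2\<close> relative to \<open>a\<close>. The base
  point lies well inside the side \<open>c\<close>, where the lift is the principal branch, and the
  angle of rotation stays bounded together with \<open>Im X\<close>.\<close>

lemma integrable_decays:
 assumes F: "fps_conv_radius F > 0" and a: "a ~= 0" and c: "\<bar>c\<bar> = (1::real)" and L: "local_lift F a c R f"
  and int: "integrable_sing F a"
 shows "decays f"
 unfolding decays_def
proof (intro allI impI)
 fix M eps :: real assume eps: "eps > 0"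
 \<comment> \<open>The angle \<open>\<theta>\<close> differs from \<open>Im X\<close> by at most
   1/2, for the change of coordinate, plus pi / 2 <= 2.\<close>
 define M' where "M' = \<bar>M\<bar> + 3"
 \<comment> \<open>Half of \<open>eps\<close> is reserved for replacing \<open>exp \<zeta>\<close>
   by \<open>exp X\<close>, whose modulus is larger by a factor of at most exp (1/2) <= 2.\<close>
 have "0 < eps * norm a / 2" using eps a by simp
 then have "\<forall>\<^sub>F z in at a within {z. Im (z / a) ~= 0}. \<forall>\<theta>\<in>{-M'..M'}.
   dist (((z - a) * cis \<theta>) * continuation_value (eval_fps F) (linepath 0 z +++ rotation_path a z \<theta>)) 0 < eps * norm a / 2"
  using int unfolding integrable_sing_def uniform_limit_iff by blast
 then obtain d where d: "d > 0" "!!z \<theta>. Im (z / a) ~= 0 ==> z ~= a ==> dist z a < d ==> \<theta> \<in> {-M'..M'} ==>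
  norm (((z - a) * cis \<theta>) * continuation_value (eval_fps F) (linepath 0 z +++ rotation_path a z \<theta>)) < eps * norm a / 2"
  unfolding eventually_at by auto
 define T where "T = min (min (-4) (R - 2)) (ln (d / norm a) - 1)"
 have "norm (f X * exp X) < eps" if X: "Re X < T" "\<bar>Im X\<bar> <= M" for X
 proof -
  have X4: "Re X <= -4" "Re X < R - 2" "Re X < ln (d / norm a) - 1" using X(1) by (auto simp: T_def)
  define \<zeta> where "\<zeta> = to_log X"
  have \<zeta>X: "norm (\<zeta> - X) <= 1/2" "from_log \<zeta> = X" using to_log[OF X4(1)] by (auto simp: \<zeta>_def)
  have \<zeta>R: "Re \<zeta> <= Re X + 1/2" "Re X <= Re \<zeta> + 1/2" and \<zeta>I: "\<bar>Im \<zeta> - Im X\<bar> <= 1/2"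
   using \<zeta>X(1) abs_Re_le_cmod[of "\<zeta> - X"] abs_Im_le_cmod[of "\<zeta> - X"] by auto
  define \<zeta>0 where "\<zeta>0 = Complex (Re \<zeta>) (c * pi / 2)"
  define \<theta> where "\<theta> = Im \<zeta> - c * pi / 2"
  have \<zeta>0: "Re \<zeta>0 <= -2" "\<zeta>0 + \<i> * of_real \<theta> = \<zeta>"
   using \<zeta>R X4 by (auto simp: \<zeta>0_def \<theta>_def complex_eq_iff)
  let ?P = "%t. from_log (\<zeta>0 + \<i> * of_real (\<theta> * t))"
  define z where "z = dexp a (from_log \<zeta>0)"
  have z: "z = a * (1 + exp \<zeta>0)" using \<zeta>0 by (simp add: z_def dexp_from_log)
  have cc: "c = 1 \<or> c = -1" using c by linarith
  have ReP: "Re (?P t) < R" for t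
   using from_log_Re[of "\<zeta>0 + \<i> * of_real (\<theta> * t)"] \<zeta>0 \<zeta>R X4 by (simp add: \<zeta>0_def)
  have ImP: "\<bar>Im (?P 0) - c * pi / 2\<bar> <= 1/2"
   using from_log(1)[OF \<zeta>0(1)] abs_Im_le_cmod[of "from_log \<zeta>0 - \<zeta>0"] by (simp add: \<zeta>0_def)
  have val: "continuation_value (eval_fps F) (linepath 0 (pathstart (rotation_path a z \<theta>)) +++ rotation_path a z \<theta>) = f (?P 1)"
  proof (rule local_lift_value(2)[OF F a L path_from_log_rotation[OF \<zeta>0(1)] ReP])
   show "0 < c * Im (?P 0)" "c * Im (?P 0) < pi" using ImP cc pi_gt3 by (auto simp: abs_if split: if_splits)
   show "rotation_path a z \<theta> t = dexp a (?P t)" for t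
    unfolding z_def by (rule rotation_path_lift[OF \<zeta>0(1)])
  qed
  have st: "pathstart (rotation_path a z \<theta>) = z" by (simp add: pathstart_def rotation_path_def)
  have P1: "?P 1 = X" using \<zeta>0(2) \<zeta>X(2) by simp
  have za: "(z - a) * cis \<theta> = a * exp \<zeta>"
  proof -
   have "exp \<zeta> = exp \<zeta>0 * cis \<theta>" using \<zeta>0(2) by (metis cis_conv_exp exp_add)
   then show ?thesis by (simp add: z algebra_simps)
  qed
  have e0: "exp \<zeta>0 = exp (Re \<zeta>) * (\<i> * c)"
   using cc by (auto simp: \<zeta>0_def exp_eq_polar complex_eq_iff)
  have "Im (z / a) ~= 0"
  proof -
   have "z / a = 1 + exp \<zeta>0" using a by (simp add: z)
   then show ?thesis using cc by (auto simp: e0)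
  qed
  moreover have "z ~= a" using a by (simp add: z)
  moreover have "dist z a < d"
  proof -
   have "dist z a = norm a * exp (Re \<zeta>)" using \<zeta>0 by (simp add: z dist_norm algebra_simps norm_mult) (simp add: \<zeta>0_def)
   also have "\<dots> < norm a * exp (ln (d / norm a))" using \<zeta>R X4 a by simp
   also have "\<dots> = d" using a d(1) by simp
   finally show ?thesis .
  qed
  moreover have "\<theta> \<in> {-M'..M'}"
  proof -
   have "\<bar>c * pi / 2\<bar> <= 2" using c pi_less_4 by (simp add: abs_mult)
   then have "\<bar>\<theta>\<bar> <= M'" using \<zeta>I X(2) unfolding \<theta>_def M'_def by linarith
   then show ?thesis by (simp add: abs_le_iff)
  qed
  ultimately have "norm (a * exp \<zeta> * f X) < eps * norm a / 2"
   using d(2)[of z \<theta>] val unfolding st P1 za by simp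
  then have "exp (Re \<zeta>) * norm (f X) < eps / 2" using a by (simp add: norm_mult field_simps)
  moreover have "exp (Re X) <= 2 * exp (Re \<zeta>)"
  proof -
   have "exp (Re X) <= exp (Re \<zeta> + 1/2)" using \<zeta>R by simp
   also have "\<dots> = exp (Re \<zeta>) * exp (1/2)" by (rule exp_add)
   also have "exp (1/2::real) <= 2" using real_exp_bound_lemma[of "1/2"] by simp
   finally show ?thesis by (simp add: mult.commute)
  qed
  then have "exp (Re X) * norm (f X) <= 2 * exp (Re \<zeta>) * norm (f X)" by (rule mult_right_mono) simp
  ultimately have "norm (f X) * exp (Re X) < eps" by (simp add: mult_ac)
  then show ?thesis by (simp add: norm_mult)
 qed
 then show "\<exists>T. \<forall>X. Re X < T --> \<bar>Im X\<bar> <= M --> norm (f X * exp X) < eps" by blast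
qed

lemma dexp_dist_bound:
 assumes "Re X <= 0" "Re Y <= 0" shows "norm (dexp a X - dexp a Y) <= norm a * exp 1 * norm (X - Y)"
proof (rule field_differentiable_bound[where S = "{X. Re X <= 0}"])
 show "convex {X. Re X <= 0}" by (simp add: convex_halfspace_Re_le)
 show "(dexp a has_field_derivative a * (exp (exp z) * exp z)) (at z within {X. Re X <= 0})" for z
  unfolding dexp_def by (auto intro!: derivative_eq_intros)
 fix z :: complex assume "z \<in> {X. Re X <= 0}"
 then have 1: "norm (exp z) <= 1" by simp
 then have "Re (exp z) <= 1" using complex_Re_le_cmod order_trans by blast
 then have "norm (exp (exp z)) <= exp 1" by simp
 then have "norm (exp (exp z) * exp z) <= exp 1 * 1" unfolding norm_mult using 1 by (intro mult_mono) auto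
 then show "norm (a * (exp (exp z) * exp z)) <= norm a * exp 1" unfolding norm_mult by (intro mult_left_mono) auto
qed (use assms in auto)

text \<open>The half-plane is convex, so \<open>f X\<close> can be defined by continuation along the
  image of the segment from one base point of the strip. Stability under perturbation of the segment
  makes \<open>f\<close> holomorphic; over the strip the image stays in the star, so that the
  principal branch itself results.\<close>

lemma isolated_local_lift:
 assumes F: "fps_conv_radius F > 0" and a: "a ~= 0" and c: "\<bar>c\<bar> = (1::real)" and iso: "isolated_sing F a"
 obtains R f where "local_lift F a c R f"
proof -
 obtain r where r: "r > 0" "!!p. p \<in> local_paths a r ==> continuable (eval_fps F) p"
  using iso unfolding isolated_sing_def by blast
 have cc: "c = 1 \<or> c = -1" using c by linarith
 \<comment> \<open>\<open>norm (exp (exp X) - 1)\<close> is at most \<open>3 * norm (exp X)\<close>,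
   which becomes smaller than \<open>r / norm a\<close>; the bound -4 ensures that the value
   \<open>a\<close> is not taken.\<close>
 define R where "R = min (-4) (ln (r / (3 * norm a)))"
 have R: "R <= -4" "R <= ln (r / (3 * norm a))" by (auto simp: R_def)
 have near: "dexp a X \<in> ball a r - {a}" if X: "Re X < R" for X
 proof -
  have X4: "Re X <= -4" using X R by simp
  have "norm (exp (exp X) - 1) <= 3 * norm (exp X)"
   using exp_small(1)[OF X4] by (intro norm_exp_minus_1_le) linarith
  also have "\<dots> < 3 * exp (ln (r / (3 * norm a)))" using X R(2) by simp
  also have "\<dots> = r / norm a" using r(1) a by simp
  finally have "norm (exp (exp X) - 1) < r / norm a" .
  moreover have "dist a (dexp a X) = norm a * norm (exp (exp X) - 1)"
  proof -
   have "a - dexp a X = - (a * (exp (exp X) - 1))" by (simp add: dexp_def algebra_simps)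
   then show ?thesis by (simp add: dist_norm norm_mult)
  qed
  ultimately have "dist a (dexp a X) < r" using a by (simp add: field_simps)
  moreover have "dexp a X ~= a" using exp_small(3)[OF X4] a by (simp add: dexp_def)
  ultimately show ?thesis by simp
 qed
 have side: "Im (dexp a X / a) ~= 0" if X: "Re X < R" "0 < c * Im X" "c * Im X < pi" for X
 proof -
  have s: "sin (Im X) ~= 0" using cc X sin_gt_zero[of "Im X"] sin_gt_zero[of "- Im X"] by auto
  then have i: "Im (exp X) ~= 0" by (simp add: Im_exp)
  have "\<bar>Im (exp X)\<bar> < pi"
   using exp_small(1)[of X] X(1) R abs_Im_le_cmod[of "exp X"] pi_gt3 by linarith
  then have "sin (Im (exp X)) ~= 0"
   using i sin_gt_zero[of "Im (exp X)"] sin_gt_zero[of "- Im (exp X)"] by (cases "Im (exp X) > 0") auto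
  then have "Im (exp (exp X)) ~= 0" by (simp add: Im_exp)
  then show ?thesis using a by (simp add: dexp_def)
 qed
 define X0 where "X0 = Complex (R - 1) (c * pi / 2)"
 have X0: "Re X0 < R" "0 < c * Im X0" "c * Im X0 < pi" using cc pi_gt3 by (auto simp: X0_def)
 define q where "q X t = dexp a (linepath X0 X t)" for X t
 have Rel: "Re (linepath X0 X t) < R" if "Re X < R" "t \<in> {0..1}" for X t
 proof -
  have "linepath X0 X t \<in> closed_segment X0 X" using that(2) by (rule linepath_in_path)
  also have "closed_segment X0 X \<subseteq> {X. Re X < R}"
   by (rule closed_segment_subset) (use X0 that convex_halfspace_Re_lt in auto)
  finally show ?thesis by simp
 qed
 have pq: "path (q X)" for X unfolding q_def path_def by (intro continuous_intros continuous_on_linepath)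
 have lp: "continuable (eval_fps F) (linepath 0 (pathstart p) +++ p)"
  if p: "path p" "!!t. t \<in> {0..1} ==> \<exists>Y. Re Y < R \<and> p t = dexp a Y"
   "\<exists>Y. Re Y < R \<and> 0 < c * Im Y \<and> c * Im Y < pi \<and> p 0 = dexp a Y" for p
 proof (rule r(2))
  have "path_image p \<subseteq> ball a r - {a}" using p(2) near by (fastforce simp: path_image_def)
  moreover have "Im (pathstart p / a) ~= 0" using p(3) side by (auto simp: pathstart_def)
  ultimately show "linepath 0 (pathstart p) +++ p \<in> local_paths a r"
   unfolding local_paths_def using p(1) by blast
 qed
 have stripstar: "dexp a X \<in> star F" if X: "Re X < R" "0 < c * Im X" "c * Im X < pi" for X
  using continuable_join_star(1)[OF F lp[of "%_. dexp a X"]] X by (auto simp: path_def pathstart_def)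
 have qc: "continuable (pbranch F) (q X)" if X: "Re X < R" for X
 proof (rule continuable_join_star(2)[OF F lp[OF pq]])
  fix t :: real assume "t \<in> {0..1}"
  then show "\<exists>Y. Re Y < R \<and> q X t = dexp a Y" using Rel[OF X] by (auto simp: q_def)
 next
  show "\<exists>Y. Re Y < R \<and> 0 < c * Im Y \<and> c * Im Y < pi \<and> q X 0 = dexp a Y"
   using X0 by (auto simp: q_def linepath_def)
 qed
 define f where "f X = continuation_value (pbranch F) (q X)" for X
 have loc: "\<exists>\<delta> \<psi>. \<delta> > 0 \<and> \<psi> holomorphic_on ball X \<delta> \<and> (\<forall>Y\<in>ball X \<delta>. f Y = \<psi> Y)" if X: "Re X < R" for X
 proof -
  obtain \<phi> where \<phi>: "continues_along (pbranch F) (q X) \<phi>" using qc[OF X] unfolding continuable_def by blast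
  then have fam: "continuation_family (q X) \<phi>" and st: "\<forall>\<^sub>F z in nhds (q X 0). \<phi> 0 z = pbranch F z"
   by (auto simp: continues_along_def pathstart_def)
  obtain eps \<phi>' where t: "eps > 0"
   "!!t. t \<in> {0..1} ==> \<phi>' t holomorphic_on ball (q X t) eps"
   "!!t. t \<in> {0..1} ==> \<forall>\<^sub>F z in nhds (q X t). \<phi>' t z = \<phi> t z"
   "!!p. path p ==> (!!t. t \<in> {0..1} ==> dist (p t) (q X t) < eps) ==> continuation_family p \<phi>'"
   by (rule continuation_family_tube[OF fam]) blast
  \<comment> \<open>\<open>norm a * exp 1\<close> is the Lipschitz constant of \<open>dexp a\<close>
    on \<open>Re X <= 0\<close>.\<close>
  define \<delta> where "\<delta> = min (R - Re X) (eps / (norm a * exp 1))"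
  have \<delta>: "\<delta> > 0" using X t(1) a by (simp add: \<delta>_def)
  have YR: "Re Y < R" if "Y \<in> ball X \<delta>" for Y
   using that abs_Re_le_cmod[of "X - Y"] by (auto simp: \<delta>_def dist_norm)
  have dst: "dist (q Y t) (q X t) < eps" if Y: "Y \<in> ball X \<delta>" and t: "t \<in> {0..1}" for Y t
  proof -
   have "dist (q Y t) (q X t) <= norm a * exp 1 * norm (linepath X0 Y t - linepath X0 X t)"
    unfolding dist_norm q_def
    by (rule dexp_dist_bound) (use Rel[OF X t] Rel[OF YR[OF Y] t] R in auto)
   also have "linepath X0 Y t - linepath X0 X t = t *\<^sub>R (Y - X)" by (simp add: linepath_def algebra_simps)
   also have "norm a * exp 1 * norm \<dots> <= norm a * exp 1 * norm (Y - X)"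
    using t by (intro mult_left_mono) (auto simp: mult_left_le_one_le)
   also have "\<dots> < norm a * exp 1 * (eps / (norm a * exp 1))"
    by (intro mult_strict_left_mono) (use Y a in \<open>auto simp: \<delta>_def dist_norm norm_minus_commute\<close>)
   also have "\<dots> = eps" using a by simp
   finally show ?thesis .
  qed
  have fY: "f Y = \<phi>' 1 (dexp a Y)" if Y: "Y \<in> ball X \<delta>" for Y
  proof -
   have "continuation_family (q Y) \<phi>'" using t(4)[OF pq] dst[OF Y] by blast
   moreover have "\<forall>\<^sub>F z in nhds (pathstart (q Y)). \<phi>' 0 z = pbranch F z"
   proof -
    have "pathstart (q Y) = q X 0" by (simp add: pathstart_def q_def linepath_def)
    moreover have "\<forall>\<^sub>F z in nhds (q X 0). \<phi>' 0 z = \<phi> 0 z" using t(3)[of 0] by simp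
    then have "\<forall>\<^sub>F z in nhds (q X 0). \<phi>' 0 z = pbranch F z" using st by eventually_elim simp
    ultimately show ?thesis by simp
   qed
   ultimately have "continues_along (pbranch F) (q Y) \<phi>'" by (simp add: continues_along_def)
   from continuation_value_eq[OF this] show ?thesis by (simp add: f_def pathfinish_def q_def linepath_def)
  qed
  have "dexp a ` ball X \<delta> \<subseteq> ball (q X 1) eps"
   using dst[of _ 1] by (auto simp: q_def linepath_def dist_commute)
  moreover have "\<phi>' 1 holomorphic_on ball (q X 1) eps" using t(2)[of 1] by simp
  ultimately have "(%Y. \<phi>' 1 (dexp a Y)) holomorphic_on ball X \<delta>"
   using holomorphic_on_compose_gen[OF dexp_holomorphic, of "\<phi>' 1"] unfolding o_def by blast
  then show ?thesis using \<delta> fY by blast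
 qed
 have "f holomorphic_on {X. Re X < R}"
 proof (rule analytic_imp_holomorphic, unfold analytic_on_def, safe)
  fix X assume "Re X < R"
  then obtain \<delta> \<psi> where d: "\<delta> > 0" "\<psi> holomorphic_on ball X \<delta>" "\<forall>Y\<in>ball X \<delta>. f Y = \<psi> Y" using loc by blast
  have "f holomorphic_on ball X \<delta>" by (rule holomorphic_transform[OF d(2)]) (use d(3) in simp)
  then show "\<exists>e>0. f holomorphic_on ball X e" using d(1) by blast
 qed
 moreover have "f X = pbranch F (dexp a X)" if X: "Re X < R" "0 < c * Im X" "c * Im X < pi" for X
 proof -
  have cv: "convex {X. 0 < c * Im X \<and> c * Im X < pi}"
  proof -
   have "{X. 0 < c * Im X \<and> c * Im X < pi} = (if c = 1 then {X. Im X > 0} \<inter> {X. Im X < pi} else {X. Im X < 0} \<inter> {X. Im X > -pi})"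
    using cc by auto
   then show ?thesis by (auto intro: convex_Int convex_halfspace_Im_gt convex_halfspace_Im_lt)
  qed
  have "path_image (q X) \<subseteq> star F"
  proof (clarsimp simp: path_image_def q_def)
   fix t :: real assume t: "0 <= t" "t <= 1"
   have "linepath X0 X t \<in> closed_segment X0 X" using t by (intro linepath_in_path) auto
   also have "closed_segment X0 X \<subseteq> {X. 0 < c * Im X \<and> c * Im X < pi}"
    by (rule closed_segment_subset[OF _ _ cv]) (use X X0 in auto)
   finally show "dexp a (linepath X0 X t) \<in> star F" using Rel[OF X(1)] t by (intro stripstar) auto
  qed
  then have "continues_along (pbranch F) (q X) (%_. pbranch F)"
   by (intro continues_along_holomorphic[OF pbranch_holomorphic open_star pq]) auto
  from continuation_value_eq[OF this] show ?thesis by (simp add: f_def pathfinish_def q_def linepath_def)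
 qed
 ultimately have "local_lift F a c R f" using stripstar by (auto simp: local_lift_def)
 then show thesis by (rule that)
qed

section \<open>The pinched kernel and its monodromy\<close>

lemma continuous_on_contour_integral_param:
 assumes "continuous_on (U \<times> closed_segment a b) (%(w, x). K w x)"
 shows "continuous_on U (%w. contour_integral (linepath a b) (K w))"
proof -
 have "continuous_on (U \<times> cbox 0 1) (%(w, t). K w (linepath a b t) * (b - a))"
  unfolding split_def
 proof (intro continuous_intros)
  show "continuous_on (U \<times> cbox 0 1) (%x. K (fst x) (linepath a b (snd x)))"
   by (rule continuous_on_compose2[OF assms, of _ "%x. (fst x, linepath a b (snd x))", simplified])
    (auto intro!: continuous_intros simp: linepath_def in_segment)
 qed
 from integral_continuous_on_param[OF this]
 show ?thesis by (simp add: contour_integral_integral)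
qed

text \<open>By Morera's theorem: the integral over a triangle is exchanged with the one over the
  segment, and vanishes for each fixed \<open>x\<close> by Cauchy's theorem.\<close>

lemma holomorphic_contour_integral_param:
 assumes U: "open U" and K: "continuous_on (U \<times> closed_segment a b) (%(w, x). K w x)"
  and h: "!!x. x \<in> closed_segment a b ==> (%w. K w x) holomorphic_on U"
 shows "(%w. contour_integral (linepath a b) (K w)) holomorphic_on U"
proof (rule analytic_imp_holomorphic, rule Morera_triangle[OF continuous_on_contour_integral_param[OF K] U], rule impI)
 fix p q s assume T: "convex hull {p, q, s} \<subseteq> U"
 have seg: "closed_segment p q \<subseteq> U" "closed_segment q s \<subseteq> U" "closed_segment s p \<subseteq> U"
  using subset_trans[OF hull_mono[of "{p, q}" "{p, q, s}"] T] subset_trans[OF hull_mono[of "{q, s}" "{p, q, s}"] T]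
   subset_trans[OF hull_mono[of "{s, p}" "{p, q, s}"] T] by (simp_all add: segment_convex_hull)
 have sw: "contour_integral (linepath p' q') (%w. contour_integral (linepath a b) (K w)) =
   contour_integral (linepath a b) (%x. contour_integral (linepath p' q') (%w. K w x))"
  if "closed_segment p' q' \<subseteq> U" for p' q'
  by (rule contour_integral_swap) (use that in \<open>auto intro: continuous_on_subset[OF K]\<close>)
 have ci: "(%x. contour_integral (linepath p' q') (%w. K w x)) contour_integrable_on linepath a b"
  if s: "closed_segment p' q' \<subseteq> U" for p' q'
 proof (rule contour_integrable_continuous_linepath, rule continuous_on_contour_integral_param)
  have "continuous_on (closed_segment a b \<times> closed_segment p' q') (%z. (%(w, x). K w x) (snd z, fst z))"
   by (rule continuous_on_compose2[OF K]) (use s in \<open>auto intro!: continuous_intros\<close>)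
  then show "continuous_on (closed_segment a b \<times> closed_segment p' q') (%(x, w). K w x)"
   by (simp add: split_def)
 qed
 have z: "contour_integral (linepath p q) (%w. K w x) + contour_integral (linepath q s) (%w. K w x) +
  contour_integral (linepath s p) (%w. K w x) = 0" if x: "x \<in> closed_segment a b" for x
 proof -
  have hol: "(%w. K w x) holomorphic_on convex hull {p, q, s}" by (rule holomorphic_on_subset[OF h[OF x] T])
  from Cauchy_theorem_triangle[OF this]
  have "contour_integral (linepath p q +++ linepath q s +++ linepath s p) (%w. K w x) = 0"
   by (rule contour_integral_unique)
  moreover have "(%w. K w x) contour_integrable_on linepath u v" if "closed_segment u v \<subseteq> U" for u v
   by (rule contour_integrable_holomorphic_simple[OF h[OF x] U]) (use that in auto)
  ultimately show ?thesis using seg by (simp add: contour_integrable_joinI valid_path_join add.assoc)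
 qed
 have "contour_integral (linepath p q) (%w. contour_integral (linepath a b) (K w)) +
    contour_integral (linepath q s) (%w. contour_integral (linepath a b) (K w)) +
    contour_integral (linepath s p) (%w. contour_integral (linepath a b) (K w)) =
    contour_integral (linepath a b) (%x. contour_integral (linepath p q) (%w. K w x) + contour_integral (linepath q s) (%w. K w x) +
  contour_integral (linepath s p) (%w. K w x))"
  using ci seg by (simp add: sw contour_integral_add contour_integrable_add)
 also have "\<dots> = contour_integral (linepath a b) (%x. 0)"
  by (rule contour_integral_eq) (simp add: z)
 finally show "contour_integral (linepath p q) (%w. contour_integral (linepath a b) (K w)) +
    contour_integral (linepath q s) (%w. contour_integral (linepath a b) (K w)) +
    contour_integral (linepath s p) (%w. contour_integral (linepath a b) (K w)) = 0" by simp
qed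

lemma contour_integral_linepath_01:
 "contour_integral (linepath a b) f = contour_integral (linepath 0 1) (%t. f (a + t * (b - a)) * (b - a))"
 by (simp add: contour_integral_integral linepath_def algebra_simps scaleR_conv_of_real)

text \<open>The substitution y = w - x changes the sign of the differential and reverses the
  segment, and the two signs cancel.\<close>

lemma contour_integral_linepath_reflect:
 "contour_integral (linepath a b) f = contour_integral (linepath (w - b) (w - a)) (%y. f (w - y))"
proof -
 have "contour_integral (linepath (w - a) (w - b)) (%y. f (w - y)) = - contour_integral (linepath a b) f"
  by (simp add: contour_integral_integral linepath_def algebra_simps flip: integral_neg)
 then show ?thesis
  using contour_integral_reverse_linepath by (metis add.inverse_inverse contour_integral_reversepath reversepath_linepath valid_path_linepath)
qed

section \<open>A branch of log (1 - exp X)\<close>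

text \<open>The zeros 2 pi i n of \<open>1 - exp X\<close> are cut away, and the two half-planes
  communicate through one gap only, so that the domain is simply connected.\<close>

definition window :: "complex set" where
 "window = {X. Re X ~= 0 \<or> (0 < Im X \<and> Im X < 2 * pi)}"

text \<open>The branch of \<open>log (1 - exp X)\<close> on the plane cut along the imaginary axis outside \<open>(0, 2\<pi>\<i>)\<close>.\<close>

definition log_1m_exp :: "complex => complex" where
 "log_1m_exp X = (if Re X > 0 then X - of_real pi * \<i> + Ln (1 - exp (- X)) else Ln (1 - exp X))"

lemma Im_Ln_neg:
 assumes "Im z < 0" shows "Im (Ln z) < 0"
proof (rule ccontr)
 assume "\<not> Im (Ln z) < 0"
 moreover have "z ~= 0" using assms by auto
 ultimately have "0 <= Im z" using Im_Ln_pos_le[of z] Im_Ln_le_pi[of z] by simp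
 then show False using assms by simp
qed

lemma Ln_1_minus:
 assumes "norm w < 1"
 shows "1 - w \<notin> \<real>\<^sub>\<le>\<^sub>0" "\<bar>Im (Ln (1 - w))\<bar> < pi / 2" "1 - w ~= 0"
proof -
 have R: "Re (1 - w) > 0" using assms complex_Re_le_cmod[of w] by simp
 then show "1 - w \<notin> \<real>\<^sub>\<le>\<^sub>0" by (auto simp: complex_nonpos_Reals_iff)
 show nz: "1 - w ~= 0" using assms by auto
 show "\<bar>Im (Ln (1 - w))\<bar> < pi / 2" using R nz Re_Ln_pos_lt by blast
qed

lemma exp_log_1m_exp:
 assumes "X \<in> window" shows "exp (log_1m_exp X) = 1 - exp X" "1 - exp X ~= 0"
proof -
 show nz: "1 - exp X ~= 0"
 proof
  assume "1 - exp X = 0"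
  then obtain n :: int where n: "Re X = 0" "Im X = of_int (2 * n) * pi" by (auto simp: exp_eq_1)
  then have "0 < of_int (2 * n) * pi" "of_int (2 * n) * pi < 2 * pi" using assms by (auto simp: window_def)
  then have "0 < n" "real_of_int n < 1" by (auto simp: zero_less_mult_iff)
  then show False by linarith
 qed
 show "exp (log_1m_exp X) = 1 - exp X"
 proof (cases "Re X > 0")
  case True
  then have "norm (exp (-X)) < 1" by simp
  from Ln_1_minus(3)[OF this] show ?thesis using True
   by (simp add: log_1m_exp_def exp_add exp_diff exp_minus field_simps)
 qed (use nz in \<open>simp add: log_1m_exp_def\<close>)
qed

text \<open>Both expressions are logarithms of \<open>1 - exp X\<close>, so it suffices that the
  first has imaginary part in (-pi, pi). \<open>Im X - pi\<close> lies there, and the remaining term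
  has the opposite sign and modulus below pi / 2, so that it cannot lead out.\<close>

lemma log_1m_exp_window:
 assumes "0 < Im X" "Im X < 2 * pi" shows "log_1m_exp X = Ln (1 - exp X)"
proof (cases "Re X > 0")
 case True
 let ?w = "exp (- X)" let ?L = "X - of_real pi * \<i> + Ln (1 - ?w)"
 have w: "norm ?w < 1" using True by simp
 note L = Ln_1_minus[OF w]
 have Im1: "Im (1 - ?w) = exp (- Re X) * sin (Im X)" by (simp add: Im_exp)
 have "\<bar>Im ?L\<bar> < pi"
 proof -
  consider "Im X < pi" | "Im X = pi" | "Im X > pi" by linarith
  then show ?thesis
  proof cases
   case 1
   then have "Im (1 - ?w) > 0" unfolding Im1 using assms by (intro mult_pos_pos sin_gt_zero) auto
   then have "0 < Im (Ln (1 - ?w))" using Im_Ln_pos_lt_imp by blast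
   then show ?thesis using 1 assms L(2) by simp
  next
   case 2
   then show ?thesis using L(2) by simp
  next
   case 3
   then have "sin (Im X) < 0" using assms by (simp add: sin_lt_zero)
   then have "Im (1 - ?w) < 0" unfolding Im1 by (simp add: mult_pos_neg)
   then have "Im (Ln (1 - ?w)) < 0" by (rule Im_Ln_neg)
   then show ?thesis using 3 assms L(2) by simp
  qed
 qed
 then have "Ln (exp ?L) = ?L" by (intro Ln_exp) auto
 moreover have "exp ?L = 1 - exp X"
  using exp_log_1m_exp(1)[of X] True by (simp add: window_def log_1m_exp_def)
 ultimately show ?thesis using True by (simp add: log_1m_exp_def)
qed (simp add: log_1m_exp_def)

lemma one_minus_exp_nonpos:
 assumes "Re X < 0 \<or> (0 < Im X \<and> Im X < 2 * pi)" shows "1 - exp X \<notin> \<real>\<^sub>\<le>\<^sub>0"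
proof (cases "Re X < 0")
 case True
 then show ?thesis by (intro Ln_1_minus(1)) simp
next
 case False
 then have I: "0 < Im X" "Im X < 2 * pi" using assms by auto
 show ?thesis
 proof
  assume "1 - exp X \<in> \<real>\<^sub>\<le>\<^sub>0"
  then have "Im (exp X) = 0" "Re (exp X) \<ge> 1" by (auto simp: complex_nonpos_Reals_iff)
  then have s: "sin (Im X) = 0" and "exp (Re X) * cos (Im X) > 0" by (auto simp: Im_exp Re_exp)
  then have c: "cos (Im X) > 0" by (simp add: zero_less_mult_iff)
  have "Im X = pi"
  proof (rule ccontr)
   assume "Im X ~= pi"
   then have "Im X < pi \<or> Im X > pi" by auto
   then show False using sin_gt_zero[of "Im X"] sin_lt_zero[of "Im X"] s I by auto
  qed
  then show False using c by simp
 qed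
qed

lemma open_window: "open window"
proof -
 have "window = {X. Re X < 0} \<union> {X. Re X > 0} \<union> ({X. Im X > 0} \<inter> {X. Im X < 2 * pi})"
  by (auto simp: window_def)
 also have "open \<dots>"
  by (intro open_Un open_Int open_halfspace_Re_lt open_halfspace_Re_gt open_halfspace_Im_lt open_halfspace_Im_gt)
 finally show ?thesis .
qed

lemma log_1m_exp_holomorphic: "log_1m_exp holomorphic_on window"
proof -
 let ?A = "{X. Re X < 0} \<union> ({X. Im X > 0} \<inter> {X. Im X < 2 * pi})" let ?B = "{X. Re X > 0}"
 have o: "open ?A" "open ?B" by (simp_all add: open_Un open_Int open_halfspace_Re_lt open_halfspace_Re_gt open_halfspace_Im_lt open_halfspace_Im_gt)
 have "(%X. Ln (1 - exp X)) holomorphic_on ?A"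
  by (intro holomorphic_intros) (use one_minus_exp_nonpos in auto)
 then have A: "log_1m_exp holomorphic_on ?A"
 proof (rule holomorphic_transform)
  fix X assume X: "X \<in> ?A"
  show "Ln (1 - exp X) = log_1m_exp X"
  proof (cases "Re X < 0")
   case False
   then show ?thesis using X log_1m_exp_window[of X] by auto
  qed (simp add: log_1m_exp_def)
 qed
 have "(%X. X - of_real pi * \<i> + Ln (1 - exp (- X))) holomorphic_on ?B"
  by (intro holomorphic_intros) (use Ln_1_minus(1) in auto)
 then have B: "log_1m_exp holomorphic_on ?B"
  by (rule holomorphic_transform) (auto simp: log_1m_exp_def)
 have "window = ?A \<union> ?B" by (auto simp: window_def)
 then show ?thesis using holomorphic_on_Un[OF A B o] by simp
qed

section \<open>The rescaled integrand and the half cell\<close>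

text \<open>With om = \<open>exp \<eta>\<close> and y = exp (\<eta> + X), the form
  \<open>exp \<eta> * kernel f g \<eta> X\<close> dX is f (log y) g (log (om - y)) dy. Dividing y by
  om fixes the two singular points at 0 and 1, while om moves only through
  \<open>\<eta>\<close>.\<close>

definition kernel :: "(complex => complex) => (complex => complex) => complex => complex => complex" where
 "kernel f g \<eta> X = f (\<eta> + X) * g (\<eta> + log_1m_exp X) * exp X"

text \<open>In these variables the inequality is |om| + |y| < exp R, which bounds y and om - y at
  once.\<close>

definition kernel_dom :: "real => complex => complex set" where
 "kernel_dom R \<eta> = window \<inter> {X. exp (Re \<eta>) * (1 + exp (Re X)) < exp R}"

lemma kernel_dom_bounds:
 assumes "X \<in> kernel_dom R \<eta>"
 shows "Re (\<eta> + X) < R" "Re (\<eta> + log_1m_exp X) < R"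
proof -
 have b: "exp (Re \<eta>) * (1 + exp (Re X)) < exp R" and w: "X \<in> window" using assms by (auto simp: kernel_dom_def)
 have "exp (Re (\<eta> + X)) < exp R" using b by (simp add: exp_add algebra_simps) (smt (verit) exp_gt_zero)
 then show "Re (\<eta> + X) < R" by simp
 have "exp (Re (\<eta> + log_1m_exp X)) = exp (Re \<eta>) * norm (1 - exp X)"
  by (simp add: exp_add flip: exp_log_1m_exp(1)[OF w])
 also have "\<dots> <= exp (Re \<eta>) * (1 + exp (Re X))"
  using norm_triangle_ineq4[of 1 "exp X"] by simp
 also have "\<dots> < exp R" by (rule b)
 finally show "Re (\<eta> + log_1m_exp X) < R" by simp
qed

lemma open_kernel_dom: "open (kernel_dom R \<eta>)"
 unfolding kernel_dom_def by (intro open_Int open_window open_Collect_less continuous_intros)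

lemma holomorphic_on_half_plane_compose:
 assumes "f holomorphic_on {X. Re X < R}" "h holomorphic_on S" "!!x. x \<in> S ==> Re (h x) < R"
 shows "(%x. f (h x)) holomorphic_on S"
 by (rule holomorphic_on_compose_gen[OF assms(2,1), unfolded o_def]) (use assms(3) in auto)

lemma continuous_on_half_plane_compose:
 assumes "f holomorphic_on {X. Re X < R}" "continuous_on S h" "!!x. x \<in> S ==> Re (h x) < R"
 shows "continuous_on S (%x. f (h x))"
 by (rule continuous_on_compose2[OF holomorphic_on_imp_continuous_on[OF assms(1)] assms(2)]) (use assms(3) in auto)

lemma kernel_holomorphic:
 assumes f: "f holomorphic_on {X. Re X < R}" and g: "g holomorphic_on {X. Re X < R}"
 shows "kernel f g \<eta> holomorphic_on kernel_dom R \<eta>"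
 unfolding kernel_def
 by (intro holomorphic_intros holomorphic_on_half_plane_compose[OF f] holomorphic_on_half_plane_compose[OF g]
    holomorphic_on_subset[OF log_1m_exp_holomorphic] kernel_dom_bounds)
  (auto simp: kernel_dom_def)

text \<open>The centre is pi i, the middle of the gap: a segment from there to a point off the
  imaginary axis meets the axis at pi i only.\<close>

lemma kernel_dom_starlike:
 assumes "2 * exp (Re \<eta>) < exp R" shows "starlike (kernel_dom R \<eta>)"
 unfolding starlike_def
proof (intro bexI[of _ "of_real pi * \<i>"] ballI subsetI)
 show "of_real pi * \<i> \<in> kernel_dom R \<eta>" using assms by (simp add: kernel_dom_def window_def)
 fix X Y assume X: "X \<in> kernel_dom R \<eta>" and "Y \<in> closed_segment (of_real pi * \<i>) X"
 then obtain t where t: "0 <= t" "t <= 1" "Y = (1 - t) *\<^sub>R (of_real pi * \<i>) + t *\<^sub>R X" by (auto simp: closed_segment_def)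
 have RI: "Re Y = t * Re X" "Im Y = (1 - t) * pi + t * Im X" by (auto simp: t(3))
 have "Y \<in> window"
 proof (cases "Re Y = 0")
  case True
  then have "t = 0 \<or> Re X = 0" by (simp add: RI(1))
  then consider "t = 0" | "t > 0" "Re X = 0" using t(1) by fastforce
  then show ?thesis
  proof cases
   case 2
   then have I: "0 < Im X" "Im X < 2 * pi" using X by (auto simp: kernel_dom_def window_def)
   have "0 < t * Im X" using 2 I by simp
   moreover have "0 <= (1 - t) * pi" using t by simp
   moreover have "t * Im X < t * (2 * pi)" using 2 I by simp
   moreover have "(1 - t) * pi <= (1 - t) * (2 * pi)" using t by (intro mult_left_mono) auto
   moreover have "t * (2 * pi) + (1 - t) * (2 * pi) = 2 * pi" by (simp add: algebra_simps)
   ultimately have "0 < Im Y" "Im Y < 2 * pi" unfolding RI by linarith+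
   then show ?thesis by (simp add: window_def)
  qed (simp add: window_def RI)
 qed (simp add: window_def)
 moreover have "exp (Re \<eta>) * (1 + exp (Re Y)) < exp R"
 proof (cases "Re X \<ge> 0")
  case True
  then have "Re Y <= Re X" unfolding RI using t by (simp add: mult_left_le_one_le)
  then have "exp (Re \<eta>) * (1 + exp (Re Y)) <= exp (Re \<eta>) * (1 + exp (Re X))" by simp
  also have "\<dots> < exp R" using X by (simp add: kernel_dom_def)
  finally show ?thesis .
 next
  case False
  then have "Re Y <= 0" unfolding RI using t by (simp add: mult_nonneg_nonpos)
  then have "exp (Re Y) <= 1" by simp
  then have "exp (Re \<eta>) * (1 + exp (Re Y)) <= exp (Re \<eta>) * (1 + 1)" by (intro mult_left_mono add_left_mono) auto
  also have "\<dots> < exp R" using assms by simp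
  finally show ?thesis .
 qed
 ultimately show "Y \<in> kernel_dom R \<eta>" by (simp add: kernel_dom_def)
qed

lemma kernel_primitive:
 assumes f: "f holomorphic_on {X. Re X < R}" and g: "g holomorphic_on {X. Re X < R}" and \<eta>: "2 * exp (Re \<eta>) < exp R"
 obtains \<Phi> where "!!X. X \<in> kernel_dom R \<eta> ==> (\<Phi> has_field_derivative kernel f g \<eta> X) (at X)"
proof -
 have "\<exists>\<Phi>. \<forall>X\<in>kernel_dom R \<eta>. (\<Phi> has_field_derivative kernel f g \<eta> X) (at X)"
  by (rule holomorphic_starlike_primitive[of _ _ "{}"])
   (use kernel_holomorphic[OF f g] open_kernel_dom kernel_dom_starlike[OF \<eta>] in
    \<open>auto intro: holomorphic_on_imp_continuous_on holomorphic_on_imp_differentiable_at\<close>)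
 then show thesis using that by blast
qed

text \<open>The integral of f (log y) g (log (om - y)) dy from \<open>- \<sigma>\<close> to the
  midpoint om / 2. Since \<open>- \<sigma>\<close> is fixed, the start moves with
  \<open>\<eta>\<close> in the coordinate \<open>X\<close>. The corner is y = - 2 om: the first leg
  stays in \<open>Re X > 0\<close>, and the second crosses the imaginary axis at pi i / 2, inside
  the gap.\<close>

definition half_cell :: "(complex => complex) => (complex => complex) => real => complex => complex" where
 "half_cell f g \<sigma> \<eta> = exp \<eta> *
  (contour_integral (linepath (Complex (ln \<sigma>) pi - \<eta>) (Complex (ln 2) pi)) (kernel f g \<eta>) +
   contour_integral (linepath (Complex (ln 2) pi) (- Complex (ln 2) 0)) (kernel f g \<eta>))"

text \<open>On the first leg |y| is at most the sum of its end values \<sigma> and 2 |om|, and on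
  the second at most 2 |om|. Together with the summand |om| in \<open>kernel_dom\<close> this
  explains \<open>3 * exp (Re \<eta>) + \<sigma>\<close>.\<close>

lemma half_cell_segments:
 assumes \<sigma>: "\<sigma> > 0" and \<eta>: "exp (Re \<eta>) < \<sigma>" "3 * exp (Re \<eta>) + \<sigma> < exp R"
 shows "closed_segment (Complex (ln \<sigma>) pi - \<eta>) (Complex (ln 2) pi) \<subseteq> kernel_dom R \<eta> \<inter> {X. Re X > 0}"
  "closed_segment (Complex (ln 2) pi) (- Complex (ln 2) 0) \<subseteq> kernel_dom R \<eta>"
proof -
 have e: "exp (Re \<eta>) * exp (ln \<sigma> - Re \<eta>) = \<sigma>" using \<sigma> by (simp add: exp_diff)
 have pos: "ln \<sigma> - Re \<eta> > 0" using \<eta>(1) \<sigma> by (metis diff_gt_0_iff_gt exp_less_cancel_iff exp_ln)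
 have exg: "exp (Re \<eta>) > 0" by simp
 show "closed_segment (Complex (ln \<sigma>) pi - \<eta>) (Complex (ln 2) pi) \<subseteq> kernel_dom R \<eta> \<inter> {X. Re X > 0}"
 proof
  fix X assume "X \<in> closed_segment (Complex (ln \<sigma>) pi - \<eta>) (Complex (ln 2) pi)"
  then obtain t where t: "0 <= t" "t <= 1" "X = (1 - t) *\<^sub>R (Complex (ln \<sigma>) pi - \<eta>) + t *\<^sub>R Complex (ln 2) pi"
   by (auto simp: closed_segment_def)
  have R: "Re X = (1 - t) * (ln \<sigma> - Re \<eta>) + t * ln 2" by (simp add: t(3))
  have "Re X > 0"
  proof (cases "t = 1")
   case False
   then have "(1 - t) * (ln \<sigma> - Re \<eta>) > 0" using t pos by simp
   moreover have "t * ln 2 \<ge> 0" using t by simp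
   ultimately show ?thesis unfolding R by linarith
  qed (simp add: R)
  moreover have "Re X <= max (ln \<sigma> - Re \<eta>) (ln 2)"
   unfolding R using t by (intro convex_bound_le) auto
  then have "exp (Re X) <= exp (ln \<sigma> - Re \<eta>) + exp (ln 2)"
   by (smt (verit, best) exp_gt_zero exp_le_cancel_iff)
  then have "exp (Re \<eta>) * exp (Re X) <= \<sigma> + exp (Re \<eta>) * 2"
   using mult_left_mono[of "exp (Re X)" "exp (ln \<sigma> - Re \<eta>) + exp (ln 2)" "exp (Re \<eta>)"] e by (simp add: distrib_left)
  then have "exp (Re \<eta>) * (1 + exp (Re X)) <= 3 * exp (Re \<eta>) + \<sigma>" by (simp add: distrib_left)
  ultimately show "X \<in> kernel_dom R \<eta> \<inter> {X. Re X > 0}"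
   using \<eta>(2) by (simp add: kernel_dom_def window_def)
 qed
 show "closed_segment (Complex (ln 2) pi) (- Complex (ln 2) 0) \<subseteq> kernel_dom R \<eta>"
 proof
  fix X assume "X \<in> closed_segment (Complex (ln 2) pi) (- Complex (ln 2) 0)"
  then obtain t where t: "0 <= t" "t <= 1" "X = (1 - t) *\<^sub>R Complex (ln 2) pi + t *\<^sub>R (- Complex (ln 2) 0)"
   by (auto simp: closed_segment_def)
  have R: "Re X = (1 - 2 * t) * ln 2" "Im X = (1 - t) * pi" by (auto simp: t(3) algebra_simps)
  have "X \<in> window"
  proof (cases "t = 1/2")
   case True
   then show ?thesis by (simp add: window_def R)
  next
   case False
   then show ?thesis by (simp add: window_def R)
  qed
  moreover have "Re X <= ln 2" unfolding R using mult_right_mono[of "1 - 2 * t" 1 "ln 2"] t by simp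
  then have "exp (Re X) <= 2" by (metis exp_le_cancel_iff exp_ln zero_less_numeral)
  then have "exp (Re \<eta>) * (1 + exp (Re X)) <= exp (Re \<eta>) * 3" by (intro mult_left_mono) auto
  then have "exp (Re \<eta>) * (1 + exp (Re X)) < exp R" using \<eta>(2) \<sigma> by linarith
  ultimately show "X \<in> kernel_dom R \<eta>" unfolding kernel_dom_def by blast
 qed
qed

lemma half_cell_eq:
 assumes \<sigma>: "\<sigma> > 0" and \<eta>: "exp (Re \<eta>) < \<sigma>" "3 * exp (Re \<eta>) + \<sigma> < exp R"
  and \<Phi>: "!!X. X \<in> kernel_dom R \<eta> ==> (\<Phi> has_field_derivative kernel f g \<eta> X) (at X)"
 shows "half_cell f g \<sigma> \<eta> = exp \<eta> * (\<Phi> (- Complex (ln 2) 0) - \<Phi> (Complex (ln \<sigma>) pi - \<eta>))"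
proof -
 note S = half_cell_segments[OF assms(1-3)]
 have "(kernel f g \<eta> has_contour_integral (\<Phi> (Complex (ln 2) pi) - \<Phi> (Complex (ln \<sigma>) pi - \<eta>)))
   (linepath (Complex (ln \<sigma>) pi - \<eta>) (Complex (ln 2) pi))"
  using contour_integral_primitive[of "kernel_dom R \<eta>" \<Phi> "kernel f g \<eta>" "linepath (Complex (ln \<sigma>) pi - \<eta>) (Complex (ln 2) pi)"]
   \<Phi> S(1) by (auto intro: has_field_derivative_at_within)
 moreover have "(kernel f g \<eta> has_contour_integral (\<Phi> (- Complex (ln 2) 0) - \<Phi> (Complex (ln 2) pi)))
   (linepath (Complex (ln 2) pi) (- Complex (ln 2) 0))"
  using contour_integral_primitive[of "kernel_dom R \<eta>" \<Phi> "kernel f g \<eta>" "linepath (Complex (ln 2) pi) (- Complex (ln 2) 0)"]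
   \<Phi> S(2) by (auto intro: has_field_derivative_at_within)
 ultimately show ?thesis unfolding half_cell_def by (simp add: contour_integral_unique)
qed

text \<open>The first leg has an endpoint that moves with \<open>\<eta>\<close>, so it is
  reparametrised over the segment from 0 to 1 before the integral is differentiated under the
  sign.\<close>

lemma half_cell_holomorphic:
 assumes f: "f holomorphic_on {X. Re X < R}" and g: "g holomorphic_on {X. Re X < R}"
  and \<sigma>: "\<sigma> > 0" and r: "exp r <= \<sigma>" "3 * exp r + \<sigma> <= exp R"
 shows "half_cell f g \<sigma> holomorphic_on {\<eta>. Re \<eta> < r}"
proof -
 let ?U = "{\<eta>::complex. Re \<eta> < r}"
 let ?P = "Complex (ln \<sigma>) pi" let ?Q = "Complex (ln 2) pi"
 have b: "exp (Re \<eta>) < \<sigma>" "3 * exp (Re \<eta>) + \<sigma> < exp R" if "\<eta> \<in> ?U" for \<eta>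
 proof -
  have "exp (Re \<eta>) < exp r" using that by simp
  then show "exp (Re \<eta>) < \<sigma>" "3 * exp (Re \<eta>) + \<sigma> < exp R" using r by linarith+
 qed
 note S = half_cell_segments[OF \<sigma> b]
 define h where "h \<eta> t = (?P - \<eta>) + t * (?Q - (?P - \<eta>))" for \<eta> t
 have hS: "h \<eta> t \<in> kernel_dom R \<eta> \<inter> {X. Re X > 0}" if that': "\<eta> \<in> ?U" "t \<in> closed_segment 0 1" for \<eta> t
 proof -
  obtain u where u: "0 <= u" "u <= 1" "t = of_real u" using that'(2) by (auto simp: closed_segment_def scaleR_conv_of_real)
  have "h \<eta> t = (1 - u) *\<^sub>R (?P - \<eta>) + u *\<^sub>R ?Q" by (simp add: h_def u(3) scaleR_conv_of_real algebra_simps)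
  then have "h \<eta> t \<in> closed_segment (?P - \<eta>) ?Q" using u unfolding closed_segment_def by blast
  then show ?thesis using S(1)[OF that'(1,1)] by blast
 qed
 have hw: "h \<eta> t \<in> window" if "\<eta> \<in> ?U" "t \<in> closed_segment 0 1" for \<eta> t
  using hS[OF that] by (simp add: kernel_dom_def)
 have 1: "(%\<eta>. contour_integral (linepath 0 1) (%t. kernel f g \<eta> (h \<eta> t) * (?Q - (?P - \<eta>)))) holomorphic_on ?U"
 proof (rule holomorphic_contour_integral_param[OF open_half_plane_Re])
  have ch: "continuous_on (?U \<times> closed_segment 0 1) (%x. h (fst x) (snd x))" unfolding h_def by (intro continuous_intros)
  have cl: "continuous_on (?U \<times> closed_segment 0 1) (%x. log_1m_exp (h (fst x) (snd x)))"
   by (rule continuous_on_compose2[OF holomorphic_on_imp_continuous_on[OF log_1m_exp_holomorphic] ch]) (use hw in auto)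
  show "continuous_on (?U \<times> closed_segment 0 1) (%(\<eta>, t). kernel f g \<eta> (h \<eta> t) * (?Q - (?P - \<eta>)))"
   unfolding kernel_def split_def
   by (intro continuous_intros continuous_on_half_plane_compose[OF f] continuous_on_half_plane_compose[OF g] ch cl)
    (use hS kernel_dom_bounds in auto)
  fix t :: complex assume t: "t \<in> closed_segment 0 1"
  have hh: "(%\<eta>. h \<eta> t) holomorphic_on ?U" unfolding h_def by (intro holomorphic_intros)
  have hl: "(%\<eta>. log_1m_exp (h \<eta> t)) holomorphic_on ?U"
   by (rule holomorphic_on_compose_gen[OF hh log_1m_exp_holomorphic, unfolded o_def]) (use hw t in auto)
  show "(%\<eta>. kernel f g \<eta> (h \<eta> t) * (?Q - (?P - \<eta>))) holomorphic_on ?U"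
   unfolding kernel_def
   by (intro holomorphic_intros holomorphic_on_half_plane_compose[OF f] holomorphic_on_half_plane_compose[OF g] hh hl)
    (use hS t kernel_dom_bounds in auto)
 qed
 have 2: "(%\<eta>. contour_integral (linepath ?Q (- Complex (ln 2) 0)) (kernel f g \<eta>)) holomorphic_on ?U"
 proof (rule holomorphic_contour_integral_param[OF open_half_plane_Re])
  have w: "x \<in> window" if "x \<in> closed_segment ?Q (- Complex (ln 2) 0)" "\<eta> \<in> ?U" for x \<eta>
   using S(2)[OF that(2,2)] that(1) by (auto simp: kernel_dom_def)
  show "continuous_on (?U \<times> closed_segment ?Q (- Complex (ln 2) 0)) (%(\<eta>, x). kernel f g \<eta> x)"
  proof -
   have cl: "continuous_on (?U \<times> closed_segment ?Q (- Complex (ln 2) 0)) (%x. log_1m_exp (snd x))"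
    by (rule continuous_on_compose2[OF holomorphic_on_imp_continuous_on[OF log_1m_exp_holomorphic]])
     (use w in \<open>auto intro!: continuous_intros\<close>)
   show ?thesis
    unfolding kernel_def split_def
    by (intro continuous_intros continuous_on_half_plane_compose[OF f] continuous_on_half_plane_compose[OF g] cl)
     (use S(2) b kernel_dom_bounds in \<open>auto simp: subset_iff\<close>)
  qed
  show "(%\<eta>. kernel f g \<eta> x) holomorphic_on ?U" if "x \<in> closed_segment ?Q (- Complex (ln 2) 0)" for x
   unfolding kernel_def
   by (intro holomorphic_intros holomorphic_on_half_plane_compose[OF f] holomorphic_on_half_plane_compose[OF g])
    (use S(2) b kernel_dom_bounds that in \<open>auto simp: subset_iff\<close>)
 qed
 have "(%\<eta>. exp \<eta> * (contour_integral (linepath 0 1) (%t. kernel f g \<eta> (h \<eta> t) * (?Q - (?P - \<eta>))) +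
   contour_integral (linepath ?Q (- Complex (ln 2) 0)) (kernel f g \<eta>))) holomorphic_on ?U"
  by (intro holomorphic_intros 1 2)
 then show ?thesis
  unfolding half_cell_def[abs_def] h_def by (simp only: contour_integral_linepath_01[of "?P - _" ?Q])
qed

text \<open>
 In the coordinate \<open>exp X\<close>, the integral of \<open>f (\<eta> + X) g (\<eta> + Ln (1 - exp X)) exp X\<close> along the
 circle around \<open>0\<close> through \<open>1/2\<close>.
\<close>

definition circle_integral :: "(complex => complex) => (complex => complex) => complex => complex" where
 "circle_integral f g \<eta> = contour_integral (linepath (- Complex (ln 2) 0) (Complex (- ln 2) (2 * pi)))
  (%X. f (\<eta> + X) * g (\<eta> + Ln (1 - exp X)) * exp X)"

section \<open>Turning the half cell once around the origin\<close>

text \<open>If om turns once while y is fixed with |y| > |om|, then om - y does not wind around 0.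
  In formulas, the two shifts cancel in both arguments, because on the right half-plane
  \<open>log_1m_exp X\<close> is X plus a function of \<open>exp X\<close>.\<close>

lemma kernel_shift_eq:
 assumes "Re X > 0"
 shows "kernel f g (\<eta> + 2 * of_real pi * \<i>) (X - 2 * of_real pi * \<i>) = kernel f g \<eta> X"
 using assms by (simp add: kernel_def log_1m_exp_def exp_diff exp_minus algebra_simps inverse_eq_divide)

lemma exp_segment:
 assumes "Y = Complex (- ln 2) t" shows "norm (exp Y) = 1/2" "exp Y = of_real (1/2) * cis t"
 by (simp_all add: assms exp_minus exp_eq_polar)

text \<open>The involution v to 1 - v exchanges the circles of radius 1/2 around 0 and 1; the point
  is on which sheet \<open>log_1m_exp\<close> inverts it. In the first half of the turn
  \<open>1 - exp Y\<close> lies below the real axis, so 2 pi i must be added to its logarithm to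
  come to the gap.\<close>

lemma log_1m_exp_Ln_lower:
 assumes Y: "Y = Complex (- ln 2) t" and t: "0 <= t" "t <= pi"
 shows "log_1m_exp (2 * of_real pi * \<i> + Ln (1 - exp Y)) = Y" "2 * of_real pi * \<i> + Ln (1 - exp Y) \<in> window"
proof -
 let ?L = "Ln (1 - exp Y)" let ?k = "2 * of_real pi * \<i> + ?L"
 note e = exp_segment[OF Y]
 have n: "norm (exp Y) < 1" using e(1) by linarith
 note L = Ln_1_minus[OF n]
 have ek: "exp ?k = 1 - exp Y" using L(3) by (simp add: exp_add)
 have main: "log_1m_exp ?k = Ln (1 - exp ?k) --> log_1m_exp ?k = Y"
 proof
  assume "log_1m_exp ?k = Ln (1 - exp ?k)"
  also have "\<dots> = Ln (exp Y)" by (simp add: ek)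
  also have "\<dots> = Y" by (rule Ln_exp) (use t in \<open>auto simp: Y intro: less_le_trans[of _ 0]\<close>)
  finally show "log_1m_exp ?k = Y" .
 qed
 consider "t = 0" | "0 < t" "t < pi" | "t = pi" using t by linarith
 then have "log_1m_exp ?k = Y \<and> ?k \<in> window"
 proof cases
  case 1
  have "exp Y = of_real (1/2)" using e(2) 1 by simp
  then have "1 - exp Y = of_real (1/2)" by simp
  then have "?L = of_real (ln (1/2))" by (simp only: Ln_of_real)
  then have "Re ?k = - ln 2" by (simp add: ln_div)
  then show ?thesis using main by (auto simp: log_1m_exp_def window_def)
 next
  case 2
  have "Im (1 - exp Y) < 0" using 2 sin_gt_zero[of t] by (simp add: e(2))
  then have "Im ?L < 0" by (rule Im_Ln_neg)
  moreover have "Im ?L > - (pi / 2)" using L(2) by linarith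
  ultimately have "0 < Im ?k" "Im ?k < 2 * pi" by auto
  then show ?thesis using main log_1m_exp_window[of ?k] by (simp add: window_def)
 next
  case 3
  have "exp Y = - of_real (1/2)" using e(2) 3 by simp
  then have eY: "1 - exp Y = of_real (3/2)" by simp
  then have k: "?L = of_real (ln (3/2))" by (simp only: Ln_of_real)
  have "Re ?k > 0" by (simp add: k)
  moreover have "exp (- ?k) = of_real (2/3)" unfolding exp_minus trans[OF ek eY] by simp
  then have "1 - exp (- ?k) = of_real (1/3)" by simp
  then have "Ln (1 - exp (- ?k)) = of_real (ln (1/3))" by (simp only: Ln_of_real)
  ultimately have "log_1m_exp ?k = of_real (ln (3/2)) + of_real pi * \<i> + of_real (ln (1/3))"
   by (simp add: log_1m_exp_def k)
  also have "ln (3/2) + ln (1/3) = - ln (2::real)" by (simp add: ln_div)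
  then have "of_real (ln (3/2)) + of_real pi * \<i> + of_real (ln (1/3)) = Y"
   by (simp add: Y 3 complex_eq_iff)
  finally show ?thesis using \<open>Re ?k > 0\<close> by (simp add: window_def)
 qed
 then show "log_1m_exp ?k = Y" "?k \<in> window" by auto
qed

text \<open>In the second half of the turn \<open>1 - exp Y\<close> lies above the real axis and its
  logarithm is already at the gap, but now the principal logarithm of \<open>exp Y\<close> is Y - 2
  pi i.\<close>

lemma log_1m_exp_Ln_upper:
 assumes Y: "Y = Complex (- ln 2) t" and t: "pi <= t" "t <= 2 * pi"
 shows "log_1m_exp (Ln (1 - exp Y)) = Y - 2 * of_real pi * \<i>" "Ln (1 - exp Y) \<in> window"
proof -
 let ?k = "Ln (1 - exp Y)"
 note e = exp_segment[OF Y]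
 have n: "norm (exp Y) < 1" using e(1) by linarith
 note L = Ln_1_minus[OF n]
 have ek: "exp ?k = 1 - exp Y" using L(3) by simp
 have main: "log_1m_exp ?k = Y - 2 * of_real pi * \<i>" if "log_1m_exp ?k = Ln (1 - exp ?k)" "t > pi"
 proof -
  have "Ln (exp (Y - 2 * of_real pi * \<i>)) = Y - 2 * of_real pi * \<i>" using t that(2) by (intro Ln_exp) (auto simp: Y)
  then show ?thesis using that(1) by (simp add: ek exp_diff)
 qed
 consider "t = 2 * pi" | "pi < t" "t < 2 * pi" | "t = pi" using t by linarith
 then have "log_1m_exp ?k = Y - 2 * of_real pi * \<i> \<and> ?k \<in> window"
 proof cases
  case 1
  have "exp Y = of_real (1/2)" using e(2) 1 by simp
  then have "1 - exp Y = of_real (1/2)" by simp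
  then have "?k = of_real (ln (1/2))" by (simp only: Ln_of_real)
  then have "Re ?k = - ln 2" by (simp add: ln_div)
  then show ?thesis using main 1 by (auto simp: log_1m_exp_def window_def)
 next
  case 2
  have "Im (1 - exp Y) > 0" using 2 sin_lt_zero[of t] by (simp add: e(2))
  then have "Im ?k > 0" using Im_Ln_pos_lt_imp by blast
  moreover have "Im ?k < pi / 2" using L(2) by linarith
  ultimately have "0 < Im ?k" "Im ?k < 2 * pi" by auto
  then show ?thesis using main 2 log_1m_exp_window[of ?k] by (simp add: window_def)
 next
  case 3
  have "exp Y = - of_real (1/2)" using e(2) 3 by simp
  then have eY: "1 - exp Y = of_real (3/2)" by simp
  then have k: "?k = of_real (ln (3/2))" by (simp only: Ln_of_real)
  have "Re ?k > 0" by (simp add: k)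
  moreover have "exp (- ?k) = of_real (2/3)" unfolding exp_minus trans[OF ek eY] by simp
  then have "1 - exp (- ?k) = of_real (1/3)" by simp
  then have "Ln (1 - exp (- ?k)) = of_real (ln (1/3))" by (simp only: Ln_of_real)
  ultimately have "log_1m_exp ?k = of_real (ln (3/2)) - of_real pi * \<i> + of_real (ln (1/3))"
   by (simp add: log_1m_exp_def k)
  also have "ln (3/2) + ln (1/3) = - ln (2::real)" by (simp add: ln_div)
  then have "of_real (ln (3/2)) - of_real pi * \<i> + of_real (ln (1/3)) = Y - 2 * of_real pi * \<i>"
   by (simp add: Y 3 complex_eq_iff)
  finally show ?thesis using \<open>Re ?k > 0\<close> by (simp add: window_def)
 qed
 then show "log_1m_exp ?k = Y - 2 * of_real pi * \<i>" "?k \<in> window" by auto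
qed

text \<open>
 The continuation of the half cell once around the origin: the path of integration gains a
 circle around \<open>0\<close>, traversed first, and then a circle around \<open>1\<close> on the next sheet of \<open>f\<close>.
\<close>

lemma half_cell_monodromy:
 assumes f: "f holomorphic_on {X. Re X < R}" and g: "g holomorphic_on {X. Re X < R}"
  and \<sigma>: "\<sigma> > 0" and \<eta>: "exp (Re \<eta>) < \<sigma>" "3 * exp (Re \<eta>) + \<sigma> < exp R"
 shows "half_cell f g \<sigma> (\<eta> + 2 * of_real pi * \<i>) - half_cell f g \<sigma> \<eta> =
  exp \<eta> * (circle_integral f g \<eta> - circle_integral g (%X. f (X + 2 * of_real pi * \<i>)) \<eta>)"
proof -
 let ?T = "2 * of_real pi * \<i> :: complex"
 have ex: "exp (Re \<eta>) > 0" by simp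
 have \<eta>2: "2 * exp (Re \<eta>) < exp R" using \<eta>(2) \<sigma> ex by linarith
 obtain \<Phi> where \<Phi>: "!!X. X \<in> kernel_dom R \<eta> ==> (\<Phi> has_field_derivative kernel f g \<eta> X) (at X)"
  using kernel_primitive[OF f g \<eta>2] by blast
 obtain \<Psi> where \<Psi>: "!!X. X \<in> kernel_dom R (\<eta> + ?T) ==> (\<Psi> has_field_derivative kernel f g (\<eta> + ?T) X) (at X)"
  using kernel_primitive[OF f g, of "\<eta> + ?T"] \<eta>2 by auto
 have dom: "kernel_dom R (\<eta> + ?T) = kernel_dom R \<eta>" by (simp add: kernel_dom_def)
 \<comment> \<open>\<open>?Q\<close> is a logarithm of 3/2, the point opposite to 1/2 on the circle
   of radius 1/2 around 1, taken after the turn around 0.\<close>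
 let ?P = "Complex (ln \<sigma>) pi" let ?h = "- Complex (ln 2) 0" let ?Q = "?T + of_real (ln (3/2))"
 have I1: "half_cell f g \<sigma> \<eta> = exp \<eta> * (\<Phi> ?h - \<Phi> (?P - \<eta>))" by (rule half_cell_eq[OF \<sigma> \<eta> \<Phi>])
 have I2: "half_cell f g \<sigma> (\<eta> + ?T) = exp \<eta> * (\<Psi> ?h - \<Psi> (?P - \<eta> - ?T))"
  using half_cell_eq[OF \<sigma> _ _ \<Psi>] \<eta> by (simp add: exp_add diff_diff_eq)
 let ?A = "{X. Re X > 0} \<inter> {X. Re X < ln ((exp R - exp (Re \<eta>)) / exp (Re \<eta>))}"
 have Ain: "X \<in> ?A \<longleftrightarrow> Re X > 0 \<and> exp (Re \<eta>) * (1 + exp (Re X)) < exp R" for X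
 proof -
  have p: "(exp R - exp (Re \<eta>)) / exp (Re \<eta>) > 0" using \<eta>2 ex by (intro divide_pos_pos) linarith+
  have "Re X < ln ((exp R - exp (Re \<eta>)) / exp (Re \<eta>)) \<longleftrightarrow> exp (Re X) < (exp R - exp (Re \<eta>)) / exp (Re \<eta>)"
   using p by (metis exp_less_cancel_iff exp_ln)
  also have "\<dots> \<longleftrightarrow> exp (Re \<eta>) * (1 + exp (Re X)) < exp R"
   using ex by (simp add: pos_less_divide_eq algebra_simps)
  finally show ?thesis by simp
 qed
 have AD: "X \<in> kernel_dom R \<eta>" "X - ?T \<in> kernel_dom R (\<eta> + ?T)" if "X \<in> ?A" for X
  using that unfolding Ain by (auto simp: kernel_dom_def window_def)
 \<comment> \<open>On the right half-plane the two integrands correspond under the translation. So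
   the comparison of the primitives can be moved from the start \<open>- \<sigma>\<close>, where it
   arises, to \<open>?Q\<close>, where the circle around 1 crosses the real axis.\<close>
 have "\<exists>k. \<forall>X\<in>?A. \<Phi> X - \<Psi> (X - ?T) = k"
 proof (rule has_field_derivative_zero_constant)
  show "convex ?A" by (intro convex_Int convex_halfspace_Re_gt convex_halfspace_Re_lt)
  fix X assume X: "X \<in> ?A"
  have "((%X. \<Psi> (X - ?T)) has_field_derivative kernel f g (\<eta> + ?T) (X - ?T) * 1) (at X)"
   by (rule DERIV_chain'[where f = "%X. X - ?T" and g = \<Psi>, OF _ \<Psi>[OF AD(2)[OF X]]]) (auto intro!: derivative_eq_intros)
  moreover have "kernel f g (\<eta> + ?T) (X - ?T) = kernel f g \<eta> X" by (rule kernel_shift_eq) (use X in simp)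
  ultimately have "((%X. \<Phi> X - \<Psi> (X - ?T)) has_field_derivative kernel f g \<eta> X - kernel f g \<eta> X) (at X)"
   using \<Phi>[OF AD(1)[OF X]] by (intro DERIV_diff) auto
  then show "((%X. \<Phi> X - \<Psi> (X - ?T)) has_field_derivative 0) (at X within ?A)"
   by (simp add: has_field_derivative_at_within)
 qed
 then obtain k where k: "!!X. X \<in> ?A ==> \<Phi> X - \<Psi> (X - ?T) = k" by blast
 have PA: "?P - \<eta> \<in> ?A" unfolding Ain
 proof
  have "Re (?P - \<eta>) = ln \<sigma> - Re \<eta>" by simp
  moreover have "exp (Re \<eta>) < exp (ln \<sigma>)" using \<eta>(1) \<sigma> by simp
  then have "Re \<eta> < ln \<sigma>" by (simp only: exp_less_cancel_iff)
  ultimately show "Re (?P - \<eta>) > 0" by simp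
  have "exp (Re \<eta>) * (1 + exp (Re (?P - \<eta>))) = exp (Re \<eta>) + \<sigma>" using \<sigma> by (simp add: exp_diff distrib_left)
  then show "exp (Re \<eta>) * (1 + exp (Re (?P - \<eta>))) < exp R" using \<eta>(2) ex by linarith
 qed
 have QA: "?Q \<in> ?A" unfolding Ain
 proof
  show "Re ?Q > 0" by simp
  have "exp (Re \<eta>) * (1 + exp (Re ?Q)) = exp (Re \<eta>) * (5/2)" by simp
  then show "exp (Re \<eta>) * (1 + exp (Re ?Q)) < exp R" using \<eta>(2) ex \<sigma> by linarith
 qed
 let ?c = "Complex (- ln 2) pi" let ?e = "Complex (- ln 2) (2 * pi)"
 have e2: "?e = ?h + ?T" by (simp add: complex_eq_iff)
 have hdom: "X \<in> kernel_dom R \<eta>" "log_1m_exp X = Ln (1 - exp X)" if "Re X = - ln 2" for X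
 proof -
  have "exp (Re X) = 1/2" using that by (simp add: exp_minus)
  then have "exp (Re \<eta>) * (1 + exp (Re X)) = exp (Re \<eta>) * (3/2)" by simp
  also have "\<dots> < exp R" using \<eta>(2) ex \<sigma> by linarith
  finally have "exp (Re \<eta>) * (1 + exp (Re X)) < exp R" .
  then show "X \<in> kernel_dom R \<eta>" using that by (simp add: kernel_dom_def window_def)
  show "log_1m_exp X = Ln (1 - exp X)" using that by (simp add: log_1m_exp_def)
 qed
 have seg: "\<exists>t. X = Complex (- ln 2) t \<and> a <= t \<and> t <= b" if X: "X \<in> closed_segment (Complex (- ln 2) a) (Complex (- ln 2) b)" and ab: "a <= b" for X a b
 proof -
  obtain u where u: "0 <= u" "u <= 1" "X = (1 - u) *\<^sub>R Complex (- ln 2) a + u *\<^sub>R Complex (- ln 2) b"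
   using X by (auto simp: closed_segment_def)
  have "X = Complex (- ln 2) ((1 - u) * a + u * b)" by (simp add: u(3) complex_eq_iff algebra_simps)
  moreover have "(1 - u) * a + u * b <= b" using u ab by (intro convex_bound_le) auto
  moreover have "a <= (1 - u) * a + u * b" using u ab mult_left_mono[of a b u] by (simp add: algebra_simps)
  ultimately show ?thesis by blast
 qed
 have he: "?h = Complex (- ln 2) 0" by (simp add: complex_eq_iff)
 have C1: "circle_integral f g \<eta> = \<Phi> ?e - \<Phi> ?h"
 proof -
  let ?S = "closed_segment ?h ?e"
  have S: "Re X = - ln 2" if "X \<in> ?S" for X using seg[of X 0 "2*pi"] that unfolding he by auto
  have "((%X. f (\<eta> + X) * g (\<eta> + Ln (1 - exp X)) * exp X) has_contour_integral \<Phi> (pathfinish (linepath ?h ?e)) - \<Phi> (pathstart (linepath ?h ?e))) (linepath ?h ?e)"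
  proof (rule contour_integral_primitive[of ?S])
   fix X assume "X \<in> ?S"
   then have "(\<Phi> has_field_derivative kernel f g \<eta> X) (at X)" "log_1m_exp X = Ln (1 - exp X)" using \<Phi> hdom S by auto
   then show "(\<Phi> has_field_derivative f (\<eta> + X) * g (\<eta> + Ln (1 - exp X)) * exp X) (at X within ?S)"
    by (auto simp: kernel_def intro: has_field_derivative_at_within)
  qed auto
  then show ?thesis by (simp add: circle_integral_def contour_integral_unique)
 qed
 \<comment> \<open>The integrand on the circle around 1, in the variable Y = log (1 - exp
   X).\<close>
 define \<psi> where "\<psi> Y = g (\<eta> + Y) * f (\<eta> + Ln (1 - exp Y) + ?T) * exp Y" for Y
 have dLn: "((%Y. Ln (1 - exp Y)) has_field_derivative (- exp Y / (1 - exp Y))) (at Y)" "1 - exp Y ~= 0" if "Y = Complex (- ln 2) t" for Y t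
 proof -
  have n: "norm (exp Y) < 1" using exp_segment(1)[OF that] by linarith
  show "((%Y. Ln (1 - exp Y)) has_field_derivative (- exp Y / (1 - exp Y))) (at Y)"
   using Ln_1_minus[OF n] by (auto intro!: derivative_eq_intros simp: field_simps)
  show "1 - exp Y ~= 0" using Ln_1_minus(3)[OF n] .
 qed
 have bnd: "exp (Re \<eta>) * (1 + exp (Re (Ln (1 - exp Y)))) < exp R" if "Y = Complex (- ln 2) t" for Y t
 proof -
  have "exp (Re (Ln (1 - exp Y))) = norm (1 - exp Y)" using dLn(2)[OF that] by (metis exp_Ln norm_exp_eq_Re)
  also have "\<dots> <= 3/2" using norm_triangle_ineq4[of 1 "exp Y"] exp_segment(1)[OF that] by simp
  finally have "exp (Re \<eta>) * (1 + exp (Re (Ln (1 - exp Y)))) <= exp (Re \<eta>) * (5/2)" by (intro mult_left_mono) auto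
  also have "\<dots> < exp R" using \<eta>(2) ex \<sigma> by linarith
  finally show ?thesis .
 qed
 have half: "exp ?h = 1/2" "exp ?c = -1/2" "exp ?e = 1/2" 
 proof -
  have "exp ?h = of_real (1/2) * cis 0" "exp ?c = of_real (1/2) * cis pi" "exp ?e = of_real (1/2) * cis (2 * pi)"
   unfolding he by (rule exp_segment(2), rule refl)+
  then show "exp ?h = 1/2" "exp ?c = -1/2" "exp ?e = 1/2" by (simp_all only: cis_zero cis_pi cis_2pi) simp_all
 qed
 have Lh: "Ln (1 - exp ?h) = ?h" "Ln (1 - exp ?e) = ?h" "Ln (1 - exp ?c) = of_real (ln (3/2))"
 proof -
  have "Ln (of_real (1/2)) = of_real (ln (1/2))" "Ln (of_real (3/2)) = of_real (ln (3/2))" by (rule Ln_of_real; simp)+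
  then show "Ln (1 - exp ?h) = ?h" "Ln (1 - exp ?e) = ?h" "Ln (1 - exp ?c) = of_real (ln (3/2))"
   unfolding half by (simp_all add: ln_div complex_eq_iff)
 qed
 \<comment> \<open>The lower half of the circle around 1, from 1/2 to 3/2, still on the sheet of
   \<open>\<Phi>\<close>.\<close>
 have B1: "(\<psi> has_contour_integral (\<Phi> ?e - \<Phi> ?Q)) (linepath ?h ?c)"
 proof -
  let ?S = "closed_segment ?h ?c"
  have "(\<psi> has_contour_integral - \<Phi> (?T + Ln (1 - exp (pathfinish (linepath ?h ?c)))) - - \<Phi> (?T + Ln (1 - exp (pathstart (linepath ?h ?c))))) (linepath ?h ?c)"
  proof (rule contour_integral_primitive[of ?S])
   fix Y assume "Y \<in> ?S"
   then obtain t where t: "Y = Complex (- ln 2) t" "0 <= t" "t <= pi" using seg[of Y 0 pi] unfolding he by auto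
   let ?k = "?T + Ln (1 - exp Y)"
   note lm = log_1m_exp_Ln_lower[OF t]
   have kd: "?k \<in> kernel_dom R \<eta>" using lm(2) bnd[OF t(1)] by (simp add: kernel_dom_def)
   have "((%Y. ?T + Ln (1 - exp Y)) has_field_derivative (- exp Y / (1 - exp Y))) (at Y)"
    using DERIV_add[OF DERIV_const[of ?T] dLn(1)[OF t(1)]] by simp
   from DERIV_chain'[where g = \<Phi>, OF this \<Phi>[OF kd]]
   have "((%Y. - \<Phi> (?T + Ln (1 - exp Y))) has_field_derivative - (kernel f g \<eta> ?k * (- exp Y / (1 - exp Y)))) (at Y)"
    by (rule DERIV_minus)
   moreover have "- (kernel f g \<eta> ?k * (- exp Y / (1 - exp Y))) = \<psi> Y"
   proof -
    have "exp ?k = 1 - exp Y" "\<eta> + ?k = \<eta> + Ln (1 - exp Y) + ?T" using dLn(2)[OF t(1)] by (simp_all add: exp_add)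
    then have "kernel f g \<eta> ?k = f (\<eta> + Ln (1 - exp Y) + ?T) * g (\<eta> + Y) * (1 - exp Y)"
     by (simp only: kernel_def lm(1))
    then show ?thesis using dLn(2)[OF t(1)] by (simp add: \<psi>_def)
   qed
   ultimately show "((%Y. - \<Phi> (?T + Ln (1 - exp Y))) has_field_derivative \<psi> Y) (at Y within ?S)"
    by (simp add: has_field_derivative_at_within)
  qed auto
  then show ?thesis by (simp only: pathfinish_linepath pathstart_linepath Lh e2) (simp add: add.commute)
 qed
 \<comment> \<open>The upper half, from 3/2 back to 1/2, on the sheet of \<open>\<Psi>\<close>; the
   two halves meet at \<open>?Q\<close>.\<close>
 have B2: "(\<psi> has_contour_integral (\<Psi> (?Q - ?T) - \<Psi> ?h)) (linepath ?c ?e)"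
 proof -
  let ?S = "closed_segment ?c ?e"
  have "(\<psi> has_contour_integral - \<Psi> (Ln (1 - exp (pathfinish (linepath ?c ?e)))) - - \<Psi> (Ln (1 - exp (pathstart (linepath ?c ?e))))) (linepath ?c ?e)"
  proof (rule contour_integral_primitive[of ?S])
   fix Y assume "Y \<in> ?S"
   then obtain t where t: "Y = Complex (- ln 2) t" "pi <= t" "t <= 2 * pi" using seg[of Y pi "2*pi"] by auto
   let ?k = "Ln (1 - exp Y)"
   note lm = log_1m_exp_Ln_upper[OF t]
   have kd: "?k \<in> kernel_dom R (\<eta> + ?T)" using lm(2) bnd[OF t(1)] by (simp add: kernel_dom_def)
   from DERIV_chain'[where g = \<Psi>, OF dLn(1)[OF t(1)] \<Psi>[OF kd]]
   have "((%Y. - \<Psi> (Ln (1 - exp Y))) has_field_derivative - (kernel f g (\<eta> + ?T) ?k * (- exp Y / (1 - exp Y)))) (at Y)"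
    by (rule DERIV_minus)
   moreover have "- (kernel f g (\<eta> + ?T) ?k * (- exp Y / (1 - exp Y))) = \<psi> Y"
   proof -
    have "exp ?k = 1 - exp Y" "\<eta> + ?T + ?k = \<eta> + Ln (1 - exp Y) + ?T" "\<eta> + ?T + (Y - ?T) = \<eta> + Y"
     using dLn(2)[OF t(1)] by simp_all
    then have "kernel f g (\<eta> + ?T) ?k = f (\<eta> + Ln (1 - exp Y) + ?T) * g (\<eta> + Y) * (1 - exp Y)"
     by (simp only: kernel_def lm(1))
    then show ?thesis using dLn(2)[OF t(1)] by (simp add: \<psi>_def)
   qed
   ultimately show "((%Y. - \<Psi> (Ln (1 - exp Y))) has_field_derivative \<psi> Y) (at Y within ?S)"
    by (simp add: has_field_derivative_at_within)
  qed auto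
  then show ?thesis by (simp only: pathfinish_linepath pathstart_linepath Lh) simp
 qed
 have "circle_integral g (%X. f (X + ?T)) \<eta> = contour_integral (linepath ?h ?e) \<psi>"
  by (simp add: circle_integral_def \<psi>_def[abs_def])
 also have "\<dots> = contour_integral (linepath ?h ?c) \<psi> + contour_integral (linepath ?c ?e) \<psi>"
 proof (rule contour_integral_split_linepath)
  have "Y \<in> kernel_dom R \<eta> \<and> Re (\<eta> + Ln (1 - exp Y) + ?T) < R \<and> 1 - exp Y \<notin> \<real>\<^sub>\<le>\<^sub>0" if Yin: "Y \<in> closed_segment ?h ?e" for Y
  proof -
   obtain t where t: "Y = Complex (- ln 2) t" using seg[of Y 0 "2*pi"] Yin unfolding he by auto
   have n: "norm (exp Y) < 1" using exp_segment(1)[OF t] by linarith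
   have "Y \<in> kernel_dom R \<eta>" using hdom t by simp
   then show ?thesis using kernel_dom_bounds(2)[of Y R \<eta>] hdom(2)[of Y] t Ln_1_minus(1)[OF n] by simp
  qed
  then show "continuous_on (closed_segment ?h ?e) \<psi>"
   unfolding \<psi>_def
   by (intro continuous_intros continuous_on_half_plane_compose[OF f] continuous_on_half_plane_compose[OF g])
    (use kernel_dom_bounds(1) in auto)
  show "?c \<in> closed_segment ?h ?e"
   by (auto simp: closed_segment_def he complex_eq_iff intro!: exI[of _ "1/2"])
 qed
 also have "\<dots> = (\<Phi> ?e - \<Phi> ?Q) + (\<Psi> (?Q - ?T) - \<Psi> ?h)"
  using B1 B2 by (simp add: contour_integral_unique)
 finally have C2: "circle_integral g (%X. f (X + ?T)) \<eta> = (\<Phi> ?e - \<Phi> ?Q) + (\<Psi> (?Q - ?T) - \<Psi> ?h)" .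
 have "half_cell f g \<sigma> (\<eta> + ?T) - half_cell f g \<sigma> \<eta> = exp \<eta> * ((\<Psi> ?h - \<Phi> ?h) + (\<Phi> (?P - \<eta>) - \<Psi> (?P - \<eta> - ?T)))"
  unfolding I1 I2 by (simp add: algebra_simps)
 also have "\<Phi> (?P - \<eta>) - \<Psi> (?P - \<eta> - ?T) = \<Phi> ?Q - \<Psi> (?Q - ?T)" using k[OF PA] k[OF QA] by simp
 finally show ?thesis unfolding C1 C2 by (simp add: algebra_simps)
qed

section \<open>From circle integrals to the segment between the singular points\<close>

lemma norm_Ln_1_minus_le:
 assumes "norm w <= 1/2" shows "norm (Ln (1 - w)) <= 2 * norm w"
proof -
 have "norm (Ln (1 + - w) - (- w)) <= norm (- w) ^ 2 / (1 - norm (- w))"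
  by (rule Ln_approx_linear) (use assms in simp)
 also have "\<dots> <= norm w ^ 2 / (1/2)" using assms by (intro frac_le) auto
 also have "\<dots> = norm w * (2 * norm w)" by (simp add: power2_eq_square)
 also have "\<dots> <= norm w * 1" using assms by (intro mult_left_mono) auto
 finally have "norm (Ln (1 - w) + w) <= norm w" by simp
 then show ?thesis using norm_triangle_ineq4[of "Ln (1 - w) + w" w] by simp
qed

lemma lens_kernel_bound:
 assumes "2 * exp (Re \<eta>) < exp R" "Re X < 0"
 shows "Re (\<eta> + X) < R" "Re (\<eta> + Ln (1 - exp X)) < R"
proof -
 have "exp (Re \<eta>) > 0" by simp
 then have "exp (Re \<eta>) < exp R" using assms(1) by linarith
 then show "Re (\<eta> + X) < R" using assms(2) by simp
 have n: "norm (exp X) < 1" using assms(2) by simp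
 have "exp (Re (\<eta> + Ln (1 - exp X))) = exp (Re \<eta>) * norm (1 - exp X)"
  using Ln_1_minus(3)[OF n] by (metis exp_Ln exp_add norm_exp_eq_Re norm_mult)
 also have "norm (1 - exp X) <= 2" using norm_triangle_ineq4[of 1 "exp X"] n unfolding norm_one by linarith
 then have "exp (Re \<eta>) * norm (1 - exp X) <= exp (Re \<eta>) * 2" by (intro mult_left_mono) auto
 also have "\<dots> < exp R" using assms(1) by simp
 finally show "Re (\<eta> + Ln (1 - exp X)) < R" by simp
qed

text \<open>\<open>A X\<close> is the integral over a full turn starting at \<open>X\<close>. Its
  derivative is the difference of the integrand at the two ends, where only \<open>f\<close> has
  changed because the other factors depend on \<open>exp X\<close>. As \<open>Re X\<close> decreases
  the circle shrinks to its centre, and the decay of \<open>f\<close> makes the integral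
  vanish.\<close>

lemma circle_integral_primitive:
 assumes f: "f holomorphic_on {X. Re X < R}" and k: "k holomorphic_on {X. Re X < R}"
  and \<eta>: "2 * exp (Re \<eta>) < exp R" and dec: "decays f"
 obtains A where
  "!!X. Re X < 0 ==> (A has_field_derivative
   (f (\<eta> + X + 2 * of_real pi * \<i>) - f (\<eta> + X)) * k (\<eta> + Ln (1 - exp X)) * exp X) (at X)"
  "A (- Complex (ln 2) 0) = circle_integral f k \<eta>"
  "!!M eps. eps > 0 ==> \<exists>T. \<forall>X. Re X < T --> \<bar>Im X\<bar> <= M --> norm (A X) < eps"
proof -
 let ?H = "{X::complex. Re X < 0}" let ?T = "2 * of_real pi * \<i> :: complex"
 define w where "w X = f (\<eta> + X) * k (\<eta> + Ln (1 - exp X)) * exp X" for X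
 have hol: "w holomorphic_on ?H"
  unfolding w_def
  by (intro holomorphic_intros holomorphic_on_half_plane_compose[OF f] holomorphic_on_half_plane_compose[OF k] lens_kernel_bound[OF \<eta>])
   (use Ln_1_minus(1) in auto)
 obtain \<Psi> where \<Psi>: "!!X. X \<in> ?H ==> (\<Psi> has_field_derivative w X) (at X)"
  using holomorphic_convex_primitive'[OF convex_halfspace_Re_lt open_half_plane_Re hol]
  by (metis at_within_open open_half_plane_Re)
 define A where "A X = \<Psi> (X + ?T) - \<Psi> X" for X
 have ci: "(w has_contour_integral A X) (linepath X (X + ?T))" if X: "Re X < 0" for X
 proof -
  have "closed_segment X (X + ?T) \<subseteq> ?H"
   by (rule closed_segment_subset) (use X convex_halfspace_Re_lt in auto)
  then have "(w has_contour_integral \<Psi> (pathfinish (linepath X (X + ?T))) - \<Psi> (pathstart (linepath X (X + ?T)))) (linepath X (X + ?T))"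
   by (intro contour_integral_primitive[of ?H]) (use \<Psi> in \<open>auto intro: has_field_derivative_at_within\<close>)
  then show ?thesis by (simp add: A_def)
 qed
 show thesis
 proof (rule that)
  fix X :: complex assume X: "Re X < 0"
  have "((%X. \<Psi> (X + ?T)) has_field_derivative w (X + ?T) * 1) (at X)"
   by (rule DERIV_chain'[where f = "%X. X + ?T" and g = \<Psi>]) (use X \<Psi> in \<open>auto intro!: derivative_eq_intros\<close>)
  then have "(A has_field_derivative w (X + ?T) * 1 - w X) (at X)"
   unfolding A_def using \<Psi> X by (intro DERIV_diff) auto
  moreover have "w (X + ?T) * 1 - w X = (f (\<eta> + X + ?T) - f (\<eta> + X)) * k (\<eta> + Ln (1 - exp X)) * exp X"
   by (simp add: w_def exp_add algebra_simps)
  ultimately show "(A has_field_derivative (f (\<eta> + X + ?T) - f (\<eta> + X)) * k (\<eta> + Ln (1 - exp X)) * exp X) (at X)"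
   by simp
 next
  have e: "- Complex (ln 2) 0 + ?T = Complex (- ln 2) (2 * pi)" by (simp add: complex_eq_iff)
  have "(w has_contour_integral A (- Complex (ln 2) 0)) (linepath (- Complex (ln 2) 0) (- Complex (ln 2) 0 + ?T))"
   by (rule ci) simp
  then show "A (- Complex (ln 2) 0) = circle_integral f k \<eta>"
   unfolding e circle_integral_def using w_def[abs_def] by (simp add: contour_integral_unique)
 next
  fix M eps :: real assume eps: "eps > 0"
  have "exp (Re \<eta>) > 0" by simp
  then have "exp (Re \<eta>) < exp R" using \<eta> by linarith
  then have "Re \<eta> < R" by simp
  then have "isCont k \<eta>"
   using k open_half_plane_Re[of R] by (auto dest!: holomorphic_on_imp_continuous_on simp: continuous_on_eq_continuous_at)
  then obtain \<delta> where \<delta>: "\<delta> > 0" "!!y. dist y \<eta> < \<delta> ==> dist (k y) (k \<eta>) < 1"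
   unfolding continuous_at_eps_delta by (metis zero_less_one)
  define C where "C = norm (k \<eta>) + 1"
  have C: "C > 0" by (simp add: C_def add_nonneg_pos)
  \<comment> \<open>The turn has length 2 pi, so the denominator 8 leaves
    \<open>eps * (pi / 4) < eps\<close>.\<close>
  define eps' where "eps' = eps * norm (exp \<eta>) / (8 * C)"
  have eps': "eps' > 0" using eps C by (simp add: eps'_def)
  obtain T0 where T0: "!!X. Re X < T0 ==> \<bar>Im X\<bar> <= M + \<bar>Im \<eta>\<bar> + 2 * pi ==> norm (f X * exp X) < eps'"
   using dec eps' unfolding decays_def by blast
  define T where "T = min (min 0 (T0 - Re \<eta>)) (ln (min (1/2) (\<delta> / 3)))"
  have "norm (A X) < eps" if X: "Re X < T" "\<bar>Im X\<bar> <= M" for X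
  proof -
   have X': "Re X < 0" "Re (\<eta> + X) < T0" "Re X < ln (min (1/2) (\<delta> / 3))" using X(1) by (auto simp: T_def)
   have "norm (w Y) <= eps' * C / norm (exp \<eta>)" if Y: "Y \<in> closed_segment X (X + ?T)" for Y
   proof -
    obtain u where u: "0 <= u" "u <= 1" "Y = (1 - u) *\<^sub>R X + u *\<^sub>R (X + ?T)" using Y by (auto simp: closed_segment_def)
    have RI: "Re Y = Re X" "Im Y = Im X + u * (2 * pi)" by (auto simp: u(3) algebra_simps)
    have "\<bar>u * (2 * pi)\<bar> <= 2 * pi" using u by (simp add: abs_mult mult_left_le_one_le)
    then have "\<bar>Im (\<eta> + Y)\<bar> <= M + \<bar>Im \<eta>\<bar> + 2 * pi" using X(2) RI(2) by simp
    then have 1: "norm (f (\<eta> + Y) * exp (\<eta> + Y)) < eps'" using T0[of "\<eta> + Y"] X'(2) RI(1) by simp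
    have "exp (Re Y) < min (1/2) (\<delta> / 3)" unfolding RI using X'(3) \<delta>(1)
     by (metis exp_less_mono exp_ln half_gt_zero_iff min_less_iff_conj zero_less_divide_iff zero_less_numeral zero_less_one)
    then have s: "norm (exp Y) <= 1/2" "norm (exp Y) < \<delta> / 3" by auto
    then have "norm (Ln (1 - exp Y)) < \<delta>" using norm_Ln_1_minus_le[OF s(1)] \<delta>(1) by linarith
    then have "dist (k (\<eta> + Ln (1 - exp Y))) (k \<eta>) < 1" by (intro \<delta>(2)) (simp add: dist_norm)
    then have 2: "norm (k (\<eta> + Ln (1 - exp Y))) <= C"
     using norm_triangle_ineq2[of "k (\<eta> + Ln (1 - exp Y))" "k \<eta>"] by (simp add: dist_norm C_def)
    have "norm (w Y) = norm (f (\<eta> + Y) * exp (\<eta> + Y)) * norm (k (\<eta> + Ln (1 - exp Y))) / norm (exp \<eta>)"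
     by (simp add: w_def norm_mult exp_add)
    also have "\<dots> <= eps' * C / norm (exp \<eta>)"
     using 1 2 C eps' by (intro divide_right_mono mult_mono) auto
    finally show ?thesis .
   qed
   then have "norm (A X) <= eps' * C / norm (exp \<eta>) * norm (X + ?T - X)"
    by (intro has_contour_integral_bound_linepath[OF ci[OF X'(1)]]) (use eps' C in auto)
   also have "\<dots> = eps * (pi / 4)" using C by (simp add: eps'_def norm_mult)
   also have "\<dots> < eps" using eps pi_less_4 by simp
   finally show ?thesis .
  qed
  then show "\<exists>T. \<forall>X. Re X < T --> \<bar>Im X\<bar> <= M --> norm (A X) < eps" by blast
 qed
qed

text \<open>The open square with diagonal [0, 1]. On it \<xi> and 1 - \<xi> have modulus below 1 and
  argument below pi / 4, so principal logarithms can be used at both corners.\<close>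

definition lens :: "complex set" where
 "lens = {\<xi>. \<bar>Im \<xi>\<bar> < Re \<xi> \<and> \<bar>Im \<xi>\<bar> < 1 - Re \<xi>}"

text \<open>The straight segment from \<alpha> to z / \<beta> becomes curved in the logarithmic
  coordinate, so cells are described along arbitrary curves of this kind. Derivatives are taken in
  the open interval, as the integrand may be unbounded at the ends.\<close>

definition lens_curve :: "(real => complex) => (real => complex) => bool" where
 "lens_curve \<xi> \<xi>' \<longleftrightarrow> continuous_on {0..1} \<xi> \<and> \<xi> 0 = 0 \<and> \<xi> 1 = 1 \<and>
  (\<forall>s\<in>{0<..<1}. \<xi> s \<in> lens \<and> (\<xi> has_vector_derivative \<xi>' s) (at s))"

lemma lens_props:
 assumes "\<xi> \<in> lens"
 shows "\<xi> \<notin> \<real>\<^sub>\<le>\<^sub>0" "1 - \<xi> \<notin> \<real>\<^sub>\<le>\<^sub>0" "norm \<xi> < 1" "norm (1 - \<xi>) < 1" "\<xi> ~= 0" "\<xi> ~= 1"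
  "Re (Ln \<xi>) < 0" "Re (Ln (1 - \<xi>)) < 0" "1 - \<xi> \<in> lens"
proof -
 have L: "\<bar>Im \<xi>\<bar> < Re \<xi>" "\<bar>Im \<xi>\<bar> < 1 - Re \<xi>" using assms by (auto simp: lens_def)
 show "\<xi> \<notin> \<real>\<^sub>\<le>\<^sub>0" "1 - \<xi> \<notin> \<real>\<^sub>\<le>\<^sub>0" using L by (auto simp: complex_nonpos_Reals_iff)
 show nz: "\<xi> ~= 0" "\<xi> ~= 1" using L by auto
 have aux: "norm z < 1" if "\<bar>Im z\<bar> < Re z" "\<bar>Im z\<bar> < 1 - Re z" for z
 proof -
  have "\<bar>Im z\<bar> * \<bar>Im z\<bar> <= Re z * (1 - Re z)" using that by (intro mult_mono) auto
  then have "(Im z)\<^sup>2 <= Re z - (Re z)\<^sup>2" by (simp add: power2_eq_square algebra_simps)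
  then have "(norm z)\<^sup>2 < 1" using that unfolding cmod_power2 by linarith
  then show ?thesis by (simp add: power2_less_1_iff abs_square_less_1)
 qed
 show n: "norm \<xi> < 1" by (rule aux[OF L])
 show n': "norm (1 - \<xi>) < 1" by (rule aux) (use L in auto)
 show "Re (Ln \<xi>) < 0" using n nz by simp
 show "Re (Ln (1 - \<xi>)) < 0" using n' nz by simp
 show "1 - \<xi> \<in> lens" using L by (simp add: lens_def)
qed

lemma lens_open_convex: "open lens" "convex lens"
proof -
 have e: "lens = {\<xi>. Im \<xi> - Re \<xi> < 0} \<inter> {\<xi>. - Im \<xi> - Re \<xi> < 0} \<inter> {\<xi>. Im \<xi> + Re \<xi> < 1} \<inter> {\<xi>. - Im \<xi> + Re \<xi> < 1}"
  by (auto simp: lens_def abs_less_iff)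
 show "open lens" unfolding e by (intro open_Int open_Collect_less continuous_intros)
 have a: "convex {\<xi>. a * Im \<xi> + b * Re \<xi> < c}" for a b c :: real
 proof -
  have "{\<xi>. a * Im \<xi> + b * Re \<xi> < c} = {\<xi>. inner (Complex b a) \<xi> < c}" by (auto simp: inner_complex_def algebra_simps)
  then show ?thesis by (simp add: convex_halfspace_lt)
 qed
 show "convex lens"
  unfolding e using a[of 1 "-1" 0] a[of "-1" "-1" 0] a[of 1 1 1] a[of "-1" 1 1]
  by (intro convex_Int) auto
qed

text \<open>\<open>A (Ln z)\<close> and \<open>- B (Ln (1 - z))\<close> are primitives of the same
  integrand on the lens. Their difference is constant and is evaluated at 1/2, where the circles
  around 0 and 1 touch. Since \<open>A\<close> tends to 0 at one corner and \<open>B\<close> at the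
  other, the total increment of the primitive is the sum of the two circle integrals.\<close>

lemma lens_integral:
 assumes f: "f holomorphic_on {X. Re X < R}" and g: "g holomorphic_on {X. Re X < R}"
  and \<eta>: "2 * exp (Re \<eta>) < exp R" and dec: "decays f" "decays g" and \<xi>: "lens_curve \<xi> \<xi>'"
 defines "\<Delta>f \<equiv> %X. f (X + 2 * of_real pi * \<i>) - f X" and "\<Delta>g \<equiv> %X. g (X + 2 * of_real pi * \<i>) - g X"
 shows "((%s. \<Delta>f (\<eta> + Ln (\<xi> s)) * \<Delta>g (\<eta> + Ln (1 - \<xi> s)) * \<xi>' s) has_integral
  (circle_integral f \<Delta>g \<eta> + circle_integral g \<Delta>f \<eta>)) {0..1}"
proof -
 have hf: "\<Delta>f holomorphic_on {X. Re X < R}" unfolding \<Delta>f_def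
  by (intro holomorphic_intros holomorphic_on_half_plane_compose[OF f] f) auto
 have hg: "\<Delta>g holomorphic_on {X. Re X < R}" unfolding \<Delta>g_def
  by (intro holomorphic_intros holomorphic_on_half_plane_compose[OF g] g) auto
 obtain A where A: "!!X. Re X < 0 ==> (A has_field_derivative \<Delta>f (\<eta> + X) * \<Delta>g (\<eta> + Ln (1 - exp X)) * exp X) (at X)"
  "A (- Complex (ln 2) 0) = circle_integral f \<Delta>g \<eta>"
  "!!M eps. eps > 0 ==> \<exists>T. \<forall>X. Re X < T --> \<bar>Im X\<bar> <= M --> norm (A X) < eps"
  using circle_integral_primitive[OF f hg \<eta> dec(1)] unfolding \<Delta>f_def by metis
 obtain B where B: "!!X. Re X < 0 ==> (B has_field_derivative \<Delta>g (\<eta> + X) * \<Delta>f (\<eta> + Ln (1 - exp X)) * exp X) (at X)"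
  "B (- Complex (ln 2) 0) = circle_integral g \<Delta>f \<eta>"
  "!!M eps. eps > 0 ==> \<exists>T. \<forall>X. Re X < T --> \<bar>Im X\<bar> <= M --> norm (B X) < eps"
  using circle_integral_primitive[OF g hf \<eta> dec(2)] unfolding \<Delta>g_def by metis
 define V where "V = circle_integral f \<Delta>g \<eta> + circle_integral g \<Delta>f \<eta>"
 define \<Theta> where "\<Theta> z = \<Delta>f (\<eta> + Ln z) * \<Delta>g (\<eta> + Ln (1 - z))" for z
 have dA: "((%z. A (Ln z)) has_field_derivative \<Theta> z) (at z)" if z: "z \<in> lens" for z
 proof -
  note L = lens_props[OF z]
  have "(Ln has_field_derivative inverse z) (at z)" by (rule has_field_derivative_Ln) (use L in auto)
  from DERIV_chain'[where g = A, OF this A(1)[OF L(7)]] show ?thesis using L by (simp add: \<Theta>_def mult.assoc)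
 qed
 have dB: "((%z. B (Ln (1 - z))) has_field_derivative - \<Theta> z) (at z)" if z: "z \<in> lens" for z
 proof -
  note L = lens_props[OF z]
  have "((%z. Ln (1 - z)) has_field_derivative - inverse (1 - z)) (at z)"
   using L by (auto intro!: derivative_eq_intros)
  from DERIV_chain'[where g = B, OF this B(1)[OF L(8)]]
  have "((%z. B (Ln (1 - z))) has_field_derivative
   \<Delta>g (\<eta> + Ln (1 - z)) * \<Delta>f (\<eta> + Ln (1 - exp (Ln (1 - z)))) * exp (Ln (1 - z)) * - inverse (1 - z)) (at z)" .
  moreover have "\<Delta>g (\<eta> + Ln (1 - z)) * \<Delta>f (\<eta> + Ln (1 - exp (Ln (1 - z)))) * exp (Ln (1 - z)) * - inverse (1 - z) = - \<Theta> z"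
   using L by (simp add: \<Theta>_def field_simps)
  ultimately show ?thesis by simp
 qed
 have half: "1/2 \<in> lens" by (simp add: lens_def)
 have "\<exists>k. \<forall>z\<in>lens. A (Ln z) + B (Ln (1 - z)) = k"
 proof (rule has_field_derivative_zero_constant[OF lens_open_convex(2)])
  fix z assume z: "z \<in> lens"
  from DERIV_add[OF dA[OF z] dB[OF z]]
  show "((%z. A (Ln z) + B (Ln (1 - z))) has_field_derivative 0) (at z within lens)"
   by (simp add: has_field_derivative_at_within)
 qed
 moreover have "A (Ln (1/2)) + B (Ln (1 - 1/2)) = V"
 proof -
  have "Ln (of_real (1/2)) = of_real (ln (1/2))" by (rule Ln_of_real) simp
  then have "Ln (1/2) = - Complex (ln 2) 0" by (simp add: ln_div complex_eq_iff)
  then show ?thesis by (simp add: A(2) B(2) V_def)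
 qed
 ultimately have V: "A (Ln z) + B (Ln (1 - z)) = V" if "z \<in> lens" for z using half that by metis
 have c: "continuous_on {0..1} \<xi>" "\<xi> 0 = 0" "\<xi> 1 = 1"
  and in_lens: "!!s. 0 < s ==> s < 1 ==> \<xi> s \<in> lens"
  and d\<xi>: "!!s. 0 < s ==> s < 1 ==> (\<xi> has_vector_derivative \<xi>' s) (at s)"
  using \<xi> by (auto simp: lens_curve_def)
 \<comment> \<open>The primitive with its limits at the ends: 0 by the decay of \<open>A\<close>,
   and \<open>V\<close> because \<open>A\<close> is \<open>V\<close> minus the decaying
   \<open>B\<close>.\<close>
 define G where "G s = (if s <= 0 then 0 else if s \<ge> 1 then V else A (Ln (\<xi> s)))" for s :: real
 have dG: "(G has_vector_derivative \<Theta> (\<xi> s) * \<xi>' s) (at s)" if s: "0 < s" "s < 1" for s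
 proof (rule has_vector_derivative_transform_within_open[of "%s. A (Ln (\<xi> s))" _ _ "{0<..<1}"])
  from field_vector_diff_chain_at[OF d\<xi>[OF s] dA[OF in_lens[OF s]]]
  show "((%s. A (Ln (\<xi> s))) has_vector_derivative \<Theta> (\<xi> s) * \<xi>' s) (at s)"
   by (simp add: o_def mult.commute)
 qed (use s in \<open>auto simp: G_def\<close>)
 have small: "\<forall>\<^sub>F s in at s0 within {0..1}. 0 < s \<and> s < 1 --> norm (C (Ln (h s))) < eps"
  if C: "!!M eps. eps > 0 ==> \<exists>T. \<forall>X. Re X < T --> \<bar>Im X\<bar> <= M --> norm (C X) < eps" and eps: "eps > (0::real)"
   and h: "continuous_on {0..1} h" "h s0 = 0" "s0 \<in> {0..1}" "!!s. 0 < s ==> s < 1 ==> h s ~= 0" for C :: "complex => complex" and eps h s0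
 proof -
  obtain T where T: "!!X. Re X < T ==> \<bar>Im X\<bar> <= pi ==> norm (C X) < eps" using C[OF eps, of pi] by blast
  have "(h \<longlongrightarrow> 0) (at s0 within {0..1})" using h(1,2,3) unfolding continuous_on by metis
  then have "\<forall>\<^sub>F s in at s0 within {0..1}. dist (h s) 0 < exp T" by (rule tendstoD) simp
  then show ?thesis
  proof eventually_elim
   case (elim s)
   show ?case
   proof
    assume s: "0 < s \<and> s < 1"
    have nz: "h s ~= 0" using h(4) s by blast
    have "ln (norm (h s)) < ln (exp T)" using elim nz by (subst ln_less_cancel_iff) auto
    then have "Re (Ln (h s)) < T" using nz by simp
    moreover have "\<bar>Im (Ln (h s))\<bar> <= pi" using mpi_less_Im_Ln[OF nz] Im_Ln_le_pi[OF nz] by linarith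
    ultimately show "norm (C (Ln (h s))) < eps" by (rule T)
   qed
  qed
 qed
 have cG: "continuous_on {0..1} G"
  unfolding continuous_on_def
 proof
  fix s :: real assume s: "s \<in> {0..1}"
  consider "s = 0" | "s = 1" | "0 < s" "s < 1" using s by fastforce
  then show "(G \<longlongrightarrow> G s) (at s within {0..1})"
  proof cases
   case 1
   show ?thesis
   proof (rule tendstoI)
    fix e :: real assume e: "e > 0"
    have "\<forall>\<^sub>F s in at 0 within {0..1}. 0 < s \<and> s < 1 --> norm (A (Ln (\<xi> s))) < e"
     by (rule small[OF A(3) e c(1,2)]) (use in_lens lens_props(5) in auto)
    moreover have "\<forall>\<^sub>F s in at 0 within {0..1}. 0 < s \<and> s < (1::real)"
     by (auto simp: eventually_at dist_real_def intro!: exI[of _ 1])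
    ultimately show "\<forall>\<^sub>F x in at s within {0..1}. dist (G x) (G s) < e"
     unfolding 1 by eventually_elim (auto simp: G_def)
   qed
  next
   case 2
   show ?thesis
   proof (rule tendstoI)
    fix e :: real assume e: "e > 0"
    have "\<forall>\<^sub>F s in at 1 within {0..1}. 0 < s \<and> s < 1 --> norm (B (Ln (1 - \<xi> s))) < e"
     by (rule small[OF B(3) e]) (use in_lens lens_props(6) c in \<open>auto intro!: continuous_intros\<close>)
    moreover have "\<forall>\<^sub>F s in at 1 within {0..1}. 0 < s \<and> s < (1::real)"
     by (auto simp: eventually_at dist_real_def intro!: exI[of _ 1])
    ultimately show "\<forall>\<^sub>F x in at s within {0..1}. dist (G x) (G s) < e"
     unfolding 2
    proof eventually_elim
     case (elim x)
     then have "G x - G 1 = - B (Ln (1 - \<xi> x))" using V[OF in_lens[of x]] by (simp add: G_def algebra_simps)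
     then show ?case using elim by (simp add: dist_norm)
    qed
   qed
  next
   case 3
   have "isCont G s" using has_vector_derivative_continuous[OF dG[OF 3]] .
   then show ?thesis unfolding isCont_def using tendsto_within_subset by blast
  qed
 qed
 have "((%s. \<Theta> (\<xi> s) * \<xi>' s) has_integral (G 1 - G 0)) {0..1}"
  by (rule fundamental_theorem_of_calculus_interior[OF _ cG]) (use dG in auto)
 then show ?thesis by (simp add: G_def \<Theta>_def V_def)
qed

text \<open>The variable is \<eta> = log log (z / \<gamma>). Existence of the integral is included,
  in the form \<open>has_integral\<close>, because integrability of the final integrand is part of
  the result.\<close>

definition cell_monodromy :: "(complex => complex) => (complex => complex) => real => (complex => complex) => bool" where
 "cell_monodromy f g r L \<longleftrightarrow> L holomorphic_on {X. Re X < r} \<and>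
  (\<forall>\<eta> \<xi> \<xi>'. Re \<eta> < r --> lens_curve \<xi> \<xi>' -->
   (\<exists>V. ((%s. (f (\<eta> + Ln (\<xi> s) + 2 * of_real pi * \<i>) - f (\<eta> + Ln (\<xi> s))) *
      (g (\<eta> + Ln (1 - \<xi> s) + 2 * of_real pi * \<i>) - g (\<eta> + Ln (1 - \<xi> s))) * \<xi>' s) has_integral V) {0..1} \<and>
      L (\<eta> + 2 * of_real pi * \<i>) - L \<eta> = - exp \<eta> * V))"

lemma cell_monodromy_mono: "cell_monodromy f g r L ==> r' <= r ==> cell_monodromy f g r' L"
 unfolding cell_monodromy_def by (fastforce intro: holomorphic_on_subset)

lemma circle_integrand_continuous:
 assumes f: "f holomorphic_on {X. Re X < R}" and g: "g holomorphic_on {X. Re X < R}" and \<eta>: "2 * exp (Re \<eta>) < exp R"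
 shows "(%X. f (\<eta> + X) * g (\<eta> + Ln (1 - exp X)) * exp X) contour_integrable_on linepath (- Complex (ln 2) 0) (Complex (- ln 2) (2 * pi))"
proof (rule contour_integrable_continuous_linepath)
 have "closed_segment (- Complex (ln 2) 0) (Complex (- ln 2) (2 * pi)) \<subseteq> {X. Re X < 0}"
  by (rule closed_segment_subset) (use convex_halfspace_Re_lt in auto)
 then show "continuous_on (closed_segment (- Complex (ln 2) 0) (Complex (- ln 2) (2 * pi)))
   (%X. f (\<eta> + X) * g (\<eta> + Ln (1 - exp X)) * exp X)"
  by (intro continuous_intros continuous_on_half_plane_compose[OF f] continuous_on_half_plane_compose[OF g] lens_kernel_bound[OF \<eta>])
   (use Ln_1_minus(1) in auto)
qed

text \<open>Each half contributes two circle integrals. \<open>circle_integral f g\<close> from the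
  first half meets the negative of the one with translated \<open>g\<close> from the second half,
  and they combine to an integral of \<open>f\<close> against \<open>\<Delta>g\<close>; the other
  two combine likewise with the roles exchanged.\<close>

lemma half_cells_monodromy:
 assumes f: "f holomorphic_on {X. Re X < R}" and g: "g holomorphic_on {X. Re X < R}"
  and dec: "decays f" "decays g" and \<sigma>: "\<sigma> > 0" and r: "exp r <= \<sigma>" "3 * exp r + \<sigma> <= exp R"
 shows "cell_monodromy f g r (%\<eta>. half_cell f g \<sigma> \<eta> + half_cell g f \<sigma> \<eta>)"
 unfolding cell_monodromy_def
proof (intro conjI allI impI)
 show "(%\<eta>. half_cell f g \<sigma> \<eta> + half_cell g f \<sigma> \<eta>) holomorphic_on {X. Re X < r}"
  by (intro holomorphic_intros half_cell_holomorphic[OF f g \<sigma> r] half_cell_holomorphic[OF g f \<sigma> r])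
next
 let ?T = "2 * of_real pi * \<i> :: complex"
 fix \<eta> :: complex and \<xi> \<xi>' assume \<eta>r: "Re \<eta> < r" and \<xi>: "lens_curve \<xi> \<xi>'"
 have "exp (Re \<eta>) < exp r" using \<eta>r by simp
 then have \<eta>: "exp (Re \<eta>) < \<sigma>" "3 * exp (Re \<eta>) + \<sigma> < exp R" using r by linarith+
 have "exp (Re \<eta>) > 0" by simp
 then have \<eta>2: "2 * exp (Re \<eta>) < exp R" using \<eta>(2) \<sigma> by linarith
 define \<Delta>f where "\<Delta>f = (%X. f (X + ?T) - f X)"
 define \<Delta>g where "\<Delta>g = (%X. g (X + ?T) - g X)"
 have sf: "(%X. f (X + ?T)) holomorphic_on {X. Re X < R}" and sg: "(%X. g (X + ?T)) holomorphic_on {X. Re X < R}"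
  by (rule holomorphic_on_half_plane_compose[OF f] holomorphic_on_half_plane_compose[OF g], auto intro!: holomorphic_intros)+
 define V where "V = circle_integral f \<Delta>g \<eta> + circle_integral g \<Delta>f \<eta>"
 have "circle_integral f \<Delta>g \<eta> = circle_integral f (%X. g (X + ?T)) \<eta> - circle_integral f g \<eta>"
  using contour_integral_diff[OF circle_integrand_continuous[OF f sg \<eta>2] circle_integrand_continuous[OF f g \<eta>2]]
  by (simp add: circle_integral_def \<Delta>g_def algebra_simps)
 moreover have "circle_integral g \<Delta>f \<eta> = circle_integral g (%X. f (X + ?T)) \<eta> - circle_integral g f \<eta>"
  using contour_integral_diff[OF circle_integrand_continuous[OF g sf \<eta>2] circle_integrand_continuous[OF g f \<eta>2]]
  by (simp add: circle_integral_def \<Delta>f_def algebra_simps)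
 moreover have "half_cell f g \<sigma> (\<eta> + ?T) + half_cell g f \<sigma> (\<eta> + ?T) - (half_cell f g \<sigma> \<eta> + half_cell g f \<sigma> \<eta>) =
   (half_cell f g \<sigma> (\<eta> + ?T) - half_cell f g \<sigma> \<eta>) + (half_cell g f \<sigma> (\<eta> + ?T) - half_cell g f \<sigma> \<eta>)" by simp
 ultimately have "half_cell f g \<sigma> (\<eta> + ?T) + half_cell g f \<sigma> (\<eta> + ?T) - (half_cell f g \<sigma> \<eta> + half_cell g f \<sigma> \<eta>) = - exp \<eta> * V"
  unfolding V_def half_cell_monodromy[OF f g \<sigma> \<eta>] half_cell_monodromy[OF g f \<sigma> \<eta>]
  by (simp only:) (simp add: distrib_left right_diff_distrib)
 moreover have "((%s. \<Delta>f (\<eta> + Ln (\<xi> s)) * \<Delta>g (\<eta> + Ln (1 - \<xi> s)) * \<xi>' s) has_integral V) {0..1}"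
  unfolding V_def \<Delta>f_def \<Delta>g_def by (rule lens_integral[OF f g \<eta>2 dec \<xi>])
 ultimately show "\<exists>V. ((%s. (f (\<eta> + Ln (\<xi> s) + ?T) - f (\<eta> + Ln (\<xi> s))) *
      (g (\<eta> + Ln (1 - \<xi> s) + ?T) - g (\<eta> + Ln (1 - \<xi> s))) * \<xi>' s) has_integral V) {0..1} \<and>
      half_cell f g \<sigma> (\<eta> + ?T) + half_cell g f \<sigma> (\<eta> + ?T) - (half_cell f g \<sigma> \<eta> + half_cell g f \<sigma> \<eta>) = - exp \<eta> * V"
  by (intro exI[of _ V]) (simp add: \<Delta>f_def \<Delta>g_def)
qed

section \<open>A run of the contour between two pinching singularities\<close>

text \<open>The vertical pieces attach the run to fixed real endpoints: neighbouring runs of equal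
  height add up, their inner verticals cancelling, and runs of different heights can be compared by
  Cauchy's theorem.\<close>

definition run :: "complex => complex => real => (complex => complex) => complex" where
 "run p q h K = contour_integral (linepath p (p + \<i> * of_real h)) K +
  contour_integral (linepath (p + \<i> * of_real h) (q + \<i> * of_real h)) K +
  contour_integral (linepath (q + \<i> * of_real h) q) K"

text \<open>The points between the horizontals through 0 and om and to the left of the line from 0
  to om, together with the midpoint. There the logarithms that the kernel computes from
  \<open>Ln om\<close> and \<open>Ln (y / om)\<close> are the principal ones of y and om -
  y.\<close>

definition pinch_dom :: "real => complex => complex set" where
 "pinch_dom R om = {y. 0 <= Im y \<and> 0 <= Im (om - y) \<and> (0 < Im (y / om) \<or> y = om / 2) \<and> norm om + norm y < exp R}"

lemma pinch_dom:
 assumes om: "Im om > 0" and y: "y \<in> pinch_dom R om"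
 shows "Ln om + Ln (y / om) = Ln y" "Ln om + log_1m_exp (Ln (y / om)) = Ln (om - y)"
  "Ln (y / om) \<in> kernel_dom R (Ln om)" "y / om \<notin> \<real>\<^sub>\<le>\<^sub>0" "y ~= 0"
proof -
 have Y: "0 <= Im y" "0 <= Im (om - y)" "0 < Im (y / om) \<or> y = om / 2" "norm om + norm y < exp R"
  using y by (auto simp: pinch_dom_def)
 have om0: "om ~= 0" using om by auto
 show y0: "y ~= 0" using Y(3) om0 by auto
 have yom: "y ~= om" using Y(3) om0 by auto
 show np: "y / om \<notin> \<real>\<^sub>\<le>\<^sub>0" using Y(3) om0 by (auto simp: complex_nonpos_Reals_iff)
 let ?X = "Ln (y / om)"
 have ImX: "0 < Im ?X \<and> Im ?X < pi \<or> ?X = of_real (ln (1/2))"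
 proof (cases "0 < Im (y / om)")
  case True
  then show ?thesis using Im_Ln_pos_lt[of "y / om"] y0 om0 by auto
 next
  case False
  then have "y / om = of_real (1/2)" using Y(3) om0 by auto
  then have "?X = of_real (ln (1/2))" by (simp only: Ln_of_real)
  then show ?thesis by blast
 qed
 then have "0 <= Im ?X \<and> Im ?X < pi" by (elim disjE) simp_all
 then have ImX': "0 <= Im ?X" "Im ?X < pi" by blast+
 have Imom: "0 < Im (Ln om)" "Im (Ln om) < pi" using Im_Ln_pos_lt[OF om0] om by blast+
 have eqI: "a = b" if "exp a = exp b" "\<bar>Im a - Im b\<bar> < 2 * pi" for a b :: complex
  by (rule exp_complex_eqI) (use that in auto)
 show 1: "Ln om + ?X = Ln y"
 proof (rule eqI)
  show "exp (Ln om + ?X) = exp (Ln y)" using y0 om0 by (simp add: exp_add)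
  have "0 <= Im (Ln y)" "Im (Ln y) <= pi" using Im_Ln_pos_le[OF y0] Y(1) by blast+
  then show "\<bar>Im (Ln om + ?X) - Im (Ln y)\<bar> < 2 * pi" using Imom ImX' by (simp add: abs_less_iff)
 qed
 have w: "?X \<in> window" using ImX by (elim disjE) (simp_all add: window_def ln_div)
 have l: "log_1m_exp ?X = Ln (1 - y / om)"
 proof -
  have e: "exp ?X = y / om" using y0 om0 by simp
  from ImX show ?thesis
  proof
   assume "0 < Im ?X \<and> Im ?X < pi"
   then show ?thesis using log_1m_exp_window[of ?X] by (simp add: e)
  next
   assume "?X = of_real (ln (1/2))"
   then have "Re ?X < 0" by (simp add: ln_div)
   then show ?thesis by (simp add: log_1m_exp_def e)
  qed
 qed
 show "Ln om + log_1m_exp ?X = Ln (om - y)"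
  unfolding l
 proof (rule eqI)
  have n0: "1 - y / om ~= 0" using yom om0 by (simp add: field_simps)
  show "exp (Ln om + Ln (1 - y / om)) = exp (Ln (om - y))" using n0 yom om0 by (simp add: exp_add field_simps)
  have "0 <= Im (Ln (om - y))" "Im (Ln (om - y)) <= pi" using Im_Ln_pos_le[of "om - y"] yom Y(2) by (simp_all only: right_minus_eq not_False_eq_True) blast+
  moreover have "Im (Ln (1 - y / om)) <= 0"
  proof (cases "0 < Im (y / om)")
   case True
   then show ?thesis using Im_Ln_neg[of "1 - y / om"] by simp
  next
   case False
   then have "1 - y / om = of_real (1/2)" using Y(3) om0 by auto
   then have "Ln (1 - y / om) = of_real (ln (1/2))" by (simp only: Ln_of_real)
   then show ?thesis by simp
  qed
  moreover have "- pi < Im (Ln (1 - y / om))" using mpi_less_Im_Ln[OF n0] .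
  ultimately show "\<bar>Im (Ln om + Ln (1 - y / om)) - Im (Ln (om - y))\<bar> < 2 * pi" using Imom by (simp add: abs_less_iff)
 qed
 have "exp (Re (Ln om)) * (1 + exp (Re ?X)) = norm om * (1 + norm (y / om))"
  using y0 om0 by simp
 also have "\<dots> = norm om + norm y" using om0 by (simp add: norm_divide field_simps)
 finally show "?X \<in> kernel_dom R (Ln om)" using w Y(4) by (simp add: kernel_dom_def)
qed

lemma pinch_primitive:
 assumes om: "Im om > 0" and y: "y \<in> pinch_dom R om"
  and \<Phi>: "!!X. X \<in> kernel_dom R (Ln om) ==> (\<Phi> has_field_derivative kernel f g (Ln om) X) (at X)"
 shows "((%y. om * \<Phi> (Ln (y / om))) has_field_derivative f (Ln y) * g (Ln (om - y))) (at y)"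
proof -
 note P = pinch_dom[OF om y]
 have om0: "om ~= 0" using om by auto
 have "((%y. Ln (y / om)) has_field_derivative inverse y) (at y)"
  using P(4,5) om0 by (auto intro!: derivative_eq_intros simp: field_simps)
 from DERIV_cmult[OF DERIV_chain'[where g = \<Phi>, OF this \<Phi>[OF P(3)]], of om]
 have "((%y. om * \<Phi> (Ln (y / om))) has_field_derivative om * (kernel f g (Ln om) (Ln (y / om)) * inverse y)) (at y)" .
 moreover have "om * (kernel f g (Ln om) (Ln (y / om)) * inverse y) = f (Ln y) * g (Ln (om - y))"
  using P(5) om0 by (simp add: kernel_def P(1,2))
 ultimately show ?thesis by simp
qed

lemma pinch_contour_integral:
 assumes om: "Im om > 0" and ab: "closed_segment a b \<subseteq> pinch_dom R om"
  and \<Phi>: "!!X. X \<in> kernel_dom R (Ln om) ==> (\<Phi> has_field_derivative kernel f g (Ln om) X) (at X)"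
 shows "contour_integral (linepath a b) (%y. f (Ln y) * g (Ln (om - y))) = om * \<Phi> (Ln (b / om)) - om * \<Phi> (Ln (a / om))"
proof (rule contour_integral_unique)
 have "((%y. f (Ln y) * g (Ln (om - y))) has_contour_integral
   om * \<Phi> (Ln (pathfinish (linepath a b) / om)) - om * \<Phi> (Ln (pathstart (linepath a b) / om))) (linepath a b)"
  by (rule contour_integral_primitive[of "pinch_dom R om"])
   (use pinch_primitive[OF om _ \<Phi>] ab in \<open>auto intro: has_field_derivative_at_within\<close>)
 then show "((%y. f (Ln y) * g (Ln (om - y))) has_contour_integral om * \<Phi> (Ln (b / om)) - om * \<Phi> (Ln (a / om))) (linepath a b)"
  by simp
qed

text \<open>The segments of the first half of a run, those of the second half reflected in om / 2,
  and the connecting piece from om - \<sigma> to - \<sigma> by which the reflected half is given the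
  starting point of a half cell.\<close>

lemma pinch_segments:
 assumes om: "Im om > 0" "norm om < \<sigma>" "\<sigma> + 3 * norm om < exp R"
 defines "h \<equiv> \<i> * of_real (Im om / 2)"
 shows "closed_segment (- of_real \<sigma>) (- of_real \<sigma> + h) \<subseteq> pinch_dom R om"
  "closed_segment (- of_real \<sigma> + h) (om / 2) \<subseteq> pinch_dom R om"
  "closed_segment (om - of_real \<sigma>) (om - of_real \<sigma> - h) \<subseteq> pinch_dom R om"
  "closed_segment (om - of_real \<sigma> - h) (om / 2) \<subseteq> pinch_dom R om"
  "closed_segment (om - of_real \<sigma>) (- of_real \<sigma>) \<subseteq> pinch_dom R om"
proof -
 have om0: "om ~= 0" using om by auto
 have Rom: "\<bar>Re om\<bar> < \<sigma>" "\<bar>Im om\<bar> <= norm om" using om(2) abs_Re_le_cmod[of om] abs_Im_le_cmod[of om] by auto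
 have \<sigma>: "\<sigma> > 0" using Rom by linarith
 have inI: "y \<in> pinch_dom R om" if "0 <= Im y" "Im y <= Im om" "0 < Im y * Re om - Re y * Im om \<or> y = om / 2"
  "norm y <= \<sigma> + 2 * norm om" for y
 proof -
  have "Im (y / om) = (Im y * Re om - Re y * Im om) / (norm om)\<^sup>2" by (simp add: Im_divide cmod_power2)
  moreover have "(norm om)\<^sup>2 > 0" using om0 by simp
  ultimately have "0 < Im (y / om) \<longleftrightarrow> 0 < Im y * Re om - Re y * Im om" by (simp add: zero_less_divide_iff)
  then show ?thesis using that om(3) by (auto simp: pinch_dom_def)
 qed
 have pos: "t * (Im om / 2) * Re om + \<sigma> * Im om > 0" "\<sigma> * Im om - t * (Im om / 2) * Re om > 0" if t: "0 <= t" "t <= 1" for t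
 proof -
  have "\<bar>t * (Im om / 2) * Re om\<bar> = (t * \<bar>Re om\<bar>) * (Im om / 2)" using t om(1) by (simp add: abs_mult)
  also have "\<dots> <= \<bar>Re om\<bar> * (Im om / 2)" using t om(1) by (intro mult_right_mono) (auto simp: mult_left_le_one_le)
  also have "\<dots> < \<sigma> * Im om" using Rom om(1) \<sigma> by (intro mult_strict_mono) auto
  finally show "t * (Im om / 2) * Re om + \<sigma> * Im om > 0" "\<sigma> * Im om - t * (Im om / 2) * Re om > 0" by linarith+
 qed
 have nh: "norm h <= norm om" using Rom(2) by (simp add: h_def norm_mult)
 have conv: "closed_segment a b \<subseteq> pinch_dom R om"
  if ab: "0 <= Im a" "Im a <= Im om" "0 < Im a * Re om - Re a * Im om" "norm a <= \<sigma> + 2 * norm om"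
   "0 <= Im b" "Im b <= Im om" "0 < Im b * Re om - Re b * Im om \<or> b = om / 2" "norm b <= \<sigma> + 2 * norm om" for a b
 proof
  fix y assume "y \<in> closed_segment a b"
  then obtain t where t: "0 <= t" "t <= 1" "y = (1 - t) *\<^sub>R a + t *\<^sub>R b" by (auto simp: closed_segment_def)
  have I: "Im y = (1 - t) * Im a + t * Im b" "Re y = (1 - t) * Re a + t * Re b" by (simp_all add: t(3))
  have q: "Im y * Re om - Re y * Im om = (1 - t) * (Im a * Re om - Re a * Im om) + t * (Im b * Re om - Re b * Im om)"
   unfolding I by (simp add: algebra_simps)
  show "y \<in> pinch_dom R om"
  proof (rule inI)
   show "0 <= Im y" unfolding I using t ab by simp
   show "Im y <= Im om" unfolding I using t ab by (intro convex_bound_le) auto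
   have "norm y <= (1 - t) * norm a + t * norm b" unfolding t(3) using norm_triangle_ineq[of "(1 - t) *\<^sub>R a" "t *\<^sub>R b"] t by simp
   also have "\<dots> <= \<sigma> + 2 * norm om" using t ab by (intro convex_bound_le) auto
   finally show "norm y <= \<sigma> + 2 * norm om" .
   show "0 < Im y * Re om - Re y * Im om \<or> y = om / 2"
   proof (cases "t = 1")
    case True
    then show ?thesis using ab(7) t(3) I by simp
   next
    case False
    have "Im b * Re om - Re b * Im om \<ge> 0" using ab(7) by auto
    then have "t * (Im b * Re om - Re b * Im om) \<ge> 0" using t by simp
    moreover have "(1 - t) * (Im a * Re om - Re a * Im om) > 0" using t False ab(3) by simp
    ultimately show ?thesis unfolding q by linarith
   qed
  qed
 qed
 have p1: "\<sigma> * Im om > 0" using \<sigma> om(1) by simp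
 have e1: "Im (- of_real \<sigma> + h) * Re om - Re (- of_real \<sigma> + h) * Im om > 0" using pos(1)[of 1] by (simp add: h_def)
 have e2: "Im (om - of_real \<sigma> - h) * Re om - Re (om - of_real \<sigma> - h) * Im om > 0" using pos(2)[of 1] by (simp add: h_def algebra_simps)
 have e3: "Im (om - of_real \<sigma>) * Re om - Re (om - of_real \<sigma>) * Im om > 0" using p1 by (simp add: algebra_simps)
 have n1: "norm (- of_real \<sigma> + h) <= \<sigma> + 2 * norm om" 
 proof -
  have "norm (- of_real \<sigma> + h) <= \<sigma> + norm h" using norm_triangle_ineq[of "- of_real \<sigma>" h] \<sigma> by simp
  then show ?thesis using nh norm_ge_zero[of om] by linarith
 qed
 have n3: "norm (om - of_real \<sigma>) <= \<sigma> + norm om" using norm_triangle_ineq4[of om "of_real \<sigma>"] \<sigma> by simp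
 have n2: "norm (om - of_real \<sigma> - h) <= \<sigma> + 2 * norm om" using norm_triangle_ineq4[of "om - of_real \<sigma>" h] nh n3 by linarith
 have n4: "norm (om / 2) <= \<sigma> + 2 * norm om" "norm (- of_real \<sigma> :: complex) <= \<sigma> + 2 * norm om" using \<sigma> norm_ge_zero[of om] by (simp_all add: norm_divide)
 have i: "Im h = Im om / 2" by (simp add: h_def)
 have e0: "Im (- of_real \<sigma>) * Re om - Re (- of_real \<sigma>) * Im om > 0" using p1 by simp
 have n5: "norm (om - of_real \<sigma>) <= \<sigma> + 2 * norm om" using n3 norm_ge_zero[of om] by linarith
 note facts = e0 e1 e2 e3 n1 n2 n4 n5
 note dj = e0[THEN disjI1] e1[THEN disjI1] e2[THEN disjI1] e3[THEN disjI1]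
 show "closed_segment (- of_real \<sigma>) (- of_real \<sigma> + h) \<subseteq> pinch_dom R om"
  by (rule conv; (rule facts dj disjI2[OF refl] | use om(1) i in simp))
 show "closed_segment (- of_real \<sigma> + h) (om / 2) \<subseteq> pinch_dom R om"
  by (rule conv; (rule facts dj disjI2[OF refl] | use om(1) i in simp))
 show "closed_segment (om - of_real \<sigma>) (om - of_real \<sigma> - h) \<subseteq> pinch_dom R om"
  by (rule conv; (rule facts dj disjI2[OF refl] | use om(1) i in simp))
 show "closed_segment (om - of_real \<sigma> - h) (om / 2) \<subseteq> pinch_dom R om"
  by (rule conv; (rule facts dj disjI2[OF refl] | use om(1) i in simp))
 show "closed_segment (om - of_real \<sigma>) (- of_real \<sigma>) \<subseteq> pinch_dom R om"
  by (rule conv; (rule facts dj disjI2[OF refl] | use om(1) i in simp))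
qed

text \<open>
 A contour which passes between the singularity \<open>0\<close> of \<open>f\<close> and the singularity \<open>om\<close> of
 \<open>g (om - x)\<close> is cut at the midpoint \<open>om / 2\<close>; the reflection \<open>x \<mapsto> om - x\<close> exchanges the roles
 of \<open>f\<close> and \<open>g\<close> in the second half.
\<close>

lemma run_between:
 assumes f: "f holomorphic_on {X. Re X < R}" and g: "g holomorphic_on {X. Re X < R}"
  and \<sigma>: "\<sigma> > 0" and r: "exp r * 2 <= \<sigma>" "3 * exp r + \<sigma> <= exp R"
 obtains S where "S holomorphic_on ball 0 (exp r)"
  "!!om. Im om > 0 ==> norm om < exp r ==>
   run (- of_real \<sigma>) (of_real \<sigma>) (Im om / 2) (%x. f (Ln x) * g (Ln (om - x))) =
   S om + (half_cell f g \<sigma> (Ln om) + half_cell g f \<sigma> (Ln om))"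
proof
 \<comment> \<open>The connecting piece from om - \<sigma> to - \<sigma>. All its points are near -
   \<sigma>; writing log (- z) as pi i + Ln z makes it holomorphic in a full disc around om = 0,
   beyond the half-disc \<open>Im om > 0\<close>.\<close>
 define S where "S om = contour_integral (linepath 0 1) (%t. g (of_real pi * \<i> + Ln (of_real \<sigma> - (1 - t) * om)) * f (Ln (of_real \<sigma> + t * om)) * (- om))" for om
 have ep: "exp r > 0" by simp
 have arg: "Re (of_real \<sigma> + c * om) > 0" "norm (of_real \<sigma> + c * om) < exp R" if "norm c <= 1" "norm om < exp r" for c om :: complex
 proof -
  have n: "norm (c * om) < exp r" using mult_right_mono[OF that(1) norm_ge_zero[of om]] that(2) by (simp add: norm_mult)
  then show "Re (of_real \<sigma> + c * om) > 0" using abs_Re_le_cmod[of "c * om"] r(1) ep by simp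
  have "norm (of_real \<sigma> + c * om) <= \<sigma> + norm (c * om)" using norm_triangle_ineq[of "of_real \<sigma>" "c * om"] \<sigma> by simp
  then show "norm (of_real \<sigma> + c * om) < exp R" using n r(2) ep by linarith
 qed
 have tn: "norm t <= 1" "norm (- (1 - t)) <= 1" if t: "t \<in> closed_segment 0 (1::complex)" for t
 proof -
  obtain u where u: "0 <= u" "u <= 1" "t = of_real u" using t by (auto simp: closed_segment_def scaleR_conv_of_real)
  have "- (1 - t) = of_real (u - 1)" by (simp add: u(3))
  then show "norm (- (1 - t)) <= 1" by (simp only: norm_of_real) (use u in simp)
  show "norm t <= 1" using u by simp
 qed
 have LnR: "Re (Ln z) < R" "z \<notin> \<real>\<^sub>\<le>\<^sub>0" if "Re z > 0" "norm z < exp R" for z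
 proof -
  have nz: "z ~= 0" using that by auto
  then have "ln (norm z) < ln (exp R)" using that(2) by (subst ln_less_cancel_iff) auto
  then show "Re (Ln z) < R" using nz by simp
  show "z \<notin> \<real>\<^sub>\<le>\<^sub>0" using that(1) by (auto simp: complex_nonpos_Reals_iff)
 qed
 have arg': "of_real \<sigma> - (1 - t) * om = of_real \<sigma> + (- (1 - t)) * om" for t om by (simp add: algebra_simps)
 have ok: "Re (Ln (of_real \<sigma> + t * om)) < R" "of_real \<sigma> + t * om \<notin> \<real>\<^sub>\<le>\<^sub>0"
   "Re (of_real pi * \<i> + Ln (of_real \<sigma> - (1 - t) * om)) < R" "of_real \<sigma> - (1 - t) * om \<notin> \<real>\<^sub>\<le>\<^sub>0"
  if "t \<in> closed_segment 0 1" "om \<in> ball 0 (exp r)" for t om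
 proof -
  have w: "norm om < exp r" using that(2) by simp
  show "Re (Ln (of_real \<sigma> + t * om)) < R" "of_real \<sigma> + t * om \<notin> \<real>\<^sub>\<le>\<^sub>0"
   using LnR[OF arg[OF tn(1)[OF that(1)] w]] .
  show "Re (of_real pi * \<i> + Ln (of_real \<sigma> - (1 - t) * om)) < R" "of_real \<sigma> - (1 - t) * om \<notin> \<real>\<^sub>\<le>\<^sub>0"
   unfolding arg' using LnR[OF arg[OF tn(2)[OF that(1)] w]] by auto
 qed
 show "S holomorphic_on ball 0 (exp r)"
  unfolding S_def[abs_def]
 proof (rule holomorphic_contour_integral_param[OF open_ball])
  show "continuous_on (ball 0 (exp r) \<times> closed_segment 0 1)
   (%(om, t). g (of_real pi * \<i> + Ln (of_real \<sigma> - (1 - t) * om)) * f (Ln (of_real \<sigma> + t * om)) * (- om))"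
   unfolding split_def
   by (intro continuous_intros continuous_on_half_plane_compose[OF f] continuous_on_half_plane_compose[OF g])
    (use ok in auto)
  show "(%om. g (of_real pi * \<i> + Ln (of_real \<sigma> - (1 - t) * om)) * f (Ln (of_real \<sigma> + t * om)) * (- om)) holomorphic_on ball 0 (exp r)"
   if "t \<in> closed_segment 0 1" for t
   by (intro holomorphic_intros holomorphic_on_half_plane_compose[OF f] holomorphic_on_half_plane_compose[OF g])
    (rule ok; (rule that | assumption))+
 qed
 fix om :: complex assume om: "Im om > 0" "norm om < exp r"
 let ?h = "\<i> * of_real (Im om / 2) :: complex" let ?s = "of_real \<sigma> :: complex"
 let ?K = "%x. f (Ln x) * g (Ln (om - x))" let ?K' = "%x. g (Ln x) * f (Ln (om - x))"
 have om0: "om ~= 0" using om by auto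
 have R3: "norm om < \<sigma>" "\<sigma> + 3 * norm om < exp R" using om(2) r ep by linarith+
 note seg = pinch_segments[OF om(1) R3]
 have eR: "exp (Re (Ln om)) = norm om" using om0 by simp
 have \<eta>2: "2 * exp (Re (Ln om)) < exp R" unfolding eR using R3 \<sigma> norm_ge_zero[of om] by linarith
 have \<eta>: "exp (Re (Ln om)) < \<sigma>" "3 * exp (Re (Ln om)) + \<sigma> < exp R" unfolding eR using R3 by linarith+
 obtain \<Phi> where \<Phi>: "!!X. X \<in> kernel_dom R (Ln om) ==> (\<Phi> has_field_derivative kernel f g (Ln om) X) (at X)"
  using kernel_primitive[OF f g \<eta>2] by blast
 obtain \<Psi> where \<Psi>: "!!X. X \<in> kernel_dom R (Ln om) ==> (\<Psi> has_field_derivative kernel g f (Ln om) X) (at X)"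
  using kernel_primitive[OF g f \<eta>2] by blast
 have half: "Ln (om / 2 / om) = - Complex (ln 2) 0"
 proof -
  have "Ln (of_real (1/2)) = of_real (ln (1/2))" by (rule Ln_of_real) simp
  then show ?thesis using om0 by (simp add: ln_div complex_eq_iff)
 qed
 have start: "Ln (- ?s / om) = Complex (ln \<sigma>) pi - Ln om"
 proof -
  have "- ?s \<in> pinch_dom R om" using seg(1) by blast
  from pinch_dom(1)[OF om(1) this] have "Ln (- ?s / om) = Ln (- ?s) - Ln om" by (simp add: algebra_simps)
  also have "Ln (- ?s) = Complex (ln \<sigma>) pi" using \<sigma> by (simp add: Ln_minus Ln_of_real complex_eq_iff)
  finally show ?thesis .
 qed
 have I1: "half_cell f g \<sigma> (Ln om) = om * \<Phi> (Ln (om / 2 / om)) - om * \<Phi> (Ln (- ?s / om))"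
  unfolding half start using half_cell_eq[OF \<sigma> \<eta> \<Phi>] om0 by (simp add: right_diff_distrib)
 have I2: "half_cell g f \<sigma> (Ln om) = om * \<Psi> (Ln (om / 2 / om)) - om * \<Psi> (Ln (- ?s / om))"
  unfolding half start using half_cell_eq[OF \<sigma> \<eta> \<Psi>] om0 by (simp add: right_diff_distrib)
 have refl: "contour_integral (linepath a b) ?K = contour_integral (linepath (om - b) (om - a)) ?K'" for a b
  using contour_integral_linepath_reflect[of a b ?K om] by (simp add: mult.commute)
 have mid: "contour_integral (linepath (- ?s + ?h) (?s + ?h)) ?K =
  contour_integral (linepath (- ?s + ?h) (om / 2)) ?K + contour_integral (linepath (om / 2) (?s + ?h)) ?K"
 proof (rule contour_integral_split_linepath)
  have "x \<in> {x. Im x = Im om / 2} \<and> norm x <= \<sigma> + norm om" if x: "x \<in> closed_segment (- ?s + ?h) (?s + ?h)" for x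
  proof -
   obtain u where u: "0 <= u" "u <= 1" "x = (1 - u) *\<^sub>R (- ?s + ?h) + u *\<^sub>R (?s + ?h)" using x by (auto simp: closed_segment_def)
   have I: "Im x = Im om / 2" "Re x = (2 * u - 1) * \<sigma>" by (simp_all add: u(3) algebra_simps)
   have "\<bar>2 * u - 1\<bar> <= 1" using u by auto
   then have "\<bar>Re x\<bar> <= \<sigma>" unfolding I using \<sigma> by (simp add: abs_mult mult_left_le_one_le)
   then have "norm x <= \<sigma> + norm om" using cmod_le[of x] I(1) abs_Im_le_cmod[of om] norm_ge_zero[of om] by simp
   then show ?thesis using I by simp
  qed
  note b = this
  have B: "Im x > 0 \<and> Im (om - x) > 0 \<and> norm x < exp R \<and> norm (om - x) < exp R" if x: "x \<in> closed_segment (- ?s + ?h) (?s + ?h)" for x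
  proof -
   have "Im x = Im om / 2" "norm x <= \<sigma> + norm om" using b[OF x] by auto
   moreover have "norm (om - x) <= norm om + norm x" by (rule norm_triangle_ineq4)
   ultimately have "norm x < exp R" "norm (om - x) < exp R" using R3 norm_ge_zero[of om] by linarith+
   then show ?thesis using \<open>Im x = Im om / 2\<close> om(1) by simp
  qed
  have L: "Re (Ln z) < R \<and> z \<notin> \<real>\<^sub>\<le>\<^sub>0" if z: "Im z > 0" "norm z < exp R" for z
  proof -
   have nz: "z ~= 0" using z by auto
   then have "ln (norm z) < ln (exp R)" using z(2) by (subst ln_less_cancel_iff) auto
   then show ?thesis using nz z(1) by (auto simp: complex_nonpos_Reals_iff)
  qed
  show "continuous_on (closed_segment (- ?s + ?h) (?s + ?h)) ?K"
   by (intro continuous_intros continuous_on_half_plane_compose[OF f] continuous_on_half_plane_compose[OF g])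
    (use B L in auto)
  \<comment> \<open>The midpoint om / 2 is at the height of the run, and it lies between the ends
    because \<open>\<bar>Re om\<bar>\<close> is less than \<sigma>.\<close>
  have "\<bar>Re om\<bar> < \<sigma>" using R3 abs_Re_le_cmod[of om] by linarith
  then have R: "- \<sigma> < Re om / 2" "Re om / 2 < \<sigma>" using \<sigma> by auto
  define u where "u = (Re om / 2 + \<sigma>) / (2 * \<sigma>)"
  have "0 <= u" "u <= 1" using R \<sigma> by (auto simp: u_def field_simps)
  moreover have "om / 2 = (1 - u) *\<^sub>R (- ?s + ?h) + u *\<^sub>R (?s + ?h)"
   using \<sigma> by (simp add: complex_eq_iff u_def field_simps)
  ultimately show "om / 2 \<in> closed_segment (- ?s + ?h) (?s + ?h)" unfolding closed_segment_def by blast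
 qed
 have tel: "(a - b) + (c - a) = c - b" "(c - a) + (a - b) = c - b" for a b c :: complex by simp_all
 have l1: "contour_integral (linepath (- ?s) (- ?s + ?h)) ?K + contour_integral (linepath (- ?s + ?h) (om / 2)) ?K = half_cell f g \<sigma> (Ln om)"
 proof -
  have "contour_integral (linepath (- ?s) (- ?s + ?h)) ?K = om * \<Phi> (Ln ((- ?s + ?h) / om)) - om * \<Phi> (Ln (- ?s / om))"
   by (rule pinch_contour_integral[OF om(1) seg(1) \<Phi>])
  moreover have "contour_integral (linepath (- ?s + ?h) (om / 2)) ?K = om * \<Phi> (Ln (om / 2 / om)) - om * \<Phi> (Ln ((- ?s + ?h) / om))"
   by (rule pinch_contour_integral[OF om(1) seg(2) \<Phi>])
  ultimately show ?thesis unfolding I1 by (simp only: tel)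
 qed
 have e1: "om - (?s + ?h) = om - ?s - ?h" "om - om / 2 = om / 2" by simp_all
 have Som: "S om = contour_integral (linepath (om - ?s) (- ?s)) ?K'"
 proof -
  have "contour_integral (linepath (om - ?s) (- ?s)) ?K' = contour_integral (linepath 0 1) (%t. ?K' ((om - ?s) + t * (- ?s - (om - ?s))) * (- ?s - (om - ?s)))"
   by (rule contour_integral_linepath_01)
  also have "\<dots> = S om"
   unfolding S_def
  proof (rule contour_integral_eq)
   fix t :: complex assume "t \<in> path_image (linepath 0 1)"
   then have t: "t \<in> closed_segment 0 1" by simp
   then obtain u where u: "0 <= u" "u <= 1" "t = of_real u" by (auto simp: closed_segment_def scaleR_conv_of_real)
   let ?z = "?s - (1 - t) * om"
   have z: "Re ?z > 0" unfolding arg' by (rule arg(1)[OF tn(2)[OF t] om(2)])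
   then have nz: "?z ~= 0" by (metis less_irrefl zero_complex.sel(1))
   \<comment> \<open>\<open>?z\<close> is in the closed lower half-plane, so \<open>Ln\<close> of
     its negative gains pi i rather than losing it.\<close>
   have "Im ?z <= 0" using u om(1) by (simp add: u(3))
   then have 1: "Ln (- ?z) = of_real pi * \<i> + Ln ?z" using nz z by (subst Ln_minus[OF nz]) (auto simp: mult.commute)
   have 2: "(om - ?s) + t * (- ?s - (om - ?s)) = - ?z" "- ?s - (om - ?s) = - om" "om - (- ?z) = ?s + t * om" by (simp_all add: algebra_simps)
   show "?K' ((om - ?s) + t * (- ?s - (om - ?s))) * (- ?s - (om - ?s)) =
    g (of_real pi * \<i> + Ln (?s - (1 - t) * om)) * f (Ln (?s + t * om)) * - om"
    by (simp only: 2(1) 2(3) 1) (simp only: 2(2))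
  qed
  finally show ?thesis by simp
 qed
 have l2: "contour_integral (linepath (om / 2) (?s + ?h)) ?K + contour_integral (linepath (?s + ?h) ?s) ?K = S om + half_cell g f \<sigma> (Ln om)"
 proof -
  have "contour_integral (linepath (om - ?s) (om - ?s - ?h)) ?K' = om * \<Psi> (Ln ((om - ?s - ?h) / om)) - om * \<Psi> (Ln ((om - ?s) / om))"
   by (rule pinch_contour_integral[OF om(1) seg(3) \<Psi>])
  moreover have "contour_integral (linepath (om - ?s - ?h) (om / 2)) ?K' = om * \<Psi> (Ln (om / 2 / om)) - om * \<Psi> (Ln ((om - ?s - ?h) / om))"
   by (rule pinch_contour_integral[OF om(1) seg(4) \<Psi>])
  moreover have "contour_integral (linepath (om - ?s) (- ?s)) ?K' = om * \<Psi> (Ln (- ?s / om)) - om * \<Psi> (Ln ((om - ?s) / om))"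
   by (rule pinch_contour_integral[OF om(1) seg(5) \<Psi>])
  ultimately show ?thesis unfolding refl e1 I2 Som by (simp only: tel)
 qed
 show "run (- ?s) ?s (Im om / 2) ?K = S om + (half_cell f g \<sigma> (Ln om) + half_cell g f \<sigma> (Ln om))"
  unfolding run_def mid using l1 l2 by (simp add: add.assoc [symmetric])
qed

section \<open>Contour integrals for the Hadamard product\<close>

text \<open>A class of paths for which integrability, dependence on a parameter and termwise
  integration follow by induction from the case of one segment.\<close>

inductive polygonal :: "(real => complex) => bool" where
 polygonal_linepath: "polygonal (linepath a b)"
| polygonal_join: "polygonal p ==> polygonal q ==> pathfinish p = pathstart q ==> polygonal (p +++ q)"

lemma polygonal_valid: "polygonal p ==> valid_path p"
 by (induction rule: polygonal.induct) (auto intro: valid_path_join)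

lemma polygonal_integrable:
 "polygonal p ==> continuous_on (path_image p) f ==> f contour_integrable_on p"
proof (induction rule: polygonal.induct)
 case (polygonal_join p q)
 then show ?case
  by (auto simp: path_image_join intro!: contour_integrable_joinI polygonal_valid intro: continuous_on_subset)
qed (auto intro: contour_integrable_continuous_linepath)

lemma polygonal_contour_integral_join:
 assumes "polygonal p" "polygonal q" "pathfinish p = pathstart q" "continuous_on (path_image (p +++ q)) f"
 shows "contour_integral (p +++ q) f = contour_integral p f + contour_integral q f"
proof (rule contour_integral_join)
 have "path_image (p +++ q) = path_image p \<union> path_image q" by (rule path_image_join[OF assms(3)])
 then have "continuous_on (path_image p) f" "continuous_on (path_image q) f"
  using assms(4) by (auto intro: continuous_on_subset)
 then show "f contour_integrable_on p" "f contour_integrable_on q"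
  using assms(1,2) polygonal_integrable by auto
qed (use assms polygonal_valid in auto)

lemma continuous_on_slice:
 assumes "continuous_on (U \<times> S) (%(w, x). K w x)" "w \<in> U" shows "continuous_on S (K w)"
 by (rule continuous_on_compose2[OF assms(1), of S "%x. (w, x)", simplified])
  (use assms(2) in \<open>auto intro!: continuous_intros\<close>)

lemma polygonal_holomorphic_param:
 assumes "polygonal p" and U: "open U"
 shows "continuous_on (U \<times> path_image p) (%(w, x). K w x) ==>
  (!!x. x \<in> path_image p ==> (%w. K w x) holomorphic_on U) ==>
  (%w. contour_integral p (K w)) holomorphic_on U"
 using assms(1)
proof (induction rule: polygonal.induct)
 case (polygonal_linepath a b)
 then show ?case by (intro holomorphic_contour_integral_param[OF U]) auto
next
 case (polygonal_join p q)
 have im: "path_image (p +++ q) = path_image p \<union> path_image q" by (rule path_image_join[OF polygonal_join.hyps(3)])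
 have sub: "U \<times> path_image p \<subseteq> U \<times> path_image (p +++ q)" "U \<times> path_image q \<subseteq> U \<times> path_image (p +++ q)"
  by (auto simp: im)
 have "(%w. contour_integral p (K w) + contour_integral q (K w)) holomorphic_on U"
  by (intro holomorphic_on_add polygonal_join.IH continuous_on_subset[OF polygonal_join.prems(1)] sub polygonal_join.prems(2))
   (auto simp: im)
 then show ?case
 proof (rule holomorphic_transform)
  fix w assume "w \<in> U"
  then show "contour_integral p (K w) + contour_integral q (K w) = contour_integral (p +++ q) (K w)"
   by (intro polygonal_contour_integral_join[symmetric] polygonal_join.hyps continuous_on_slice[OF polygonal_join.prems(1)])
 qed
qed

lemma polygonal_sums:
 fixes f :: "nat => complex => complex"
 assumes "polygonal p" and M: "summable M"
 shows "(!!n. continuous_on (path_image p) (f n)) ==> (!!n x. x \<in> path_image p ==> norm (f n x) <= M n) ==>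
  continuous_on (path_image p) (%x. \<Sum>n. f n x) \<and> (%n. contour_integral p (f n)) sums contour_integral p (%x. \<Sum>n. f n x)"
 using assms(1)
proof (induction rule: polygonal.induct)
 case (polygonal_linepath a b)
 have ul: "uniform_limit (path_image (linepath a b)) (%n x. \<Sum>i<n. f i x) (%x. \<Sum>i. f i x) sequentially"
  by (rule Weierstrass_m_test[OF polygonal_linepath(2) M])
 have c: "continuous_on (closed_segment a b) (f n)" for n using polygonal_linepath(1) by simp
 have ci: "(%x. \<Sum>i<n. f i x) contour_integrable_on linepath a b" for n
  by (intro contour_integrable_continuous_linepath continuous_intros c)
 have eq: "contour_integral (linepath a b) (%x. \<Sum>i<n. f i x) = (\<Sum>i<n. contour_integral (linepath a b) (f i))" for n
  by (rule contour_integral_sum) (auto intro: contour_integrable_continuous_linepath c)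
 have "(%n. contour_integral (linepath a b) (%x. \<Sum>i<n. f i x)) \<longlonglongrightarrow> contour_integral (linepath a b) (%x. \<Sum>i. f i x)"
  by (rule contour_integral_uniform_limit(2)[OF _ ul, of "norm (b - a)"]) (use ci in auto)
 moreover have "continuous_on (path_image (linepath a b)) (%x. \<Sum>i. f i x)"
  by (rule uniform_limit_theorem[OF _ ul]) (auto intro!: always_eventually continuous_intros c)
 ultimately show ?case unfolding sums_def eq by blast
next
 case (polygonal_join p q)
 have im: "path_image (p +++ q) = path_image p \<union> path_image q" by (rule path_image_join[OF polygonal_join.hyps(3)])
 have c: "continuous_on (path_image p) (f n)" "continuous_on (path_image q) (f n)" for n
  using polygonal_join.prems(1)[of n] by (auto simp: im intro: continuous_on_subset)
 have 1: "continuous_on (path_image p) (%x. \<Sum>n. f n x) \<and> (%n. contour_integral p (f n)) sums contour_integral p (%x. \<Sum>n. f n x)"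
  by (rule polygonal_join.IH(1)[OF c(1)]) (auto intro: polygonal_join.prems(2) simp: im)
 have 2: "continuous_on (path_image q) (%x. \<Sum>n. f n x) \<and> (%n. contour_integral q (f n)) sums contour_integral q (%x. \<Sum>n. f n x)"
  by (rule polygonal_join.IH(2)[OF c(2)]) (auto intro: polygonal_join.prems(2) simp: im)
 have ul: "uniform_limit (path_image (p +++ q)) (%n x. \<Sum>i<n. f i x) (%x. \<Sum>i. f i x) sequentially"
  by (rule Weierstrass_m_test[OF polygonal_join.prems(2) M])
 have C: "continuous_on (path_image (p +++ q)) (%x. \<Sum>i. f i x)"
  by (rule uniform_limit_theorem[OF _ ul]) (auto intro!: always_eventually continuous_intros polygonal_join.prems(1))
 note J = polygonal_contour_integral_join[OF polygonal_join.hyps]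
 have "(%n. contour_integral (p +++ q) (f n)) sums contour_integral (p +++ q) (%x. \<Sum>n. f n x)"
  unfolding J[OF polygonal_join.prems(1)] J[OF C] using 1 2 by (intro sums_add) auto
 then show ?case using C by blast
qed

text \<open>The compact image has a positive distance from the complement of \<open>S\<close>, and
  changing \<open>z\<close> moves it by at most the change times a bound of \<open>a\<close> on
  \<open>K\<close>.\<close>

lemma open_ball_Collect:
 assumes K: "compact K" and S: "open S" and a: "continuous_on K a" "continuous_on K b"
 shows "open {z::complex. \<forall>x\<in>K. z * a x + b x \<in> S}"
 unfolding open_contains_ball
proof
 fix z assume z: "z \<in> {z. \<forall>x\<in>K. z * a x + b x \<in> S}"
 have "compact ((%x. z * a x + b x) ` K)" by (intro compact_continuous_image continuous_intros a K)
 then obtain e where e: "e > 0" "(\<Union>y\<in>(%x. z * a x + b x) ` K. ball y e) \<subseteq> S"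
  using compact_subset_open_imp_ball_epsilon_subset[OF _ S] z by blast
 have "bounded (a ` K)" by (intro compact_imp_bounded compact_continuous_image a K)
 then obtain B where B: "B > 0" "!!x. x \<in> K ==> norm (a x) <= B" unfolding bounded_pos by auto
 have "w * a x + b x \<in> S" if w: "w \<in> ball z (e / B)" and x: "x \<in> K" for w x
 proof -
  have "dist (z * a x + b x) (w * a x + b x) = norm (z - w) * norm (a x)" by (simp add: dist_norm left_diff_distrib flip: norm_mult)
  also have "\<dots> <= norm (z - w) * B" using B(2)[OF x] by (intro mult_left_mono) auto
  also have "\<dots> < e" using w B(1) by (simp add: dist_norm field_simps)
  finally show ?thesis using e(2) x by fastforce
 qed
 then show "\<exists>e>0. ball z e \<subseteq> {z. \<forall>x\<in>K. z * a x + b x \<in> S}"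
  using e(1) B(1) by (intro exI[of _ "e / B"]) auto
qed

lemma polygonal_compact: "polygonal p ==> compact (path_image p)"
 by (intro compact_path_image valid_path_imp_path polygonal_valid)

section \<open>The Hadamard product as a contour integral\<close>

text \<open>An explicit primitive replaces any deformation of contours. Removing the Taylor
  polynomial of degree \<open>n\<close> leaves z^(n + 1) times a function holomorphic on the star,
  which has a primitive \<open>Q\<close> there. All terms of the resulting primitive in
  \<open>x\<close> have period 2 pi i, except \<open>?c n * x\<close>.\<close>

lemma pbranch_coefficient:
 assumes F: "fps_conv_radius F > 0" and p: "polygonal p" "pathfinish p = pathstart p + 2 * of_real pi * \<i>"
  and star: "!!x. x \<in> path_image p ==> exp x \<in> star F"
 shows "contour_integral p (%x. pbranch F (exp x) * exp (- x) ^ n) = 2 * of_real pi * \<i> * fps_nth F n"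
proof -
 let ?c = "fps_nth F"
 obtain r where r: "r > 0" "ereal r < fps_conv_radius F" "ball 0 r \<subseteq> star F" "!!z. z \<in> ball 0 r ==> pbranch F z = eval_fps F z"
  by (rule pbranch_near_0[OF F]) blast
 define E where "E z = (\<Sum>k. ?c (k + Suc n) * z ^ k)" for z
 \<comment> \<open>\<open>E\<close> is the power series of the quotient and fills its removable
   singularity at 0.\<close>
 define Rem where "Rem z = (if z = 0 then E z else (pbranch F z - (\<Sum>k\<le>n. ?c k * z ^ k)) / z ^ Suc n)" for z
 have RE: "Rem z = E z" if z: "z \<in> ball 0 r" for z
 proof (cases "z = 0")
  case False
  have nz: "ereal (norm z) < fps_conv_radius F" using z r(2) by (simp add: less_trans[of "ereal (norm z)" "ereal r"])
  have s: "summable (%k. ?c k * z ^ k)" using sums_eval_fps[OF nz] by (simp add: sums_iff)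
  have "pbranch F z = (\<Sum>k. ?c k * z ^ k)" using r(4)[OF z] sums_eval_fps[OF nz] by (simp add: sums_iff)
  also have "\<dots> = (\<Sum>k. ?c (k + Suc n) * z ^ (k + Suc n)) + (\<Sum>k<Suc n. ?c k * z ^ k)"
   by (rule suminf_split_initial_segment[OF s])
  also have "(\<Sum>k. ?c (k + Suc n) * z ^ (k + Suc n)) = z ^ Suc n * E z"
  proof -
   have "summable (%k. ?c (k + Suc n) * z ^ (k + Suc n))" using s by (rule summable_ignore_initial_segment)
   then have "summable (%k. z ^ Suc n * (?c (k + Suc n) * z ^ k))" by (simp add: power_add mult_ac)
   then have "summable (%k. ?c (k + Suc n) * z ^ k)" using False by (simp only: summable_cmult_iff) simp
   then show ?thesis unfolding E_def by (subst suminf_mult[symmetric]) (auto simp: power_add mult_ac)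
  qed
  finally show ?thesis using False by (simp add: Rem_def lessThan_Suc_atMost)
 qed (simp add: Rem_def)
 have Ehol: "E holomorphic_on ball 0 r"
 proof -
  have e: "E = eval_fps (fps_shift (Suc n) F)" by (simp add: E_def eval_fps_def fun_eq_iff)
  have "fps_conv_radius (fps_shift (Suc n) F) = fps_conv_radius F" by (rule fps_conv_radius_shift)
  then show ?thesis unfolding e
   by (intro holomorphic_on_eval_fps) (use r(2) in \<open>auto simp: eball_def intro: less_trans[of _ "ereal r"]\<close>)
 qed
 have "Rem holomorphic_on star F"
 proof -
  have 1: "Rem holomorphic_on ball 0 r" by (rule holomorphic_transform[OF Ehol]) (simp add: RE)
  have "(%z. (pbranch F z - (\<Sum>k\<le>n. ?c k * z ^ k)) / z ^ Suc n) holomorphic_on star F - {0}"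
   by (intro holomorphic_intros holomorphic_on_subset[OF pbranch_holomorphic]) auto
  then have 2: "Rem holomorphic_on star F - {0}" by (rule holomorphic_transform) (simp add: Rem_def)
  have "star F = ball 0 r \<union> (star F - {0})" using r(1,3) by auto
  moreover have "open (star F - {0})" using open_star by (intro open_Diff) auto
  ultimately show ?thesis using holomorphic_on_Un[OF 1 2] by simp
 qed
 moreover have "starlike (star F)"
  unfolding starlike_def using star_segment zero_in_star[OF F] by blast
 ultimately have "\<exists>Q. \<forall>z\<in>star F. (Q has_field_derivative Rem z) (at z)"
  by (intro holomorphic_starlike_primitive[of _ _ "{}"])
   (use open_star in \<open>auto intro: holomorphic_on_imp_continuous_on holomorphic_on_imp_differentiable_at\<close>)
 then obtain Q where Q: "!!z. z \<in> star F ==> (Q has_field_derivative Rem z) (at z)" by blast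
 define T where "T x = (\<Sum>k<n. ?c k * (exp (- (of_nat (n - k) * x)) / - of_nat (n - k))) + ?c n * x + Q (exp x)" for x
 have dT: "(T has_field_derivative pbranch F (exp x) * exp (- x) ^ n) (at x)" if x: "exp x \<in> star F" for x
 proof -
  have dQ: "((%x. Q (exp x)) has_field_derivative Rem (exp x) * exp x) (at x)"
   using DERIV_chain'[where g = Q, OF DERIV_exp Q[OF x]] by simp
  have dk: "((%x. ?c k * (exp (- (of_nat (n - k) * x)) / - of_nat (n - k))) has_field_derivative ?c k * exp (- (of_nat (n - k) * x))) (at x)"
   if "k < n" for k
  proof -
   have "of_nat (n - k) ~= (0::complex)" using that by simp
   then show ?thesis by (auto intro!: derivative_eq_intros simp del: of_nat_diff simp: field_simps)
  qed
  have "(T has_field_derivative (\<Sum>k<n. ?c k * exp (- (of_nat (n - k) * x))) + ?c n * 1 + Rem (exp x) * exp x) (at x)"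
   unfolding T_def by (intro DERIV_add DERIV_sum dk DERIV_cmult DERIV_ident dQ) auto
  moreover have "(\<Sum>k<n. ?c k * exp (- (of_nat (n - k) * x))) + ?c n * 1 + Rem (exp x) * exp x = pbranch F (exp x) * exp (- x) ^ n"
  proof -
   have k: "exp (- (of_nat (n - k) * x)) = exp x ^ k * exp (- x) ^ n" if "k <= n" for k
   proof -
    have "exp x ^ k * exp (- x) ^ n = exp (of_nat k * x + of_nat n * (- x))" by (simp only: exp_add exp_of_nat_mult)
    also have "of_nat k * x + of_nat n * (- x) = - (of_nat (n - k) * x)" using that by (simp add: of_nat_diff algebra_simps)
    finally show ?thesis by simp
   qed
   have inv: "exp x ^ n * exp (- x) ^ n = 1" by (simp add: exp_minus flip: power_mult_distrib)
   have R: "Rem (exp x) * exp x = (pbranch F (exp x) - (\<Sum>k\<le>n. ?c k * exp x ^ k)) * exp (- x) ^ n"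
    by (simp add: Rem_def exp_minus power_inverse field_simps)
   have "(\<Sum>k<n. ?c k * exp (- (of_nat (n - k) * x))) + ?c n * 1 = (\<Sum>k<n. ?c k * exp x ^ k) * exp (- x) ^ n + ?c n * (exp x ^ n * exp (- x) ^ n)"
   proof -
    have "(\<Sum>k<n. ?c k * exp (- (of_nat (n - k) * x))) = (\<Sum>k<n. ?c k * exp x ^ k) * exp (- x) ^ n"
     unfolding sum_distrib_right
    proof (rule sum.cong)
     fix j assume "j \<in> {..<n}"
     then have "j <= n" by simp
     then show "?c j * exp (- (of_nat (n - j) * x)) = ?c j * exp x ^ j * exp (- x) ^ n" by (simp only: k mult.assoc)
    qed simp
    then show ?thesis unfolding inv by (simp only:)
   qed
   also have "\<dots> = (\<Sum>k\<le>n. ?c k * exp x ^ k) * exp (- x) ^ n"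
    by (simp add: lessThan_Suc_atMost[symmetric] distrib_right mult.assoc)
   finally have S: "(\<Sum>k<n. ?c k * exp (- (of_nat (n - k) * x))) + ?c n * 1 = (\<Sum>k\<le>n. ?c k * exp x ^ k) * exp (- x) ^ n" .
   show ?thesis unfolding S R by (simp add: left_diff_distrib)
  qed
  ultimately show ?thesis by simp
 qed
 have "((%x. pbranch F (exp x) * exp (- x) ^ n) has_contour_integral T (pathfinish p) - T (pathstart p)) p"
  by (rule contour_integral_primitive[of "{x. exp x \<in> star F}"])
   (use dT star polygonal_valid[OF p(1)] in \<open>auto intro: has_field_derivative_at_within\<close>)
 moreover have "T (pathfinish p) - T (pathstart p) = 2 * of_real pi * \<i> * ?c n"
 proof -
  have e: "exp (- (of_nat m * (x + 2 * of_real pi * \<i>))) = exp (- (of_nat m * x))" for m and x :: complex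
  proof -
   have "- (of_nat m * (x + 2 * of_real pi * \<i>)) = - (of_nat m * x) - 2 * of_nat m * of_real pi * \<i>" by (simp add: algebra_simps)
   moreover have "exp (2 * of_nat m * of_real pi * \<i>) = 1" using exp_integer_2pi[of "of_nat m"] by (simp add: mult_ac)
   ultimately show ?thesis by (simp add: exp_diff)
  qed
  show ?thesis unfolding T_def p(2) e by (simp add: exp_add algebra_simps)
 qed
 ultimately show ?thesis by (simp add: contour_integral_unique)
qed

text \<open>One contour serves all \<open>z\<close> in \<open>W\<close>, which is star-shaped about
  0 because the star of \<open>G\<close> is. The integral is holomorphic on \<open>W\<close> and
  near 0 it is the Hadamard series, by termwise integration; \<open>pbranch_unique\<close> then
  identifies it with the principal branch.\<close>

lemma hadamard_contour:
 assumes F: "fps_conv_radius F > 0" and G: "fps_conv_radius G > 0"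
  and p: "polygonal p" "pathfinish p = pathstart p + 2 * of_real pi * \<i>"
  and dom: "!!x. x \<in> path_image p ==> exp x \<in> star F \<and> exp (w - x) \<in> star G"
 shows "exp w \<in> star (fps_hadamard F G)"
  "pbranch (fps_hadamard F G) (exp w) =
   contour_integral p (%x. pbranch F (exp x) * pbranch G (exp (w - x))) / (2 * of_real pi * \<i>)"
proof -
 let ?I = "path_image p"
 define W where "W = {z. \<forall>x\<in>?I. z * exp (- x) + 0 \<in> star G}"
 have W: "open W" unfolding W_def
  by (rule open_ball_Collect[OF polygonal_compact[OF p(1)] open_star]) (auto intro!: continuous_intros)
 define k where "k z = contour_integral p (%x. pbranch F (exp x) * pbranch G (z * exp (- x))) / (2 * of_real pi * \<i>)" for z
 have cF: "continuous_on ?I (%x. pbranch F (exp x))"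
  by (rule continuous_on_compose2[OF holomorphic_on_imp_continuous_on[OF pbranch_holomorphic]])
   (use dom in \<open>auto intro!: continuous_intros\<close>)
 have "(%z. contour_integral p (%x. pbranch F (exp x) * pbranch G (z * exp (- x)))) holomorphic_on W"
 proof (rule polygonal_holomorphic_param[OF p(1) W])
  have c1: "continuous_on (W \<times> ?I) (%y. pbranch F (exp (snd y)))"
   by (rule continuous_on_compose2[OF cF]) (auto intro!: continuous_intros)
  have c2: "continuous_on (W \<times> ?I) (%y. pbranch G (fst y * exp (- snd y)))"
   by (rule continuous_on_compose2[OF holomorphic_on_imp_continuous_on[OF pbranch_holomorphic]])
    (auto intro!: continuous_intros simp: W_def)
  show "continuous_on (W \<times> ?I) (%(z, x). pbranch F (exp x) * pbranch G (z * exp (- x)))"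
   unfolding split_def by (intro continuous_on_mult c1 c2)
  show "(%z. pbranch F (exp x) * pbranch G (z * exp (- x))) holomorphic_on W" if "x \<in> ?I" for x
   by (intro holomorphic_on_mult holomorphic_on_const holomorphic_on_compose_gen[OF _ pbranch_holomorphic, unfolded o_def])
    (use that in \<open>auto intro!: holomorphic_intros simp: W_def\<close>)
 qed
 then have khol: "k holomorphic_on W" unfolding k_def by (intro holomorphic_intros) auto
 have seg: "closed_segment 0 z \<subseteq> W" if z: "z \<in> W" for z
 proof
  fix y assume "y \<in> closed_segment 0 z"
  then obtain t where t: "t \<in> {0..1}" "y = of_real t * z" by (auto simp: closed_segment_def scaleR_conv_of_real)
  show "y \<in> W" unfolding W_def t(2)
   using star_scale[OF _ t(1)] z by (auto simp: W_def mult.assoc)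
 qed
 have wW: "exp w \<in> W" using dom by (auto simp: W_def exp_diff exp_minus field_simps)
 obtain r where r: "r > 0" "ereal r < fps_conv_radius G" "ball 0 r \<subseteq> star G" "!!z. z \<in> ball 0 r ==> pbranch G z = eval_fps G z"
  by (rule pbranch_near_0[OF G]) blast
 have "bounded ((%x. exp (- x)) ` ?I)"
  by (intro compact_imp_bounded compact_continuous_image polygonal_compact p continuous_intros)
 then obtain B where B: "B > 0" "!!x. x \<in> ?I ==> norm (exp (- x)) <= B" unfolding bounded_pos by auto
 have "bounded ((%x. pbranch F (exp x)) ` ?I)"
  by (intro compact_imp_bounded compact_continuous_image polygonal_compact p cF)
 then obtain C where C: "C > 0" "!!x. x \<in> ?I ==> norm (pbranch F (exp x)) <= C" unfolding bounded_pos by auto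
 let ?f = "fps_nth F" and ?g = "fps_nth G"
 \<comment> \<open>On the contour \<open>z * exp (- x)\<close> stays within \<open>r / 2\<close>, so
   the terms are dominated by the absolutely convergent series of \<open>G\<close> at
   \<open>r / 2\<close>.\<close>
 have k0: "k z = eval_fps (fps_hadamard F G) z" if z: "z \<in> ball 0 (r / (2 * B))" for z
 proof -
  have zB: "norm (z * exp (- x)) <= r / 2" if x: "x \<in> ?I" for x
  proof -
   have "norm (z * exp (- x)) <= norm z * B" unfolding norm_mult using B(2)[OF x] by (intro mult_left_mono) auto
   also have "\<dots> <= r / 2" using z B(1) by (simp add: field_simps)
   finally show ?thesis .
  qed
  define M where "M n = C * norm (?g n * of_real (r / 2) ^ n)" for n
  have "ereal (norm (complex_of_real (r / 2))) < fps_conv_radius G"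
   using r(1,2) by (simp add: less_trans[of "ereal (r/2)" "ereal r"])
  then have "summable (%n. norm (?g n * of_real (r / 2) ^ n))"
   unfolding fps_conv_radius_def by (rule abs_summable_in_conv_radius)
  then have sM: "summable M" unfolding M_def by (rule summable_mult)
  define h where "h n x = pbranch F (exp x) * (?g n * (z * exp (- x)) ^ n)" for n x
  have hc: "continuous_on ?I (h n)" for n unfolding h_def by (intro continuous_intros cF)
  have hM: "norm (h n x) <= M n" if x: "x \<in> ?I" for n x
  proof -
   have "norm (z * exp (- x)) ^ n <= (r / 2) ^ n" using zB[OF x] by (intro power_mono) auto
   then have "norm (?g n * (z * exp (- x)) ^ n) <= norm (?g n * of_real (r / 2) ^ n)"
    using r(1) unfolding norm_mult norm_power by (intro mult_left_mono) auto
   then show ?thesis unfolding h_def M_def norm_mult[of "pbranch F (exp x)"]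
    using C(2)[OF x] C(1) by (intro mult_mono) auto
  qed
  have hs: "(\<Sum>n. h n x) = pbranch F (exp x) * pbranch G (z * exp (- x))" if x: "x \<in> ?I" for x
  proof -
   have b: "norm (z * exp (- x)) < r" using zB[OF x] r(1) by simp
   then have "ereal (norm (z * exp (- x))) < fps_conv_radius G" using r(2) by (meson ereal_less(2) less_ereal.simps(1) less_trans)
   from sums_mult[OF sums_eval_fps[OF this], of "pbranch F (exp x)"]
   have "(\<Sum>n. h n x) = pbranch F (exp x) * eval_fps G (z * exp (- x))" unfolding h_def by (simp add: sums_iff)
   then show ?thesis using r(4)[of "z * exp (- x)"] b by simp
  qed
  have "(%n. contour_integral p (h n)) sums contour_integral p (%x. \<Sum>n. h n x)"
   using polygonal_sums[OF p(1) sM hc hM] by blast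
  also have "contour_integral p (%x. \<Sum>n. h n x) = k z * (2 * of_real pi * \<i>)"
   unfolding k_def by (simp add: hs cong: contour_integral_cong)
  also have "(%n. contour_integral p (h n)) = (%n. (?f n * ?g n * z ^ n) * (2 * of_real pi * \<i>))"
  proof
   fix n
   have "h n = (%x. (?g n * z ^ n) * (pbranch F (exp x) * exp (- x) ^ n))"
    by (simp add: h_def fun_eq_iff power_mult_distrib mult_ac)
   then have "contour_integral p (h n) = (?g n * z ^ n) * contour_integral p (%x. pbranch F (exp x) * exp (- x) ^ n)"
    using polygonal_integrable[OF p(1), of "%x. pbranch F (exp x) * exp (- x) ^ n"] cF
    by (simp add: contour_integral_lmul continuous_intros)
   then show "contour_integral p (h n) = (?f n * ?g n * z ^ n) * (2 * of_real pi * \<i>)"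
    using pbranch_coefficient[OF F p, of n] dom by (simp add: mult_ac)
  qed
  finally have "(%n. ?f n * ?g n * z ^ n) sums k z"
   by (subst (asm) sums_mult2_iff) auto
  then show ?thesis by (simp add: eval_fps_def fps_hadamard_def sums_iff)
 qed
 have ev: "\<forall>\<^sub>F z in nhds 0. k z = eval_fps (fps_hadamard F G) z"
  unfolding eventually_nhds using k0 r(1) B(1) by (intro exI[of _ "ball 0 (r / (2 * B))"]) auto
 show "exp w \<in> star (fps_hadamard F G)"
  by (rule pbranch_unique(1)[OF khol W seg ev wW])
 have "pbranch (fps_hadamard F G) (exp w) = k (exp w)"
  by (rule pbranch_unique(2)[OF khol W seg ev wW])
 then show "pbranch (fps_hadamard F G) (exp w) =
   contour_integral p (%x. pbranch F (exp x) * pbranch G (exp (w - x))) / (2 * of_real pi * \<i>)"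
  unfolding k_def exp_add[of w "- x" for x, symmetric] by simp
qed

section \<open>Holomorphic germs plus one term for each pinch\<close>

text \<open>The form of an integral that persists when pieces of contour are added: a germ
  holomorphic at om = 0 and one multivalued term per pinch, written in \<open>Ln om\<close>.
  \<open>LP\<close> abstracts from what is known of these terms, so that the bookkeeping does not
  involve monodromy.\<close>

definition pinch_sum :: "('a => real => (complex => complex) => bool) => 'a set => (complex => complex) => bool" where
 "pinch_sum LP M k \<longleftrightarrow> finite M \<and> (\<exists>r h L. h holomorphic_on ball 0 (exp r) \<and> (\<forall>\<alpha>\<in>M. LP \<alpha> r (L \<alpha>)) \<and>
  (\<forall>om. 0 < Im om --> norm om < exp r --> k om = h om + (\<Sum>\<alpha>\<in>M. L \<alpha> (Ln om))))"

definition LP_mono :: "('a => real => (complex => complex) => bool) => bool" where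
 "LP_mono LP \<longleftrightarrow> (\<forall>\<alpha> r r' L. LP \<alpha> r L --> r' <= r --> LP \<alpha> r' L)"

lemma pinch_sum_holomorphic:
 assumes "h holomorphic_on ball 0 (exp r)" shows "pinch_sum LP {} h"
 unfolding pinch_sum_def using assms by auto

lemma pinch_sum_cong:
 assumes mono: "LP_mono LP" and k: "pinch_sum LP M k" and eq: "!!om. 0 < Im om ==> norm om < exp r0 ==> k' om = k om"
 shows "pinch_sum LP M k'"
proof -
 obtain r h L where *: "finite M" "h holomorphic_on ball 0 (exp r)" "\<forall>\<alpha>\<in>M. LP \<alpha> r (L \<alpha>)"
  "!!om. 0 < Im om ==> norm om < exp r ==> k om = h om + (\<Sum>\<alpha>\<in>M. L \<alpha> (Ln om))"
  using k unfolding pinch_sum_def by blast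
 let ?r = "min r r0"
 have e: "exp ?r <= exp r" "exp ?r <= exp r0" by auto
 show ?thesis unfolding pinch_sum_def
 proof (intro conjI exI[of _ ?r] exI[of _ h] exI[of _ L] allI impI)
  show "h holomorphic_on ball 0 (exp ?r)" by (rule holomorphic_on_subset[OF *(2) subset_ball[OF e(1)]])
  show "\<forall>\<alpha>\<in>M. LP \<alpha> ?r (L \<alpha>)" using *(3) mono unfolding LP_mono_def by (meson min.cobounded1)
  fix om :: complex assume "0 < Im om" "norm om < exp ?r"
  then show "k' om = h om + (\<Sum>\<alpha>\<in>M. L \<alpha> (Ln om))" using *(4)[of om] eq[of om] e by simp
 qed (rule *(1))
qed

lemma pinch_sum_add:
 assumes mono: "LP_mono LP" and k: "pinch_sum LP M k" and k': "pinch_sum LP M' k'" and disj: "M \<inter> M' = {}"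
 shows "pinch_sum LP (M \<union> M') (%om. k om + k' om)"
proof -
 obtain r h L where 1: "finite M" "h holomorphic_on ball 0 (exp r)" "\<forall>\<alpha>\<in>M. LP \<alpha> r (L \<alpha>)"
  "!!om. 0 < Im om ==> norm om < exp r ==> k om = h om + (\<Sum>\<alpha>\<in>M. L \<alpha> (Ln om))"
  using k unfolding pinch_sum_def by blast
 obtain r' h' L' where 2: "finite M'" "h' holomorphic_on ball 0 (exp r')" "\<forall>\<alpha>\<in>M'. LP \<alpha> r' (L' \<alpha>)"
  "!!om. 0 < Im om ==> norm om < exp r' ==> k' om = h' om + (\<Sum>\<alpha>\<in>M'. L' \<alpha> (Ln om))"
  using k' unfolding pinch_sum_def by blast
 let ?r = "min r r'" let ?L = "%\<alpha>. if \<alpha> \<in> M then L \<alpha> else L' \<alpha>"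
 have e: "exp ?r <= exp r" "exp ?r <= exp r'" by auto
 show ?thesis unfolding pinch_sum_def
 proof (intro conjI exI[of _ ?r] exI[of _ "%om. h om + h' om"] exI[of _ ?L] allI impI)
  show "(%om. h om + h' om) holomorphic_on ball 0 (exp ?r)"
   by (intro holomorphic_intros holomorphic_on_subset[OF 1(2)] holomorphic_on_subset[OF 2(2)] subset_ball e)
  show "\<forall>\<alpha>\<in>M \<union> M'. LP \<alpha> ?r (?L \<alpha>)" using 1(3) 2(3) mono disj unfolding LP_mono_def
   by (auto intro: min.cobounded1 min.cobounded2)
  fix om :: complex assume om: "0 < Im om" "norm om < exp ?r"
  have "(\<Sum>\<alpha>\<in>M \<union> M'. ?L \<alpha> (Ln om)) = (\<Sum>\<alpha>\<in>M. ?L \<alpha> (Ln om)) + (\<Sum>\<alpha>\<in>M'. ?L \<alpha> (Ln om))"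
   by (rule sum.union_disjoint) (use 1(1) 2(1) disj in auto)
  also have "\<dots> = (\<Sum>\<alpha>\<in>M. L \<alpha> (Ln om)) + (\<Sum>\<alpha>\<in>M'. L' \<alpha> (Ln om))"
   using disj by (intro arg_cong2[of _ _ _ _ "(+)"] sum.cong) auto
  finally show "k om + k' om = h om + h' om + (\<Sum>\<alpha>\<in>M \<union> M'. ?L \<alpha> (Ln om))"
   using 1(4)[of om] 2(4)[of om] om e by simp
 qed (use 1(1) 2(1) in auto)
qed

lemma segment_param_holomorphic:
 assumes f: "f holomorphic_on U1" and g: "g holomorphic_on U2" "open U2"
  and ab: "closed_segment a b \<subseteq> U1" "!!x. x \<in> closed_segment a b ==> c - x \<in> U2"
 obtains r where "(%om. contour_integral (linepath a b) (%x. f x * g (c + om - x))) holomorphic_on ball 0 (exp r)"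
proof -
 have "open {om. \<forall>x\<in>closed_segment a b. om * 1 + (c - x) \<in> U2}"
  by (rule open_ball_Collect[OF _ g(2)]) (auto intro!: continuous_intros)
 moreover have "0 \<in> {om. \<forall>x\<in>closed_segment a b. om * 1 + (c - x) \<in> U2}" using ab(2) by auto
 ultimately obtain e where e: "e > 0" "ball 0 e \<subseteq> {om. \<forall>x\<in>closed_segment a b. om * 1 + (c - x) \<in> U2}"
  using open_contains_ball by meson
 have in2: "c + om - x \<in> U2" if "om \<in> ball 0 (exp (ln e))" "x \<in> closed_segment a b" for om x
 proof -
  have "om * 1 + (c - x) \<in> U2" using e that by auto
  then show ?thesis by (simp add: algebra_simps)
 qed
 have "(%om. contour_integral (linepath a b) (%x. f x * g (c + om - x))) holomorphic_on ball 0 (exp (ln e))"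
 proof (rule holomorphic_contour_integral_param[OF open_ball])
  have 1: "continuous_on (ball 0 (exp (ln e)) \<times> closed_segment a b) (%y. f (snd y))"
   by (rule continuous_on_compose2[OF holomorphic_on_imp_continuous_on[OF f]]) (use ab(1) in \<open>auto intro!: continuous_intros\<close>)
  have 2: "continuous_on (ball 0 (exp (ln e)) \<times> closed_segment a b) (%y. g (c + fst y - snd y))"
   by (rule continuous_on_compose2[OF holomorphic_on_imp_continuous_on[OF g(1)]]) (use in2 in \<open>auto intro!: continuous_intros\<close>)
  show "continuous_on (ball 0 (exp (ln e)) \<times> closed_segment a b) (%(om, x). f x * g (c + om - x))"
   unfolding split_def by (intro continuous_on_mult 1 2)
  show "(%om. f x * g (c + om - x)) holomorphic_on ball 0 (exp (ln e))" if "x \<in> closed_segment a b" for x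
   by (intro holomorphic_on_mult holomorphic_on_const holomorphic_on_compose_gen[OF _ g(1), unfolded o_def])
    (use in2 that in \<open>auto intro!: holomorphic_intros\<close>)
 qed
 then show thesis by (rule that)
qed

lemma contour_integral_triangle:
 assumes "K holomorphic_on W" "open W" "convex hull {a, b, c} \<subseteq> W"
 shows "contour_integral (linepath a b) K + contour_integral (linepath b c) K = contour_integral (linepath a c) K"
proof -
 have seg: "closed_segment a b \<subseteq> W" "closed_segment b c \<subseteq> W" "closed_segment c a \<subseteq> W"
  using subset_trans[OF hull_mono[of "{a, b}" "{a, b, c}"] assms(3)] subset_trans[OF hull_mono[of "{b, c}" "{a, b, c}"] assms(3)]
   subset_trans[OF hull_mono[of "{c, a}" "{a, b, c}"] assms(3)] by (simp_all add: segment_convex_hull)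
 have i: "K contour_integrable_on linepath u v" if "closed_segment u v \<subseteq> W" for u v
  by (rule contour_integrable_holomorphic_simple[OF assms(1,2)]) (use that in auto)
 have "contour_integral (linepath a b +++ linepath b c +++ linepath c a) K = 0"
  by (rule contour_integral_unique[OF Cauchy_theorem_triangle[OF holomorphic_on_subset[OF assms(1,3)]]])
 then have "contour_integral (linepath a b) K + (contour_integral (linepath b c) K + contour_integral (linepath c a) K) = 0"
  using i seg by (simp add: contour_integrable_joinI valid_path_join)
 moreover have "contour_integral (linepath c a) K = - contour_integral (linepath a c) K"
  by (metis contour_integral_reversepath reversepath_linepath valid_path_linepath)
 ultimately show ?thesis by (simp add: algebra_simps add_eq_0_iff)
qed

lemma convex_rectangle: "convex {x::complex. a <= Re x \<and> Re x <= b \<and> c <= Im x \<and> Im x <= d}"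
proof -
 have e: "{x::complex. a <= Re x \<and> Re x <= b \<and> c <= Im x \<and> Im x <= d} = {x. Re x \<ge> a} \<inter> {x. Re x <= b} \<inter> {x. Im x \<ge> c} \<inter> {x. Im x <= d}"
  by auto
 show ?thesis
  unfolding e by (intro convex_Int convex_halfspace_Im_ge convex_halfspace_Im_le convex_halfspace_Re_ge convex_halfspace_Re_le)
qed

text \<open>The runs are compared through a diagonal of the rectangle between the two heights, so
  that Cauchy's theorem for triangles suffices; the verticals are degenerate triangles.\<close>

lemma run_change_height:
 assumes K: "K holomorphic_on W" "open W" and ab: "a <= b"
  and rect: "!!x. a <= Re x ==> Re x <= b ==> min h1 h2 <= Im x ==> Im x <= max h1 h2 ==> x \<in> W"
  and vert: "!!x. Re x = a \<or> Re x = b ==> min 0 (min h1 h2) <= Im x ==> Im x <= max 0 (max h1 h2) ==> x \<in> W"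
 shows "run (of_real a) (of_real b) h1 K = run (of_real a) (of_real b) h2 K"
proof -
 let ?a = "complex_of_real a" and ?b = "complex_of_real b"
 let ?i1 = "\<i> * complex_of_real h1" and ?i2 = "\<i> * complex_of_real h2"
 have hull: "convex hull S \<subseteq> W" if "S \<subseteq> {x. l <= Re x \<and> Re x <= u \<and> c <= Im x \<and> Im x <= d}"
  "{x. l <= Re x \<and> Re x <= u \<and> c <= Im x \<and> Im x <= d} \<subseteq> W" for S l u c d
  using hull_minimal[of S "{x. l <= Re x \<and> Re x <= u \<and> c <= Im x \<and> Im x <= d}" convex, OF that(1) convex_rectangle] that(2) by blast
 have rs: "{x. a <= Re x \<and> Re x <= b \<and> min h1 h2 <= Im x \<and> Im x <= max h1 h2} \<subseteq> W"
  using rect by blast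
 have vs: "{x. a <= Re x \<and> Re x <= a \<and> min 0 (min h1 h2) <= Im x \<and> Im x <= max 0 (max h1 h2)} \<subseteq> W"
  "{x. b <= Re x \<and> Re x <= b \<and> min 0 (min h1 h2) <= Im x \<and> Im x <= max 0 (max h1 h2)} \<subseteq> W"
  using vert by (auto dest: antisym)
 have e1: "contour_integral (linepath ?a (?a + ?i1)) K + contour_integral (linepath (?a + ?i1) (?a + ?i2)) K = contour_integral (linepath ?a (?a + ?i2)) K"
  by (rule contour_integral_triangle[OF K hull[OF _ vs(1)]]) (use ab in \<open>auto simp: min_def max_def\<close>)
 have e2: "contour_integral (linepath (?a + ?i1) (?a + ?i2)) K + contour_integral (linepath (?a + ?i2) (?b + ?i2)) K = contour_integral (linepath (?a + ?i1) (?b + ?i2)) K"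
  by (rule contour_integral_triangle[OF K hull[OF _ rs]]) (use ab in \<open>auto simp: min_def max_def\<close>)
 have e3: "contour_integral (linepath (?a + ?i1) (?b + ?i1)) K + contour_integral (linepath (?b + ?i1) (?b + ?i2)) K = contour_integral (linepath (?a + ?i1) (?b + ?i2)) K"
  by (rule contour_integral_triangle[OF K hull[OF _ rs]]) (use ab in \<open>auto simp: min_def max_def\<close>)
 have e4: "contour_integral (linepath (?b + ?i1) (?b + ?i2)) K + contour_integral (linepath (?b + ?i2) ?b) K = contour_integral (linepath (?b + ?i1) ?b) K"
  by (rule contour_integral_triangle[OF K hull[OF _ vs(2)]]) (use ab in \<open>auto simp: min_def max_def\<close>)
 have "A1 + M1 + B1 = A2 + M2 + B2" if "A1 + D = A2" "D + M2 = X" "M1 + E = X" "E + B2 = B1" for A1 M1 B1 A2 M2 B2 D E X :: complex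
  using that by (auto simp: algebra_simps)
 from this[OF e1 e2 e3 e4] show ?thesis unfolding run_def by (simp add: add.assoc)
qed

text \<open>Induction on the number of exceptional points inside: one of them is enclosed in a short
  interval, and the two remaining intervals contain fewer. It is used for the singular points of one
  ray and again for the rays of one period.\<close>

lemma finite_interval_induct:
 fixes P :: "real => real => bool"
 assumes B: "finite B"
  and base: "!!p q. l <= p ==> p < q ==> q <= u ==> B \<inter> {p..q} = {} ==> P p q"
  and loc: "!!s. s \<in> B ==> l < s ==> s < u ==> \<exists>eps>0. \<forall>\<sigma>. 0 < \<sigma> --> \<sigma> < eps --> P (s - \<sigma>) (s + \<sigma>)"
  and join: "!!p q r. l <= p ==> p < q ==> q < r ==> r <= u ==> q \<notin> B ==> P p q ==> P q r ==> P p r"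
 shows "l <= p ==> p < q ==> q <= u ==> p \<notin> B ==> q \<notin> B ==> P p q"
proof (induction "card (B \<inter> {p<..<q})" arbitrary: p q rule: less_induct)
 case less
 show ?case
 proof (cases "B \<inter> {p<..<q} = {}")
  case True
  have "B \<inter> {p..q} = {}"
  proof (rule ccontr)
   assume "B \<inter> {p..q} ~= {}"
   then obtain x where x: "x \<in> B" "p <= x" "x <= q" by auto
   then have "x ~= p" "x ~= q" using less.prems by auto
   then show False using x True by auto
  qed
  then show ?thesis by (intro base less.prems)
 next
  case False
  then obtain s where s: "s \<in> B" "p < s" "s < q" by auto
  obtain eps where eps: "eps > 0" "!!\<sigma>. 0 < \<sigma> ==> \<sigma> < eps ==> P (s - \<sigma>) (s + \<sigma>)"
   using loc[OF s(1)] s less.prems by auto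
  obtain d where d: "d > 0" "!!x. x \<in> B ==> x ~= s ==> d <= dist s x"
   using finite_set_avoid[OF B, of s] by blast
  define \<sigma> where "\<sigma> = min (min eps d) (min (s - p) (q - s)) / 2"
  have \<sigma>: "0 < \<sigma>" "\<sigma> < eps" "\<sigma> < d" "\<sigma> < s - p" "\<sigma> < q - s" using eps(1) d(1) s by (auto simp: \<sigma>_def min_def)
  have nb: "s - \<sigma> \<notin> B" "s + \<sigma> \<notin> B" using d(2)[of "s - \<sigma>"] d(2)[of "s + \<sigma>"] \<sigma> by (auto simp: dist_real_def)
  have ps: "C \<subset> D" if "C \<subseteq> D" "s \<in> D" "s \<notin> C" for C D using that by blast
  have "P p (s - \<sigma>)"
  proof (rule less.hyps)
   show "card (B \<inter> {p<..<s - \<sigma>}) < card (B \<inter> {p<..<q})" by (intro psubset_card_mono ps) (use B s \<sigma> in auto)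
  qed (use less.prems \<sigma> s nb in auto)
  moreover have "P (s + \<sigma>) q"
  proof (rule less.hyps)
   show "card (B \<inter> {s + \<sigma><..<q}) < card (B \<inter> {p<..<q})" by (intro psubset_card_mono ps) (use B s \<sigma> in auto)
  qed (use less.prems \<sigma> s nb in auto)
  moreover have "P (s - \<sigma>) (s + \<sigma>)" by (rule eps(2)) (use \<sigma> in auto)
  ultimately have "P p (s + \<sigma>)" "P (s + \<sigma>) q"
   using join[of p "s - \<sigma>" "s + \<sigma>"] nb \<sigma> s less.prems by auto
  then show ?thesis using join[of p "s + \<sigma>" q] nb \<sigma> s less.prems by auto
 qed
qed

lemma contour_integral_translate:
 "contour_integral (linepath (a + t) (b + t)) f = contour_integral (linepath a b) (%x. f (x + t))"
 by (simp add: contour_integral_integral linepath_def algebra_simps scaleR_conv_of_real)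

lemma run_translate: "run (p + t) (q + t) h K = run p q h (%x. K (x + t))"
proof -
 have e: "p + t + \<i> * of_real h = (p + \<i> * of_real h) + t" for p by simp
 show ?thesis unfolding run_def e contour_integral_translate ..
qed

lemma run_add:
 assumes K: "K holomorphic_on W" "open W" and abc: "a <= b" "b <= c"
  and W: "!!x. a <= Re x ==> Re x <= c ==> Im x = h ==> x \<in> W"
 shows "run (of_real a) (of_real c) h K = run (of_real a) (of_real b) h K + run (of_real b) (of_real c) h K"
proof -
 let ?a = "complex_of_real a" and ?b = "complex_of_real b" and ?c = "complex_of_real c" and ?h = "\<i> * complex_of_real h"
 have "convex hull {?a + ?h, ?b + ?h, ?c + ?h} \<subseteq> {x. a <= Re x \<and> Re x <= c \<and> h <= Im x \<and> Im x <= h}"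
  by (rule hull_minimal[of _ "{x. a <= Re x \<and> Re x <= c \<and> h <= Im x \<and> Im x <= h}" convex, OF _ convex_rectangle]) (use abc in auto)
 also have "\<dots> \<subseteq> W" using W by (auto dest: antisym)
 finally have 1: "contour_integral (linepath (?a + ?h) (?b + ?h)) K + contour_integral (linepath (?b + ?h) (?c + ?h)) K
   = contour_integral (linepath (?a + ?h) (?c + ?h)) K"
  by (rule contour_integral_triangle[OF K])
 have 2: "contour_integral (linepath (?b + ?h) ?b) K = - contour_integral (linepath ?b (?b + ?h)) K"
  by (metis contour_integral_reversepath reversepath_linepath valid_path_linepath)
 show ?thesis unfolding run_def 1[symmetric] 2 by simp
qed

lemma real_segment_nbhd:
 assumes "open U" "!!x. p <= x ==> x <= q ==> complex_of_real x \<in> U"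
 obtains eps where "eps > 0" "!!z. p <= Re z ==> Re z <= q ==> \<bar>Im z\<bar> < eps ==> z \<in> U"
  "!!x z. p <= x ==> x <= q ==> norm z < eps ==> of_real x + z \<in> U"
proof -
 have "compact (complex_of_real ` {p..q})" by (intro compact_continuous_image continuous_intros) auto
 moreover have "complex_of_real ` {p..q} \<subseteq> U" using assms(2) by auto
 ultimately obtain eps where eps: "eps > 0" "(\<Union>x\<in>complex_of_real ` {p..q}. ball x eps) \<subseteq> U"
  using compact_subset_open_imp_ball_epsilon_subset[OF _ assms(1)] by blast
 have *: "of_real x + z \<in> U" if "p <= x" "x <= q" "norm z < eps" for x z
 proof -
  have "of_real x + z \<in> ball (of_real x) eps" using that by (simp add: dist_norm)
  then show ?thesis using eps(2) that(1,2) by fastforce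
 qed
 show thesis
 proof (rule that[OF eps(1) _ *])
  fix z assume "p <= Re z" "Re z <= q" "\<bar>Im z\<bar> < eps"
  then show "z \<in> U" using *[of "Re z" "\<i> * of_real (Im z)"] by (simp add: norm_mult complex_eq[symmetric])
 qed
qed

text \<open>At the fixed height \<open>\<kappa>\<close> the contour no longer depends on om and
  avoids the singularities of both factors, so the integral is holomorphic in om near 0; for
  \<open>Im om > 0\<close> it equals the original run.\<close>

lemma run_push:
 assumes mono: "LP_mono LP" and f: "f holomorphic_on U1" "open U1" and g: "g holomorphic_on U2" "open U2" and ab: "a <= b"
  and h: "!!om x. 0 < Im om ==> norm om < exp r0 ==> a <= Re x ==> Re x <= b ==> min (Im om / 2) \<kappa> <= Im x ==> Im x <= max (Im om / 2) \<kappa> ==> x \<in> U1 \<and> c + om - x \<in> U2"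
  and v: "!!om x. 0 < Im om ==> norm om < exp r0 ==> Re x = a \<or> Re x = b ==> min 0 (min (Im om / 2) \<kappa>) <= Im x ==> Im x <= max 0 (max (Im om / 2) \<kappa>) ==> x \<in> U1 \<and> c + om - x \<in> U2"
  and z: "!!x. a <= Re x ==> Re x <= b ==> min 0 \<kappa> <= Im x ==> Im x <= max 0 \<kappa> ==> Re x = a \<or> Re x = b \<or> Im x = \<kappa> ==> x \<in> U1 \<and> c - x \<in> U2"
 shows "pinch_sum LP {} (%om. run (of_real a) (of_real b) (Im om / 2) (%x. f x * g (c + om - x)))"
proof -
 let ?a = "complex_of_real a" and ?b = "complex_of_real b" and ?k = "\<i> * complex_of_real \<kappa>"
 have s: "closed_segment u w \<subseteq> {x. l <= Re x \<and> Re x <= u' \<and> i <= Im x \<and> Im x <= j}"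
  if "{u, w} \<subseteq> {x. l <= Re x \<and> Re x <= u' \<and> i <= Im x \<and> Im x <= j}" for u w l u' i j
  using closed_segment_subset[OF _ _ convex_rectangle] that by blast
 have s1: "closed_segment ?a (?a + ?k) \<subseteq> {x. a <= Re x \<and> Re x <= a \<and> min 0 \<kappa> <= Im x \<and> Im x <= max 0 \<kappa>}" by (rule s) auto
 have s2: "closed_segment (?a + ?k) (?b + ?k) \<subseteq> {x. a <= Re x \<and> Re x <= b \<and> \<kappa> <= Im x \<and> Im x <= \<kappa>}" by (rule s) (use ab in auto)
 have s3: "closed_segment (?b + ?k) ?b \<subseteq> {x. b <= Re x \<and> Re x <= b \<and> min 0 \<kappa> <= Im x \<and> Im x <= max 0 \<kappa>}" by (rule s) auto
 have z1: "x \<in> U1 \<and> c - x \<in> U2" if "x \<in> closed_segment ?a (?a + ?k)" for x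
  by (rule z) (use s1 that ab in auto)
 have z2: "x \<in> U1 \<and> c - x \<in> U2" if "x \<in> closed_segment (?a + ?k) (?b + ?k)" for x
  by (rule z) (use s2 that ab in auto)
 have z3: "x \<in> U1 \<and> c - x \<in> U2" if "x \<in> closed_segment (?b + ?k) ?b" for x
  by (rule z) (use s3 that ab in auto)
 obtain r1 where r1: "(%om. contour_integral (linepath ?a (?a + ?k)) (%x. f x * g (c + om - x))) holomorphic_on ball 0 (exp r1)"
  by (rule segment_param_holomorphic[OF f(1) g, of ?a "?a + ?k" c]) (use z1 in auto)
 obtain r2 where r2: "(%om. contour_integral (linepath (?a + ?k) (?b + ?k)) (%x. f x * g (c + om - x))) holomorphic_on ball 0 (exp r2)"
  by (rule segment_param_holomorphic[OF f(1) g, of "?a + ?k" "?b + ?k" c]) (use z2 in auto)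
 obtain r3 where r3: "(%om. contour_integral (linepath (?b + ?k) ?b) (%x. f x * g (c + om - x))) holomorphic_on ball 0 (exp r3)"
  by (rule segment_param_holomorphic[OF f(1) g, of "?b + ?k" ?b c]) (use z3 in auto)
 have "(%om. run ?a ?b \<kappa> (%x. f x * g (c + om - x))) holomorphic_on ball 0 (exp (min r1 (min r2 r3)))"
  unfolding run_def
  by (intro holomorphic_on_add holomorphic_on_subset[OF r1] holomorphic_on_subset[OF r2] holomorphic_on_subset[OF r3] subset_ball) auto
 then have "pinch_sum LP {} (%om. run ?a ?b \<kappa> (%x. f x * g (c + om - x)))" by (rule pinch_sum_holomorphic)
 then show ?thesis
 proof (rule pinch_sum_cong[OF mono])
  fix om :: complex assume om: "0 < Im om" "norm om < exp r0"
  let ?W = "U1 \<inter> (%x. c + om - x) -` U2"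
  have W: "open ?W" by (intro open_Int f(2) open_vimage g(2) continuous_intros)
  have K: "(%x. f x * g (c + om - x)) holomorphic_on ?W"
   by (intro holomorphic_on_mult holomorphic_on_subset[OF f(1)] holomorphic_on_compose_gen[OF _ g(1), unfolded o_def])
    (auto intro!: holomorphic_intros)
  show "run ?a ?b (Im om / 2) (%x. f x * g (c + om - x)) = run ?a ?b \<kappa> (%x. f x * g (c + om - x))"
   by (rule run_change_height[OF K W ab]) (use h[OF om] v[OF om] in auto)
 qed
qed

section \<open>Runs along one ray\<close>

text \<open>A function seen from above a line: defined in a strip above it and extended to the
  points of the line outside \<open>B\<close>, including those which lie behind a point of
  \<open>B\<close>.\<close>

definition line_dom :: "(complex => complex) => complex set => real set => real => real => real => bool" where
 "line_dom f U B \<delta> l u \<longleftrightarrow> open U \<and> f holomorphic_on U \<and> \<delta> > 0 \<and>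
  (\<forall>x. 0 < Im x --> Im x < \<delta> --> l < Re x --> Re x < u --> x \<in> U) \<and>
  (\<forall>x. l < x --> x < u --> x \<notin> B --> of_real x \<in> U)"

text \<open>The singularities of the first factor are on the real axis, those of the second at
  height \<open>Im om\<close>, and the run passes between them. If the second factor has none over
  the interval, the run is pushed up; if the first has none, it is pushed down.\<close>

lemma run_unmatched:
 assumes mono: "LP_mono LP" and f: "line_dom f U1 B1 \<delta> l u" and g: "line_dom g U2 B2 \<delta> (c - u) (c - l)"
  and ab: "l < a" "a <= b" "b < u"
  and good: "a \<notin> B1" "b \<notin> B1" "c - a \<notin> B2" "c - b \<notin> B2"
  and un: "(\<forall>x\<in>{a..b}. c - x \<notin> B2) \<or> (\<forall>x\<in>{a..b}. x \<notin> B1)"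
 shows "pinch_sum LP {} (%om. run (of_real a) (of_real b) (Im om / 2) (%x. f x * g (of_real c + om - x)))"
proof -
 have f': "open U1" "f holomorphic_on U1" "\<delta> > 0" "!!x. 0 < Im x ==> Im x < \<delta> ==> l < Re x ==> Re x < u ==> x \<in> U1"
  "!!x. l < x ==> x < u ==> x \<notin> B1 ==> of_real x \<in> U1" using f by (auto simp: line_dom_def)
 have g': "open U2" "g holomorphic_on U2" "!!x. 0 < Im x ==> Im x < \<delta> ==> c - u < Re x ==> Re x < c - l ==> x \<in> U2"
  "!!x. c - u < x ==> x < c - l ==> x \<notin> B2 ==> of_real x \<in> U2" using g by (auto simp: line_dom_def)
 have split: "of_real c + om - x = of_real (c - Re x) + (om - \<i> * of_real (Im x))" for om x
  by (simp add: complex_eq_iff)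
 have nrm: "norm (om - \<i> * of_real (Im x)) < 2 * \<kappa>" if "norm om < \<kappa>" "\<bar>Im x\<bar> <= \<kappa>" for om x \<kappa>
  using norm_triangle_ineq4[of om "\<i> * of_real (Im x)"] that by (simp add: norm_mult)
 have gn: "\<exists>eps>0. \<forall>x om. p <= Re x --> Re x <= q --> norm (om - \<i> * of_real (Im x)) < eps --> of_real c + om - x \<in> U2"
  if "\<forall>x\<in>{p..q}. c - x \<notin> B2" "l < p" "q < u" for p q
 proof -
  have "complex_of_real x \<in> U2" if x: "c - q <= x" "x <= c - p" for x
   using \<open>\<forall>x\<in>{p..q}. c - x \<notin> B2\<close> x \<open>l < p\<close> \<open>q < u\<close> by (intro g'(4)) (auto dest: bspec[of _ _ "c - x"])
  from real_segment_nbhd[OF g'(1) this] obtain eps where eps: "eps > 0"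
   "!!x z. c - q <= x ==> x <= c - p ==> norm z < eps ==> of_real x + z \<in> U2" by metis
  show ?thesis
  proof (intro exI[of _ eps] conjI allI impI eps(1))
   fix x om assume "p <= Re x" "Re x <= q" "norm (om - \<i> * of_real (Im x)) < eps"
   then show "of_real c + om - x \<in> U2" unfolding split by (intro eps(2)) auto
  qed
 qed
 have fn: "\<exists>eps>0. \<forall>x. p <= Re x --> Re x <= q --> \<bar>Im x\<bar> < eps --> x \<in> U1"
  if "\<forall>x\<in>{p..q}. x \<notin> B1" "l < p" "q < u" for p q
 proof -
  have "complex_of_real x \<in> U1" if x: "p <= x" "x <= q" for x
   using \<open>\<forall>x\<in>{p..q}. x \<notin> B1\<close> x \<open>l < p\<close> \<open>q < u\<close> by (intro f'(5)) auto
  from real_segment_nbhd[OF f'(1) this] show ?thesis by metis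
 qed
 obtain epsa where epsa: "epsa > 0" "!!x. Re x = a ==> \<bar>Im x\<bar> < epsa ==> x \<in> U1" using fn[of a a] good ab by auto
 obtain epsb where epsb: "epsb > 0" "!!x. Re x = b ==> \<bar>Im x\<bar> < epsb ==> x \<in> U1" using fn[of b b] good ab by auto
 obtain \<eta>a where \<eta>a: "\<eta>a > 0" "!!x om. Re x = a ==> norm (om - \<i> * of_real (Im x)) < \<eta>a ==> of_real c + om - x \<in> U2" using gn[of a a] good ab by auto
 obtain \<eta>b where \<eta>b: "\<eta>b > 0" "!!x om. Re x = b ==> norm (om - \<i> * of_real (Im x)) < \<eta>b ==> of_real c + om - x \<in> U2" using gn[of b b] good ab by auto
 from un show ?thesis
 proof
  assume "\<forall>x\<in>{a..b}. c - x \<notin> B2"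
  then obtain eps where eps: "eps > 0" "!!x om. a <= Re x ==> Re x <= b ==> norm (om - \<i> * of_real (Im x)) < eps ==> of_real c + om - x \<in> U2"
   using gn[of a b] ab by auto
  \<comment> \<open>A third of each bound, since the distance in \<open>nrm\<close> can be as large
    as \<open>2 * \<kappa>\<close>.\<close>
  define \<kappa> where "\<kappa> = min (min \<delta> eps) (min epsa epsb) / 3"
  have \<kappa>: "\<kappa> > 0" "\<kappa> < \<delta>" "2 * \<kappa> < eps" "\<kappa> < epsa" "\<kappa> < epsb"
   using f'(3) eps(1) epsa(1) epsb(1) by (auto simp: \<kappa>_def min_def)
  have Q1: "x \<in> U1" if "a <= Re x" "Re x <= b" "0 < Im x" "Im x <= \<kappa>" for x
   by (rule f'(4)) (use that ab \<kappa> in auto)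
  have Q2: "x \<in> U1" if "Re x = a \<or> Re x = b" "0 <= Im x" "Im x <= \<kappa>" for x
   using epsa(2)[of x] epsb(2)[of x] that \<kappa> by auto
  have Q3: "of_real c + om - x \<in> U2" if "a <= Re x" "Re x <= b" "norm om < \<kappa>" "0 <= Im x" "Im x <= \<kappa>" for x om
   by (rule eps(2)) (use that nrm[of om \<kappa> x] \<kappa> in auto)
  have Q30: "of_real c - x \<in> U2" if "a <= Re x" "Re x <= b" "0 <= Im x" "Im x <= \<kappa>" for x
   using Q3[of x 0] that \<kappa>(1) by simp
  show ?thesis
  proof (rule run_push[OF mono f'(2,1) g'(2,1) ab(2), of "ln \<kappa>" \<kappa>])
   fix om x :: complex assume w: "0 < Im om" "norm om < exp (ln \<kappa>)"
   then have w': "norm om < \<kappa>" "Im om / 2 < \<kappa>" using \<kappa>(1) abs_Im_le_cmod[of om] by auto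
   { assume "a <= Re x" "Re x <= b" "min (Im om / 2) \<kappa> <= Im x" "Im x <= max (Im om / 2) \<kappa>"
    then show "x \<in> U1 \<and> of_real c + om - x \<in> U2" using w w' by (intro conjI Q1 Q3) auto }
   { assume "Re x = a \<or> Re x = b" "min 0 (min (Im om / 2) \<kappa>) <= Im x" "Im x <= max 0 (max (Im om / 2) \<kappa>)"
    then show "x \<in> U1 \<and> of_real c + om - x \<in> U2" using w w' \<kappa> ab by (intro conjI Q2 Q3) auto }
  next
   fix x assume x: "a <= Re x" "Re x <= b" "min 0 \<kappa> <= Im x" "Im x <= max 0 \<kappa>" "Re x = a \<or> Re x = b \<or> Im x = \<kappa>"
   then have "x \<in> U1" using \<kappa>(1) Q1[of x] Q2[of x] by auto
   moreover have "of_real c - x \<in> U2" using x \<kappa>(1) by (intro Q30) auto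
   ultimately show "x \<in> U1 \<and> of_real c - x \<in> U2" ..
  qed
 next
  assume "\<forall>x\<in>{a..b}. x \<notin> B1"
  then obtain eps where eps: "eps > 0" "!!x. a <= Re x ==> Re x <= b ==> \<bar>Im x\<bar> < eps ==> x \<in> U1"
   using fn[of a b] ab by auto
  define \<kappa> where "\<kappa> = min (min \<delta> eps) (min (min \<eta>a \<eta>b) (min (a - l) (u - b))) / 3"
  have \<kappa>: "\<kappa> > 0" "2 * \<kappa> < \<delta>" "\<kappa> < eps" "2 * \<kappa> < \<eta>a" "2 * \<kappa> < \<eta>b" "\<kappa> < a - l" "\<kappa> < u - b"
   using f'(3) eps(1) \<eta>a(1) \<eta>b(1) ab by (auto simp: \<kappa>_def min_def)
  have R1: "x \<in> U1" if "a <= Re x" "Re x <= b" "\<bar>Im x\<bar> <= \<kappa>" for x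
   by (rule eps(2)) (use that \<kappa> in auto)
  have R2: "of_real c + om - x \<in> U2" if "a <= Re x" "Re x <= b" "\<bar>Im x\<bar> <= \<kappa>" "norm om < \<kappa>" "Im x < Im om" for x om
  proof (rule g'(3))
   have "\<bar>Re om\<bar> < \<kappa>" "\<bar>Im om\<bar> < \<kappa>" using abs_Re_le_cmod[of om] abs_Im_le_cmod[of om] that(4) by auto
   then show "0 < Im (of_real c + om - x)" "Im (of_real c + om - x) < \<delta>" "c - u < Re (of_real c + om - x)" "Re (of_real c + om - x) < c - l"
    using that \<kappa> by auto
  qed
  have R3: "of_real c + om - x \<in> U2" if "Re x = a \<or> Re x = b" "\<bar>Im x\<bar> <= \<kappa>" "norm om < \<kappa>" for x om
   using \<eta>a(2)[of x om] \<eta>b(2)[of x om] nrm[of om \<kappa> x] that \<kappa> by auto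
  show ?thesis
  proof (rule run_push[OF mono f'(2,1) g'(2,1) ab(2), of "ln \<kappa>" "- \<kappa>"])
   fix om x :: complex assume w: "0 < Im om" "norm om < exp (ln \<kappa>)"
   then have w': "norm om < \<kappa>" "Im om / 2 < \<kappa>" using \<kappa>(1) abs_Im_le_cmod[of om] by auto
   { assume "a <= Re x" "Re x <= b" "min (Im om / 2) (- \<kappa>) <= Im x" "Im x <= max (Im om / 2) (- \<kappa>)"
    then show "x \<in> U1 \<and> of_real c + om - x \<in> U2" using w w' \<kappa>(1) by (intro conjI R1 R2) auto }
   { assume "Re x = a \<or> Re x = b" "min 0 (min (Im om / 2) (- \<kappa>)) <= Im x" "Im x <= max 0 (max (Im om / 2) (- \<kappa>))"
    then show "x \<in> U1 \<and> of_real c + om - x \<in> U2" using w w' \<kappa> ab by (intro conjI R1 R2) auto }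
  next
   fix x assume x: "a <= Re x" "Re x <= b" "min 0 (- \<kappa>) <= Im x" "Im x <= max 0 (- \<kappa>)" "Re x = a \<or> Re x = b \<or> Im x = - \<kappa>"
   have "x \<in> U1" using x \<kappa>(1) by (intro R1) auto
   moreover have "of_real c + 0 - x \<in> U2"
   proof (cases "Im x = - \<kappa>")
    case True then show ?thesis using x \<kappa>(1) by (intro R2) auto
   next
    case False then show ?thesis using x \<kappa>(1) by (intro R3) auto
   qed
   ultimately show "x \<in> U1 \<and> of_real c - x \<in> U2" by simp
  qed
 qed
qed

text \<open>Around a point that is singular for one factor only, a short interval is still
  unmatched, so only the matched points contribute terms. \<open>m\<close> labels the pinches;
  injectivity keeps the labels of adjoining intervals disjoint.\<close>

lemma run_pinch_sum:
 assumes mono: "LP_mono LP" and f: "line_dom f U1 B1 \<delta> l u" and g: "line_dom g U2 B2 \<delta> (c - u) (c - l)"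
  and fin: "finite B1" "finite B2" and inj: "inj m"
  and matched: "!!s. s \<in> B1 ==> c - s \<in> B2 ==> l < s ==> s < u ==> \<exists>eps>0. \<forall>\<sigma>. 0 < \<sigma> --> \<sigma> < eps -->
   pinch_sum LP {m s} (%om. run (of_real (s - \<sigma>)) (of_real (s + \<sigma>)) (Im om / 2) (%x. f x * g (of_real c + om - x)))"
  and pq: "l < p" "p < q" "q < u" and good: "p \<notin> B1" "q \<notin> B1" "c - p \<notin> B2" "c - q \<notin> B2"
 shows "pinch_sum LP (m ` {s. p < s \<and> s < q \<and> s \<in> B1 \<and> c - s \<in> B2})
  (%om. run (of_real p) (of_real q) (Im om / 2) (%x. f x * g (of_real c + om - x)))"
proof -
 let ?B = "B1 \<union> (%y. c - y) ` B2"
 have B: "x \<in> ?B \<longleftrightarrow> x \<in> B1 \<or> c - x \<in> B2" for x by force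
 define P where "P p q = pinch_sum LP (m ` {s. p < s \<and> s < q \<and> s \<in> B1 \<and> c - s \<in> B2})
  (%om. run (of_real p) (of_real q) (Im om / 2) (%x. f x * g (of_real c + om - x)))" for p q
 have "P p q"
 proof (rule finite_interval_induct[of ?B p q P])
  show "finite ?B" using fin by auto
 next
  fix a b assume ab: "p <= a" "a < b" "b <= q" "?B \<inter> {a..b} = {}"
  have nb: "x \<notin> B1" "c - x \<notin> B2" if "x \<in> {a..b}" for x using ab(4) that B[of x] by blast+
  have "{s. a < s \<and> s < b \<and> s \<in> B1 \<and> c - s \<in> B2} = {}" using nb by fastforce
  moreover have "pinch_sum LP {} (%om. run (of_real a) (of_real b) (Im om / 2) (%x. f x * g (of_real c + om - x)))"
   by (rule run_unmatched[OF mono f g]) (use ab pq nb in auto)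
  ultimately show "P a b" unfolding P_def by (simp only: image_empty)
 next
  fix s assume s: "s \<in> ?B" "p < s" "s < q"
  obtain d where d: "d > 0" "!!x. x \<in> ?B ==> x ~= s ==> d <= dist s x"
   using finite_set_avoid[of ?B s] fin by blast
  have nb: "x \<notin> B1" "c - x \<notin> B2" if "\<bar>x - s\<bar> < d" "x ~= s" for x
   using d(2)[of x] B[of x] that by (auto simp: dist_real_def)
  show "\<exists>eps>0. \<forall>\<sigma>. 0 < \<sigma> --> \<sigma> < eps --> P (s - \<sigma>) (s + \<sigma>)"
  proof (cases "s \<in> B1 \<and> c - s \<in> B2")
   case True
   then obtain eps where eps: "eps > 0" "!!\<sigma>. 0 < \<sigma> ==> \<sigma> < eps ==>
    pinch_sum LP {m s} (%om. run (of_real (s - \<sigma>)) (of_real (s + \<sigma>)) (Im om / 2) (%x. f x * g (of_real c + om - x)))"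
    using matched[of s] s pq by auto
   have "P (s - \<sigma>) (s + \<sigma>)" if \<sigma>: "0 < \<sigma>" "\<sigma> < min eps d" for \<sigma>
   proof -
    have "x = s" if "s - \<sigma> < x" "x < s + \<sigma>" "x \<in> B1" for x by (rule ccontr) (use nb(1)[of x] that \<sigma> in \<open>auto simp: abs_less_iff\<close>)
    then have "{x. s - \<sigma> < x \<and> x < s + \<sigma> \<and> x \<in> B1 \<and> c - x \<in> B2} = {s}" using True \<sigma> by auto
    then show ?thesis unfolding P_def using eps(2)[of \<sigma>] \<sigma> by simp
   qed
   then show ?thesis using eps(1) d(1) by (intro exI[of _ "min eps d"]) auto
  next
   case False
   have "P (s - \<sigma>) (s + \<sigma>)" if \<sigma>: "0 < \<sigma>" "\<sigma> < min d (min (s - p) (q - s))" for \<sigma>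
   proof -
    have "\<bar>x - s\<bar> < d" if "s - \<sigma> <= x" "x <= s + \<sigma>" for x using that \<sigma> by (simp add: abs_less_iff)
    then have nb': "x \<notin> B1" "c - x \<notin> B2" if "s - \<sigma> <= x" "x <= s + \<sigma>" "x ~= s" for x using nb that by auto
    have "x \<notin> B1 \<or> c - x \<notin> B2" if "s - \<sigma> < x" "x < s + \<sigma>" for x using nb'[of x] False that by (cases "x = s") auto
    then have e: "{x. s - \<sigma> < x \<and> x < s + \<sigma> \<and> x \<in> B1 \<and> c - x \<in> B2} = {}" by blast
    have "pinch_sum LP {} (%om. run (of_real (s - \<sigma>)) (of_real (s + \<sigma>)) (Im om / 2) (%x. f x * g (of_real c + om - x)))"
    proof (rule run_unmatched[OF mono f g])
     show "(\<forall>x\<in>{s - \<sigma>..s + \<sigma>}. c - x \<notin> B2) \<or> (\<forall>x\<in>{s - \<sigma>..s + \<sigma>}. x \<notin> B1)"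
      using False nb' by (metis atLeastAtMost_iff)
    qed (use \<sigma> pq nb'[of "s - \<sigma>"] nb'[of "s + \<sigma>"] in auto)
    then show ?thesis unfolding P_def e by simp
   qed
   then show ?thesis using d(1) s by (intro exI[of _ "min d (min (s - p) (q - s))"]) auto
  qed
 next
  fix a b d assume ab: "p <= a" "a < b" "b < d" "d <= q" "b \<notin> ?B" "P a b" "P b d"
  let ?S = "%p q. {s. p < s \<and> s < q \<and> s \<in> B1 \<and> c - s \<in> B2}"
  have "b \<notin> B1" using ab(5) by auto
  then have S: "?S a d = ?S a b \<union> ?S b d" using ab(2,3) by (auto simp: not_less_iff_gr_or_eq)
  have "m ` ?S a b \<inter> m ` ?S b d = m ` (?S a b \<inter> ?S b d)" by (rule image_Int[OF inj, symmetric])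
  also have "?S a b \<inter> ?S b d = {}" by auto
  finally have D: "m ` ?S a b \<inter> m ` ?S b d = {}" by simp
  note J = pinch_sum_add[OF mono ab(6,7)[unfolded P_def] D]
  show "P a d" unfolding P_def S image_Un
  proof (rule pinch_sum_cong[OF mono J, of "ln (min \<delta> (min (p - l) (u - q)))"])
   fix om :: complex assume "0 < Im om" and n: "norm om < exp (ln (min \<delta> (min (p - l) (u - q))))"
   have f': "open U1" "f holomorphic_on U1" "\<delta> > 0" "!!x. 0 < Im x ==> Im x < \<delta> ==> l < Re x ==> Re x < u ==> x \<in> U1"
    using f by (auto simp: line_dom_def)
   have g': "open U2" "g holomorphic_on U2" "!!x. 0 < Im x ==> Im x < \<delta> ==> c - u < Re x ==> Re x < c - l ==> x \<in> U2"
    using g by (auto simp: line_dom_def)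
   have n': "norm om < \<delta>" "norm om < p - l" "norm om < u - q" using n f'(3) pq by auto
   let ?W = "U1 \<inter> (%x. of_real c + om - x) -` U2"
   have W: "open ?W" by (intro open_Int f'(1) open_vimage g'(1) continuous_intros)
   have K: "(%x. f x * g (of_real c + om - x)) holomorphic_on ?W"
    by (intro holomorphic_on_mult holomorphic_on_subset[OF f'(2)] holomorphic_on_compose_gen[OF _ g'(2), unfolded o_def])
     (auto intro!: holomorphic_intros)
   have inW: "x \<in> ?W" if "a <= Re x" "Re x <= d" "Im x = Im om / 2" for x
   proof -
    have "\<bar>Re om\<bar> <= norm om" "\<bar>Im om\<bar> <= norm om" by (rule abs_Re_le_cmod, rule abs_Im_le_cmod)
    then have "x \<in> U1" "of_real c + om - x \<in> U2"
     using that n' \<open>0 < Im om\<close> ab pq by (auto intro!: f'(4) g'(3))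
    then show ?thesis by auto
   qed
   show "run (of_real a) (of_real d) (Im om / 2) (%x. f x * g (of_real c + om - x)) =
     run (of_real a) (of_real b) (Im om / 2) (%x. f x * g (of_real c + om - x)) +
     run (of_real b) (of_real d) (Im om / 2) (%x. f x * g (of_real c + om - x))"
    by (rule run_add[OF K W _ _ inW]) (use ab in auto)
  qed
 qed (use pq good B in auto)
 then show ?thesis by (simp add: P_def)
qed

section \<open>Principal branches in the logarithmic coordinate\<close>

lemma finite_exp_preimage:
 assumes "finite T"
 shows "finite {x::complex. exp x \<in> T \<and> a <= Im x \<and> Im x <= b}"
proof -
 have "finite {x::complex. exp x = \<alpha> \<and> a <= Im x \<and> Im x <= b}" for \<alpha>
 proof (cases "{x::complex. exp x = \<alpha> \<and> a <= Im x \<and> Im x <= b} = {}")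
  case False
  then obtain x0 where x0: "exp x0 = \<alpha>" "a <= Im x0" "Im x0 <= b" by auto
  define N where "N = \<lceil>b - a\<rceil>"
  have "{x::complex. exp x = \<alpha> \<and> a <= Im x \<and> Im x <= b} \<subseteq> (%n::int. x0 + (of_int (2 * n) * pi) * \<i>) ` {- N..N}"
  proof
   fix x assume "x \<in> {x::complex. exp x = \<alpha> \<and> a <= Im x \<and> Im x <= b}"
   then have x: "exp x = exp x0" "a <= Im x" "Im x <= b" using x0(1) by auto
   obtain n :: int where n: "x = x0 + (of_int (2 * n) * pi) * \<i>" using x(1) unfolding exp_eq by blast
   have "\<bar>of_int n * (2 * pi)\<bar> <= b - a" using x x0 unfolding n by auto
   moreover have "\<bar>of_int n\<bar> * 1 <= \<bar>of_int n\<bar> * (2 * pi)" using pi_ge_two by (intro mult_left_mono) auto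
   ultimately have "\<bar>real_of_int n\<bar> <= b - a" by (simp add: abs_mult)
   then have "\<bar>n\<bar> <= N" unfolding N_def by linarith
   then show "x \<in> (%n::int. x0 + (of_int (2 * n) * pi) * \<i>) ` {- N..N}" using n by (intro image_eqI[of _ _ n]) (auto simp: abs_le_iff)
  qed
  then show ?thesis by (rule finite_subset) simp
 qed (simp only: finite.emptyI)
 then have "finite (\<Union>\<alpha>\<in>T. {x::complex. exp x = \<alpha> \<and> a <= Im x \<and> Im x <= b})" using assms by blast
 then show ?thesis by (rule finite_subset[rotated]) auto
qed

lemma finite_log_singularities:
 assumes "finite (singularities F \<inter> cball 0 (exp A))"
 shows "finite {x. exp x \<in> singularities F \<and> Re x <= A \<and> a <= Im x \<and> Im x <= b}"
 by (rule finite_subset[OF _ finite_exp_preimage[OF assms, of a b]]) auto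

text \<open>In the coordinate \<open>x\<close> the segment from 0 to \<open>exp x\<close> is the
  half-line to the left of \<open>x\<close>, and a point outside the star has a singularity on its
  segment.\<close>

lemma exp_in_star:
 assumes F: "fps_conv_radius F > 0" and "!!s. s <= Re x ==> exp (Complex s (Im x)) \<notin> singularities F"
 shows "exp x \<in> star F"
proof (rule ccontr)
 assume "exp x \<notin> star F"
 then obtain t where t: "0 < t" "t <= 1" "complex_of_real t * exp x \<in> singularities F"
  by (rule not_in_star_singular[OF F]) blast
 have "complex_of_real t * exp x = exp (Complex (ln t + Re x) (Im x))"
  using t(1) by (simp add: exp_eq_polar exp_add mult.assoc)
 moreover have "ln t + Re x <= Re x" using t by simp
 ultimately show False using assms(2)[of "ln t + Re x"] t(3) by simp
qed

text \<open>Discs centred on the real axis are symmetric: if two of them overlap, the overlap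
  contains a real point and hence points of the upper half-plane, where both extensions equal
  \<open>P\<close>. The local extensions therefore glue to one function.\<close>

lemma extend_across_reals:
 assumes P: "P holomorphic_on S" "open S" "!!z. z \<in> S ==> 0 < Im z"
  and loc: "!!x. x \<in> X ==> \<exists>\<rho>>0. \<exists>\<phi>. \<phi> holomorphic_on ball (complex_of_real x) \<rho> \<and>
   (\<forall>z\<in>ball (complex_of_real x) \<rho>. 0 < Im z --> z \<in> S \<and> \<phi> z = P z)"
 obtains U f where "open U" "f holomorphic_on U" "S \<subseteq> U" "complex_of_real ` X \<subseteq> U"
  "!!z. z \<in> U ==> 0 < Im z ==> z \<in> S \<and> f z = P z"
proof -
 obtain \<rho> \<phi> where \<rho>: "!!x. x \<in> X ==> \<rho> x > 0" "!!x. x \<in> X ==> \<phi> x holomorphic_on ball (complex_of_real x) (\<rho> x)"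
  "!!x z. x \<in> X ==> z \<in> ball (complex_of_real x) (\<rho> x) ==> 0 < Im z ==> z \<in> S \<and> \<phi> x z = P z"
  using loc by metis
 let ?B = "%x. ball (complex_of_real x) (\<rho> x)"
 have consistent: "\<phi> x z = \<phi> y z" if x: "x \<in> X" "z \<in> ?B x" and y: "y \<in> X" "z \<in> ?B y" for x y z
 proof -
  let ?W = "?B x \<inter> ?B y"
  have W: "open ?W" "connected ?W" by (auto intro!: convex_connected convex_Int)
  have "dist (complex_of_real a) (of_real (Re z)) <= dist (complex_of_real a) z" for a
  proof -
   have "dist (complex_of_real a) (of_real (Re z)) = \<bar>Re (of_real a - z)\<bar>" by (simp add: dist_norm flip: of_real_diff)
   also have "\<dots> <= dist (complex_of_real a) z" unfolding dist_norm by (rule abs_Re_le_cmod)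
   finally show ?thesis .
  qed
  then have "of_real (Re z) \<in> ?W" using x(2) y(2) by (auto intro: le_less_trans)
  then obtain e where e: "e > 0" "ball (of_real (Re z)) e \<subseteq> ?W" using W(1) open_contains_ball by meson
  have "of_real (Re z) + \<i> * of_real (e / 2) \<in> ball (complex_of_real (Re z)) e" using e(1) by (simp add: dist_norm norm_mult)
  then have "of_real (Re z) + \<i> * of_real (e / 2) \<in> ?W" using e(2) by blast
  moreover have "0 < Im (of_real (Re z) + \<i> * of_real (e / 2))" using e(1) by simp
  ultimately have "of_real (Re z) + \<i> * of_real (e / 2) \<in> ?W \<inter> {z. 0 < Im z}" by blast
  then have ne: "?W \<inter> {z. 0 < Im z} ~= {}" by (metis empty_iff)
  show ?thesis
  proof (rule analytic_continuation_open[of "?W \<inter> {z. 0 < Im z}" ?W "\<phi> x" "\<phi> y"])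
   show "open (?W \<inter> {z. 0 < Im z})" by (intro open_Int W(1) open_halfspace_Im_gt)
   show "\<phi> x holomorphic_on ?W" "\<phi> y holomorphic_on ?W" using \<rho>(2) x(1) y(1) by (auto intro: holomorphic_on_subset)
  qed (use W ne x y \<rho>(3) in auto)
 qed
 define f where "f z = (if z \<in> S then P z else \<phi> (SOME x. x \<in> X \<and> z \<in> ?B x) z)" for z
 have fB: "f z = \<phi> x z" if x: "x \<in> X" "z \<in> ?B x" for x z
 proof (cases "z \<in> S")
  case True
  then show ?thesis using \<rho>(3)[OF x] P(3) by (simp add: f_def)
 next
  case False
  have sm: "(SOME x. x \<in> X \<and> z \<in> ?B x) \<in> X \<and> z \<in> ?B (SOME x. x \<in> X \<and> z \<in> ?B x)"
   by (rule someI[of "%x. x \<in> X \<and> z \<in> ?B x" x]) (use x in auto)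
  show ?thesis unfolding f_def using False consistent[OF conjunct1[OF sm] conjunct2[OF sm] x] by simp
 qed
 show thesis
 proof (rule that[of "S \<union> (\<Union>x\<in>X. ?B x)" f])
  show "open (S \<union> (\<Union>x\<in>X. ?B x))" using P(2) by auto
  have "f holomorphic_on (\<Union>x\<in>X. ?B x)"
  proof (rule holomorphic_on_UN_open)
   show "f holomorphic_on ?B x" if "x \<in> X" for x
    by (rule holomorphic_transform[OF \<rho>(2)[OF that]]) (simp add: fB[OF that])
  qed simp
  moreover have "f holomorphic_on S" by (rule holomorphic_transform[OF P(1)]) (simp add: f_def)
  ultimately show "f holomorphic_on S \<union> (\<Union>x\<in>X. ?B x)" using P(2) by (intro holomorphic_on_Un) auto
  show "complex_of_real ` X \<subseteq> S \<union> (\<Union>x\<in>X. ?B x)" using \<rho>(1) by fastforce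
  show "z \<in> S \<and> f z = P z" if z: "z \<in> S \<union> (\<Union>x\<in>X. ?B x)" "0 < Im z" for z
  proof -
   have "z \<in> S" using z \<rho>(3) by blast
   then show ?thesis by (simp add: f_def)
  qed
 qed auto
qed

lemma exp_pb_holomorphic:
 "(%z. pbranch F (exp (c + d * z))) holomorphic_on {z. exp (c + d * z) \<in> star F}"
 "open {z. exp (c + d * z) \<in> star F}"
proof -
 have "open ((%z. exp (c + d * z)) -` star F)" by (intro open_vimage open_star continuous_intros)
 then show "open {z. exp (c + d * z) \<in> star F}" by (simp add: vimage_def)
 show "(%z. pbranch F (exp (c + d * z))) holomorphic_on {z. exp (c + d * z) \<in> star F}"
  by (rule holomorphic_on_compose_gen[OF _ pbranch_holomorphic, unfolded o_def]) (auto intro!: holomorphic_intros)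
qed

text \<open>Finitely many singularities have modulus at most \<open>exp A\<close>, so a thin strip
  above the line meets no singular ray and lies over the star. At a nonsingular point of the line
  the branch is extended from above, also behind a singularity.\<close>

lemma line_exists:
 assumes F: "fps_conv_radius F > 0" and fin: "finite (singularities F \<inter> cball 0 (exp A))"
 obtains \<delta> U f where "!!l \<delta>'. 0 < \<delta>' ==> \<delta>' <= \<delta> ==> line_dom f U {s. s <= A \<and> exp (Complex s \<theta>) \<in> singularities F} \<delta>' l A"
  "finite {s. s <= A \<and> exp (Complex s \<theta>) \<in> singularities F}" "\<delta> > 0"
  "!!x. x \<in> U ==> 0 < Im x ==> exp (x + \<i> * of_real \<theta>) \<in> star F \<and> f x = pbranch F (exp (x + \<i> * of_real \<theta>))"
proof -
 let ?t = "\<i> * complex_of_real \<theta>"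
 let ?B = "{s. s <= A \<and> exp (Complex s \<theta>) \<in> singularities F}"
 let ?S = "{z. exp (?t + 1 * z) \<in> star F} \<inter> {z. 0 < Im z}"
 let ?P = "%z. pbranch F (exp (?t + 1 * z))"
 let ?X = "{x. exp (Complex x \<theta>) \<notin> singularities F}"
 have S: "open ?S" by (intro open_Int exp_pb_holomorphic open_halfspace_Im_gt)
 have P: "?P holomorphic_on ?S" by (rule holomorphic_on_subset[OF exp_pb_holomorphic(1)]) auto
 have pos: "0 < Im z" if "z \<in> ?S" for z using that by simp
 have loc: "\<exists>\<rho>>0. \<exists>\<phi>. \<phi> holomorphic_on ball (complex_of_real x) \<rho> \<and>
   (\<forall>z\<in>ball (complex_of_real x) \<rho>. 0 < Im z --> z \<in> ?S \<and> \<phi> z = ?P z)" if x: "x \<in> ?X" for x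
 proof -
  let ?a = "exp (Complex x \<theta>)"
  obtain r \<phi> where r: "r > 0" "\<phi> holomorphic_on ball ?a r"
   "!!z. z \<in> ball ?a r ==> 1 * Im (z / ?a) > 0 ==> z \<in> star F \<and> pbranch F z = \<phi> z"
   by (rule nonsingular_extension[OF F, of ?a 1]) (use x in auto)
  have cx: "?t + of_real x = Complex x \<theta>" by (simp add: complex_eq_iff)
  have "isCont (%z. exp (?t + 1 * z)) (of_real x)" by (intro continuous_intros)
  then obtain d where d: "d > 0" "!!z. dist z (of_real x) < d ==> dist (exp (?t + 1 * z)) (exp (?t + 1 * of_real x)) < r"
   unfolding continuous_at_eps_delta using r(1) by blast
  have in_ball: "exp (?t + 1 * z) \<in> ball ?a r" if "z \<in> ball (of_real x) (min d 1)" for z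
   using d(2)[of z] that by (simp add: cx dist_commute)
  have im: "Im (exp (?t + 1 * z) / ?a) > 0" if "z \<in> ball (of_real x) (min d 1)" "0 < Im z" for z
  proof -
   have "\<bar>Im (z - of_real x)\<bar> <= norm (z - of_real x)" by (rule abs_Im_le_cmod)
   then have "Im z < 1" using that by (simp add: dist_norm norm_minus_commute)
   then have "Im z < pi" using pi_gt3 by linarith
   then have "sin (Im z) > 0" using that(2) by (intro sin_gt_zero)
   moreover have "exp (?t + 1 * z) / ?a = exp (z - of_real x)" by (simp add: cx[symmetric] flip: exp_diff)
   ultimately show ?thesis by (simp add: Im_exp)
  qed
  show ?thesis
  proof (intro exI[of _ "min d 1"] conjI exI[of _ "%z. \<phi> (exp (?t + 1 * z))"] ballI impI)
   show "(%z. \<phi> (exp (?t + 1 * z))) holomorphic_on ball (complex_of_real x) (min d 1)"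
    by (rule holomorphic_on_compose_gen[OF _ r(2), unfolded o_def]) (use in_ball in \<open>auto intro!: holomorphic_intros\<close>)
   fix z assume z: "z \<in> ball (complex_of_real x) (min d 1)" "0 < Im z"
   have "exp (?t + 1 * z) \<in> star F \<and> ?P z = \<phi> (exp (?t + 1 * z))" using r(3)[OF in_ball[OF z(1)]] im[OF z] by simp
   then show "z \<in> ?S" "\<phi> (exp (?t + 1 * z)) = ?P z" using z by auto
  qed (use d in auto)
 qed
 obtain U f where U: "open U" "f holomorphic_on U" "?S \<subseteq> U" "complex_of_real ` ?X \<subseteq> U"
  "!!z. z \<in> U ==> 0 < Im z ==> z \<in> ?S \<and> f z = ?P z"
  by (rule extend_across_reals[OF P S pos loc]) (assumption | (rule that; (assumption | blast)))+
 let ?Z = "{x. exp x \<in> singularities F \<and> Re x <= A \<and> \<theta> <= Im x \<and> Im x <= \<theta> + 1}"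
 have Z: "finite ?Z" by (rule finite_log_singularities[OF fin])
 have "?B \<subseteq> Re ` ?Z"
 proof
  fix s assume "s \<in> ?B"
  then have "Complex s \<theta> \<in> ?Z" by simp
  then have "Re (Complex s \<theta>) \<in> Re ` ?Z" by (rule imageI)
  then show "s \<in> Re ` ?Z" by simp
 qed
 then have B: "finite ?B" using Z finite_subset by blast
 have "finite (Im ` ?Z)" by (rule finite_imageI[OF Z])
 from finite_set_avoid[OF this, of \<theta>]
 obtain d where d0: "d > 0 \<and> (\<forall>y\<in>Im ` ?Z. y ~= \<theta> --> d <= dist \<theta> y)" by (rule exE)
 have d: "d <= dist \<theta> y" if "y \<in> Im ` ?Z" "y ~= \<theta>" for y
  using bspec[OF conjunct2[OF d0] that(1)] that(2) by simp
 define \<delta> where "\<delta> = min d 1"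
 have strip: "x \<in> U" if x: "0 < Im x" "Im x < \<delta>" "Re x < A" for x
 proof -
  have "exp (?t + 1 * x) \<in> star F"
  proof (rule exp_in_star[OF F])
   fix s assume s: "s <= Re (?t + 1 * x)"
   show "exp (Complex s (Im (?t + 1 * x))) \<notin> singularities F"
   proof
    assume "exp (Complex s (Im (?t + 1 * x))) \<in> singularities F"
    then have "Complex s (Im (?t + 1 * x)) \<in> ?Z" using s x by (auto simp: \<delta>_def)
    then have "Im (Complex s (Im (?t + 1 * x))) \<in> Im ` ?Z" by (rule imageI)
    then have "\<theta> + Im x \<in> Im ` ?Z" by simp
    from d[OF this] show False using x d0 by (simp add: dist_real_def \<delta>_def)
   qed
  qed
  then show ?thesis using U(3) x by auto
 qed
 show thesis
 proof (rule that[of \<delta> f U])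
  fix l \<delta>' assume "0 < \<delta>'" "\<delta>' <= \<delta>"
  then show "line_dom f U ?B \<delta>' l A" unfolding line_dom_def using U(1,2,4) strip by auto
 next
  show "exp (x + ?t) \<in> star F \<and> f x = pbranch F (exp (x + ?t))" if "x \<in> U" "0 < Im x" for x
   using U(5)[OF that] by (simp add: add.commute)
 qed (use B d0 in \<open>auto simp: \<delta>_def\<close>)
qed

lemma linepath_integral_spike:
 assumes "!!t. 0 < t ==> t < 1 ==> K (linepath a b t) = K' (linepath a b t)"
 shows "contour_integral (linepath a b) K = contour_integral (linepath a b) K'"
 unfolding contour_integral_integral
 by (rule integral_spike[of "{0, 1}"]) (use assms in \<open>auto simp: negligible_finite less_le\<close>)

text \<open>On the real axis the principal branch may be meaningless, but a run meets the axis at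
  its endpoints only, and these are negligible.\<close>

lemma run_cong:
 assumes pq: "p <= q" and h: "0 < h"
  and K: "!!x. 0 < Im x ==> Im x <= h ==> p <= Re x ==> Re x <= q ==> K x = K' x"
 shows "run (of_real p) (of_real q) h K = run (of_real p) (of_real q) h K'"
proof -
 have "(1 - t) * p + t * q \<ge> p" "(1 - t) * p + t * q <= q" if "0 <= t" "t <= 1" for t
 proof -
  have "t * (q - p) \<ge> 0" "(1 - t) * (q - p) \<ge> 0" using that pq by auto
  then show "(1 - t) * p + t * q \<ge> p" "(1 - t) * p + t * q <= q" by (auto simp: algebra_simps)
 qed
 note R = this
 have L: "Re (linepath a b t) = (1 - t) * Re a + t * Re b" "Im (linepath a b t) = (1 - t) * Im a + t * Im b" for a b t
  by (simp_all add: linepath_def)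
 have H: "0 < t * h" "t * h <= h" "0 < (1 - t) * h" "(1 - t) * h <= h" if "0 < t" "t < 1" for t
  using that h mult_right_mono[of t 1 h] mult_right_mono[of "1 - t" 1 h] by simp_all
 have C: "(1 - t) * x + t * x = x" for t x :: real by (simp add: algebra_simps)
 let ?p = "complex_of_real p" and ?q = "complex_of_real q" and ?h = "\<i> * complex_of_real h"
 have "contour_integral (linepath ?p (?p + ?h)) K = contour_integral (linepath ?p (?p + ?h)) K'"
 proof (intro linepath_integral_spike K)
  fix t :: real assume t: "0 < t" "t < 1"
  then show "0 < Im (linepath ?p (?p + ?h) t)" "Im (linepath ?p (?p + ?h) t) <= h"
   "p <= Re (linepath ?p (?p + ?h) t)" "Re (linepath ?p (?p + ?h) t) <= q"
   unfolding L using H[OF t] C[of t p] pq by simp_all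
 qed
 moreover have "contour_integral (linepath (?p + ?h) (?q + ?h)) K = contour_integral (linepath (?p + ?h) (?q + ?h)) K'"
 proof (intro linepath_integral_spike K)
  fix t :: real assume t: "0 < t" "t < 1"
  then show "0 < Im (linepath (?p + ?h) (?q + ?h) t)" "Im (linepath (?p + ?h) (?q + ?h) t) <= h"
   "p <= Re (linepath (?p + ?h) (?q + ?h) t)" "Re (linepath (?p + ?h) (?q + ?h) t) <= q"
   unfolding L using C[of t h] h R[of t] by simp_all
 qed
 moreover have "contour_integral (linepath (?q + ?h) ?q) K = contour_integral (linepath (?q + ?h) ?q) K'"
 proof (intro linepath_integral_spike K)
  fix t :: real assume t: "0 < t" "t < 1"
  then show "0 < Im (linepath (?q + ?h) ?q t)" "Im (linepath (?q + ?h) ?q t) <= h"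
   "p <= Re (linepath (?q + ?h) ?q t)" "Re (linepath (?q + ?h) ?q t) <= q"
   unfolding L using H[OF t] C[of t q] pq by simp_all
 qed
 ultimately show ?thesis unfolding run_def by simp
qed

text \<open>After translation by \<open>s\<close> the two factors become \<open>ft (Ln z)\<close>
  and \<open>gt (Ln (om - z))\<close>, because \<open>dexp a (Ln z)\<close> is a times exp z. The
  run is then the one between the singularities 0 and om.\<close>

lemma run_matched:
 assumes f1: "line_dom f1 U1 B1 \<delta> l u" "!!x. x \<in> U1 ==> 0 < Im x ==> exp (x + \<i> * of_real \<theta>) \<in> star F \<and> f1 x = pbranch F (exp (x + \<i> * of_real \<theta>))"
  and g1: "line_dom g1 U2 B2 \<delta> (c - u) (c - l)" "!!x. x \<in> U2 ==> 0 < Im x ==> exp (x + \<i> * of_real \<theta>') \<in> star G \<and> g1 x = pbranch G (exp (x + \<i> * of_real \<theta>'))"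
  and s: "l < s" "s < u"
  and ft: "local_lift F (exp (Complex s \<theta>)) 1 R ft" "decays ft"
  and gt: "local_lift G (exp (Complex (c - s) \<theta>')) 1 R gt" "decays gt"
  and LP: "!!r L. cell_monodromy ft gt r L ==> LP x r L" and mono: "LP_mono LP"
 shows "\<exists>eps>0. \<forall>\<sigma>. 0 < \<sigma> --> \<sigma> < eps -->
   pinch_sum LP {x} (%om. run (of_real (s - \<sigma>)) (of_real (s + \<sigma>)) (Im om / 2) (%x. f1 x * g1 (of_real c + om - x)))"
proof -
 define eps where "eps = min (exp R / 2) (min \<delta> (min ((s - l) / 2) ((u - s) / 2)))"
 have \<delta>: "\<delta> > 0" using f1(1) by (simp add: line_dom_def)
 have eps: "eps > 0" using \<delta> s by (simp add: eps_def)
 have hol: "ft holomorphic_on {X. Re X < R}" "gt holomorphic_on {X. Re X < R}" using ft(1) gt(1) by (auto simp: local_lift_def)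
 have "pinch_sum LP {x} (%om. run (of_real (s - \<sigma>)) (of_real (s + \<sigma>)) (Im om / 2) (%x. f1 x * g1 (of_real c + om - x)))"
  if \<sigma>: "0 < \<sigma>" "\<sigma> < eps" for \<sigma>
 proof -
  have \<sigma>': "\<sigma> < exp R / 2" "\<sigma> < \<delta>" "2 * \<sigma> < s - l" "2 * \<sigma> < u - s" using \<sigma> by (auto simp: eps_def)
  \<comment> \<open>With |om| < \<sigma> / 8, the points z of the run satisfy |z| <= \<sigma> +
    \<sigma> / 16, and om - z stays below 2 \<sigma>, which is within the range of the
    lifts.\<close>
  define r where "r = ln (\<sigma> / 8)"
  have r: "exp r = \<sigma> / 8" using \<sigma> by (simp add: r_def)
  have r1: "exp r * 2 <= \<sigma>" "exp r <= \<sigma>" "3 * exp r + \<sigma> <= exp R" using r \<sigma> \<sigma>' by auto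
  obtain S where S: "S holomorphic_on ball 0 (exp r)" "!!om. Im om > 0 ==> norm om < exp r ==>
   run (- of_real \<sigma>) (of_real \<sigma>) (Im om / 2) (%x. ft (Ln x) * gt (Ln (om - x))) =
   S om + (half_cell ft gt \<sigma> (Ln om) + half_cell gt ft \<sigma> (Ln om))"
   by (rule run_between[OF hol \<sigma>(1) r1(1,3)]) blast
  have cm: "LP x r (%\<eta>. half_cell ft gt \<sigma> \<eta> + half_cell gt ft \<sigma> \<eta>)"
   by (intro LP half_cells_monodromy[OF hol ft(2) gt(2) \<sigma>(1) r1(2,3)])
  have fx: "f1 (of_real s + z) = ft (Ln z)" if z: "0 < Im z" "Im z < \<sigma>" "norm z < 2 * \<sigma>" for z
  proof -
   have "\<bar>Re z\<bar> <= norm z" by (rule abs_Re_le_cmod)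
   then have "of_real s + z \<in> U1" using f1(1) z \<sigma>' by (auto simp: line_dom_def)
   then have 1: "f1 (of_real s + z) = pbranch F (exp (of_real s + z + \<i> * of_real \<theta>))" using f1(2)[of "of_real s + z"] z(1) by simp
   have nz: "z ~= 0" using z(1) by auto
   have "0 < Im (Ln z)" "Im (Ln z) < pi" using z(1) nz by (simp_all add: Im_Ln_pos_lt_imp)
   moreover have "norm z < exp R" using z(3) \<sigma>'(1) by simp
   then have "Re (Ln z) < R" using nz by (metis Re_Ln exp_gt_zero ln_exp ln_less_cancel_iff zero_less_norm_iff)
   moreover have "dexp (exp (Complex s \<theta>)) (Ln z) = exp (of_real s + z + \<i> * of_real \<theta>)"
   proof -
    have "dexp (exp (Complex s \<theta>)) (Ln z) = exp (Complex s \<theta> + z)" using nz by (simp add: dexp_def exp_add)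
    also have "Complex s \<theta> + z = of_real s + z + \<i> * of_real \<theta>" by (simp add: complex_eq_iff)
    finally show ?thesis .
   qed
   ultimately show ?thesis using ft(1) 1 unfolding local_lift_def by simp
  qed
  have gx: "g1 (of_real (c - s) + z) = gt (Ln z)" if z: "0 < Im z" "Im z < \<sigma>" "norm z < 2 * \<sigma>" for z
  proof -
   have "\<bar>Re z\<bar> <= norm z" by (rule abs_Re_le_cmod)
   then have "of_real (c - s) + z \<in> U2" using g1(1) z \<sigma>' by (auto simp: line_dom_def)
   then have 1: "g1 (of_real (c - s) + z) = pbranch G (exp (of_real (c - s) + z + \<i> * of_real \<theta>'))" using g1(2)[of "of_real (c - s) + z"] z(1) by simp
   have nz: "z ~= 0" using z(1) by auto
   have "0 < Im (Ln z)" "Im (Ln z) < pi" using z(1) nz by (simp_all add: Im_Ln_pos_lt_imp)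
   moreover have "norm z < exp R" using z(3) \<sigma>'(1) by simp
   then have "Re (Ln z) < R" using nz by (metis Re_Ln exp_gt_zero ln_exp ln_less_cancel_iff zero_less_norm_iff)
   moreover have "dexp (exp (Complex (c - s) \<theta>')) (Ln z) = exp (of_real (c - s) + z + \<i> * of_real \<theta>')"
   proof -
    have "dexp (exp (Complex (c - s) \<theta>')) (Ln z) = exp (Complex (c - s) \<theta>' + z)" using nz by (simp add: dexp_def exp_add)
    also have "Complex (c - s) \<theta>' + z = of_real (c - s) + z + \<i> * of_real \<theta>'" by (simp add: complex_eq_iff)
    finally show ?thesis .
   qed
   ultimately show ?thesis using gt(1) 1 unfolding local_lift_def by simp
  qed
  have R: "run (of_real (s - \<sigma>)) (of_real (s + \<sigma>)) (Im om / 2) (%x. f1 x * g1 (of_real c + om - x)) =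
   S om + (half_cell ft gt \<sigma> (Ln om) + half_cell gt ft \<sigma> (Ln om))" if om: "0 < Im om" "norm om < exp r" for om
  proof -
   have w: "norm om < \<sigma> / 8" "Im om < \<sigma> / 8" using om r abs_Im_le_cmod[of om] by auto
   have "run (of_real (s - \<sigma>)) (of_real (s + \<sigma>)) (Im om / 2) (%x. f1 x * g1 (of_real c + om - x)) =
    run (of_real (- \<sigma>)) (of_real \<sigma>) (Im om / 2) (%x. f1 (x + of_real s) * g1 (of_real c + om - (x + of_real s)))"
   proof -
    have e: "of_real (s - \<sigma>) = of_real (- \<sigma>) + complex_of_real s" "of_real (s + \<sigma>) = of_real \<sigma> + complex_of_real s" by simp_all
    show ?thesis unfolding e run_translate ..
   qed
   also have "\<dots> = run (of_real (- \<sigma>)) (of_real \<sigma>) (Im om / 2) (%x. ft (Ln x) * gt (Ln (om - x)))"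
   proof (rule run_cong)
    fix z assume z: "0 < Im z" "Im z <= Im om / 2" "- \<sigma> <= Re z" "Re z <= \<sigma>"
    have "norm z <= \<bar>Re z\<bar> + \<bar>Im z\<bar>" by (rule cmod_le)
    then have nz: "norm z <= \<sigma> + \<sigma> / 16" using z w by auto
    then have "norm (om - z) < 2 * \<sigma>" using norm_triangle_ineq4[of om z] w \<sigma>(1) by linarith
    then have "gt (Ln (om - z)) = g1 (of_real (c - s) + (om - z))" by (intro gx[symmetric]) (use z w om \<sigma>(1) in auto)
    moreover have "ft (Ln z) = f1 (of_real s + z)" by (intro fx[symmetric]) (use z w om \<sigma>(1) nz in auto)
    ultimately show "f1 (z + of_real s) * g1 (of_real c + om - (z + of_real s)) = ft (Ln z) * gt (Ln (om - z))"
     by (simp add: algebra_simps)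
   qed (use \<sigma> om in auto)
   also have "\<dots> = S om + (half_cell ft gt \<sigma> (Ln om) + half_cell gt ft \<sigma> (Ln om))" using S(2)[OF om] by simp
   finally show ?thesis .
  qed
  show ?thesis unfolding pinch_sum_def
  proof (intro conjI exI[of _ r] exI[of _ S] exI[of _ "%_ \<eta>. half_cell ft gt \<sigma> \<eta> + half_cell gt ft \<sigma> \<eta>"] allI impI)
   show "\<forall>\<alpha>\<in>{x}. LP \<alpha> r (%\<eta>. half_cell ft gt \<sigma> \<eta> + half_cell gt ft \<sigma> \<eta>)" using cm by blast
   fix om :: complex assume "0 < Im om" "norm om < exp r"
   from R[OF this] show "run (of_real (s - \<sigma>)) (of_real (s + \<sigma>)) (Im om / 2) (%x. f1 x * g1 (of_real c + om - x)) =
    S om + (\<Sum>_\<in>{x}. half_cell ft gt \<sigma> (Ln om) + half_cell gt ft \<sigma> (Ln om))" by (simp only: sum.empty sum.insert finite.emptyI empty_iff not_False_eq_True add_0_right)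
  qed (use S(1) in simp_all)
 qed
 then show ?thesis using eps by blast
qed

section \<open>Assembling the contour over a full period\<close>

text \<open>The pieces of the contour vary with om; for joining them only the endpoints, the domain
  and the value of the integral matter.\<close>

definition poly_value :: "complex set => (complex => complex) => complex => complex => complex => bool" where
 "poly_value S K a b v \<longleftrightarrow> (\<exists>p. polygonal p \<and> pathstart p = a \<and> pathfinish p = b \<and> path_image p \<subseteq> S \<and> contour_integral p K = v)"

lemma poly_value_linepath: "closed_segment a b \<subseteq> S ==> poly_value S K a b (contour_integral (linepath a b) K)"
 unfolding poly_value_def by (rule exI[of _ "linepath a b"]) (auto intro: polygonal_linepath)

lemma poly_value_join:
 assumes "continuous_on S K" "poly_value S K a b v" "poly_value S K b d w"
 shows "poly_value S K a d (v + w)"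
proof -
 obtain p where p: "polygonal p" "pathstart p = a" "pathfinish p = b" "path_image p \<subseteq> S" "contour_integral p K = v"
  using assms(2) unfolding poly_value_def by blast
 obtain q where q: "polygonal q" "pathstart q = b" "pathfinish q = d" "path_image q \<subseteq> S" "contour_integral q K = w"
  using assms(3) unfolding poly_value_def by blast
 have im: "path_image (p +++ q) \<subseteq> S" using path_image_join_subset[of p q] p q by blast
 have "contour_integral (p +++ q) K = v + w"
  using polygonal_contour_integral_join[OF p(1) q(1) _ continuous_on_subset[OF assms(1) im]] p q by simp
 moreover have "polygonal (p +++ q)" by (rule polygonal_join) (use p q in auto)
 ultimately show ?thesis unfolding poly_value_def using im p q by (intro exI[of _ "p +++ q"]) simp
qed

definition contour_dom :: "complex fps => complex fps => complex => complex set" where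
 "contour_dom F G w = {x. exp x \<in> star F \<and> exp (w - x) \<in> star G}"

definition contour_kernel :: "complex fps => complex fps => complex => complex => complex" where
 "contour_kernel F G w x = pbranch F (exp x) * pbranch G (exp (w - x))"

lemma contour_kernel_continuous: "continuous_on (contour_dom F G w) (contour_kernel F G w)"
 unfolding contour_kernel_def[abs_def]
proof (intro continuous_on_mult)
 show "continuous_on (contour_dom F G w) (%x. pbranch F (exp x))"
  by (rule continuous_on_compose2[OF holomorphic_on_imp_continuous_on[OF pbranch_holomorphic]])
   (auto simp: contour_dom_def intro!: continuous_intros)
 show "continuous_on (contour_dom F G w) (%x. pbranch G (exp (w - x)))"
  by (rule continuous_on_compose2[OF holomorphic_on_imp_continuous_on[OF pbranch_holomorphic]])
   (auto simp: contour_dom_def intro!: continuous_intros)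
qed

text \<open>A pair is determined by its first member, the second one being \<gamma> /
  \<alpha>.\<close>

definition pinched :: "complex fps => complex fps => complex => complex set" where
 "pinched F G \<gamma> = {\<alpha> \<in> singularities F. \<gamma> / \<alpha> \<in> singularities G}"

lemma line_exists':
 assumes F: "fps_conv_radius F > 0" and fin: "finite (singularities F \<inter> cball 0 (exp A))"
 shows "\<exists>\<delta> U f. \<delta> > 0 \<and> finite {s. s <= A \<and> exp (Complex s \<theta>) \<in> singularities F} \<and>
  (\<forall>l \<delta>'. 0 < \<delta>' --> \<delta>' <= \<delta> --> line_dom f U {s. s <= A \<and> exp (Complex s \<theta>) \<in> singularities F} \<delta>' l A) \<and>
  (\<forall>x\<in>U. 0 < Im x --> exp (x + \<i> * of_real \<theta>) \<in> star F \<and> f x = pbranch F (exp (x + \<i> * of_real \<theta>)))"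
proof (rule line_exists[OF F fin, of \<theta>])
 fix \<delta> U f
 assume *: "!!l \<delta>'. 0 < \<delta>' ==> \<delta>' <= \<delta> ==> line_dom f U {s. s <= A \<and> exp (Complex s \<theta>) \<in> singularities F} \<delta>' l A"
  "finite {s. s <= A \<and> exp (Complex s \<theta>) \<in> singularities F}" "\<delta> > 0"
  "!!x. x \<in> U ==> 0 < Im x ==> exp (x + \<i> * of_real \<theta>) \<in> star F \<and> f x = pbranch F (exp (x + \<i> * of_real \<theta>))"
 show ?thesis
  by (intro exI[of _ \<delta>] exI[of _ U] exI[of _ f] conjI allI impI ballI *(1,2,3) *(4)[THEN conjunct1] *(4)[THEN conjunct2])
qed

text \<open>\<open>c\<close> is a logarithm of \<gamma>. \<open>F (exp x)\<close> is regular for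
  \<open>Re x <= \<rho>\<close>, and \<open>G (exp (c + om - x))\<close> for
  \<open>Re x >= A\<close> as long as |om| < 1, which is the role of the 1 in \<open>starG\<close>.
  \<open>A\<close> and \<open>\<rho>\<close> are in general position, so that the ends of a run are
  regular; the margin 1 in \<open>finF\<close> and \<open>finG\<close> lets the lines extend beyond
  these ends.\<close>

locale left_contour =
 fixes F G :: "complex fps" and c :: complex and A \<rho> :: real and LP :: "complex => real => (complex => complex) => bool"
 assumes F: "fps_conv_radius F > 0" and G: "fps_conv_radius G > 0"
  and finF: "finite (singularities F \<inter> cball 0 (exp (A + 1)))"
  and finG: "finite (singularities G \<inter> cball 0 (exp (Re c - \<rho> + 1)))"
  and starF: "!!x. Re x <= \<rho> ==> exp x \<in> star F"
  and starG: "!!x. Re x <= Re c + 1 - A ==> exp x \<in> star G"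
  and \<rho>A: "\<rho> < A"
  and genF: "!!x. Re x = A ==> exp x \<notin> singularities F"
  and genG: "!!x. Re x = Re c - \<rho> ==> exp x \<notin> singularities G"
  and mono: "LP_mono LP"
  and lifts: "!!x. exp x \<in> pinched F G (exp c) ==> \<exists>ft gt R. local_lift F (exp x) 1 R ft \<and> decays ft \<and>
   local_lift G (exp (c - x)) 1 R gt \<and> decays gt \<and> (\<forall>r L. cell_monodromy ft gt r L --> LP x r L)"
begin

definition pinch_logs :: "real => real => complex set" where
 "pinch_logs \<theta>1 \<theta>2 = {x. exp x \<in> pinched F G (exp c) \<and> \<theta>1 < Im x \<and> Im x < \<theta>2}"

definition sector :: "real => real => bool" where
 "sector \<theta>1 \<theta>2 \<longleftrightarrow> (\<exists>k r. pinch_sum LP (pinch_logs \<theta>1 \<theta>2) k \<and>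
  (\<forall>om. 0 < Im om --> norm om < exp r -->
    poly_value (contour_dom F G (c + om)) (contour_kernel F G (c + om)) (Complex A \<theta>1) (Complex A \<theta>2) (k om)))"

definition bad_angles :: "real set" where
 "bad_angles = {y. \<exists>s\<le>A. exp (Complex s y) \<in> singularities F}"

lemma pinched_bounds:
 assumes "exp x \<in> pinched F G (exp c)"
 shows "\<rho> < Re x" "Re x < A" "Im x \<in> bad_angles"
proof -
 have s: "exp x \<in> singularities F" "exp (c - x) \<in> singularities G" using assms by (auto simp: pinched_def exp_diff)
 show "\<rho> < Re x" using star_nonsingular[OF F starF[of x]] s(1) by force
 show A: "Re x < A"
 proof (rule ccontr)
  assume "\<not> Re x < A"
  then have "Re (c - x) <= Re c + 1 - A" by simp
  then show False using star_nonsingular[OF G starG] s(2) by blast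
 qed
 show "Im x \<in> bad_angles" unfolding bad_angles_def using s(1) A by (auto intro!: exI[of _ "Re x"])
qed

lemma finite_bad_angles: "finite (bad_angles \<inter> {a..b})"
proof (rule finite_subset)
 show "bad_angles \<inter> {a..b} \<subseteq> Im ` {x. exp x \<in> singularities F \<and> Re x <= A + 1 \<and> a <= Im x \<and> Im x <= b}"
 proof
  fix y assume "y \<in> bad_angles \<inter> {a..b}"
  then obtain s where s: "s <= A" "exp (Complex s y) \<in> singularities F" "a <= y" "y <= b" by (auto simp: bad_angles_def)
  then show "y \<in> Im ` {x. exp x \<in> singularities F \<and> Re x <= A + 1 \<and> a <= Im x \<and> Im x <= b}"
   by (intro image_eqI[of _ _ "Complex s y"]) auto
 qed
 show "finite (Im ` {x. exp x \<in> singularities F \<and> Re x <= A + 1 \<and> a <= Im x \<and> Im x <= b})"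
  by (intro finite_imageI finite_log_singularities finF)
qed

lemma good_angle_star: "Im x \<notin> bad_angles ==> Re x <= A ==> exp x \<in> star F"
 by (rule exp_in_star[OF F]) (auto simp: bad_angles_def)

lemma sector_join:
 assumes "sector \<theta>1 \<theta>2" "sector \<theta>2 \<theta>3" "\<theta>1 < \<theta>2" "\<theta>2 < \<theta>3" "\<theta>2 \<notin> bad_angles"
 shows "sector \<theta>1 \<theta>3"
proof -
 obtain k r where k: "pinch_sum LP (pinch_logs \<theta>1 \<theta>2) k" "!!om. 0 < Im om ==> norm om < exp r ==>
  poly_value (contour_dom F G (c + om)) (contour_kernel F G (c + om)) (Complex A \<theta>1) (Complex A \<theta>2) (k om)"
  using assms(1) unfolding sector_def by blast
 obtain k' r' where k': "pinch_sum LP (pinch_logs \<theta>2 \<theta>3) k'" "!!om. 0 < Im om ==> norm om < exp r' ==>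
  poly_value (contour_dom F G (c + om)) (contour_kernel F G (c + om)) (Complex A \<theta>2) (Complex A \<theta>3) (k' om)"
  using assms(2) unfolding sector_def by blast
 have "Im x ~= \<theta>2" if "exp x \<in> pinched F G (exp c)" for x using pinched_bounds(3)[OF that] assms(5) by auto
 then have ne: "Im x < \<theta>2 \<or> \<theta>2 < Im x" if "exp x \<in> pinched F G (exp c)" for x using that by (meson linorder_neqE_linordered_idom)
 have U: "pinch_logs \<theta>1 \<theta>3 = pinch_logs \<theta>1 \<theta>2 \<union> pinch_logs \<theta>2 \<theta>3"
 proof (intro set_eqI iffI)
  fix x assume "x \<in> pinch_logs \<theta>1 \<theta>3"
  then show "x \<in> pinch_logs \<theta>1 \<theta>2 \<union> pinch_logs \<theta>2 \<theta>3" using ne[of x] by (auto simp: pinch_logs_def)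
 next
  fix x assume "x \<in> pinch_logs \<theta>1 \<theta>2 \<union> pinch_logs \<theta>2 \<theta>3"
  then show "x \<in> pinch_logs \<theta>1 \<theta>3" using assms(3,4) by (auto simp: pinch_logs_def)
 qed
 have D: "pinch_logs \<theta>1 \<theta>2 \<inter> pinch_logs \<theta>2 \<theta>3 = {}" by (auto simp: pinch_logs_def)
 have e: "exp (min r r') <= exp r" "exp (min r r') <= exp r'" by auto
 show ?thesis unfolding sector_def U
 proof (intro exI[of _ "%om. k om + k' om"] exI[of _ "min r r'"] conjI pinch_sum_add[OF mono k(1) k'(1) D] allI impI)
  fix om :: complex assume om: "0 < Im om" "norm om < exp (min r r')"
  then have "norm om < exp r" "norm om < exp r'" using e by linarith+
  then show "poly_value (contour_dom F G (c + om)) (contour_kernel F G (c + om)) (Complex A \<theta>1) (Complex A \<theta>3) (k om + k' om)"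
   using om(1) by (intro poly_value_join[OF contour_kernel_continuous k(2) k'(2)]) auto
 qed
qed

lemma segment_rectangle:
 assumes "x \<in> closed_segment a b" "l <= Re a" "l <= Re b" "Re a <= u" "Re b <= u" "i <= Im a" "i <= Im b" "Im a <= j" "Im b <= j"
 shows "l <= Re x" "Re x <= u" "i <= Im x" "Im x <= j"
proof -
 have "closed_segment a b \<subseteq> {x. l <= Re x \<and> Re x <= u \<and> i <= Im x \<and> Im x <= j}"
  using closed_segment_subset[OF _ _ convex_rectangle, of a l u i j b] assms(2-) by blast
 then have "x \<in> {x. l <= Re x \<and> Re x <= u \<and> i <= Im x \<and> Im x <= j}" using assms(1) by (rule subsetD)
 then show "l <= Re x" "Re x <= u" "i <= Im x" "Im x <= j" by simp_all
qed

text \<open>No cut of \<open>F\<close> reaches the line \<open>Re x = A\<close> between the two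
  angles, so the contour is a fixed segment of this line.\<close>

lemma sector_plain:
 assumes "\<theta>1 < \<theta>2" "bad_angles \<inter> {\<theta>1..\<theta>2} = {}"
 shows "sector \<theta>1 \<theta>2"
proof -
 let ?a = "Complex A \<theta>1" and ?b = "Complex A \<theta>2"
 have seg: "Re x = A \<and> Im x \<notin> bad_angles" if "x \<in> closed_segment ?a ?b" for x
 proof -
  note R = segment_rectangle[OF that, of A A \<theta>1 \<theta>2]
  have "Re x = A" "Im x \<in> {\<theta>1..\<theta>2}" using R assms(1) by auto
  then show ?thesis using assms(2) by blast
 qed
 have f: "(%z. pbranch F (exp z)) holomorphic_on {z. exp z \<in> star F}" using exp_pb_holomorphic(1)[where F = F and c = 0 and d = 1] by simp
 have g: "(%z. pbranch G (exp z)) holomorphic_on {z. exp z \<in> star G}" "open {z. exp z \<in> star G}" using exp_pb_holomorphic[where F = G and c = 0 and d = 1] by simp_all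
 obtain r where r: "(%om. contour_integral (linepath ?a ?b) (%x. pbranch F (exp x) * pbranch G (exp (c + om - x)))) holomorphic_on ball 0 (exp r)"
 proof (rule segment_param_holomorphic[OF f g, of ?a ?b c])
  show "closed_segment ?a ?b \<subseteq> {z. exp z \<in> star F}" using seg good_angle_star by fastforce
  show "c - x \<in> {z. exp z \<in> star G}" if "x \<in> closed_segment ?a ?b" for x using seg[OF that] by (auto intro!: starG)
 qed blast
 have "pinch_logs \<theta>1 \<theta>2 = {}" using pinched_bounds(3) assms(2) by (fastforce simp: pinch_logs_def)
 then have ps: "pinch_sum LP (pinch_logs \<theta>1 \<theta>2) (%om. contour_integral (linepath ?a ?b) (contour_kernel F G (c + om)))"
  using pinch_sum_holomorphic[OF r, of LP] by (simp add: contour_kernel_def[abs_def])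
 have pv: "poly_value (contour_dom F G (c + om)) (contour_kernel F G (c + om)) ?a ?b (contour_integral (linepath ?a ?b) (contour_kernel F G (c + om)))"
  if om: "0 < Im om" "norm om < exp 0" for om
 proof (rule poly_value_linepath, rule subsetI)
  fix x assume x: "x \<in> closed_segment ?a ?b"
  have "\<bar>Re om\<bar> < 1" using abs_Re_le_cmod[of om] om(2) by simp
  then have "exp (c + om - x) \<in> star G" using seg[OF x] by (intro starG) auto
  then show "x \<in> contour_dom F G (c + om)" using seg[OF x] good_angle_star by (simp add: contour_dom_def)
 qed
 show ?thesis unfolding sector_def
  by (intro exI[of _ "%om. contour_integral (linepath ?a ?b) (contour_kernel F G (c + om))"] exI[of _ 0] conjI allI impI ps pv)
qed

text \<open>Cuts of \<open>F (exp x)\<close> start at its singularities and go right; those of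
  \<open>G (exp (c + om - x))\<close> go left, and on the same line they are displaced upwards by
  \<open>Im om\<close>. The contour therefore goes left below both kinds, up at
  \<open>\<rho>\<close>, back between them at height \<open>Im om / 2\<close>, and up again at
  \<open>A\<close>. Only the run between the cuts can be pinched.\<close>

lemma sector_special:
 "\<exists>eps>0. \<forall>\<sigma>. 0 < \<sigma> --> \<sigma> < eps --> sector (\<theta> - \<sigma>) (\<theta> + \<sigma>)"
proof -
 define c0 \<theta>' l u where "c0 = Re c" and "\<theta>' = Im c - \<theta>" and "l = \<rho> - 1" and "u = A + 1"
 let ?t = "\<i> * complex_of_real \<theta>" and ?t' = "\<i> * complex_of_real \<theta>'"
 define B1 where "B1 = {s. s <= u \<and> exp (Complex s \<theta>) \<in> singularities F}"
 define B2 where "B2 = {s. s <= c0 - l \<and> exp (Complex s \<theta>') \<in> singularities G}"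
 have finF': "finite (singularities F \<inter> cball 0 (exp u))" using finF by (simp add: u_def)
 have finG': "finite (singularities G \<inter> cball 0 (exp (c0 - l)))" using finG by (simp add: c0_def l_def algebra_simps)
 obtain \<delta>1 U1 f1 where L1': "\<delta>1 > 0 \<and> finite B1 \<and> (\<forall>l \<delta>'. 0 < \<delta>' --> \<delta>' <= \<delta>1 --> line_dom f1 U1 B1 \<delta>' l u) \<and>
  (\<forall>x\<in>U1. 0 < Im x --> exp (x + ?t) \<in> star F \<and> f1 x = pbranch F (exp (x + ?t)))"
  using line_exists'[OF F finF', of \<theta>, folded B1_def] by (elim exE) (rule that)
 obtain \<delta>2 U2 g1 where L2': "\<delta>2 > 0 \<and> finite B2 \<and> (\<forall>l' \<delta>'. 0 < \<delta>' --> \<delta>' <= \<delta>2 --> line_dom g1 U2 B2 \<delta>' l' (c0 - l)) \<and>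
  (\<forall>x\<in>U2. 0 < Im x --> exp (x + ?t') \<in> star G \<and> g1 x = pbranch G (exp (x + ?t')))"
  using line_exists'[OF G finG', of \<theta>', folded B2_def] by (elim exE) (rule that)
 have L1: "!!l \<delta>'. 0 < \<delta>' ==> \<delta>' <= \<delta>1 ==> line_dom f1 U1 B1 \<delta>' l u" "finite B1" "\<delta>1 > 0"
  "!!x. x \<in> U1 ==> 0 < Im x ==> exp (x + ?t) \<in> star F \<and> f1 x = pbranch F (exp (x + ?t))"
  using L1' by blast+
 have L2: "!!l' \<delta>'. 0 < \<delta>' ==> \<delta>' <= \<delta>2 ==> line_dom g1 U2 B2 \<delta>' l' (c0 - l)" "finite B2" "\<delta>2 > 0"
  "!!x. x \<in> U2 ==> 0 < Im x ==> exp (x + ?t') \<in> star G \<and> g1 x = pbranch G (exp (x + ?t'))"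
  using L2' by blast+
 define \<delta> where "\<delta> = min \<delta>1 \<delta>2"
 have \<delta>: "\<delta> > 0" using L1(3) L2(3) by (simp add: \<delta>_def)
 have ld1: "line_dom f1 U1 B1 \<delta> l u" and ld2: "line_dom g1 U2 B2 \<delta> (c0 - u) (c0 - l)"
  using L1(1) L2(1) \<delta> by (auto simp: \<delta>_def)
 have f1: "open U1" "f1 holomorphic_on U1" "!!x. 0 < Im x ==> Im x < \<delta> ==> l < Re x ==> Re x < u ==> x \<in> U1"
  "!!x. l < x ==> x < u ==> x \<notin> B1 ==> of_real x \<in> U1" using ld1 by (auto simp: line_dom_def)
 have g1: "open U2" "g1 holomorphic_on U2" "!!x. 0 < Im x ==> Im x < \<delta> ==> c0 - u < Re x ==> Re x < c0 - l ==> x \<in> U2"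
  "!!x. c0 - u < x ==> x < c0 - l ==> x \<notin> B2 ==> of_real x \<in> U2" using ld2 by (auto simp: line_dom_def)
 have A_good: "A \<notin> B1" using genF[of "Complex A \<theta>"] by (simp add: B1_def)
 have \<rho>_good: "c0 - \<rho> \<notin> B2" using genG[of "Complex (c0 - \<rho>) \<theta>'"] by (simp add: B2_def c0_def)
 have \<rho>_good': "\<rho> \<notin> B1" using star_nonsingular[OF F starF[of "Complex \<rho> \<theta>"]] by (simp add: B1_def)
 have A_good': "c0 - A \<notin> B2" using star_nonsingular[OF G starG[of "Complex (c0 - A) \<theta>'"]] by (simp add: B2_def c0_def)
 \<comment> \<open>\<open>f2\<close> and \<open>g2\<close> are the principal branches, available
   over the stars; \<open>f1\<close> and \<open>g1\<close> are extended from above and available on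
   the line. The pieces independent of om combine them in such a way that they make sense at om =
   0.\<close>
 define f2 where "f2 z = pbranch F (exp (?t + 1 * z))" for z
 define g2 where "g2 z = pbranch G (exp (?t' + 1 * z))" for z
 define SF where "SF = {z. exp (?t + 1 * z) \<in> star F}"
 define SG where "SG = {z. exp (?t' + 1 * z) \<in> star G}"
 have f2: "f2 holomorphic_on SF" unfolding f2_def[abs_def] SF_def by (rule exp_pb_holomorphic)
 have g2: "g2 holomorphic_on SG" "open SG" unfolding g2_def[abs_def] SG_def by (rule exp_pb_holomorphic)+
 have f12: "z \<in> SF \<and> f1 z = f2 z" if "z \<in> U1" "0 < Im z" for z
  using L1(4)[OF that] by (simp add: SF_def f2_def add.commute)
 have g12: "z \<in> SG \<and> g1 z = g2 z" if "z \<in> U2" "0 < Im z" for z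
  using L2(4)[OF that] by (simp add: SG_def g2_def add.commute)
 have SF_left: "z \<in> SF" if "Re z <= \<rho>" for z unfolding SF_def using that by (auto intro!: starF)
 have SG_left: "z \<in> SG" if "Re z <= c0 + 1 - A" for z unfolding SG_def using that by (auto intro!: starG simp: c0_def)
 have "finite (bad_angles \<inter> {\<theta> - 1..\<theta> + 1})" by (rule finite_bad_angles)
 from finite_set_avoid[OF this, of \<theta>] obtain d
  where d0: "d > 0 \<and> (\<forall>y\<in>bad_angles \<inter> {\<theta> - 1..\<theta> + 1}. y ~= \<theta> --> d <= dist \<theta> y)" by (rule exE)
 have d: "y \<notin> bad_angles" if "\<bar>y - \<theta>\<bar> < d" "\<bar>y - \<theta>\<bar> < 1" "y ~= \<theta>" for y
  using d0 that by (fastforce simp: dist_real_def abs_less_iff)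
 define eps where "eps = min (\<delta> / 2) (min d 1)"
 have "sector (\<theta> - \<sigma>) (\<theta> + \<sigma>)" if \<sigma>0: "0 < \<sigma>" "\<sigma> < eps" for \<sigma>
 proof -
  have \<sigma>: "0 < \<sigma>" "2 * \<sigma> < \<delta>" "\<sigma> < d" "\<sigma> < 1" using \<sigma>0 by (auto simp: eps_def)
  let ?a1 = "Complex A (- \<sigma>)" and ?a2 = "Complex \<rho> (- \<sigma>)" and ?a3 = "complex_of_real \<rho>" and ?a5 = "complex_of_real A" and ?a6 = "Complex A \<sigma>"
  define I1 where "I1 om = contour_integral (linepath ?a1 ?a2) (%z. f2 z * g1 (of_real c0 + om - z))" for om
  define I2 where "I2 om = contour_integral (linepath ?a2 ?a3) (%z. f2 z * g1 (of_real c0 + om - z))" for om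
  define R where "R om = run ?a3 ?a5 (Im om / 2) (%z. f1 z * g1 (of_real c0 + om - z))" for om
  \<comment> \<open>The contour turns upwards at height \<open>Im om / 2\<close>, whereas the run
    descends to the real point \<open>?a5\<close> and \<open>T\<close> starts there, on a fixed
    segment. The vertical piece in between is traversed both ways.\<close>
  define T where "T om = contour_integral (linepath ?a5 ?a6) (%z. f1 z * g2 (of_real c0 + om - z))" for om
  have s1: "\<rho> <= Re z" "Re z <= A" "- \<sigma> <= Im z" "Im z <= - \<sigma>" if "z \<in> closed_segment ?a1 ?a2" for z
   using segment_rectangle[OF that, of \<rho> A "- \<sigma>" "- \<sigma>"] \<rho>A by auto
  have s2: "\<rho> <= Re z" "Re z <= \<rho>" "- \<sigma> <= Im z" "Im z <= 0" if "z \<in> closed_segment ?a2 ?a3" for z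
   using segment_rectangle[OF that, of \<rho> \<rho> "- \<sigma>" 0] \<sigma> by auto
  have s5: "A <= Re z" "Re z <= A" "0 <= Im z" "Im z <= \<sigma>" if "z \<in> closed_segment ?a5 ?a6" for z
   using segment_rectangle[OF that, of A A 0 \<sigma>] \<sigma> by auto
  have nb: "\<theta> - \<sigma> \<notin> bad_angles" by (rule d) (use \<sigma> in auto)
  have SF1: "z \<in> SF" if "Im z = - \<sigma>" "Re z <= A" for z
   unfolding SF_def using nb that by (auto intro!: good_angle_star)
  obtain r1 where r1: "I1 holomorphic_on ball 0 (exp r1)"
  proof (rule segment_param_holomorphic[OF f2 g1(2,1), of ?a1 ?a2 "of_real c0"])
   show "closed_segment ?a1 ?a2 \<subseteq> SF" using s1 by (auto intro!: SF1 antisym)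
   show "of_real c0 - z \<in> U2" if "z \<in> closed_segment ?a1 ?a2" for z
    by (rule g1(3)) (use s1[OF that] \<sigma> in \<open>auto simp: l_def u_def\<close>)
  qed (auto simp: I1_def[abs_def])
  obtain r2 where r2: "I2 holomorphic_on ball 0 (exp r2)"
  proof (rule segment_param_holomorphic[OF f2 g1(2,1), of ?a2 ?a3 "of_real c0"])
   show "closed_segment ?a2 ?a3 \<subseteq> SF" using s2 by (auto intro!: SF_left)
   show "of_real c0 - z \<in> U2" if "z \<in> closed_segment ?a2 ?a3" for z
   proof (cases "Im z = 0")
    case True
    then have "of_real c0 - z = of_real (c0 - \<rho>)" using s2[OF that] by (simp add: complex_eq_iff)
    then show ?thesis using \<rho>_good \<rho>A by (simp only:) (rule g1(4), auto simp: l_def u_def)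
   next
    case False
    then show ?thesis using s2[OF that] \<sigma> \<rho>A by (intro g1(3)) (auto simp: l_def u_def)
   qed
  qed (auto simp: I2_def[abs_def])
  have W5: "z \<in> U1" if "Re z = A" "0 <= Im z" "Im z <= \<sigma>" for z
  proof (cases "Im z = 0")
   case True
   then have "z = of_real A" using that by (simp add: complex_eq_iff)
   then show ?thesis using A_good \<rho>A by (simp only:) (rule f1(4), auto simp: l_def u_def)
  next
   case False
   then show ?thesis using that \<sigma> \<rho>A by (intro f1(3)) (auto simp: l_def u_def)
  qed
  obtain r5 where r5: "T holomorphic_on ball 0 (exp r5)"
  proof (rule segment_param_holomorphic[OF f1(2) g2, of ?a5 ?a6 "of_real c0"])
   show "closed_segment ?a5 ?a6 \<subseteq> U1" using s5 by (auto intro!: W5 antisym)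
   show "of_real c0 - z \<in> SG" if "z \<in> closed_segment ?a5 ?a6" for z using s5[OF that] by (auto intro!: SG_left)
  qed (auto simp: T_def[abs_def])
  have "pinch_sum LP ((%s. Complex s \<theta>) ` {s. \<rho> < s \<and> s < A \<and> s \<in> B1 \<and> c0 - s \<in> B2}) R"
   unfolding R_def[abs_def]
  proof (rule run_pinch_sum[OF mono ld1 ld2 L1(2) L2(2)])
   show "inj (%s. Complex s \<theta>)" by (auto intro: injI)
   fix s assume s: "s \<in> B1" "c0 - s \<in> B2" "l < s" "s < u"
   have e: "c - Complex s \<theta> = Complex (c0 - s) \<theta>'" by (simp add: complex_eq_iff c0_def \<theta>'_def)
   have "exp (Complex s \<theta>) \<in> pinched F G (exp c)"
    using s e by (simp add: pinched_def B1_def B2_def exp_diff[symmetric])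
   from lifts[OF this] obtain ft gt R where *: "local_lift F (exp (Complex s \<theta>)) 1 R ft" "decays ft"
    "local_lift G (exp (Complex (c0 - s) \<theta>')) 1 R gt" "decays gt" "!!r L. cell_monodromy ft gt r L ==> LP (Complex s \<theta>) r L"
    unfolding e by blast
   show "\<exists>eps>0. \<forall>\<sigma>. 0 < \<sigma> --> \<sigma> < eps --> pinch_sum LP {Complex s \<theta>}
     (%om. run (of_real (s - \<sigma>)) (of_real (s + \<sigma>)) (Im om / 2) (%x. f1 x * g1 (of_real c0 + om - x)))"
    by (rule run_matched[OF ld1 L1(4) ld2 L2(4) s(3,4) * mono])
  qed (use \<rho>A A_good A_good' \<rho>_good \<rho>_good' in \<open>auto simp: l_def u_def\<close>)
  also have "(%s. Complex s \<theta>) ` {s. \<rho> < s \<and> s < A \<and> s \<in> B1 \<and> c0 - s \<in> B2} = pinch_logs (\<theta> - \<sigma>) (\<theta> + \<sigma>)"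
  proof (intro set_eqI iffI)
   fix x assume "x \<in> (%s. Complex s \<theta>) ` {s. \<rho> < s \<and> s < A \<and> s \<in> B1 \<and> c0 - s \<in> B2}"
   then obtain s where s: "x = Complex s \<theta>" "s \<in> B1" "c0 - s \<in> B2" by auto
   have e: "c - x = Complex (c0 - s) \<theta>'" by (simp add: complex_eq_iff c0_def \<theta>'_def s(1))
   then show "x \<in> pinch_logs (\<theta> - \<sigma>) (\<theta> + \<sigma>)"
    using s \<sigma> by (simp add: pinch_logs_def pinched_def B1_def B2_def exp_diff[symmetric])
  next
   fix x assume x: "x \<in> pinch_logs (\<theta> - \<sigma>) (\<theta> + \<sigma>)"
   then have p: "exp x \<in> pinched F G (exp c)" and I: "\<theta> - \<sigma> < Im x" "Im x < \<theta> + \<sigma>" by (auto simp: pinch_logs_def)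
   note b = pinched_bounds[OF p]
   have "Im x = \<theta>" using d[of "Im x"] b(3) I \<sigma> by (auto simp: abs_less_iff)
   then have X: "x = Complex (Re x) \<theta>" by (simp add: complex_eq_iff)
   have e: "Complex (c0 - Re x) \<theta>' = c - x" by (subst X) (simp add: complex_eq_iff c0_def \<theta>'_def)
   have E1: "exp (Complex (Re x) \<theta>) = exp x" by (rule arg_cong[OF X[symmetric]])
   have E2: "exp (Complex (c0 - Re x) \<theta>') = exp c / exp x" unfolding e by (rule exp_diff)
   have "Re x \<in> B1" "c0 - Re x \<in> B2"
    using p b E1 E2 by (simp_all add: B1_def B2_def pinched_def u_def l_def)
   then show "x \<in> (%s. Complex s \<theta>) ` {s. \<rho> < s \<and> s < A \<and> s \<in> B1 \<and> c0 - s \<in> B2}"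
    using X b by (intro image_eqI[of _ _ "Re x"]) auto
  qed
  finally have "pinch_sum LP (pinch_logs (\<theta> - \<sigma>) (\<theta> + \<sigma>)) R" .
  from pinch_sum_add[OF mono pinch_sum_holomorphic[OF r1] pinch_sum_add[OF mono pinch_sum_holomorphic[OF r2] pinch_sum_add[OF mono pinch_sum_holomorphic[OF r5] this]]]
  have ps: "pinch_sum LP (pinch_logs (\<theta> - \<sigma>) (\<theta> + \<sigma>)) (%om. I1 om + (I2 om + (T om + R om)))" by simp
  define r where "r = ln (min \<sigma> (1/2))"
  have er: "exp r = min \<sigma> (1/2)" using \<sigma> by (simp add: r_def)
  have pv: "poly_value (contour_dom F G (c + om)) (contour_kernel F G (c + om)) (Complex A (\<theta> - \<sigma>)) (Complex A (\<theta> + \<sigma>)) (I1 om + (I2 om + (T om + R om)))"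
   if om: "0 < Im om" "norm om < exp r" for om
  proof -
   let ?D = "contour_dom F G (c + om)" and ?K = "contour_kernel F G (c + om)"
   define h where "h = Im om / 2"
   have w: "norm om < \<sigma>" "norm om < 1" using om(2) er by auto
   have wR: "\<bar>Re om\<bar> < 1" and wI: "Im om < \<sigma>" using abs_Re_le_cmod[of om] abs_Im_le_cmod[of om] w by auto
   have h: "0 < h" "h < \<sigma>" "2 * h = Im om" using om(1) wI by (auto simp: h_def)
   define Kt where "Kt z = f2 z * g2 (of_real c0 + om - z)" for z
   have arg: "?t' + 1 * (of_real c0 + om - z) = c + om - (z + ?t)" for z
    by (simp add: complex_eq_iff c0_def \<theta>'_def)
   have KK: "?K (z + ?t) = Kt z" for z
    unfolding contour_kernel_def Kt_def f2_def g2_def arg by (simp add: add.commute)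
   have DD: "z + ?t \<in> ?D" if "z \<in> SF" "of_real c0 + om - z \<in> SG" for z
    using that unfolding contour_dom_def SF_def SG_def mem_Collect_eq arg by (simp add: add.commute)
   have step: "poly_value ?D ?K (a + ?t) (b + ?t) (contour_integral (linepath a b) Kt)"
    if "!!z. z \<in> closed_segment a b ==> z \<in> SF \<and> of_real c0 + om - z \<in> SG" for a b
   proof -
    have "closed_segment (a + ?t) (b + ?t) = (%z. ?t + z) ` closed_segment a b"
     using closed_segment_translation[of ?t a b] by (simp add: add.commute)
    also have "\<dots> \<subseteq> ?D"
    proof (rule image_subsetI)
     fix z assume "z \<in> closed_segment a b"
     then have "z + ?t \<in> ?D" using that by (intro DD) auto
     then show "?t + z \<in> ?D" by (simp only: add.commute)
    qed
    finally have "poly_value ?D ?K (a + ?t) (b + ?t) (contour_integral (linepath (a + ?t) (b + ?t)) ?K)" by (rule poly_value_linepath)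
    then show ?thesis unfolding contour_integral_translate KK .
   qed
   have QG: "of_real c0 + om - z \<in> SG \<and> g1 (of_real c0 + om - z) = g2 (of_real c0 + om - z)"
    if "\<rho> <= Re z" "Re z <= A" "Im z < Im om" "- \<sigma> <= Im z" for z
   proof -
    have "of_real c0 + om - z \<in> U2" by (rule g1(3)) (use that wR wI \<sigma> in \<open>auto simp: l_def u_def\<close>)
    then show ?thesis using that by (intro g12) auto
   qed
   have QF: "z \<in> SF \<and> f1 z = f2 z" if "\<rho> <= Re z" "Re z <= A" "0 < Im z" "Im z <= \<sigma>" for z
   proof -
    have "z \<in> U1" by (rule f1(3)) (use that \<sigma> in \<open>auto simp: l_def u_def\<close>)
    then show ?thesis using that by (intro f12) auto
   qed
   have QA: "of_real c0 + om - z \<in> SG" if "Re z = A" for z using that wR by (intro SG_left) auto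
   let ?a3' = "?a3 + \<i> * of_real h" and ?a5' = "?a5 + \<i> * of_real h"
   have p1: "poly_value ?D ?K (?a1 + ?t) (?a2 + ?t) (contour_integral (linepath ?a1 ?a2) Kt)"
    by (rule step) (use s1 om(1) \<sigma> in \<open>fastforce intro!: SF1 QG[THEN conjunct1]\<close>)
   have p2: "poly_value ?D ?K (?a2 + ?t) (?a3 + ?t) (contour_integral (linepath ?a2 ?a3) Kt)"
    by (rule step) (use s2 om(1) \<sigma> \<rho>A in \<open>fastforce intro!: SF_left QG[THEN conjunct1]\<close>)
   have p3: "poly_value ?D ?K (?a3 + ?t) (?a3' + ?t) (contour_integral (linepath ?a3 ?a3') Kt)"
   proof (rule step)
    fix z assume "z \<in> closed_segment ?a3 ?a3'"
    from segment_rectangle[OF this, of \<rho> \<rho> 0 h] have "\<rho> <= Re z" "Re z <= \<rho>" "0 <= Im z" "Im z <= h" using h by auto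
    then show "z \<in> SF \<and> of_real c0 + om - z \<in> SG" using h \<rho>A \<sigma> by (intro conjI SF_left QG[THEN conjunct1]) auto
   qed
   have p4: "poly_value ?D ?K (?a3' + ?t) (?a5' + ?t) (contour_integral (linepath ?a3' ?a5') Kt)"
   proof (rule step)
    fix z assume "z \<in> closed_segment ?a3' ?a5'"
    from segment_rectangle[OF this, of \<rho> A h h] have "\<rho> <= Re z" "Re z <= A" "h <= Im z" "Im z <= h" using h \<rho>A by auto
    then show "z \<in> SF \<and> of_real c0 + om - z \<in> SG" using h \<rho>A \<sigma> by (intro conjI QF[THEN conjunct1] QG[THEN conjunct1]) auto
   qed
   have s5': "Re z = A" "h <= Im z" "Im z <= \<sigma>" if "z \<in> closed_segment ?a5' ?a6" for z
    using segment_rectangle[OF that, of A A h \<sigma>] h by auto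
   have p5: "poly_value ?D ?K (?a5' + ?t) (?a6 + ?t) (contour_integral (linepath ?a5' ?a6) Kt)"
   proof (rule step)
    fix z assume "z \<in> closed_segment ?a5' ?a6"
    from s5'[OF this] show "z \<in> SF \<and> of_real c0 + om - z \<in> SG"
     using h \<rho>A by (intro conjI QF[THEN conjunct1] QA) auto
   qed
   note J = poly_value_join[OF contour_kernel_continuous]
   have P: "poly_value ?D ?K (?a1 + ?t) (?a6 + ?t) (contour_integral (linepath ?a1 ?a2) Kt + (contour_integral (linepath ?a2 ?a3) Kt +
     (contour_integral (linepath ?a3 ?a3') Kt + (contour_integral (linepath ?a3' ?a5') Kt + contour_integral (linepath ?a5' ?a6) Kt))))"
    by (rule J[OF p1 J[OF p2 J[OF p3 J[OF p4 p5]]]])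
   have e1: "contour_integral (linepath ?a1 ?a2) Kt = I1 om" unfolding I1_def Kt_def[abs_def]
   proof (rule contour_integral_cong)
    fix z assume "z \<in> path_image (linepath ?a1 ?a2)"
    then show "f2 z * g2 (of_real c0 + om - z) = f2 z * g1 (of_real c0 + om - z)"
     using s1[of z] QG[of z] om(1) \<sigma> by auto
   qed simp
   have e2: "contour_integral (linepath ?a2 ?a3) Kt = I2 om" unfolding I2_def Kt_def[abs_def]
   proof (rule contour_integral_cong)
    fix z assume "z \<in> path_image (linepath ?a2 ?a3)"
    then show "f2 z * g2 (of_real c0 + om - z) = f2 z * g1 (of_real c0 + om - z)"
     using s2[of z] QG[of z] om(1) \<sigma> \<rho>A by auto
   qed simp
   have "R om = run ?a3 ?a5 h Kt" unfolding R_def h_def[symmetric] Kt_def[abs_def]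
   proof (rule run_cong)
    fix z assume z: "0 < Im z" "Im z <= h" "\<rho> <= Re z" "Re z <= A"
    then show "f1 z * g1 (of_real c0 + om - z) = f2 z * g2 (of_real c0 + om - z)" using QF[of z] QG[of z] h \<sigma> by auto
   qed (use h \<rho>A in auto)
   then have e3: "R om = contour_integral (linepath ?a3 ?a3') Kt + contour_integral (linepath ?a3' ?a5') Kt + contour_integral (linepath ?a5' ?a5) Kt"
    by (simp add: run_def)
   let ?f = "%z. f1 z * g2 (of_real c0 + om - z)"
   have e5: "contour_integral (linepath ?a5' ?a5) Kt = contour_integral (linepath ?a5' ?a5) ?f"
   proof (rule linepath_integral_spike)
    fix t :: real assume t: "0 < t" "t < 1"
    have "Re (linepath ?a5' ?a5 t) = A" "Im (linepath ?a5' ?a5 t) = (1 - t) * h" by (simp_all add: linepath_def algebra_simps)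
    moreover have "0 < (1 - t) * h" using t h by simp
    moreover have "(1 - t) * h <= \<sigma>"
    proof -
     have "(1 - t) * h <= 1 * h" by (rule mult_right_mono) (use t h in auto)
     then show ?thesis using h by linarith
    qed
    ultimately show "Kt (linepath ?a5' ?a5 t) = ?f (linepath ?a5' ?a5 t)" unfolding Kt_def using QF[of "linepath ?a5' ?a5 t"] h \<rho>A by auto
   qed
   have e6: "contour_integral (linepath ?a5' ?a6) Kt = contour_integral (linepath ?a5' ?a6) ?f" unfolding Kt_def[abs_def]
   proof (rule contour_integral_cong)
    fix z assume "z \<in> path_image (linepath ?a5' ?a6)"
    then show "f2 z * g2 (of_real c0 + om - z) = ?f z" using s5'[of z] QF[of z] h \<rho>A by auto
   qed simp
   let ?W = "U1 \<inter> (%z. of_real c0 + om - z) -` SG"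
   have "contour_integral (linepath ?a5' ?a5) ?f + contour_integral (linepath ?a5 ?a6) ?f = contour_integral (linepath ?a5' ?a6) ?f"
   proof (rule contour_integral_triangle)
    show "open ?W" by (intro open_Int f1(1) open_vimage g2(2) continuous_intros)
    show "?f holomorphic_on ?W"
     by (intro holomorphic_on_mult holomorphic_on_subset[OF f1(2)] holomorphic_on_compose_gen[OF _ g2(1), unfolded o_def])
      (auto intro!: holomorphic_intros)
    have "convex hull {?a5', ?a5, ?a6} \<subseteq> {z. A <= Re z \<and> Re z <= A \<and> 0 <= Im z \<and> Im z <= \<sigma>}"
     by (rule hull_minimal[of _ "{z. A <= Re z \<and> Re z <= A \<and> 0 <= Im z \<and> Im z <= \<sigma>}" convex, OF _ convex_rectangle]) (use h in auto)
    also have "\<dots> \<subseteq> ?W" using W5 QA by (auto dest: antisym)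
    finally show "convex hull {?a5', ?a5, ?a6} \<subseteq> ?W" .
   qed
   then have e7: "contour_integral (linepath ?a5' ?a6) Kt = contour_integral (linepath ?a5' ?a5) Kt + T om"
    unfolding e5 e6 T_def by simp
   have ends: "?a1 + ?t = Complex A (\<theta> - \<sigma>)" "?a6 + ?t = Complex A (\<theta> + \<sigma>)" by (simp_all add: complex_eq_iff)
   have "contour_integral (linepath ?a1 ?a2) Kt + (contour_integral (linepath ?a2 ?a3) Kt +
     (contour_integral (linepath ?a3 ?a3') Kt + (contour_integral (linepath ?a3' ?a5') Kt + contour_integral (linepath ?a5' ?a6) Kt)))
    = I1 om + (I2 om + (T om + R om))"
    unfolding e1 e2 e3 e7 by (simp only: ac_simps)
   then show ?thesis using P unfolding ends by simp
  qed
  show ?thesis unfolding sector_def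
   by (intro exI[of _ "%om. I1 om + (I2 om + (T om + R om))"] exI[of _ r] conjI allI impI ps pv)
 qed
 moreover have "eps > 0" using \<delta> d0 by (simp add: eps_def)
 ultimately show ?thesis by blast
qed

text \<open>The period starts at an angle without singular rays, so that both of its ends are
  regular and no logarithm of a pinching \<alpha> lies on its boundary.\<close>

lemma full_circle:
 obtains \<theta> k r where "pinch_sum LP (pinch_logs \<theta> (\<theta> + 2 * pi)) k" "\<theta> \<notin> bad_angles"
  "!!om. 0 < Im om ==> norm om < exp r ==> exp (c + om) \<in> star (fps_hadamard F G) \<and>
   pbranch (fps_hadamard F G) (exp (c + om)) = k om / (2 * of_real pi * \<i>)"
proof -
 have "infinite ({0..1} - (bad_angles \<inter> {0..1::real}))"
  using finite_bad_angles by (intro Diff_infinite_finite) auto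
 then have "{0..1} - (bad_angles \<inter> {0..1}) ~= {}" by (rule infinite_imp_nonempty)
 then obtain \<theta> where "\<theta> \<in> {0..1} - (bad_angles \<inter> {0..1})" by blast
 then have \<theta>: "\<theta> \<notin> bad_angles" by auto
 have per: "exp (Complex s (\<theta> + 2 * pi)) = exp (Complex s \<theta>)" for s
 proof -
  have "Complex s (\<theta> + 2 * pi) = Complex s \<theta> + of_real (2 * pi) * \<i>" by (simp add: complex_eq_iff)
  then show ?thesis by (simp add: exp_add)
 qed
 have \<theta>': "\<theta> + 2 * pi \<notin> bad_angles" using \<theta> by (simp add: bad_angles_def per)
 have "sector \<theta> (\<theta> + 2 * pi)"
 proof (rule finite_interval_induct[of "bad_angles \<inter> {\<theta>..\<theta> + 2 * pi}" \<theta> "\<theta> + 2 * pi" sector])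
  show "finite (bad_angles \<inter> {\<theta>..\<theta> + 2 * pi})" by (rule finite_bad_angles)
  show "sector p q" if "\<theta> <= p" "p < q" "q <= \<theta> + 2 * pi" "bad_angles \<inter> {\<theta>..\<theta> + 2 * pi} \<inter> {p..q} = {}" for p q
   by (rule sector_plain) (use that in auto)
  show "\<exists>eps>0. \<forall>\<sigma>. 0 < \<sigma> --> \<sigma> < eps --> sector (s - \<sigma>) (s + \<sigma>)" for s by (rule sector_special)
  show "sector p q'" if "\<theta> <= p" "p < q" "q < q'" "q' <= \<theta> + 2 * pi" "q \<notin> bad_angles \<inter> {\<theta>..\<theta> + 2 * pi}" "sector p q" "sector q q'" for p q q'
   by (rule sector_join[OF that(6,7,2,3)]) (use that in auto)
 qed (use \<theta> \<theta>' in auto)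
 then obtain k r where k: "pinch_sum LP (pinch_logs \<theta> (\<theta> + 2 * pi)) k" "!!om. 0 < Im om ==> norm om < exp r ==>
  poly_value (contour_dom F G (c + om)) (contour_kernel F G (c + om)) (Complex A \<theta>) (Complex A (\<theta> + 2 * pi)) (k om)"
  unfolding sector_def by blast
 show thesis
 proof (rule that[OF k(1) \<theta>, of r])
  fix om :: complex assume "0 < Im om" "norm om < exp r"
  from k(2)[OF this] obtain p where p: "polygonal p" "pathstart p = Complex A \<theta>" "pathfinish p = Complex A (\<theta> + 2 * pi)"
   "path_image p \<subseteq> contour_dom F G (c + om)" "contour_integral p (contour_kernel F G (c + om)) = k om"
   unfolding poly_value_def by blast
  have e: "pathfinish p = pathstart p + 2 * of_real pi * \<i>" using p by (simp add: complex_eq_iff)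
  have dom: "exp x \<in> star F \<and> exp (c + om - x) \<in> star G" if "x \<in> path_image p" for x
   using p(4) that by (auto simp: contour_dom_def)
  show "exp (c + om) \<in> star (fps_hadamard F G) \<and>
   pbranch (fps_hadamard F G) (exp (c + om)) = k om / (2 * of_real pi * \<i>)"
   using hadamard_contour[OF F G p(1) e dom] p(5) by (simp add: contour_kernel_def[abs_def])
 qed
qed

end

section \<open>Representation near a point on either side of its ray\<close>

text \<open>In om = log (z / \<gamma>), the principal branch on the side \<open>s\<close> of the
  ray, multiplied by 2 pi i, is a holomorphic germ plus one cell per pair. \<open>ft\<close> and
  \<open>gt\<close> are the lifts belonging to this side.\<close>

definition pinch_data where
 "pinch_data F G \<gamma> s ft gt r h L \<longleftrightarrow> finite (pinched F G \<gamma>) \<and> h holomorphic_on ball 0 (exp r) \<and>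
  (\<forall>\<alpha>\<in>pinched F G \<gamma>. cell_monodromy (ft \<alpha>) (gt \<alpha>) r (L \<alpha>)) \<and>
  (\<forall>om. 0 < (s::real) * Im om --> norm om < exp r --> \<gamma> * exp om \<in> star (fps_hadamard F G) \<and>
    pbranch (fps_hadamard F G) (\<gamma> * exp om) = (h om + (\<Sum>\<alpha>\<in>pinched F G \<gamma>. L \<alpha> (Ln om))) / (2 * of_real pi * \<i>))"

lemma finite_avoid_interval:
 assumes "finite S" "a < (b::real)"
 obtains x where "a < x" "x < b" "x \<notin> S"
proof -
 have "infinite ({a<..<b} - S)" using assms by (intro Diff_infinite_finite) (auto simp: infinite_Ioo)
 then have "{a<..<b} - S ~= {}" by (rule infinite_imp_nonempty)
 then obtain x where "x \<in> {a<..<b} - S" by blast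
 then show thesis by (intro that[of x]) auto
qed

lemma log_in_strip:
 assumes "\<alpha> ~= 0"
 obtains x where "exp x = \<alpha>" "\<theta> <= Im x" "Im x < \<theta> + 2 * pi"
proof -
 let ?y = "Arg2pi (\<alpha> / cis \<theta>)"
 have "\<alpha> / cis \<theta> = of_real (norm (\<alpha> / cis \<theta>)) * exp (\<i> * of_real ?y)" by (rule Arg2pi_eq)
 then have "\<alpha> = of_real (norm \<alpha>) * exp (\<i> * of_real ?y) * cis \<theta>" by (simp add: norm_divide field_simps)
 also have "of_real (norm \<alpha>) = exp (complex_of_real (ln (norm \<alpha>)))" using assms by (metis exp_ln exp_of_real zero_less_norm_iff)
 finally have "exp (Complex (ln (norm \<alpha>)) (\<theta> + ?y)) = \<alpha>"
  by (simp add: cis_conv_exp exp_add[symmetric] Complex_eq algebra_simps)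
 then show thesis using Arg2pi_ge_0[of "\<alpha> / cis \<theta>"] Arg2pi_lt_2pi[of "\<alpha> / cis \<theta>"] by (intro that) auto
qed

lemma hadamard_radius:
 assumes "fps_conv_radius F > 0" "fps_conv_radius G > 0" shows "fps_conv_radius (fps_hadamard F G) > 0"
proof -
 obtain r where r: "r > 0" "ereal r < fps_conv_radius F" by (rule pbranch_near_0[OF assms(1)]) blast
 obtain s where s: "s > 0" "ereal s < fps_conv_radius G" by (rule pbranch_near_0[OF assms(2)]) blast
 have sF: "summable (%n. norm (fps_nth F n * of_real r ^ n))"
  by (rule abs_summable_in_conv_radius) (use r in \<open>simp add: fps_conv_radius_def\<close>)
 have "summable (%n. norm (fps_nth G n * of_real s ^ n))"
  by (rule abs_summable_in_conv_radius) (use s in \<open>simp add: fps_conv_radius_def\<close>)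
 then have "(%n. norm (fps_nth G n * of_real s ^ n)) \<longlonglongrightarrow> 0" by (rule summable_LIMSEQ_zero)
 then have ev: "\<forall>\<^sub>F n in sequentially. norm (fps_nth G n * of_real s ^ n) < 1" by (rule order_tendstoD) simp
 have "summable (%n. fps_nth (fps_hadamard F G) n * (of_real (r * s)) ^ n)"
 proof (rule summable_comparison_test_ev[OF _ sF])
  show "\<forall>\<^sub>F n in sequentially. norm (fps_nth (fps_hadamard F G) n * of_real (r * s) ^ n) <= norm (fps_nth F n * of_real r ^ n)"
   using ev
  proof (rule eventually_mono)
   fix n assume n: "norm (fps_nth G n * of_real s ^ n) < 1"
   have "norm (fps_nth (fps_hadamard F G) n * of_real (r * s) ^ n) = norm (fps_nth F n * of_real r ^ n) * norm (fps_nth G n * of_real s ^ n)"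
    unfolding norm_mult[symmetric] by (simp add: fps_hadamard_def power_mult_distrib mult_ac)
   also have "\<dots> <= norm (fps_nth F n * of_real r ^ n) * 1" using n by (intro mult_left_mono) auto
   finally show "norm (fps_nth (fps_hadamard F G) n * of_real (r * s) ^ n) <= norm (fps_nth F n * of_real r ^ n)" by simp
  qed
 qed
 then have "ereal (norm (complex_of_real (r * s))) <= fps_conv_radius (fps_hadamard F G)"
  unfolding fps_conv_radius_def by (rule conv_radius_geI)
 moreover have "0 < ereal (norm (complex_of_real (r * s)))" using r(1) s(1) by simp
 ultimately show ?thesis by (rule less_le_trans[rotated])
qed

text \<open>Finitely many moduli have to be avoided in choosing \<open>\<rho>\<close> and
  \<open>A\<close>. Within one period each pinching \<alpha> has exactly one logarithm, so that the
  sum over logarithms can be reindexed by the \<alpha>.\<close>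

lemma left_representation:
 fixes ft gt :: "complex => complex => complex"
 assumes F: "fps_conv_radius F > 0" and G: "fps_conv_radius G > 0" and \<gamma>: "\<gamma> ~= 0"
  and fin: "!!r. finite (singularities F \<inter> cball 0 r)" "!!r. finite (singularities G \<inter> cball 0 r)"
  and lifts: "!!\<alpha>. \<alpha> \<in> pinched F G \<gamma> ==> \<exists>R. local_lift F \<alpha> 1 R (ft \<alpha>) \<and> decays (ft \<alpha>) \<and>
   local_lift G (\<gamma> / \<alpha>) 1 R (gt \<alpha>) \<and> decays (gt \<alpha>)"
 shows "\<exists>r h L. pinch_data F G \<gamma> 1 ft gt r h L"
proof -
 define c where "c = Ln \<gamma>"
 have c: "exp c = \<gamma>" using \<gamma> by (simp add: c_def)
 obtain rF where rF: "rF > 0" "ball 0 rF \<subseteq> star F" by (rule pbranch_near_0[OF F]) blast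
 obtain rG where rG: "rG > 0" "ball 0 rG \<subseteq> star G" by (rule pbranch_near_0[OF G]) blast
 have sF: "exp x \<in> star F" if "Re x <= ln (rF / 2)" for x
 proof -
  have "exp (Re x) <= exp (ln (rF / 2))" using that by simp
  then have "norm (exp x) < rF" using rF(1) by (simp add: norm_exp_eq_Re)
  then show ?thesis using rF(2) by auto
 qed
 have sG: "exp x \<in> star G" if "Re x <= ln (rG / 2)" for x
 proof -
  have "exp (Re x) <= exp (ln (rG / 2))" using that by simp
  then have "norm (exp x) < rG" using rG(1) by (simp add: norm_exp_eq_Re)
  then show ?thesis using rG(2) by auto
 qed
 define \<rho>0 where "\<rho>0 = ln (rF / 2)"
 let ?SG = "(%z. Re c - ln (norm z)) ` (singularities G \<inter> cball 0 (exp (Re c - \<rho>0 + 1)))"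
 obtain \<rho> where \<rho>: "\<rho>0 - 1 < \<rho>" "\<rho> < \<rho>0" "\<rho> \<notin> ?SG"
  by (rule finite_avoid_interval[of ?SG "\<rho>0 - 1" \<rho>0]) (use fin(2) in auto)
 \<comment> \<open>The first bound puts exp x into the star of \<open>G\<close> for
   \<open>Re x <= Re c + 1 - A\<close>; the second keeps \<open>\<rho>\<close> to the left of
   \<open>A\<close>.\<close>
 define A0 where "A0 = max (Re c + 1 - ln (rG / 2)) \<rho>0"
 let ?SF = "(%z. ln (norm z)) ` (singularities F \<inter> cball 0 (exp (A0 + 1)))"
 obtain A where A: "A0 < A" "A < A0 + 1" "A \<notin> ?SF"
  by (rule finite_avoid_interval[of ?SF A0 "A0 + 1"]) (use fin(1) in auto)
 define LP where "LP x r L = cell_monodromy (ft (exp x)) (gt (exp x)) r L" for x r L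
 interpret left_contour F G c A \<rho> LP
 proof
  show "\<rho> < A" using \<rho> A by (simp add: A0_def)
  show "exp x \<in> star F" if "Re x <= \<rho>" for x using sF[of x] that \<rho> by (simp add: \<rho>0_def)
  show "exp x \<in> star G" if "Re x <= Re c + 1 - A" for x using sG[of x] that A(1) by (simp add: A0_def)
  show "exp x \<notin> singularities F" if x: "Re x = A" for x
  proof
   assume "exp x \<in> singularities F"
   moreover have "exp x \<in> cball 0 (exp (A0 + 1))" using x A(2) by (simp add: norm_exp_eq_Re)
   ultimately have "ln (norm (exp x)) \<in> ?SF" by blast
   then show False using A(3) x by (simp add: norm_exp_eq_Re)
  qed
  show "exp x \<notin> singularities G" if x: "Re x = Re c - \<rho>" for x
  proof
   assume "exp x \<in> singularities G"
   moreover have "exp x \<in> cball 0 (exp (Re c - \<rho>0 + 1))" using x \<rho>(1) by (simp add: norm_exp_eq_Re)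
   ultimately have "Re c - ln (norm (exp x)) \<in> ?SG" by blast
   then show False using \<rho>(3) x by (simp add: norm_exp_eq_Re)
  qed
  show "LP_mono LP" unfolding LP_mono_def LP_def using cell_monodromy_mono by blast
  fix x assume "exp x \<in> pinched F G (exp c)"
  then have "exp x \<in> pinched F G \<gamma>" by (simp add: c)
  from lifts[OF this] obtain R where *: "local_lift F (exp x) 1 R (ft (exp x))" "decays (ft (exp x))"
   "local_lift G (\<gamma> / exp x) 1 R (gt (exp x))" "decays (gt (exp x))" by blast
  have e: "exp (c - x) = \<gamma> / exp x" by (simp add: exp_diff c)
  show "\<exists>ft' gt' R. local_lift F (exp x) 1 R ft' \<and> decays ft' \<and> local_lift G (exp (c - x)) 1 R gt' \<and> decays gt' \<and>
    (\<forall>r L. cell_monodromy ft' gt' r L --> LP x r L)"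
   unfolding e LP_def by (intro exI[of _ "ft (exp x)"] exI[of _ "gt (exp x)"] exI[of _ R] conjI * allI impI)
 qed (use F G fin in auto)
 let ?M = "pinched F G \<gamma>"
 have "\<exists>\<theta> k r. pinch_sum LP (pinch_logs \<theta> (\<theta> + 2 * pi)) k \<and> \<theta> \<notin> bad_angles \<and>
  (\<forall>om. 0 < Im om --> norm om < exp r --> exp (c + om) \<in> star (fps_hadamard F G) \<and>
   pbranch (fps_hadamard F G) (exp (c + om)) = k om / (2 * of_real pi * \<i>))"
 proof (rule full_circle)
  fix \<theta> k r
  assume a: "pinch_sum LP (pinch_logs \<theta> (\<theta> + 2 * pi)) k" "\<theta> \<notin> bad_angles"
   and b: "!!om. 0 < Im om ==> norm om < exp r ==> exp (c + om) \<in> star (fps_hadamard F G) \<and>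
   pbranch (fps_hadamard F G) (exp (c + om)) = k om / (2 * of_real pi * \<i>)"
  show ?thesis
   by (intro exI[of _ \<theta>] exI[of _ k] exI[of _ r] conjI allI impI a b[THEN conjunct1] b[THEN conjunct2])
 qed
 then obtain \<theta> k r where k0: "pinch_sum LP (pinch_logs \<theta> (\<theta> + 2 * pi)) k \<and> \<theta> \<notin> bad_angles \<and>
  (\<forall>om. 0 < Im om --> norm om < exp r --> exp (c + om) \<in> star (fps_hadamard F G) \<and>
   pbranch (fps_hadamard F G) (exp (c + om)) = k om / (2 * of_real pi * \<i>))"
  by (elim exE) (rule that)
 have k: "pinch_sum LP (pinch_logs \<theta> (\<theta> + 2 * pi)) k" "\<theta> \<notin> bad_angles"
  "!!om. 0 < Im om ==> norm om < exp r ==> exp (c + om) \<in> star (fps_hadamard F G) \<and>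
   pbranch (fps_hadamard F G) (exp (c + om)) = k om / (2 * of_real pi * \<i>)"
  using k0 by simp_all
 let ?X = "pinch_logs \<theta> (\<theta> + 2 * pi)"
 have fX: "finite ?X" by (rule conjunct1[OF k(1)[unfolded pinch_sum_def]])
 from conjunct2[OF k(1)[unfolded pinch_sum_def]]
 obtain r' h L where L0: "h holomorphic_on ball 0 (exp r') \<and> (\<forall>x\<in>?X. LP x r' (L x)) \<and>
  (\<forall>om. 0 < Im om --> norm om < exp r' --> k om = h om + (\<Sum>x\<in>?X. L x (Ln om)))"
  by (elim exE) (rule that)
 note L = fX conjunct1[OF L0] conjunct1[OF conjunct2[OF L0]] conjunct2[OF conjunct2[OF L0]]
 have inj: "inj_on exp ?X"
 proof (rule inj_onI)
  fix x y assume xy: "x \<in> ?X" "y \<in> ?X" "exp x = exp y"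
  have "\<bar>Im x - Im y\<bar> < 2 * pi" using xy(1,2) by (auto simp: pinch_logs_def abs_less_iff)
  then show "x = y" using xy(3) by (rule exp_complex_eqI)
 qed
 have im: "exp ` ?X = ?M"
 proof (intro set_eqI iffI)
  fix \<alpha> assume \<alpha>: "\<alpha> \<in> ?M"
  then have "\<alpha> ~= 0" using zero_not_singular by (auto simp: pinched_def)
  then obtain x where x: "exp x = \<alpha>" "\<theta> <= Im x" "Im x < \<theta> + 2 * pi" by (rule log_in_strip)
  have p: "exp x \<in> pinched F G (exp c)" using \<alpha> x(1) c by simp
  have "Im x ~= \<theta>" using pinched_bounds(3)[OF p] k(2) by auto
  then show "\<alpha> \<in> exp ` ?X" using x p by (intro image_eqI[of _ _ x]) (auto simp: pinch_logs_def)
 qed (auto simp: pinch_logs_def c)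
 have bij: "bij_betw (inv_into ?X exp) ?M ?X"
  using inj im by (metis bij_betw_inv_into bij_betw_def)
 let ?r = "min r r'"
 have e: "exp ?r <= exp r" "exp ?r <= exp r'" by auto
 have "pinch_data F G \<gamma> 1 ft gt ?r h (%\<alpha>. L (inv_into ?X exp \<alpha>))"
  unfolding pinch_data_def
 proof (intro conjI ballI allI impI)
  show "finite ?M" using L(1) im by (metis finite_imageI)
  show "h holomorphic_on ball 0 (exp ?r)" by (rule holomorphic_on_subset[OF L(2) subset_ball[OF e(2)]])
  fix \<alpha> assume \<alpha>: "\<alpha> \<in> ?M"
  then have "inv_into ?X exp \<alpha> \<in> ?X" "exp (inv_into ?X exp \<alpha>) = \<alpha>"
   using im by (auto intro: inv_into_into f_inv_into_f)
  then have "cell_monodromy (ft \<alpha>) (gt \<alpha>) r' (L (inv_into ?X exp \<alpha>))" using L(3)[rule_format, of "inv_into ?X exp \<alpha>"] by (simp add: LP_def)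
  then show "cell_monodromy (ft \<alpha>) (gt \<alpha>) ?r (L (inv_into ?X exp \<alpha>))" by (rule cell_monodromy_mono) simp
 next
  fix om :: complex assume w: "0 < 1 * Im om" "norm om < exp ?r"
  have w': "0 < Im om" "norm om < exp r" "norm om < exp r'"
   using w(1) order.strict_trans2[OF w(2) e(1)] order.strict_trans2[OF w(2) e(2)] by simp_all
  have "(\<Sum>x\<in>?X. L x (Ln om)) = (\<Sum>\<alpha>\<in>?M. L (inv_into ?X exp \<alpha>) (Ln om))"
   by (rule sum.reindex_bij_betw[OF bij, symmetric])
  then show "\<gamma> * exp om \<in> star (fps_hadamard F G)"
   "pbranch (fps_hadamard F G) (\<gamma> * exp om) = (h om + (\<Sum>\<alpha>\<in>?M. L (inv_into ?X exp \<alpha>) (Ln om))) / (2 * of_real pi * \<i>)"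
   using k(3)[OF w'(1,2)] L(4)[rule_format, OF w'(1,3)] by (simp_all add: exp_add c)
 qed
 then show ?thesis by blast
qed

section \<open>Complex conjugation exchanges the two sides\<close>

text \<open>The series of the reflected function cnj (F (cnj z)), whose singularities are reflected
  and whose rays have their sides exchanged.\<close>

definition conj_fps :: "complex fps => complex fps" where
 "conj_fps F = Abs_fps (%n. cnj (fps_nth F n))"

lemma conj_fps_conj [simp]: "conj_fps (conj_fps F) = F"
 by (simp add: conj_fps_def fps_eq_iff)

lemma conj_fps_radius [simp]: "fps_conv_radius (conj_fps F) = fps_conv_radius F"
 by (simp add: conj_fps_def fps_conv_radius_def conv_radius_def)

lemma conj_fps_hadamard: "fps_hadamard (conj_fps F) (conj_fps G) = conj_fps (fps_hadamard F G)"
 by (simp add: conj_fps_def fps_hadamard_def fps_eq_iff)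

lemma DERIV_cnj_cnj:
 assumes "(f has_field_derivative D) (at (cnj x))"
 shows "((%z. cnj (f (cnj z))) has_field_derivative cnj D) (at x)"
proof -
 have "filterlim cnj (at 0) (at 0)"
  unfolding filterlim_at by (auto intro!: tendsto_eq_intros simp: eventually_at_filter)
 then have "((%h. (f (cnj x + cnj h) - f (cnj x)) / cnj h) \<longlongrightarrow> D) (at 0)"
  using assms unfolding DERIV_def by (rule filterlim_compose[rotated])
 then have "((%h. cnj ((f (cnj x + cnj h) - f (cnj x)) / cnj h)) \<longlongrightarrow> cnj D) (at 0)" by (rule tendsto_cnj)
 then show ?thesis unfolding DERIV_def by simp
qed

lemma holomorphic_cnj_cnj:
 assumes f: "f holomorphic_on S" "open S"
 shows "(%z. cnj (f (cnj z))) holomorphic_on cnj -` S"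
proof -
 have "\<exists>D. ((%z. cnj (f (cnj z))) has_field_derivative D) (at z within cnj -` S)" if z: "z \<in> cnj -` S" for z
 proof -
  have "(f has_field_derivative deriv f (cnj z)) (at (cnj z))" using f z by (auto intro: holomorphic_derivI)
  then show ?thesis using DERIV_cnj_cnj has_field_derivative_at_within by blast
 qed
 then show ?thesis unfolding holomorphic_on_def field_differentiable_def by blast
qed

lemma cnj_vimage_ball: "cnj -` ball (cnj a) e = ball a e"
proof -
 have "dist (cnj a) (cnj z) = dist a z" for z by (metis complex_cnj_diff complex_mod_cnj dist_norm)
 then show ?thesis by auto
qed

lemma eventually_nhds_cnj:
 assumes "\<forall>\<^sub>F z in nhds a. P z" shows "\<forall>\<^sub>F z in nhds (cnj a). P (cnj z)"
proof (rule eventually_compose_filterlim[OF assms])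
 have "((%z. cnj z) \<longlongrightarrow> cnj (cnj a)) (nhds (cnj a))" by (intro tendsto_cnj filterlim_ident)
 then show "filterlim cnj (nhds a) (nhds (cnj a))" by simp
qed

lemma continues_along_cnj:
 assumes c: "continues_along f p \<phi>" and g: "\<forall>\<^sub>F z in nhds (pathstart p). g (cnj z) = cnj (f z)"
 shows "continues_along g (%t. cnj (p t)) (%t z. cnj (\<phi> t (cnj z)))"
 unfolding continues_along_def continuation_family_def
proof (intro conjI ballI)
 have p: "path p" and an: "!!t. t \<in> {0..1} ==> \<phi> t analytic_on {p t}"
  and ev: "!!t. t \<in> {0..1} ==> \<forall>\<^sub>F s in at t within {0..1}. \<forall>\<^sub>F z in nhds (p s). \<phi> s z = \<phi> t z"
  and st: "\<forall>\<^sub>F z in nhds (pathstart p). \<phi> 0 z = f z"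
  using c unfolding continues_along_def continuation_family_def by auto
 show "path (%t. cnj (p t))" using p unfolding path_def by (intro continuous_on_cnj)
 have "\<forall>\<^sub>F z in nhds (cnj (pathstart p)). g (cnj (cnj z)) = cnj (f (cnj z)) \<and> \<phi> 0 (cnj z) = f (cnj z)"
  using eventually_nhds_cnj[OF eventually_conj[OF g st]] by simp
 then show "\<forall>\<^sub>F z in nhds (pathstart (%t. cnj (p t))). cnj (\<phi> 0 (cnj z)) = g z"
  unfolding pathstart_def by (rule eventually_mono) auto
 fix t :: real assume t: "t \<in> {0..1}"
 obtain e where e: "e > 0" "\<phi> t holomorphic_on ball (p t) e" using an[OF t] by (auto simp: analytic_on_def)
 have "(%z. cnj (\<phi> t (cnj z))) holomorphic_on cnj -` ball (p t) e" by (rule holomorphic_cnj_cnj[OF e(2)]) simp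
 moreover have "cnj -` ball (p t) e = ball (cnj (p t)) e" using cnj_vimage_ball[of "cnj (p t)" e] by simp
 ultimately show "(%z. cnj (\<phi> t (cnj z))) analytic_on {cnj (p t)}" using e(1) by (auto simp: analytic_on_def)
 show "\<forall>\<^sub>F s in at t within {0..1}. \<forall>\<^sub>F z in nhds (cnj (p s)). cnj (\<phi> s (cnj z)) = cnj (\<phi> t (cnj z))"
  using ev[OF t]
 proof (rule eventually_mono)
  fix s assume "\<forall>\<^sub>F z in nhds (p s). \<phi> s z = \<phi> t z"
  from eventually_nhds_cnj[OF this] show "\<forall>\<^sub>F z in nhds (cnj (p s)). cnj (\<phi> s (cnj z)) = cnj (\<phi> t (cnj z))"
   by (rule eventually_mono) simp
 qed
qed

lemma continuable_conj_fps:
 assumes F: "fps_conv_radius F > 0" and p: "pathstart p = 0" "continuable (eval_fps F) p"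
 shows "continuable (eval_fps (conj_fps F)) (%t. cnj (p t))"
  "continuation_value (eval_fps (conj_fps F)) (%t. cnj (p t)) = cnj (continuation_value (eval_fps F) p)"
proof -
 obtain \<phi> where \<phi>: "continues_along (eval_fps F) p \<phi>" using p(2) unfolding continuable_def by blast
 obtain r where r: "r > 0" "ereal r < fps_conv_radius F" by (rule pbranch_near_0[OF F]) blast
 have "eval_fps (conj_fps F) (cnj z) = cnj (eval_fps F z)" if "z \<in> ball 0 r" for z
 proof -
  have "ereal (norm z) < fps_conv_radius F" using that r(2) by (simp add: less_trans[of "ereal (norm z)" "ereal r"])
  then have "(%n. fps_nth F n * z ^ n) sums eval_fps F z" by (rule sums_eval_fps)
  then have "(%n. cnj (fps_nth F n * z ^ n)) sums cnj (eval_fps F z)" by (simp only: sums_cnj)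
  then show ?thesis by (simp add: eval_fps_def conj_fps_def sums_iff)
 qed
 then have "\<forall>\<^sub>F z in nhds (pathstart p). eval_fps (conj_fps F) (cnj z) = cnj (eval_fps F z)"
  unfolding eventually_nhds p(1) using r(1) by (intro exI[of _ "ball 0 r"]) auto
 from continues_along_cnj[OF \<phi> this]
 have *: "continues_along (eval_fps (conj_fps F)) (%t. cnj (p t)) (%t z. cnj (\<phi> t (cnj z)))" .
 then show "continuable (eval_fps (conj_fps F)) (%t. cnj (p t))" unfolding continuable_def by blast
 show "continuation_value (eval_fps (conj_fps F)) (%t. cnj (p t)) = cnj (continuation_value (eval_fps F) p)"
  unfolding continuation_value_eq[OF *] continuation_value_eq[OF \<phi>] by (simp add: pathfinish_def)
qed

lemma cnj_linepath: "(%t. cnj (linepath a b t)) = linepath (cnj a) (cnj b)"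
 by (simp add: linepath_def fun_eq_iff)

lemma star_conj_fps:
 assumes F: "fps_conv_radius F > 0" and z: "z \<in> star F"
 shows "cnj z \<in> star (conj_fps F)" "pbranch (conj_fps F) (cnj z) = cnj (pbranch F z)"
 using continuable_conj_fps[OF F, of "linepath 0 z"] z
 unfolding star_def pbranch_def cnj_linepath by auto

lemma singularities_conj_fps_imp:
 assumes F: "fps_conv_radius F > 0" and a: "a \<in> singularities (conj_fps F)"
 shows "cnj a \<in> singularities F"
proof (rule ccontr)
 assume "cnj a \<notin> singularities F"
 then obtain r where r: "r > 0" "!!z. z \<in> ball (cnj a) r ==> Im (z / cnj a) ~= 0 ==> continuable (eval_fps F) (linepath 0 z +++ linepath z (cnj a))"
  by (rule nonsingularE) blast
 have "a \<notin> singularities (conj_fps F)"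
 proof (rule nonsingularI[OF r(1)])
  fix z assume z: "z \<in> ball a r" "Im (z / a) ~= 0"
  have "cnj z \<in> ball (cnj a) r" using z(1) cnj_vimage_ball[of "a" r] by blast
  moreover have "Im (cnj z / cnj a) ~= 0" using z(2) by (metis Im_complex_div_eq_0 cnj.sel(2) complex_cnj_divide neg_equal_0_iff_equal)
  ultimately have "continuable (eval_fps F) (linepath 0 (cnj z) +++ linepath (cnj z) (cnj a))" by (rule r(2))
  from continuable_conj_fps(1)[OF F _ this]
  have "continuable (eval_fps (conj_fps F)) (%t. cnj ((linepath 0 (cnj z) +++ linepath (cnj z) (cnj a)) t))" by simp
  also have "(%t. cnj ((linepath 0 (cnj z) +++ linepath (cnj z) (cnj a)) t)) = linepath 0 z +++ linepath z a"
   using cnj_linepath[of 0 "cnj z"] cnj_linepath[of "cnj z" "cnj a"] by (auto simp: joinpaths_def fun_eq_iff)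
  finally show "continuable (eval_fps (conj_fps F)) (linepath 0 z +++ linepath z a)" .
 qed
 then show False using a by simp
qed

lemma singularities_conj_fps:
 assumes F: "fps_conv_radius F > 0"
 shows "a \<in> singularities (conj_fps F) \<longleftrightarrow> cnj a \<in> singularities F"
 using singularities_conj_fps_imp[OF F, of a] singularities_conj_fps_imp[of "conj_fps F" "cnj a"] F by auto

lemma dexp_cnj: "dexp (cnj a) X = cnj (dexp a (cnj X))"
 by (simp add: dexp_def exp_cnj)

lemma cnj_vimage_half_plane: "cnj -` {X. Re X < R} = {X. Re X < R}" by auto

lemma local_lift_conj:
 assumes F: "fps_conv_radius F > 0" and L: "local_lift F a s R f"
 shows "local_lift (conj_fps F) (cnj a) (- s) R (%X. cnj (f (cnj X)))"
 unfolding local_lift_def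
proof (intro conjI allI impI)
 have f: "f holomorphic_on {X. Re X < R}" using L by (simp add: local_lift_def)
 show "(%X. cnj (f (cnj X))) holomorphic_on {X. Re X < R}"
  using holomorphic_cnj_cnj[OF f open_half_plane_Re] by (simp only: cnj_vimage_half_plane)
 fix X assume X: "Re X < R" "0 < - s * Im X" "- s * Im X < pi"
 have "dexp a (cnj X) \<in> star F \<and> f (cnj X) = pbranch F (dexp a (cnj X))"
  using L X unfolding local_lift_def by (auto dest!: spec[of _ "cnj X"])
 then show "dexp (cnj a) X \<in> star (conj_fps F)" "cnj (f (cnj X)) = pbranch (conj_fps F) (dexp (cnj a) X)"
  using star_conj_fps[OF F, of "dexp a (cnj X)"] by (auto simp: dexp_cnj)
qed

lemma decays_conj:
 assumes "decays f" shows "decays (%X. cnj (f (cnj X)))"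
 unfolding decays_def
proof (intro allI impI)
 fix M eps :: real assume "eps > 0"
 then obtain T where T: "!!X. Re X < T ==> \<bar>Im X\<bar> <= M ==> norm (f X * exp X) < eps" using assms unfolding decays_def by blast
 have "norm (cnj (f (cnj X)) * exp X) < eps" if "Re X < T" "\<bar>Im X\<bar> <= M" for X
 proof -
  have "norm (cnj (f (cnj X)) * exp X) = norm (f (cnj X) * exp (cnj X))" by (simp add: norm_mult)
  then show ?thesis using T[of "cnj X"] that by simp
 qed
 then show "\<exists>T. \<forall>X. Re X < T --> \<bar>Im X\<bar> <= M --> norm (cnj (f (cnj X)) * exp X) < eps" by blast
qed

text \<open>Conjugation reverses the direction of turning, so the given formula is used at
  \<open>cnj \<eta> - 2 pi i\<close>. The two differences change sign, but their product does not;
  the increment of the cell does, which the minus sign corrects. The same sign comes from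
  conjugating 1 / (2 pi i).\<close>

lemma cell_monodromy_conj:
 assumes cm: "cell_monodromy (%X. cnj (f (cnj X))) (%X. cnj (g (cnj X))) r L"
 shows "cell_monodromy f g r (%\<eta>. - cnj (L (cnj \<eta>)))"
 unfolding cell_monodromy_def
proof (intro conjI allI impI)
 have L: "L holomorphic_on {X. Re X < r}" using cm by (simp add: cell_monodromy_def)
 show "(%\<eta>. - cnj (L (cnj \<eta>))) holomorphic_on {X. Re X < r}"
  using holomorphic_cnj_cnj[OF L open_half_plane_Re] by (intro holomorphic_on_minus) (simp only: cnj_vimage_half_plane)
 fix \<eta> :: complex and \<xi> \<xi>' assume \<eta>: "Re \<eta> < r" and \<xi>: "lens_curve \<xi> \<xi>'"
 let ?T = "2 * of_real pi * \<i> :: complex"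
 have lc: "lens_curve (%s. cnj (\<xi> s)) (%s. cnj (\<xi>' s))"
  using \<xi> unfolding lens_curve_def
  by (auto simp: lens_def intro!: continuous_on_cnj bounded_linear.has_vector_derivative[OF bounded_linear_cnj])
 let ?\<eta> = "cnj \<eta> - ?T"
 have "Re ?\<eta> < r" using \<eta> by simp
 then obtain V where V: "((%s. (cnj (f (cnj (?\<eta> + Ln (cnj (\<xi> s)) + ?T))) - cnj (f (cnj (?\<eta> + Ln (cnj (\<xi> s)))))) *
   (cnj (g (cnj (?\<eta> + Ln (1 - cnj (\<xi> s)) + ?T))) - cnj (g (cnj (?\<eta> + Ln (1 - cnj (\<xi> s)))))) * cnj (\<xi>' s)) has_integral V) {0..1}"
   "L (?\<eta> + ?T) - L ?\<eta> = - exp ?\<eta> * V"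
  using cm lc unfolding cell_monodromy_def by blast
 have "((%s. (f (\<eta> + Ln (\<xi> s) + ?T) - f (\<eta> + Ln (\<xi> s))) * (g (\<eta> + Ln (1 - \<xi> s) + ?T) - g (\<eta> + Ln (1 - \<xi> s))) * \<xi>' s) has_integral cnj V) {0..1}"
 proof (rule has_integral_spike_finite[OF _ _ has_integral_linear[OF V(1) bounded_linear_cnj]])
  show "finite {0, 1::real}" by simp
  fix s :: real assume "s \<in> {0..1} - {0, 1}"
  then have "\<xi> s \<in> lens" using \<xi> by (auto simp: lens_curve_def)
  note p = lens_props(1,2)[OF this]
  have l: "Ln (cnj (\<xi> s)) = cnj (Ln (\<xi> s))" "Ln (1 - cnj (\<xi> s)) = cnj (Ln (1 - \<xi> s))"
   using cnj_Ln[OF p(1)] cnj_Ln[OF p(2)] by simp_all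
  have a: "cnj (?\<eta> + cnj y + ?T) = \<eta> + y" "cnj (?\<eta> + cnj y) = \<eta> + y + ?T" for y by simp_all
  show "(f (\<eta> + Ln (\<xi> s) + ?T) - f (\<eta> + Ln (\<xi> s))) * (g (\<eta> + Ln (1 - \<xi> s) + ?T) - g (\<eta> + Ln (1 - \<xi> s))) * \<xi>' s =
   (cnj \<circ> (%s. (cnj (f (cnj (?\<eta> + Ln (cnj (\<xi> s)) + ?T))) - cnj (f (cnj (?\<eta> + Ln (cnj (\<xi> s)))))) *
   (cnj (g (cnj (?\<eta> + Ln (1 - cnj (\<xi> s)) + ?T))) - cnj (g (cnj (?\<eta> + Ln (1 - cnj (\<xi> s)))))) * cnj (\<xi>' s))) s"
   unfolding o_def l a by (simp add: algebra_simps)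
 qed
 moreover have "- cnj (L (cnj (\<eta> + ?T))) - - cnj (L (cnj \<eta>)) = - exp \<eta> * cnj V"
 proof -
  have "exp ?\<eta> = exp (cnj \<eta>)" by (simp add: exp_diff)
  then have "cnj (L (?\<eta> + ?T) - L ?\<eta>) = - exp \<eta> * cnj V" unfolding V(2) by (simp add: exp_cnj)
  moreover have "cnj (\<eta> + ?T) = ?\<eta>" by simp
  ultimately show ?thesis by simp
 qed
 ultimately show "\<exists>V. ((%s. (f (\<eta> + Ln (\<xi> s) + ?T) - f (\<eta> + Ln (\<xi> s))) * (g (\<eta> + Ln (1 - \<xi> s) + ?T) - g (\<eta> + Ln (1 - \<xi> s))) * \<xi>' s) has_integral V) {0..1} \<and>
   - cnj (L (cnj (\<eta> + ?T))) - - cnj (L (cnj \<eta>)) = - exp \<eta> * V" by blast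
qed

text \<open>The side -1 at \<gamma> is the side 1 at \<open>cnj \<gamma>\<close> for the reflected
  series, whose lifts are the conjugated ones.\<close>

lemma right_representation:
 fixes ft gt :: "complex => complex => complex"
 assumes F: "fps_conv_radius F > 0" and G: "fps_conv_radius G > 0" and \<gamma>: "\<gamma> ~= 0"
  and fin: "!!r. finite (singularities F \<inter> cball 0 r)" "!!r. finite (singularities G \<inter> cball 0 r)"
  and lifts: "!!\<alpha>. \<alpha> \<in> pinched F G \<gamma> ==> \<exists>R. local_lift F \<alpha> (- 1) R (ft \<alpha>) \<and> decays (ft \<alpha>) \<and>
   local_lift G (\<gamma> / \<alpha>) (- 1) R (gt \<alpha>) \<and> decays (gt \<alpha>)"
 shows "\<exists>r h L. pinch_data F G \<gamma> (- 1) ft gt r h L"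
proof -
 let ?F = "conj_fps F" and ?G = "conj_fps G" and ?M = "pinched F G \<gamma>"
 have F': "fps_conv_radius ?F > 0" and G': "fps_conv_radius ?G > 0" using F G by simp_all
 have sF: "singularities ?F = cnj ` singularities F" using singularities_conj_fps[OF F] by (force simp: image_iff)
 have sG: "singularities ?G = cnj ` singularities G" using singularities_conj_fps[OF G] by (force simp: image_iff)
 have fin': "finite (singularities ?F \<inter> cball 0 r)" "finite (singularities ?G \<inter> cball 0 r)" for r
 proof -
  have "cnj ` S \<inter> cball 0 r = cnj ` (S \<inter> cball 0 r)" for S by auto
  then show "finite (singularities ?F \<inter> cball 0 r)" "finite (singularities ?G \<inter> cball 0 r)"
   unfolding sF sG using fin by simp_all
 qed
 have pin: "\<alpha> \<in> pinched ?F ?G (cnj \<gamma>) \<longleftrightarrow> cnj \<alpha> \<in> ?M" for \<alpha>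
  using singularities_conj_fps[OF F, of \<alpha>] singularities_conj_fps[OF G, of "cnj \<gamma> / \<alpha>"] by (simp add: pinched_def)
 have pinM: "pinched ?F ?G (cnj \<gamma>) = cnj ` ?M" using pin by (force simp: image_iff)
 have "\<exists>R. local_lift ?F \<alpha> 1 R (%X. cnj (ft (cnj \<alpha>) (cnj X))) \<and> decays (%X. cnj (ft (cnj \<alpha>) (cnj X))) \<and>
   local_lift ?G (cnj \<gamma> / \<alpha>) 1 R (%X. cnj (gt (cnj \<alpha>) (cnj X))) \<and> decays (%X. cnj (gt (cnj \<alpha>) (cnj X)))"
  if "\<alpha> \<in> pinched ?F ?G (cnj \<gamma>)" for \<alpha>
 proof -
  have "cnj \<alpha> \<in> ?M" using that pin by simp
  from lifts[OF this] obtain R where *: "local_lift F (cnj \<alpha>) (- 1) R (ft (cnj \<alpha>))" "decays (ft (cnj \<alpha>))"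
   "local_lift G (\<gamma> / cnj \<alpha>) (- 1) R (gt (cnj \<alpha>))" "decays (gt (cnj \<alpha>))" by blast
  show ?thesis using local_lift_conj[OF F *(1)] local_lift_conj[OF G *(3)] decays_conj[OF *(2)] decays_conj[OF *(4)]
   by (intro exI[of _ R]) simp
 qed
 from left_representation[OF F' G' _ fin' this] \<gamma>
 obtain r h L where D: "pinch_data ?F ?G (cnj \<gamma>) 1 (%\<alpha> X. cnj (ft (cnj \<alpha>) (cnj X))) (%\<alpha> X. cnj (gt (cnj \<alpha>) (cnj X))) r h L" by auto
 have D1: "finite (cnj ` ?M)" "h holomorphic_on ball 0 (exp r)"
  and D2: "!!\<alpha>. \<alpha> \<in> ?M ==> cell_monodromy (%X. cnj (ft \<alpha> (cnj X))) (%X. cnj (gt \<alpha> (cnj X))) r (L (cnj \<alpha>))"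
  and D3: "!!om. 0 < Im om ==> norm om < exp r ==> cnj \<gamma> * exp om \<in> star (conj_fps (fps_hadamard F G)) \<and>
    pbranch (conj_fps (fps_hadamard F G)) (cnj \<gamma> * exp om) = (h om + (\<Sum>\<alpha>\<in>cnj ` ?M. L \<alpha> (Ln om))) / (2 * of_real pi * \<i>)"
  using D unfolding pinch_data_def pinM conj_fps_hadamard by auto
 have H: "fps_conv_radius (conj_fps (fps_hadamard F G)) > 0"
  using hadamard_radius[OF F G] by simp
 have "pinch_data F G \<gamma> (- 1) ft gt r (%om. - cnj (h (cnj om))) (%\<alpha> \<eta>. - cnj (L (cnj \<alpha>) (cnj \<eta>)))"
  unfolding pinch_data_def
 proof (intro conjI ballI allI impI)
  show "finite ?M" using D1(1) by (rule finite_imageD) (auto simp: inj_on_def)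
  have "cnj -` ball 0 (exp r) = ball 0 (exp r)" using cnj_vimage_ball[of 0 "exp r"] by simp
  then show "(%om. - cnj (h (cnj om))) holomorphic_on ball 0 (exp r)"
   using holomorphic_cnj_cnj[OF D1(2) open_ball] by (intro holomorphic_on_minus) simp
  show "cell_monodromy (ft \<alpha>) (gt \<alpha>) r (%\<eta>. - cnj (L (cnj \<alpha>) (cnj \<eta>)))" if "\<alpha> \<in> ?M" for \<alpha>
   by (rule cell_monodromy_conj[OF D2[OF that]])
  fix om :: complex assume w: "0 < - 1 * Im om" "norm om < exp r"
  have cw: "0 < Im (cnj om)" "norm (cnj om) < exp r" using w by simp_all
  note d = D3[OF cw]
  have z: "cnj (cnj \<gamma> * exp (cnj om)) = \<gamma> * exp om" by (simp add: exp_cnj)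
  show "\<gamma> * exp om \<in> star (fps_hadamard F G)"
   using star_conj_fps(1)[OF H conjunct1[OF d]] unfolding z by simp
  have "om \<notin> \<real>\<^sub>\<le>\<^sub>0" using w(1) by (auto simp: complex_nonpos_Reals_iff)
  then have ln: "Ln (cnj om) = cnj (Ln om)" by (rule cnj_Ln[symmetric])
  have "pbranch (fps_hadamard F G) (\<gamma> * exp om) = cnj ((h (cnj om) + (\<Sum>\<alpha>\<in>cnj ` ?M. L \<alpha> (Ln (cnj om)))) / (2 * of_real pi * \<i>))"
   using star_conj_fps(2)[OF H conjunct1[OF d]] conjunct2[OF d] unfolding z by simp
  also have "(\<Sum>\<alpha>\<in>cnj ` ?M. L \<alpha> (Ln (cnj om))) = (\<Sum>\<alpha>\<in>?M. L (cnj \<alpha>) (cnj (Ln om)))"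
   unfolding ln by (subst sum.reindex) (auto simp: inj_on_def)
  also have "cnj ((h (cnj om) + (\<Sum>\<alpha>\<in>?M. L (cnj \<alpha>) (cnj (Ln om)))) / (2 * of_real pi * \<i>)) =
    (- cnj (h (cnj om)) + (\<Sum>\<alpha>\<in>?M. - cnj (L (cnj \<alpha>) (cnj (Ln om))))) / (2 * of_real pi * \<i>)"
   by (simp add: sum_negf minus_divide_left)
  finally show "pbranch (fps_hadamard F G) (\<gamma> * exp om) =
    (- cnj (h (cnj om)) + (\<Sum>\<alpha>\<in>?M. - cnj (L (cnj \<alpha>) (cnj (Ln om))))) / (2 * of_real pi * \<i>)" .
 qed
 then show ?thesis by blast
qed

section \<open>The monodromy formula\<close>

lemma norm_exp_quadratic:
 fixes z :: complex
 assumes "norm z < 1" shows "norm (exp z - 1 - z) <= 3 * norm z * norm z"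
proof -
 have "norm ((exp z - z) - (exp 0 - 0)) <= (3 * norm z) * norm (z - 0)"
 proof (rule field_differentiable_bound[of "cball 0 (norm z)" "%w. exp w - w" "%w. exp w - 1"])
  show "((%w. exp w - w) has_field_derivative exp w - 1) (at w within cball 0 (norm z))" for w :: complex
   by (auto intro!: derivative_eq_intros)
  fix w :: complex assume w: "w \<in> cball 0 (norm z)"
  then have "norm (exp w - 1) <= 3 * norm w" using assms by (intro norm_exp_minus_1_le) simp
  then show "norm (exp w - 1) <= 3 * norm z" using w by simp
 qed auto
 then show ?thesis by (simp add: algebra_simps)
qed

lemma ratio_near_1:
 fixes a b :: complex
 assumes "norm a <= 3/64" "norm b <= 3/64"
 shows "norm ((1 + a) / (1 + b) - 1) <= 1/8" "1 + b ~= 0"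
proof -
 have n: "norm (1 + b) \<ge> 61/64" using norm_triangle_ineq4[of "1 + b" b] assms(2) by simp
 then show nz: "1 + b ~= 0" by auto
 have "(1 + a) / (1 + b) - 1 = (a - b) / (1 + b)" using nz by (simp add: field_simps)
 then have "norm ((1 + a) / (1 + b) - 1) = norm (a - b) / norm (1 + b)" by (simp add: norm_divide)
 also have "\<dots> <= (6/64) / (61/64)" using norm_triangle_ineq4[of a b] assms n by (intro frac_le) auto
 also have "\<dots> <= 1/8" by simp
 finally show "norm ((1 + a) / (1 + b) - 1) <= 1/8" .
qed

lemma exp_quotient:
 assumes "norm z <= 1/64" "z ~= 0"
 obtains eps where "exp z - 1 = z * (1 + eps)" "norm (eps::complex) <= 3/64"
proof (rule that)
 show "exp z - 1 = z * (1 + (exp z - 1 - z) / z)" using assms(2) by (simp add: field_simps)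
 have "norm (exp z - 1 - z) <= 3 * norm z * norm z" by (rule norm_exp_quadratic) (use assms in simp)
 then have "norm ((exp z - 1 - z) / z) <= 3 * norm z" using assms(2) by (simp add: norm_divide divide_le_eq)
 then show "norm ((exp z - 1 - z) / z) <= 3/64" using assms(1) by linarith
qed

lemma norm_exp_tiny:
 assumes "Re \<eta> <= -6" shows "norm (exp \<eta>) <= 1/64"
proof -
 have n: "norm (exp (\<eta> / 3)) <= 1/4" by (rule exp_le_quarter) (use assms in simp)
 have "exp (of_nat 3 * (\<eta> / 3)) = exp (\<eta> / 3) ^ 3" by (rule exp_of_nat_mult)
 then have "norm (exp \<eta>) = norm (exp (\<eta> / 3) ^ 3)" by simp
 also have "\<dots> = norm (exp (\<eta> / 3)) ^ 3" by (rule norm_power)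
 also have "\<dots> <= (1/4) ^ 3" by (rule power_mono[OF n norm_ge_zero])
 also have "\<dots> = 1/64" by (simp add: power3_eq_cube)
 finally show ?thesis .
qed

text \<open>As exp z - 1 is close to z, the quotient defining \<open>chart_dom\<close> is \<zeta>
  times a factor within 1/8 of 1; arguments below pi / 4 leave its real part positive. So the chart
  value is near \<eta> + Ln \<zeta>. Having the same double exponential, the two are equal once
  their imaginary parts differ by less than 2 pi, which is checked at both levels of the
  exponential.\<close>

lemma log_chart_exp:
 assumes a: "a ~= 0" and \<eta>: "Re \<eta> <= -6" and \<zeta>: "\<zeta> \<in> lens"
 shows "a * exp (exp \<eta> * \<zeta>) \<in> chart_dom a \<eta>" "log_chart a \<eta> (a * exp (exp \<eta> * \<zeta>)) = \<eta> + Ln \<zeta>"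
proof -
 let ?w = "exp \<eta>" and ?v = "a * exp (exp \<eta> * \<zeta>)"
 have w: "norm ?w <= 1/64" by (rule norm_exp_tiny[OF \<eta>])
 have z0: "\<zeta> ~= 0" and z1: "norm \<zeta> < 1" using lens_props[OF \<zeta>] by auto
 have zr: "\<bar>Im \<zeta>\<bar> < Re \<zeta>" using \<zeta> by (simp add: lens_def)
 have "norm (?w * \<zeta>) <= 1/64 * 1" unfolding norm_mult using w z1 by (intro mult_mono) auto
 then have wz: "norm (?w * \<zeta>) <= 1/64" by simp
 obtain e1 where e1: "exp (?w * \<zeta>) - 1 = ?w * \<zeta> * (1 + e1)" "norm e1 <= 3/64"
  by (rule exp_quotient[OF wz]) (use z0 in auto)
 obtain e2 where e2: "exp ?w - 1 = ?w * (1 + e2)" "norm e2 <= 3/64"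
  by (rule exp_quotient[OF w]) auto
 define m where "m = (1 + e1) / (1 + e2)"
 have m: "norm (m - 1) <= 1/8" and n2: "1 + e2 ~= 0" using ratio_near_1[OF e1(2) e2(2)] by (auto simp: m_def)
 have mr: "Re m \<ge> 7/8" "\<bar>Im m\<bar> <= 1/8"
  using m abs_Re_le_cmod[of "m - 1"] abs_Im_le_cmod[of "m - 1"] by (auto simp: abs_le_iff)
 have m0: "m ~= 0" using mr(1) by auto
 have "?v - a = a * (exp (?w * \<zeta>) - 1)" "dexp a \<eta> - a = a * (exp ?w - 1)" by (simp_all add: dexp_def algebra_simps)
 then have \<kappa>: "(?v - a) / (dexp a \<eta> - a) = \<zeta> * m"
  using a n2 unfolding e1(1) e2(1) m_def by simp
 have Re\<kappa>: "Re (\<zeta> * m) > 0"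
 proof -
  have "\<bar>Im \<zeta> * Im m\<bar> <= Re \<zeta> * (1/8)" unfolding abs_mult using zr mr(2) by (intro mult_mono) auto
  moreover have "Re \<zeta> * Re m \<ge> Re \<zeta> * (7/8)" using zr mr(1) by (intro mult_left_mono) auto
  ultimately show ?thesis using zr by (simp add: abs_le_iff)
 qed
 have "norm m <= 9/8" using norm_triangle_ineq[of "m - 1" 1] m by simp
 then have "norm (\<zeta> * m) <= 1 * (9/8)" unfolding norm_mult using z1 by (intro mult_mono) auto
 then show dom: "?v \<in> chart_dom a \<eta>" unfolding chart_dom_def mem_Collect_eq \<kappa> using Re\<kappa> by simp
 have "norm (Ln (1 - (1 - m))) <= 2 * norm (1 - m)" using m by (intro norm_Ln_1_minus_le) (simp add: norm_minus_commute)
 then have Lm: "norm (Ln m) <= 1/4" using m by (simp add: norm_minus_commute)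
 have pi: "pi > 3" by (rule pi_gt3)
 have Ln\<kappa>: "Ln (\<zeta> * m) = Ln \<zeta> + Ln m"
 proof (rule exp_complex_eqI)
  have "0 < Re \<zeta>" using zr by linarith
  then have "\<bar>Im (Ln (\<zeta> * m))\<bar> < pi / 2" "\<bar>Im (Ln \<zeta>)\<bar> < pi / 2" by (intro Re_Ln_pos_lt_imp Re\<kappa>)+
  moreover have "\<bar>Im (Ln m)\<bar> <= 1/4" using abs_Im_le_cmod[of "Ln m"] Lm by linarith
  ultimately show "\<bar>Im (Ln (\<zeta> * m)) - Im (Ln \<zeta> + Ln m)\<bar> < 2 * pi" using pi unfolding plus_complex.sel by linarith
  show "exp (Ln (\<zeta> * m)) = exp (Ln \<zeta> + Ln m)" using z0 m0 by (simp add: exp_add)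
 qed
 let ?y = "log_chart a \<eta> ?v"
 have "norm (?y - (\<eta> + Ln ((?v - a) / (dexp a \<eta> - a)))) <= 1" by (rule log_chart(5)[OF a \<eta> dom])
 then have y1: "norm (?y - (\<eta> + Ln \<zeta>) - Ln m) <= 1" unfolding \<kappa> Ln\<kappa> by (simp add: algebra_simps)
 have y2: "norm (?y - (\<eta> + Ln \<zeta>)) <= 2" using norm_triangle_ineq[of "?y - (\<eta> + Ln \<zeta>) - Ln m" "Ln m"] y1 Lm by simp
 show "?y = \<eta> + Ln \<zeta>"
 proof (rule exp_complex_eqI)
  have "\<bar>Im (?y - (\<eta> + Ln \<zeta>))\<bar> <= 2" using abs_Im_le_cmod[of "?y - (\<eta> + Ln \<zeta>)"] y2 by linarith
  then show "\<bar>Im ?y - Im (\<eta> + Ln \<zeta>)\<bar> < 2 * pi" using pi by simp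
  have "exp ?y = ?w * \<zeta>"
  proof (rule exp_complex_eqI)
   have "Re ?y <= -2" using log_chart(4)[OF a \<eta> dom] \<eta> by simp
   then have "norm (exp ?y) <= 1/4" by (rule exp_le_quarter)
   then have "\<bar>Im (exp ?y)\<bar> <= 1/4" "\<bar>Im (?w * \<zeta>)\<bar> <= 1/64"
    using abs_Im_le_cmod[of "exp ?y"] abs_Im_le_cmod[of "?w * \<zeta>"] wz by linarith+
   then show "\<bar>Im (exp ?y) - Im (?w * \<zeta>)\<bar> < 2 * pi" using pi by linarith
   have "dexp a ?y = ?v" by (rule log_chart(3)[OF a \<eta> dom])
   then show "exp (exp ?y) = exp (?w * \<zeta>)" using a by (simp add: dexp_def)
  qed
  then show "exp ?y = exp (\<eta> + Ln \<zeta>)" using z0 by (simp add: exp_add)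
 qed
qed

text \<open>The points a (1 + s (exp w - 1)) of the segment are written as a exp (w \<xi>); then z /
  u becomes b exp (w (1 - \<xi>)). The difference of \<xi> and s vanishes at both ends and has
  Lipschitz constant 1/8, so it is at most an eighth of the distance to either end; this keeps the
  curve in the lens.\<close>

lemma log_segment_lens_curve:
 assumes w: "norm w <= 1/64" "w ~= 0"
 defines "\<xi> \<equiv> %s::real. Ln (1 + of_real s * (exp w - 1)) / w"
  and "\<xi>' \<equiv> %s::real. (exp w - 1) / (1 + of_real s * (exp w - 1)) / w"
 shows "lens_curve \<xi> \<xi>'" "!!s. s \<in> {0..1} ==> exp (w * \<xi> s) = 1 + of_real s * (exp w - 1)"
proof -
 let ?D = "exp w - 1"
 obtain e where e: "?D = w * (1 + e)" "norm e <= 3/64" by (rule exp_quotient[OF w])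
 have D: "norm ?D <= 3/64" using norm_exp_minus_1_le[of w] w(1) by simp
 have xD: "norm (x * ?D) <= 3/64" if "norm x <= 1" for x
  using mult_mono[of "norm x" 1 "norm ?D" "3/64"] that D by (simp add: norm_mult)
 have nR: "1 + x * ?D \<notin> \<real>\<^sub>\<le>\<^sub>0" if "norm x <= 1" for x
 proof -
  have "\<bar>Re (x * ?D)\<bar> <= 3/64" using abs_Re_le_cmod[of "x * ?D"] xD[OF that] by linarith
  then have "Re (1 + x * ?D) > 0" unfolding plus_complex.sel one_complex.sel by linarith
  then show ?thesis by (auto simp: complex_nonpos_Reals_iff)
 qed
 have nz: "1 + x * ?D ~= 0" if "norm x <= 1" for x using ratio_near_1(2)[of 0, OF _ xD[OF that]] by simp
 have dL: "((%x. Ln (1 + x * ?D) / w) has_field_derivative ?D / (1 + x * ?D) / w) (at x)" if "norm x <= 1" for x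
 proof -
  have "((%x. 1 + x * ?D) has_field_derivative ?D) (at x)" by (auto intro!: derivative_eq_intros)
  from DERIV_chain'[where g = Ln, OF this has_field_derivative_Ln[OF nR[OF that]]]
  have "((%x. Ln (1 + x * ?D)) has_field_derivative inverse (1 + x * ?D) * ?D) (at x)" by (simp add: mult.commute)
  from DERIV_cdivide[OF this, of w] show ?thesis by (simp add: divide_inverse mult_ac)
 qed
 have ex: "exp (w * (Ln (1 + x * ?D) / w)) = 1 + x * ?D" if "norm x <= 1" for x
  using w(2) nz[OF that] by simp
 show "exp (w * \<xi> s) = 1 + of_real s * ?D" if "s \<in> {0..1}" for s
  unfolding \<xi>_def by (rule ex) (use that in simp)
 define \<phi> where "\<phi> x = Ln (1 + x * ?D) / w - x" for x
 have lip: "norm (\<phi> x - \<phi> y) <= 1/8 * norm (x - y)" if "norm x <= 1" "norm y <= 1" for x y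
 proof (rule field_differentiable_bound[of "cball 0 1" \<phi> "%x. ?D / (1 + x * ?D) / w - 1"])
  fix z :: complex assume "z \<in> cball 0 1"
  then have z: "norm z <= 1" by simp
  show "(\<phi> has_field_derivative ?D / (1 + z * ?D) / w - 1) (at z within cball 0 1)"
   unfolding \<phi>_def by (intro DERIV_diff DERIV_subset[OF dL[OF z]] DERIV_ident) auto
  have "?D / (1 + z * ?D) / w = (1 + e) / (1 + z * ?D)" unfolding e(1) using w(2) by simp
  then show "norm (?D / (1 + z * ?D) / w - 1) <= 1/8" using ratio_near_1(1)[OF e(2) xD[OF z]] by simp
 qed (use that in auto)
 have "\<bar>Im w\<bar> < pi" using abs_Im_le_cmod[of w] w(1) pi_gt3 by linarith
 then have Lw: "Ln (exp w) = w" by (intro Ln_exp) auto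
 have \<phi>01: "\<phi> 0 = 0" "\<phi> 1 = 0" using w(2) Lw by (simp_all add: \<phi>_def)
 have close: "norm (\<xi> s - of_real s) <= s / 8" "norm (\<xi> s - of_real s) <= (1 - s) / 8" if s: "0 <= s" "s <= 1" for s
 proof -
  have E: "\<xi> s - of_real s = \<phi> (of_real s)" by (simp add: \<xi>_def \<phi>_def)
  show "norm (\<xi> s - of_real s) <= s / 8" using lip[of "of_real s" 0] \<phi>01 s unfolding E by simp
  have "norm (complex_of_real s - 1) = 1 - s" using s by (metis abs_of_nonneg diff_ge_0_iff_ge norm_minus_commute norm_of_real of_real_1 of_real_diff)
  then show "norm (\<xi> s - of_real s) <= (1 - s) / 8" using lip[of "of_real s" 1] \<phi>01 s unfolding E by simp
 qed
 have vd: "(\<xi> has_vector_derivative \<xi>' s) (at s within S)" if "0 <= s" "s <= 1" for s S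
  unfolding \<xi>_def \<xi>'_def
  by (rule has_vector_derivative_real_field[where f = "%x. Ln (1 + x * ?D) / w"]) (rule dL, use that in simp)
 show "lens_curve \<xi> \<xi>'" unfolding lens_curve_def
 proof (intro conjI ballI)
  show "continuous_on {0..1} \<xi>"
   unfolding continuous_on_eq_continuous_within using vd has_vector_derivative_continuous by (metis atLeastAtMost_iff)
  show "\<xi> 0 = 0" by (simp add: \<xi>_def)
  show "\<xi> 1 = 1" using Lw w(2) by (simp add: \<xi>_def)
  fix s :: real assume "s \<in> {0<..<1}"
  then have s: "0 < s" "s < 1" by auto
  have "\<bar>Re (\<xi> s - of_real s)\<bar> <= s / 8" "\<bar>Im (\<xi> s - of_real s)\<bar> <= s / 8" "\<bar>Re (\<xi> s - of_real s)\<bar> <= (1 - s) / 8" "\<bar>Im (\<xi> s - of_real s)\<bar> <= (1 - s) / 8"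
   using close[of s] s abs_Re_le_cmod[of "\<xi> s - of_real s"] abs_Im_le_cmod[of "\<xi> s - of_real s"] by linarith+
  then have c: "\<bar>Re (\<xi> s) - s\<bar> <= s / 8" "\<bar>Im (\<xi> s)\<bar> <= s / 8" "\<bar>Re (\<xi> s) - s\<bar> <= (1 - s) / 8" "\<bar>Im (\<xi> s)\<bar> <= (1 - s) / 8"
   unfolding minus_complex.sel Re_complex_of_real Im_complex_of_real diff_zero by auto
  have "\<bar>Im (\<xi> s)\<bar> < Re (\<xi> s)"
  proof -
   have r: "- (Re (\<xi> s) - s) <= s / 8" by (rule abs_le_D2[OF c(1)])
   show ?thesis using r c(2) s by (linarith | argo | (auto simp: field_simps abs_le_iff) | smt (verit))
  qed
  moreover have "\<bar>Im (\<xi> s)\<bar> < 1 - Re (\<xi> s)"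
  proof -
   have r: "Re (\<xi> s) - s <= (1 - s) / 8" by (rule abs_le_D1[OF c(3)])
   show ?thesis using r c(4) s by (linarith | argo | (auto simp: field_simps abs_le_iff) | smt (verit))
  qed
  ultimately show "\<xi> s \<in> lens" by (simp add: lens_def)
  show "(\<xi> has_vector_derivative \<xi>' s) (at s)" by (rule vd) (use s in auto)
 qed
qed

lemma lift_iterated_Sigma:
 assumes F: "fps_conv_radius F > 0" and a: "a ~= 0" and L: "local_lift F a c R f"
  and P: "path P" "!!t. t \<in> {0..1} ==> Re (P t) < R" "0 < c * Im (P 0)" "c * Im (P 0) < pi"
  and q: "!!t. t \<in> {0..1} ==> q t = dexp a (P t)"
  and X: "Re (P 1) <= -6" "Re (P 1) + 3 < R" and v: "v \<in> chart_dom a (P 1)"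
 shows "(Sigma_op a ^^ k) (branch (eval_fps F) (linepath 0 (pathstart q) +++ q)) v =
  f (log_chart a (P 1) v + 2 * of_real pi * \<i> * of_nat k)"
proof (rule Sigma_op_power_lift[OF a _ chart_dom_open log_chart(6)[OF a X(1)] _ _ _ v])
 show "f holomorphic_on {X. Re X < R}" using L by (simp add: local_lift_def)
 show "dexp a (log_chart a (P 1) v) = v" if "v \<in> chart_dom a (P 1)" for v by (rule log_chart(3)[OF a X(1) that])
 show "branch (eval_fps F) (linepath 0 (pathstart q) +++ q) v = f (log_chart a (P 1) v)" if "v \<in> chart_dom a (P 1)" for v
  by (rule local_lift_branch_chart[OF F a L P q X(1) _ that]) (use X in auto)
 show "Re (log_chart a (P 1) v) <= - 4 \<and> Re (log_chart a (P 1) v) + 1 < R" if "v \<in> chart_dom a (P 1)" for v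
  using log_chart(4)[OF a X(1) that] X by simp
qed

lemma scaled_local_path:
 fixes q :: "real => complex"
 shows "(%t. (linepath 0 (pathstart q) +++ q) t / b) = linepath 0 (pathstart (%t. q t / b)) +++ (%t. q t / b)"
 by (auto simp: joinpaths_def linepath_def pathstart_def fun_eq_iff scaleR_conv_of_real)

text \<open>The substitution u = a exp (w \<xi>) turns the segment into a lens curve and du / u into
  w d\<xi>. As w = exp \<eta> is unchanged when 2 pi i k is added to \<eta>, the formula for the
  cell on the k-th sheet yields the increment of \<open>L\<close> there.\<close>

lemma pair_integral:
 assumes F: "fps_conv_radius F > 0" and G: "fps_conv_radius G > 0" and a: "a ~= 0" and b: "b ~= 0"
  and f: "local_lift F a c R f" and g: "local_lift G b c R g" and cm: "cell_monodromy f g R L"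
  and P: "path P" "!!t. t \<in> {0..1} ==> Re (P t) < R" "0 < c * Im (P 0)" "c * Im (P 0) < pi"
  and q: "!!t. t \<in> {0..1} ==> q t = dexp (a * b) (P t)"
  and X: "Re (P 1) <= -6" "Re (P 1) + 3 < R"
 defines "p \<equiv> linepath 0 (pathstart q) +++ q"
 shows "(monodromy_integrand F G p k a b has_contour_integral
  - (L (P 1 + 2 * of_real pi * \<i> * of_nat (Suc k)) - L (P 1 + 2 * of_real pi * \<i> * of_nat k))) (linepath a (pathfinish p / b))"
proof -
 define \<eta> where "\<eta> = P 1"
 define w where "w = exp \<eta>"
 let ?T = "2 * of_real pi * \<i> :: complex"
 let ?D = "exp w - 1"
 define \<xi> where "\<xi> = (%s::real. Ln (1 + of_real s * ?D) / w)"
 define \<xi>' where "\<xi>' = (%s::real. ?D / (1 + of_real s * ?D) / w)"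
 have \<eta>: "Re \<eta> <= -6" using X by (simp add: \<eta>_def)
 have w: "norm w <= 1/64" "w ~= 0" using norm_exp_tiny[OF \<eta>] by (auto simp: w_def)
 have lc: "lens_curve \<xi> \<xi>'" unfolding \<xi>_def \<xi>'_def by (rule log_segment_lens_curve(1)[OF w])
 have ex: "exp (w * \<xi> s) = 1 + of_real s * ?D" if "s \<in> {0..1}" for s
  unfolding \<xi>_def by (rule log_segment_lens_curve(2)[OF w that])
 have "pathfinish p = q 1" by (simp add: p_def pathfinish_def joinpaths_def)
 then have z: "pathfinish p = a * b * exp w" using q[of 1] by (simp add: dexp_def w_def \<eta>_def)
 have SF: "(Sigma_op a ^^ j) (branch (eval_fps F) (%t. p t / b)) v = f (log_chart a \<eta> v + ?T * of_nat j)"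
  if "v \<in> chart_dom a \<eta>" for v j
  unfolding p_def scaled_local_path \<eta>_def
  by (rule lift_iterated_Sigma[OF F a f P _ X]) (use that q b in \<open>auto simp: \<eta>_def dexp_def\<close>)
 have SG: "(Sigma_op b ^^ j) (branch (eval_fps G) (%t. p t / a)) v = g (log_chart b \<eta> v + ?T * of_nat j)"
  if "v \<in> chart_dom b \<eta>" for v j
  unfolding p_def scaled_local_path \<eta>_def
  by (rule lift_iterated_Sigma[OF G b g P _ X]) (use that q a in \<open>auto simp: \<eta>_def dexp_def\<close>)
 have DF: "Delta_op a ((Sigma_op a ^^ k) (branch (eval_fps F) (%t. p t / b))) v =
   f (log_chart a \<eta> v + ?T * of_nat (Suc k)) - f (log_chart a \<eta> v + ?T * of_nat k)" if "v \<in> chart_dom a \<eta>" for v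
  using SF[OF that, of "Suc k"] SF[OF that, of k] by (simp only: Delta_op_def funpow.simps o_apply)
 have DG: "Delta_op b ((Sigma_op b ^^ k) (branch (eval_fps G) (%t. p t / a))) v =
   g (log_chart b \<eta> v + ?T * of_nat (Suc k)) - g (log_chart b \<eta> v + ?T * of_nat k)" if "v \<in> chart_dom b \<eta>" for v
  using SG[OF that, of "Suc k"] SG[OF that, of k] by (simp only: Delta_op_def funpow.simps o_apply)
 let ?\<eta> = "\<eta> + ?T * of_nat k"
 have "Re ?\<eta> < R" using X by (simp add: \<eta>_def)
 with cm lc obtain V where V: "((%s. (f (?\<eta> + Ln (\<xi> s) + ?T) - f (?\<eta> + Ln (\<xi> s))) *
   (g (?\<eta> + Ln (1 - \<xi> s) + ?T) - g (?\<eta> + Ln (1 - \<xi> s))) * \<xi>' s) has_integral V) {0..1}"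
   "L (?\<eta> + ?T) - L ?\<eta> = - exp ?\<eta> * V"
  unfolding cell_monodromy_def by blast
 have e\<eta>: "exp ?\<eta> = w"
 proof -
  have "exp (?T * of_nat k) = 1" using exp_integer_2pi[of "of_nat k"] by (simp add: mult_ac)
  then show ?thesis by (simp add: exp_add w_def)
 qed
 \<comment> \<open>The two integrands are compared inside the interval only: at the ends \<xi> is 0
   or 1, and one of the logarithms has a default value.\<close>
 have "((%x. monodromy_integrand F G p k a b (linepath a (pathfinish p / b) x) * (pathfinish p / b - a)) has_integral w * V) {0..1}"
 proof (rule has_integral_spike_finite[OF _ _ has_integral_mult_right[OF V(1), of w]])
  show "finite {0, 1::real}" by simp
  fix s :: real assume s: "s \<in> {0..1} - {0, 1}"
  then have s01: "s \<in> {0..1}" by simp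
  have lz: "\<xi> s \<in> lens" using lc s by (auto simp: lens_curve_def)
  note e = ex[OF s01]
  have nz: "1 + of_real s * ?D ~= 0" using e exp_not_eq_zero[of "w * \<xi> s"] by simp
  let ?u = "linepath a (pathfinish p / b) s"
  have u: "?u = a * exp (w * \<xi> s)" unfolding e z linepath_def scaleR_conv_of_real using b by (simp add: algebra_simps)
  have u0: "?u ~= 0" using a by (simp add: u)
  have zu: "pathfinish p / ?u = b * exp (w * (1 - \<xi> s))"
  proof -
   have "pathfinish p / ?u = a * b * exp w / (a * exp (w * \<xi> s))" by (rule arg_cong2[of _ _ _ _ "(/)", OF z u])
   also have "\<dots> = b * (exp w / exp (w * \<xi> s))" using a by simp
   also have "exp w / exp (w * \<xi> s) = exp (w * (1 - \<xi> s))" by (simp add: exp_diff right_diff_distrib)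
   finally show ?thesis .
  qed
  have 1: "?u \<in> chart_dom a \<eta>" "log_chart a \<eta> ?u = \<eta> + Ln (\<xi> s)"
   unfolding u w_def by (rule log_chart_exp[OF a \<eta> lz])+
  have 2: "pathfinish p / ?u \<in> chart_dom b \<eta>" "log_chart b \<eta> (pathfinish p / ?u) = \<eta> + Ln (1 - \<xi> s)"
   unfolding zu w_def by (rule log_chart_exp[OF b \<eta> lens_props(9)[OF lz]])+
  have sh: "\<eta> + y + ?T * of_nat (Suc k) = ?\<eta> + y + ?T" "\<eta> + y + ?T * of_nat k = ?\<eta> + y" for y
   by (simp_all add: algebra_simps)
  have J: "(pathfinish p / b - a) / ?u = w * \<xi>' s"
  proof -
   have 3: "pathfinish p / b - a = a * ?D" unfolding z using b by (simp add: algebra_simps)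
   have "(pathfinish p / b - a) / ?u = a * ?D / (a * exp (w * \<xi> s))" by (rule arg_cong2[of _ _ _ _ "(/)", OF 3 u])
   also have "\<dots> = ?D / (1 + of_real s * ?D)" unfolding e using a by simp
   also have "\<dots> = w * \<xi>' s" unfolding \<xi>'_def using w(2) by simp
   finally show ?thesis .
  qed
  have "monodromy_integrand F G p k a b ?u * (pathfinish p / b - a) =
    (f (?\<eta> + Ln (\<xi> s) + ?T) - f (?\<eta> + Ln (\<xi> s))) * (g (?\<eta> + Ln (1 - \<xi> s) + ?T) - g (?\<eta> + Ln (1 - \<xi> s))) * ((pathfinish p / b - a) / ?u)"
   unfolding monodromy_integrand_def DF[OF 1(1)] DG[OF 2(1)] 1(2) 2(2) sh by simp
  then show "monodromy_integrand F G p k a b ?u * (pathfinish p / b - a) =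
    w * ((f (?\<eta> + Ln (\<xi> s) + ?T) - f (?\<eta> + Ln (\<xi> s))) * (g (?\<eta> + Ln (1 - \<xi> s) + ?T) - g (?\<eta> + Ln (1 - \<xi> s))) * \<xi>' s)"
   unfolding J by (simp only: mult_ac)
 qed
 moreover have "w * V = - (L (P 1 + ?T * of_nat (Suc k)) - L (P 1 + ?T * of_nat k))"
 proof -
  have V2: "L (?\<eta> + ?T) - L ?\<eta> = - w * V" using V(2) unfolding e\<eta> .
  have e1: "P 1 + ?T * of_nat (Suc k) = ?\<eta> + ?T" by (simp add: \<eta>_def algebra_simps)
  have e2: "P 1 + ?T * of_nat k = ?\<eta>" by (simp add: \<eta>_def)
  show ?thesis unfolding e1 e2 V2 by simp
 qed
 ultimately show ?thesis unfolding has_contour_integral_linepath by simp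
qed

section \<open>Lifting paths near \<gamma>\<close>

lemma sgn_Im_Ln:
 assumes "Im z ~= 0"
 shows "0 < sgn (Im z) * Im (Ln z)" "sgn (Im z) * Im (Ln z) < pi" "Im (Ln z) ~= 0" "sgn (Im (Ln z)) = sgn (Im z)"
proof -
 have z: "z ~= 0" using assms by auto
 have "(0 < Im z \<and> 0 < Im (Ln z) \<and> Im (Ln z) < pi) \<or> (Im z < 0 \<and> Im (Ln z) < 0 \<and> - pi < Im (Ln z))"
  using Im_Ln_pos_lt_imp[of z] Im_Ln_pos_le[OF z] Im_Ln_le_pi[OF z] mpi_less_Im_Ln[OF z] assms by linarith
 then show "0 < sgn (Im z) * Im (Ln z)" "sgn (Im z) * Im (Ln z) < pi" "Im (Ln z) ~= 0" "sgn (Im (Ln z)) = sgn (Im z)"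
  by (auto simp: sgn_if)
qed

lemma Ln_near_1:
 assumes "\<gamma> ~= 0" "v \<in> ball \<gamma> (norm \<gamma> * min (1/2) (exp R / 4))"
 shows "v / \<gamma> \<notin> \<real>\<^sub>\<le>\<^sub>0" "norm (Ln (v / \<gamma>)) < exp R" "\<gamma> * exp (Ln (v / \<gamma>)) = v"
proof -
 have "norm (1 - v / \<gamma>) = dist \<gamma> v / norm \<gamma>" using assms(1) by (simp add: dist_norm diff_divide_distrib flip: norm_divide)
 also have "\<dots> < min (1/2) (exp R / 4)"
 proof (rule pos_divide_less_eq[THEN iffD2])
  show "0 < norm \<gamma>" using assms(1) by simp
  show "dist \<gamma> v < min (1/2) (exp R / 4) * norm \<gamma>" using assms(2) unfolding mem_ball by (simp only: mult.commute)
 qed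
 finally have n: "norm (1 - v / \<gamma>) < 1/2" "norm (1 - v / \<gamma>) < exp R / 4" by auto
 have "\<bar>Re (1 - v / \<gamma>)\<bar> < 1/2" using abs_Re_le_cmod[of "1 - v / \<gamma>"] n(1) by linarith
 then have "Re (v / \<gamma>) > 0" unfolding minus_complex.sel one_complex.sel by linarith
 then show nR: "v / \<gamma> \<notin> \<real>\<^sub>\<le>\<^sub>0" by (auto simp: complex_nonpos_Reals_iff)
 have "norm (Ln (1 - (1 - v / \<gamma>))) <= 2 * norm (1 - v / \<gamma>)" using n(1) by (intro norm_Ln_1_minus_le) simp
 then have "norm (Ln (v / \<gamma>)) <= 2 * norm (1 - v / \<gamma>)" by simp
 then show "norm (Ln (v / \<gamma>)) < exp R" using n(2) exp_gt_zero[of R] by linarith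
 have "v / \<gamma> ~= 0" using nR by auto
 then have "exp (Ln (v / \<gamma>)) = v / \<gamma>" by (rule exp_Ln)
 then show "\<gamma> * exp (Ln (v / \<gamma>)) = v" using assms(1) by simp
qed

text \<open>\<open>Ln (v / \<gamma>)\<close> is single-valued near \<gamma> and vanishes at \<gamma>
  only, so it has a continuous logarithm along the path, the interval being contractible.\<close>

lemma path_lift_dexp:
 assumes \<gamma>: "\<gamma> ~= 0" and q: "path q" "path_image q \<subseteq> ball \<gamma> (norm \<gamma> * min (1/2) (exp R / 4)) - {\<gamma>}" "Im (pathstart q / \<gamma>) ~= 0"
 obtains P where "path P" "!!t. t \<in> {0..1} ==> q t = dexp \<gamma> (P t)" "!!t. t \<in> {0..1} ==> Re (P t) < R"
  "0 < sgn (Im (pathstart q / \<gamma>)) * Im (P 0)" "sgn (Im (pathstart q / \<gamma>)) * Im (P 0) < pi"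
proof -
 have qt: "q t \<in> ball \<gamma> (norm \<gamma> * min (1/2) (exp R / 4))" "q t ~= \<gamma>" if "t \<in> {0..1}" for t
 proof -
  have "q t \<in> path_image q" using that by (simp add: path_image_def)
  then have d: "q t \<in> ball \<gamma> (norm \<gamma> * min (1/2) (exp R / 4)) - {\<gamma>}" by (rule subsetD[OF q(2)])
  show "q t \<in> ball \<gamma> (norm \<gamma> * min (1/2) (exp R / 4))" by (rule DiffD1[OF d])
  show "q t ~= \<gamma>" using DiffD2[OF d] by blast
 qed
 note n = Ln_near_1[OF \<gamma> qt(1)]
 have c: "continuous_on {0..1} (%t. Ln (q t / \<gamma>))"
 proof (rule continuous_on_compose2[of "- \<real>\<^sub>\<le>\<^sub>0" Ln])
  show "continuous_on (- \<real>\<^sub>\<le>\<^sub>0) Ln" by (rule continuous_on_Ln) auto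
  show "continuous_on {0..1} (%t. q t / \<gamma>)" using q(1) \<gamma> unfolding path_def by (intro continuous_intros) auto
  show "(%t. q t / \<gamma>) ` {0..1} \<subseteq> - \<real>\<^sub>\<le>\<^sub>0" using n(1) by auto
 qed
 have nz: "Ln (q t / \<gamma>) ~= 0" if "t \<in> {0..1}" for t
  using n(3)[OF that] qt(2)[OF that] by auto
 have "contractible {0..1::real}" by (intro convex_imp_contractible convex_real_interval)
 then obtain g where g: "continuous_on {0..1} g" "!!t. t \<in> {0..1} ==> Ln (q t / \<gamma>) = exp (g t)"
  using continuous_logarithm_on_contractible[OF c _ nz] by metis
 \<comment> \<open>Normalised to start at the principal value, which lies in the strip of the side
   from which the path starts.\<close>
 define P where "P t = g t - g 0 + Ln (Ln (q 0 / \<gamma>))" for t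
 have eP: "exp (P t) = Ln (q t / \<gamma>)" if "t \<in> {0..1}" for t
 proof -
  have "exp (P t) = exp (g t) / exp (g 0) * Ln (q 0 / \<gamma>)" using nz[of 0] by (simp add: P_def exp_add exp_diff)
  then show ?thesis using g(2)[OF that] g(2)[of 0] by simp
 qed
 have s: "Im (q 0 / \<gamma>) ~= 0" using q(3) by (simp add: pathstart_def)
 note s1 = sgn_Im_Ln[OF s]
 note s2 = sgn_Im_Ln[OF s1(3)]
 show thesis
 proof (rule that)
  show "path P" unfolding path_def P_def by (intro continuous_intros g(1))
  show "q t = dexp \<gamma> (P t)" if "t \<in> {0..1}" for t using n(3)[OF that] by (simp add: dexp_def eP[OF that])
  show "Re (P t) < R" if "t \<in> {0..1}" for t
  proof -
   have "exp (Re (P t)) = norm (exp (P t))" by (simp add: norm_exp_eq_Re)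
   also have "\<dots> < exp R" unfolding eP[OF that] by (rule n(2)[OF that])
   finally show ?thesis by simp
  qed
  have "P 0 = Ln (Ln (q 0 / \<gamma>))" by (simp add: P_def)
  then show "0 < sgn (Im (pathstart q / \<gamma>)) * Im (P 0)" "sgn (Im (pathstart q / \<gamma>)) * Im (P 0) < pi"
   using s2(1,2) s1(4) by (simp_all add: pathstart_def)
 qed
qed

lemma pinch_data_mono:
 assumes D: "pinch_data F G \<gamma> s ft gt r h L" and "r' <= r" shows "pinch_data F G \<gamma> s ft gt r' h L"
proof -
 have e: "exp r' <= exp r" using assms(2) by simp
 have D': "finite (pinched F G \<gamma>)" "h holomorphic_on ball 0 (exp r)"
  "!!\<alpha>. \<alpha> \<in> pinched F G \<gamma> ==> cell_monodromy (ft \<alpha>) (gt \<alpha>) r (L \<alpha>)"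
  "!!om. 0 < s * Im om ==> norm om < exp r ==> \<gamma> * exp om \<in> star (fps_hadamard F G) \<and>
    pbranch (fps_hadamard F G) (\<gamma> * exp om) = (h om + (\<Sum>\<alpha>\<in>pinched F G \<gamma>. L \<alpha> (Ln om))) / (2 * of_real pi * \<i>)"
  using D unfolding pinch_data_def by simp_all
 show ?thesis unfolding pinch_data_def
  by (intro conjI ballI allI impI D'(1) holomorphic_on_subset[OF D'(2) subset_ball[OF e]] cell_monodromy_mono[OF D'(3) assms(2)]
     D'(4)[THEN conjunct1] D'(4)[THEN conjunct2] order.strict_trans2[OF _ e]; assumption)
qed

text \<open>Put om = \<open>exp X\<close>: on the strip of the side \<open>s\<close> the principal
  logarithm of om is \<open>X\<close>, while the right-hand side is holomorphic on a whole
  half-plane. So the representation is itself a lift.\<close>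

lemma hadamard_lift:
 assumes D: "pinch_data F G \<gamma> s ft gt r h L" and s: "s = 1 \<or> s = - 1"
 shows "local_lift (fps_hadamard F G) \<gamma> s r (%\<eta>. (h (exp \<eta>) + (\<Sum>\<alpha>\<in>pinched F G \<gamma>. L \<alpha> \<eta>)) / (2 * of_real pi * \<i>))"
 unfolding local_lift_def
proof (intro conjI allI impI)
 have h: "h holomorphic_on ball 0 (exp r)" and L: "!!\<alpha>. \<alpha> \<in> pinched F G \<gamma> ==> L \<alpha> holomorphic_on {X. Re X < r}"
  using D unfolding pinch_data_def cell_monodromy_def by simp_all
 have "(%\<eta>. h (exp \<eta>)) holomorphic_on {X. Re X < r}"
  by (rule holomorphic_on_compose_gen[OF _ h, unfolded o_def]) (auto intro!: holomorphic_intros)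
 then show "(%\<eta>. (h (exp \<eta>) + (\<Sum>\<alpha>\<in>pinched F G \<gamma>. L \<alpha> \<eta>)) / (2 * of_real pi * \<i>)) holomorphic_on {X. Re X < r}"
  by (intro holomorphic_intros L) auto
 fix X assume X: "Re X < r" "0 < s * Im X" "s * Im X < pi"
 have "0 < sin (s * Im X)" using X by (intro sin_gt_zero)
 then have "0 < s * sin (Im X)" using s by auto
 then have "0 < exp (Re X) * (s * sin (Im X))" by (rule mult_pos_pos[OF exp_gt_zero])
 then have "0 < s * Im (exp X)" by (simp only: Im_exp mult.left_commute)
 moreover have "norm (exp X) < exp r" using X(1) by (simp add: norm_exp_eq_Re)
 moreover have "Ln (exp X) = X" using X s by (intro Ln_exp) auto
 ultimately show "dexp \<gamma> X \<in> star (fps_hadamard F G)"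
  "(h (exp X) + (\<Sum>\<alpha>\<in>pinched F G \<gamma>. L \<alpha> X)) / (2 * of_real pi * \<i>) = pbranch (fps_hadamard F G) (dexp \<gamma> X)"
  using D unfolding pinch_data_def dexp_def by (simp_all add: norm_exp_eq_Re)
qed

section \<open>Singularities and monodromy of the Hadamard product\<close>

locale isolated_pair =
 fixes F G :: "complex fps"
 assumes F: "fps_conv_radius F > 0" and G: "fps_conv_radius G > 0"
  and sF: "\<forall>\<alpha>\<in>singularities F. isolated_sing F \<alpha> \<and> integrable_sing F \<alpha>"
  and sG: "\<forall>\<beta>\<in>singularities G. isolated_sing G \<beta> \<and> integrable_sing G \<beta>"
begin

lemma singular_lift:
 assumes H: "fps_conv_radius H > 0" "\<forall>\<alpha>\<in>singularities H. isolated_sing H \<alpha> \<and> integrable_sing H \<alpha>" "\<alpha> \<in> singularities H"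
  and s: "s = 1 \<or> s = - 1"
 shows "\<exists>R f. local_lift H \<alpha> s R f \<and> decays f"
proof -
 have a: "\<alpha> ~= 0" using H(3) zero_not_singular by auto
 have c: "\<bar>s\<bar> = 1" using s by auto
 have iso: "isolated_sing H \<alpha>" and int: "integrable_sing H \<alpha>" using H(2,3) by auto
 obtain R f where L: "local_lift H \<alpha> s R f" by (rule isolated_local_lift[OF H(1) a c iso])
 show ?thesis using L integrable_decays[OF H(1) a c L int] by blast
qed

lemma representation:
 assumes \<gamma>: "\<gamma> ~= 0" and s: "s = 1 \<or> s = - 1"
 shows "\<exists>ft gt r h L. pinch_data F G \<gamma> s ft gt r h L \<and>
  (\<forall>\<alpha>\<in>pinched F G \<gamma>. local_lift F \<alpha> s r (ft \<alpha>) \<and> local_lift G (\<gamma> / \<alpha>) s r (gt \<alpha>))"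
proof -
 let ?M = "pinched F G \<gamma>"
 have fin: "finite (singularities F \<inter> cball 0 r)" "finite (singularities G \<inter> cball 0 r)" for r
  using finite_singularities_cball[OF F] finite_singularities_cball[OF G] sF sG by auto
 define Q where "Q \<alpha> f g R \<longleftrightarrow> local_lift F \<alpha> s R f \<and> decays f \<and> local_lift G (\<gamma> / \<alpha>) s R g \<and> decays g" for \<alpha> f g R
 have "\<exists>f g R. Q \<alpha> f g R" if \<alpha>: "\<alpha> \<in> ?M" for \<alpha>
 proof -
  have "\<alpha> \<in> singularities F" "\<gamma> / \<alpha> \<in> singularities G" using \<alpha> by (auto simp: pinched_def)
  with singular_lift[OF F sF _ s] singular_lift[OF G sG _ s]
  obtain R f R' g where "local_lift F \<alpha> s R f" "decays f" "local_lift G (\<gamma> / \<alpha>) s R' g" "decays g" by meson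
  then have "Q \<alpha> f g (min R R')" unfolding Q_def by (auto intro: local_lift_mono)
  then show ?thesis by blast
 qed
 then obtain ft gt R where Q: "!!\<alpha>. \<alpha> \<in> ?M ==> Q \<alpha> (ft \<alpha>) (gt \<alpha>) (R \<alpha>)" by metis
 have "\<exists>r h L. pinch_data F G \<gamma> s ft gt r h L"
  using s
 proof
  assume "s = 1"
  have "\<exists>R. local_lift F \<alpha> 1 R (ft \<alpha>) \<and> decays (ft \<alpha>) \<and> local_lift G (\<gamma> / \<alpha>) 1 R (gt \<alpha>) \<and> decays (gt \<alpha>)" if "\<alpha> \<in> ?M" for \<alpha>
   using Q[OF that] unfolding Q_def \<open>s = 1\<close> by blast
  from left_representation[OF F G \<gamma> fin this] show ?thesis unfolding \<open>s = 1\<close> .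
 next
  assume "s = - 1"
  have "\<exists>R. local_lift F \<alpha> (- 1) R (ft \<alpha>) \<and> decays (ft \<alpha>) \<and> local_lift G (\<gamma> / \<alpha>) (- 1) R (gt \<alpha>) \<and> decays (gt \<alpha>)" if "\<alpha> \<in> ?M" for \<alpha>
   using Q[OF that] unfolding Q_def \<open>s = - 1\<close> by blast
  from right_representation[OF F G \<gamma> fin this] show ?thesis unfolding \<open>s = - 1\<close> .
 qed
 then obtain r h L where D: "pinch_data F G \<gamma> s ft gt r h L" by blast
 have M: "finite ?M" using D by (simp add: pinch_data_def)
 define r' where "r' = Min (insert r (R ` ?M))"
 have r': "r' <= r" "!!\<alpha>. \<alpha> \<in> ?M ==> r' <= R \<alpha>" using M by (auto simp: r'_def)
 have "\<forall>\<alpha>\<in>?M. local_lift F \<alpha> s r' (ft \<alpha>) \<and> local_lift G (\<gamma> / \<alpha>) s r' (gt \<alpha>)"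
 proof
  fix \<alpha> assume \<alpha>: "\<alpha> \<in> ?M"
  show "local_lift F \<alpha> s r' (ft \<alpha>) \<and> local_lift G (\<gamma> / \<alpha>) s r' (gt \<alpha>)"
   using Q[OF \<alpha>] local_lift_mono[OF _ r'(2)[OF \<alpha>]] unfolding Q_def by simp
 qed
 then show ?thesis using pinch_data_mono[OF D r'(1)] by metis
qed

abbreviation "H \<equiv> fps_hadamard F G"

lemma H: "fps_conv_radius H > 0" by (rule hadamard_radius[OF F G])

text \<open>Without pinches, the representation on each side is a holomorphic function of log (z /
  \<gamma>) and extends the principal branch from this side to \<gamma>. The sides are treated
  separately because the two extensions may differ.\<close>

lemma hadamard_nonsingular:
 assumes \<gamma>: "\<gamma> ~= 0" and M: "pinched F G \<gamma> = {}" shows "\<gamma> \<notin> singularities H"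
proof -
 have "\<exists>r>0. \<forall>z\<in>ball \<gamma> r. 0 < s * Im (z / \<gamma>) --> continuable (eval_fps H) (linepath 0 z +++ linepath z \<gamma>)"
  if s: "s = 1 \<or> s = - 1" for s :: real
 proof -
  obtain ft gt r h L where D: "pinch_data F G \<gamma> s ft gt r h L" using representation[OF \<gamma> s] by blast
  have h: "h holomorphic_on ball 0 (exp r)" and D': "!!om. 0 < s * Im om ==> norm om < exp r ==> \<gamma> * exp om \<in> star H \<and>
    pbranch H (\<gamma> * exp om) = h om / (2 * of_real pi * \<i>)"
   using D unfolding pinch_data_def M by simp_all
  define \<rho> where "\<rho> = norm \<gamma> * min (1/2) (exp r / 4)"
  have \<rho>: "\<rho> > 0" using \<gamma> by (simp add: \<rho>_def)
  note n = Ln_near_1[OF \<gamma>, of _ r, folded \<rho>_def]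
  define f where "f z = h (Ln (z / \<gamma>)) / (2 * of_real pi * \<i>)" for z
  have "(%z. h (Ln (z / \<gamma>))) holomorphic_on ball \<gamma> \<rho>"
  proof (rule holomorphic_on_compose_gen[OF _ h, unfolded o_def])
   show "(%z. Ln (z / \<gamma>)) holomorphic_on ball \<gamma> \<rho>" using \<gamma> n(1) by (intro holomorphic_intros) auto
   show "(%z. Ln (z / \<gamma>)) ` ball \<gamma> \<rho> \<subseteq> ball 0 (exp r)" using n(2) by auto
  qed
  then have f: "f holomorphic_on ball \<gamma> \<rho>" unfolding f_def by (intro holomorphic_intros) auto
  have up: "z \<in> star H \<and> pbranch H z = f z" if z: "z \<in> ball \<gamma> \<rho>" "0 < s * Im (z / \<gamma>)" for z
  proof -
   have "Im (z / \<gamma>) ~= 0" using z(2) by auto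
   note sg = sgn_Im_Ln[OF this]
   have "s = sgn (Im (z / \<gamma>))" using s z(2) by (auto simp: sgn_if zero_less_mult_iff)
   then have "0 < s * Im (Ln (z / \<gamma>))" using sg(1) by simp
   from D'[OF this n(2)[OF z(1)]] show ?thesis unfolding n(3)[OF z(1)] f_def .
  qed
  have "continuable (eval_fps H) (linepath 0 z +++ linepath z \<gamma>)" if z: "z \<in> ball \<gamma> \<rho>" "0 < s * Im (z / \<gamma>)" for z
  proof -
   have "closed_segment z \<gamma> \<subseteq> ball \<gamma> \<rho>" using z(1) \<rho> by (intro closed_segment_subset convex_ball) auto
   moreover have "\<forall>\<^sub>F v in nhds z. f v = pbranch H v"
   proof -
    have "open (ball \<gamma> \<rho> \<inter> {v. 0 < s * Im (v / \<gamma>)})" by (intro open_Int open_ball open_half_plane_Im_div)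
    then have "\<forall>\<^sub>F v in nhds z. v \<in> ball \<gamma> \<rho> \<inter> {v. 0 < s * Im (v / \<gamma>)}" by (rule eventually_nhds_in_open) (use z in simp)
    then show ?thesis by (rule eventually_mono) (use up in auto)
   qed
   ultimately have "continues_along (pbranch H) (linepath z \<gamma>) (%_. f)"
    by (intro continues_along_holomorphic[OF f open_ball]) auto
   then show ?thesis using continuable_joinI(1)[OF H, of "linepath z \<gamma>"] up[OF z] by simp
  qed
  then show ?thesis using \<rho> by blast
 qed
 from this[of 1] this[of "- 1"] obtain r1 r2 where
  r1: "r1 > 0" "!!z. z \<in> ball \<gamma> r1 ==> 0 < Im (z / \<gamma>) ==> continuable (eval_fps H) (linepath 0 z +++ linepath z \<gamma>)" and
  r2: "r2 > 0" "!!z. z \<in> ball \<gamma> r2 ==> Im (z / \<gamma>) < 0 ==> continuable (eval_fps H) (linepath 0 z +++ linepath z \<gamma>)"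
  by auto
 show ?thesis
 proof (rule nonsingularI[of "min r1 r2"])
  fix z assume "z \<in> ball \<gamma> (min r1 r2)" "Im (z / \<gamma>) ~= 0"
  then show "continuable (eval_fps H) (linepath 0 z +++ linepath z \<gamma>)" using r1(2)[of z] r2(2)[of z] by (cases "0 < Im (z / \<gamma>)") auto
 qed (use r1 r2 in auto)
qed

text \<open>Every path near \<gamma> lifts to the half-plane, on which the lift for the side of its
  starting point is holomorphic.\<close>

lemma hadamard_isolated:
 assumes \<gamma>: "\<gamma> ~= 0" shows "isolated_sing H \<gamma>"
proof -
 have ex: "\<exists>r f. local_lift H \<gamma> s r f" if s: "s = 1 \<or> s = - 1" for s
  using representation[OF \<gamma> s] hadamard_lift[OF _ s] by blast
 have ex1: "\<exists>r f. local_lift H \<gamma> 1 r f" and ex2: "\<exists>r f. local_lift H \<gamma> (- 1) r f" by (rule ex, simp)+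
 obtain r f where L1: "local_lift H \<gamma> 1 r f" using ex1 by blast
 obtain r' f' where L2: "local_lift H \<gamma> (- 1) r' f'" using ex2 by blast
 define R where "R = min r r'"
 define \<rho> where "\<rho> = norm \<gamma> * min (1/2) (exp R / 4)"
 have "continuable (eval_fps H) p" if pl: "p \<in> local_paths \<gamma> \<rho>" for p
 proof -
  obtain q where p: "p = linepath 0 (pathstart q) +++ q" and q: "path q" "path_image q \<subseteq> ball \<gamma> \<rho> - {\<gamma>}" "Im (pathstart q / \<gamma>) ~= 0"
   using pl unfolding local_paths_def by blast
  obtain P where P: "path P" "!!t. t \<in> {0..1} ==> q t = dexp \<gamma> (P t)" "!!t. t \<in> {0..1} ==> Re (P t) < R"
   "0 < sgn (Im (pathstart q / \<gamma>)) * Im (P 0)" "sgn (Im (pathstart q / \<gamma>)) * Im (P 0) < pi"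
   by (rule path_lift_dexp[OF \<gamma> q(1) q(2)[unfolded \<rho>_def] q(3)]) blast
  have "sgn (Im (pathstart q / \<gamma>)) = 1 \<or> sgn (Im (pathstart q / \<gamma>)) = - 1" using q(3) by (auto simp: sgn_if)
  then obtain fs where "local_lift H \<gamma> (sgn (Im (pathstart q / \<gamma>))) R fs"
   using local_lift_mono[OF L1, of R] local_lift_mono[OF L2, of R] by (auto simp: R_def)
  from local_lift_value(1)[OF H \<gamma> this P(1,3,4,5,2)] show ?thesis unfolding p .
 qed
 moreover have "\<rho> > 0" using \<gamma> by (simp add: \<rho>_def)
 ultimately show ?thesis unfolding isolated_sing_def by blast
qed

lemma pinched_nonzero: "\<alpha> \<in> pinched F G \<gamma> ==> \<alpha> ~= 0 \<and> \<gamma> / \<alpha> ~= 0"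
 unfolding pinched_def using zero_not_singular by (metis (no_types, lifting) mem_Collect_eq)

lemma singular_pairs_eq: "singular_pairs F G \<gamma> = (%\<alpha>. (\<alpha>, \<gamma> / \<alpha>)) ` pinched F G \<gamma>"
proof (intro set_eqI iffI)
 fix x assume "x \<in> singular_pairs F G \<gamma>"
 then obtain \<alpha> \<beta> where x: "x = (\<alpha>, \<beta>)" "\<alpha> \<in> singularities F" "\<beta> \<in> singularities G" "\<alpha> * \<beta> = \<gamma>" by (auto simp: singular_pairs_def)
 have "\<alpha> ~= 0" using x(2) zero_not_singular by auto
 then have "\<beta> = \<gamma> / \<alpha>" using x(4) by auto
 then show "x \<in> (%\<alpha>. (\<alpha>, \<gamma> / \<alpha>)) ` pinched F G \<gamma>" using x by (auto simp: pinched_def)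
next
 fix x assume "x \<in> (%\<alpha>. (\<alpha>, \<gamma> / \<alpha>)) ` pinched F G \<gamma>"
 then obtain \<alpha> where x: "x = (\<alpha>, \<gamma> / \<alpha>)" "\<alpha> \<in> pinched F G \<gamma>" by blast
 then show "x \<in> singular_pairs F G \<gamma>" using pinched_nonzero[OF x(2)] by (auto simp: singular_pairs_def pinched_def)
qed

text \<open>On the lift, N turns are the translation by 2 pi i N. The term
  \<open>h (exp \<eta>)\<close> is periodic and drops out; the increments of the cells, sheet by
  sheet, are the integrals of the pairs, and they telescope.\<close>

lemma local_formula:
 assumes \<gamma>: "\<gamma> ~= 0" and D: "pinch_data F G \<gamma> s ft gt r h L" and s: "s = 1 \<or> s = - 1"
  and lifts: "\<forall>\<alpha>\<in>pinched F G \<gamma>. local_lift F \<alpha> s r (ft \<alpha>) \<and> local_lift G (\<gamma> / \<alpha>) s r (gt \<alpha>)"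
  and P: "path P" "!!t. t \<in> {0..1} ==> q t = dexp \<gamma> (P t)" "!!t. t \<in> {0..1} ==> Re (P t) < min (- 6) (r - 3)"
   "0 < s * Im (P 0)" "s * Im (P 0) < pi"
 defines "p \<equiv> linepath 0 (pathstart q) +++ q"
 shows "\<forall>(\<alpha>, \<beta>)\<in>singular_pairs F G \<gamma>. \<forall>k<N.
     monodromy_integrand F G p k \<alpha> \<beta> contour_integrable_on linepath \<alpha> (pathfinish p / \<beta>)"
  "(Sigma_op \<gamma> ^^ N) (branch (eval_fps H) p) (pathfinish p) - branch (eval_fps H) p (pathfinish p) =
   - (1 / (2 * of_real pi * \<i>)) * (\<Sum>(\<alpha>, \<beta>)\<in>singular_pairs F G \<gamma>. \<Sum>k<N.
     contour_integral (linepath \<alpha> (pathfinish p / \<beta>)) (monodromy_integrand F G p k \<alpha> \<beta>))"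
proof -
 let ?M = "pinched F G \<gamma>" and ?T = "2 * of_real pi * \<i> :: complex"
 define \<eta> where "\<eta> = P 1"
 have X: "Re (P 1) <= - 6" "Re (P 1) + 3 < r" using P(3)[of 1] by auto
 have Pr: "Re (P t) < r" if "t \<in> {0..1}" for t using P(3)[OF that] by auto
 have cm: "cell_monodromy (ft \<alpha>) (gt \<alpha>) r (L \<alpha>)" if "\<alpha> \<in> ?M" for \<alpha> using D that by (simp add: pinch_data_def)
 have I: "(monodromy_integrand F G p k \<alpha> (\<gamma> / \<alpha>) has_contour_integral
  - (L \<alpha> (\<eta> + ?T * of_nat (Suc k)) - L \<alpha> (\<eta> + ?T * of_nat k))) (linepath \<alpha> (pathfinish p / (\<gamma> / \<alpha>)))"
  if \<alpha>: "\<alpha> \<in> ?M" for \<alpha> k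
 proof -
  have nz: "\<alpha> ~= 0" "\<gamma> / \<alpha> ~= 0" using pinched_nonzero[OF \<alpha>] by auto
  have e: "\<alpha> * (\<gamma> / \<alpha>) = \<gamma>" using nz by simp
  have l: "local_lift F \<alpha> s r (ft \<alpha>)" "local_lift G (\<gamma> / \<alpha>) s r (gt \<alpha>)" using lifts \<alpha> by auto
  show ?thesis unfolding p_def \<eta>_def
   by (rule pair_integral[OF F G nz l cm[OF \<alpha>] P(1) Pr P(4,5) _ X]) (simp_all only: e P(2))
 qed
 then show "\<forall>(\<alpha>, \<beta>)\<in>singular_pairs F G \<gamma>. \<forall>k<N.
     monodromy_integrand F G p k \<alpha> \<beta> contour_integrable_on linepath \<alpha> (pathfinish p / \<beta>)"
  unfolding singular_pairs_eq using has_contour_integral_integrable by fastforce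
 let ?H = "%\<eta>. (h (exp \<eta>) + (\<Sum>\<alpha>\<in>?M. L \<alpha> \<eta>)) / ?T"
 have zq: "pathfinish p = q 1" by (simp add: p_def pathfinish_def joinpaths_def)
 have z: "pathfinish p = dexp \<gamma> \<eta>" using P(2)[of 1] zq by (simp add: \<eta>_def)
 note lc = log_chart(1,2)[OF \<gamma> X(1), folded \<eta>_def]
 have S: "(Sigma_op \<gamma> ^^ N) (branch (eval_fps H) p) (pathfinish p) = ?H (\<eta> + ?T * of_nat N)" for N
  using lift_iterated_Sigma[OF H \<gamma> hadamard_lift[OF D s] P(1) Pr P(4,5,2) X lc(1)[unfolded \<eta>_def]]
  unfolding p_def[symmetric] z \<eta>_def[symmetric] lc(2) by simp
 have per: "exp (\<eta> + ?T * of_nat N) = exp \<eta>"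
 proof -
  have "exp (?T * of_nat N) = 1" using exp_integer_2pi[of "of_nat N"] by (simp add: mult_ac)
  then show ?thesis by (simp add: exp_add)
 qed
 have "(\<Sum>(\<alpha>, \<beta>)\<in>singular_pairs F G \<gamma>. \<Sum>k<N. contour_integral (linepath \<alpha> (pathfinish p / \<beta>)) (monodromy_integrand F G p k \<alpha> \<beta>))
   = (\<Sum>\<alpha>\<in>?M. \<Sum>k<N. contour_integral (linepath \<alpha> (pathfinish p / (\<gamma> / \<alpha>))) (monodromy_integrand F G p k \<alpha> (\<gamma> / \<alpha>)))"
  unfolding singular_pairs_eq by (subst sum.reindex) (auto simp: inj_on_def)
 also have "\<dots> = (\<Sum>\<alpha>\<in>?M. - (L \<alpha> (\<eta> + ?T * of_nat N) - L \<alpha> \<eta>))"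
 proof (rule sum.cong)
  fix \<alpha> assume \<alpha>: "\<alpha> \<in> ?M"
  have "(\<Sum>k<N. contour_integral (linepath \<alpha> (pathfinish p / (\<gamma> / \<alpha>))) (monodromy_integrand F G p k \<alpha> (\<gamma> / \<alpha>))) =
    (\<Sum>k<N. - (L \<alpha> (\<eta> + ?T * of_nat (Suc k)) - L \<alpha> (\<eta> + ?T * of_nat k)))"
   by (intro sum.cong contour_integral_unique I \<alpha>) simp
  also have "\<dots> = - (L \<alpha> (\<eta> + ?T * of_nat N) - L \<alpha> (\<eta> + ?T * of_nat 0))"
   unfolding sum_negf by (subst sum_lessThan_telescope) (rule refl)
  finally show "(\<Sum>k<N. contour_integral (linepath \<alpha> (pathfinish p / (\<gamma> / \<alpha>))) (monodromy_integrand F G p k \<alpha> (\<gamma> / \<alpha>))) =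
    - (L \<alpha> (\<eta> + ?T * of_nat N) - L \<alpha> \<eta>)" by simp
 qed simp
 also have "\<dots> = - ((\<Sum>\<alpha>\<in>?M. L \<alpha> (\<eta> + ?T * of_nat N)) - (\<Sum>\<alpha>\<in>?M. L \<alpha> \<eta>))" by (simp only: sum_negf sum_subtractf)
 finally have R: "(\<Sum>(\<alpha>, \<beta>)\<in>singular_pairs F G \<gamma>. \<Sum>k<N. contour_integral (linepath \<alpha> (pathfinish p / \<beta>)) (monodromy_integrand F G p k \<alpha> \<beta>))
   = - ((\<Sum>\<alpha>\<in>?M. L \<alpha> (\<eta> + ?T * of_nat N)) - (\<Sum>\<alpha>\<in>?M. L \<alpha> \<eta>))" .
 \<comment> \<open>No turn at all: the value of the branch itself is the case 0 of the formula for
   iterates.\<close>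
 have B: "branch (eval_fps H) p (pathfinish p) = ?H \<eta>" using S[of 0] by simp
 have alg: "(x + y) / t - (x + y') / t = - (1 / t) * - (y - y')" for x y y' t :: complex
  by (simp add: diff_divide_distrib add_divide_distrib)
 show "(Sigma_op \<gamma> ^^ N) (branch (eval_fps H) p) (pathfinish p) - branch (eval_fps H) p (pathfinish p) =
   - (1 / (2 * of_real pi * \<i>)) * (\<Sum>(\<alpha>, \<beta>)\<in>singular_pairs F G \<gamma>. \<Sum>k<N.
     contour_integral (linepath \<alpha> (pathfinish p / \<beta>)) (monodromy_integrand F G p k \<alpha> \<beta>))"
  unfolding S B R per by (rule alg)
qed

lemma hadamard_monodromy:
 assumes \<gamma>: "\<gamma> ~= 0"
 shows "\<exists>\<rho>>0. \<forall>p\<in>local_paths \<gamma> \<rho>.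
       (\<forall>(\<alpha>, \<beta>)\<in>singular_pairs F G \<gamma>. \<forall>k<N.
         monodromy_integrand F G p k \<alpha> \<beta> contour_integrable_on linepath \<alpha> (pathfinish p / \<beta>)) \<and>
       (Sigma_op \<gamma> ^^ N) (branch (eval_fps H) p) (pathfinish p) - branch (eval_fps H) p (pathfinish p) =
       - (1 / (2 * of_real pi * \<i>)) * (\<Sum>(\<alpha>, \<beta>)\<in>singular_pairs F G \<gamma>. \<Sum>k<N.
          contour_integral (linepath \<alpha> (pathfinish p / \<beta>)) (monodromy_integrand F G p k \<alpha> \<beta>))"
proof -
 obtain f1 g1 r1 h1 L1 where D1: "pinch_data F G \<gamma> 1 f1 g1 r1 h1 L1"
  "\<forall>\<alpha>\<in>pinched F G \<gamma>. local_lift F \<alpha> 1 r1 (f1 \<alpha>) \<and> local_lift G (\<gamma> / \<alpha>) 1 r1 (g1 \<alpha>)"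
  using representation[OF \<gamma>, of 1] by auto
 obtain f2 g2 r2 h2 L2 where D2: "pinch_data F G \<gamma> (- 1) f2 g2 r2 h2 L2"
  "\<forall>\<alpha>\<in>pinched F G \<gamma>. local_lift F \<alpha> (- 1) r2 (f2 \<alpha>) \<and> local_lift G (\<gamma> / \<alpha>) (- 1) r2 (g2 \<alpha>)"
  using representation[OF \<gamma>, of "- 1"] by auto
 \<comment> \<open>The bound -6 is the one for the charts, and the margin 3 is that of
   \<open>lift_iterated_Sigma\<close>: 2 for the chart and 1 for the turn.\<close>
 define R where "R = min (- 6) (min r1 r2 - 3)"
 define \<rho> where "\<rho> = norm \<gamma> * min (1/2) (exp R / 4)"
 have main: "(\<forall>(\<alpha>, \<beta>)\<in>singular_pairs F G \<gamma>. \<forall>k<N.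
         monodromy_integrand F G p k \<alpha> \<beta> contour_integrable_on linepath \<alpha> (pathfinish p / \<beta>)) \<and> (Sigma_op \<gamma> ^^ N) (branch (eval_fps H) p) (pathfinish p) - branch (eval_fps H) p (pathfinish p) =
       - (1 / (2 * of_real pi * \<i>)) * (\<Sum>(\<alpha>, \<beta>)\<in>singular_pairs F G \<gamma>. \<Sum>k<N.
          contour_integral (linepath \<alpha> (pathfinish p / \<beta>)) (monodromy_integrand F G p k \<alpha> \<beta>))" if pl: "p \<in> local_paths \<gamma> \<rho>" for p
 proof -
  obtain q where p: "p = linepath 0 (pathstart q) +++ q" and q: "path q" "path_image q \<subseteq> ball \<gamma> \<rho> - {\<gamma>}" "Im (pathstart q / \<gamma>) ~= 0"
   using pl unfolding local_paths_def by blast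
  obtain P where P: "path P" "!!t. t \<in> {0..1} ==> q t = dexp \<gamma> (P t)" "!!t. t \<in> {0..1} ==> Re (P t) < R"
   "0 < sgn (Im (pathstart q / \<gamma>)) * Im (P 0)" "sgn (Im (pathstart q / \<gamma>)) * Im (P 0) < pi"
   by (rule path_lift_dexp[OF \<gamma> q(1) q(2)[unfolded \<rho>_def] q(3)]) blast
  have R1: "Re (P t) < min (- 6) (r1 - 3)" "Re (P t) < min (- 6) (r2 - 3)" if "t \<in> {0..1}" for t
   using P(3)[OF that] by (auto simp: R_def)
  have "sgn (Im (pathstart q / \<gamma>)) = 1 \<or> sgn (Im (pathstart q / \<gamma>)) = - 1" using q(3) by (auto simp: sgn_if)
  then have AB: "(\<forall>(\<alpha>, \<beta>)\<in>singular_pairs F G \<gamma>. \<forall>k<N.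
         monodromy_integrand F G p k \<alpha> \<beta> contour_integrable_on linepath \<alpha> (pathfinish p / \<beta>)) \<and> (Sigma_op \<gamma> ^^ N) (branch (eval_fps H) p) (pathfinish p) - branch (eval_fps H) p (pathfinish p) =
       - (1 / (2 * of_real pi * \<i>)) * (\<Sum>(\<alpha>, \<beta>)\<in>singular_pairs F G \<gamma>. \<Sum>k<N.
          contour_integral (linepath \<alpha> (pathfinish p / \<beta>)) (monodromy_integrand F G p k \<alpha> \<beta>))" (is "?A \<and> ?B")
  proof
   assume e: "sgn (Im (pathstart q / \<gamma>)) = 1"
   note lf = local_formula[OF \<gamma> D1(1) _ D1(2) P(1,2) R1(1) P(4,5)[unfolded e], where N = N, folded p]
   show "?A \<and> ?B" by (intro conjI lf) simp_all
  next
   assume e: "sgn (Im (pathstart q / \<gamma>)) = - 1"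
   note lf = local_formula[OF \<gamma> D2(1) _ D2(2) P(1,2) R1(2) P(4,5)[unfolded e], where N = N, folded p]
   show "?A \<and> ?B" by (intro conjI lf) simp_all
  qed
  show ?thesis by (rule AB)
 qed
 have "\<rho> > 0" using \<gamma> by (simp add: \<rho>_def)
 then show ?thesis by (rule exI[of _ \<rho>, OF conjI]) (rule ballI, erule main)
qed

lemma product_set_nonzero:
 assumes "\<gamma> \<in> {\<alpha> * \<beta> |\<alpha> \<beta>. \<alpha> \<in> singularities F \<and> \<beta> \<in> singularities G}" shows "\<gamma> ~= 0"
 using assms zero_not_singular by auto

lemma finite_singular_pairs:
 assumes "\<gamma> ~= 0" shows "finite (singular_pairs F G \<gamma>)"
proof -
 obtain ft gt r h L where "pinch_data F G \<gamma> 1 ft gt r h L" using representation[OF assms, of 1] by auto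
 then show ?thesis unfolding singular_pairs_eq by (simp add: pinch_data_def)
qed

lemma singularities_hadamard:
 assumes "\<gamma> \<in> singularities H"
 shows "\<gamma> \<in> {\<alpha> * \<beta> |\<alpha> \<beta>. \<alpha> \<in> singularities F \<and> \<beta> \<in> singularities G}" "isolated_sing H \<gamma>"
proof -
 have \<gamma>: "\<gamma> ~= 0" using assms zero_not_singular by auto
 then show "isolated_sing H \<gamma>" by (rule hadamard_isolated)
 have "pinched F G \<gamma> ~= {}" using hadamard_nonsingular[OF \<gamma>] assms by blast
 then obtain \<alpha> where \<alpha>: "\<alpha> \<in> pinched F G \<gamma>" by blast
 have "\<gamma> = \<alpha> * (\<gamma> / \<alpha>)" using pinched_nonzero[OF \<alpha>] by simp
 then show "\<gamma> \<in> {\<alpha> * \<beta> |\<alpha> \<beta>. \<alpha> \<in> singularities F \<and> \<beta> \<in> singularities G}" using \<alpha> unfolding pinched_def by blast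
qed

end

theorem theorem1p1:
  fixes F G :: "complex fps"
  assumes "fps_conv_radius F > 0" and "fps_conv_radius G > 0"
    and "\<forall>\<alpha>\<in>singularities F. isolated_sing F \<alpha> \<and> integrable_sing F \<alpha>"
    and "\<forall>\<beta>\<in>singularities G. isolated_sing G \<beta> \<and> integrable_sing G \<beta>"
  shows "singularities (fps_hadamard F G) \<subseteq>
           {\<alpha> * \<beta> |\<alpha> \<beta>. \<alpha> \<in> singularities F \<and> \<beta> \<in> singularities G} \<and>
         (\<forall>\<gamma>\<in>singularities (fps_hadamard F G). isolated_sing (fps_hadamard F G) \<gamma>) \<and>
         (\<forall>\<gamma>\<in>{\<alpha> * \<beta> |\<alpha> \<beta>. \<alpha> \<in> singularities F \<and> \<beta> \<in> singularities G}.
            finite (singular_pairs F G \<gamma>) \<and>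
            (\<forall>N\<ge>1. \<exists>r>0. \<forall>p\<in>local_paths \<gamma> r.
               (\<forall>(\<alpha>, \<beta>)\<in>singular_pairs F G \<gamma>. \<forall>k<N.
                  monodromy_integrand F G p k \<alpha> \<beta>
                    contour_integrable_on linepath \<alpha> (pathfinish p / \<beta>)) \<and>
               (Sigma_op \<gamma> ^^ N) (branch (eval_fps (fps_hadamard F G)) p) (pathfinish p) -
                 branch (eval_fps (fps_hadamard F G)) p (pathfinish p) =
               - (1 / (2 * of_real pi * \<i>)) *
                 (\<Sum>(\<alpha>, \<beta>)\<in>singular_pairs F G \<gamma>. \<Sum>k<N.
                    contour_integral (linepath \<alpha> (pathfinish p / \<beta>))
                      (monodromy_integrand F G p k \<alpha> \<beta>))))"
proof -
  interpret isolated_pair F G using assms by unfold_locales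
  show ?thesis
  proof (intro conjI subsetI ballI allI impI)
    fix \<gamma> assume "\<gamma> \<in> singularities (fps_hadamard F G)"
    note * = singularities_hadamard[OF this]
    show "\<gamma> \<in> {\<alpha> * \<beta> |\<alpha> \<beta>. \<alpha> \<in> singularities F \<and> \<beta> \<in> singularities G}" by (rule *(1))
    show "isolated_sing (fps_hadamard F G) \<gamma>" by (rule *(2))
  qed (rule finite_singular_pairs hadamard_monodromy, erule product_set_nonzero)+
qed

end
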